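(* Let $\mathcal C$ be a join restriction category with local glueings. The equivalence $\Phi\colon\mathrm{peCat}_c(\mathcal C)\simeq\mathrm{jrCat}/\!/_h\,\mathcal C\colon\Psi$ restricts to an equivalence $$\Phi\colon\mathrm{peCat}_{\mathrm{cov}}(\mathcal C)^{\mathrm{op}}\;\simeq\;\mathrm{jrCat}/\!/_{h\ell}\,\mathcal C\;\colon\Psi$$ between the opposite of the category of source-étale partite internal categories and partite internal covering functors in $\mathcal C$, and the subcategory of $\mathrm{jrCat}/\!/_h\,\mathcal C$ comprising all the objects and the localic morphisms between them.
   Context: RESTRICTION CATEGORIES. A restriction category is a category with an operation assigning to each $f\colon A\to B$ a map $\bar f\colon A\to A$ such that $f\bar f=f$; $\bar f\bar g=\bar g\bar f$ and $\overline{g\bar f}=\bar g\bar f$ for $f\colon A\to B$, $g\colon A\to C$; and $\bar g f=f\,\overline{gf}$ for $f\colon A\to B$, $g\colon B\to C$. $\mathcal O(A)$ is the set of restriction idempotents on $A$ (maps $e\colon A\to A$ with $\bar e=e$). A map $f$ is total if $\bar f=1$. For parallel maps, $f\leqslant g$ iff $f=g\bar f$, and $f\smile g$ (compatible) iff $f\bar g=g\bar f$. A restriction functor satisfies $F\bar f=\overline{Ff}$; it is hyperconnected if each induced $\mathcal O(A)\to\mathcal O(FA)$ is an isomorphism. A join restriction category is a restriction category in which every pairwise-compatible family of parallel maps has a join for $\leqslant$, and these joins are preserved by precomposition; a join restriction functor is a restriction functor preserving these joins. In a join restriction category any two parallel maps $f,g$ have a meet $f\wedge g$ for $\leqslant$.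 A partial isomorphism is a map $s\colon A\to B$ with a (necessarily unique) partial inverse $s^*\colon B\to A$: $s^*s=\bar s$, $ss^*=\overline{s^*}$. A local homeomorphism is a total map which is a join of partial isomorphisms. A local atlas on $X$ is a set $I$ and a family $\varphi_{ij}\in\mathcal O(X)$ ($i,j\in I$) with $\varphi_{ij}=\varphi_{ji}$ and $\varphi_{jk}\varphi_{ij}\leqslant\varphi_{ik}$. A glueing of $\varphi$ is a local homeomorphism $p=\bigvee_i p_i\colon A\to X$, with each $p_i$ a partial isomorphism with partial inverse $s_i$, such that $\varphi_{ij}=p_js_i$. $\mathcal C$ has local glueings if every local atlas on every object has a glueing. A partial section of a total map $p\colon A\to X$ is a map $s\colon X\to A$ with $ps=\bar s$. PARTITE INTERNAL CATEGORIES. For a set $I$, an $I$-partite internal category $\mathbb A$ in $\mathcal C$ comprises objects $A_i$; objects $A_{ij}$ with total maps $\sigma_{ij}\colon A_{ij}\to A_i$, $\tau_{ij}\colon A_{ij}\to A_j$, where $\sigma_{ij}$ admits pullbacks along all total maps; maps $\eta_i\colon A_i\to A_{ii}$ with $\sigma_{ii}\eta_i=1=\tau_{ii}\eta_i$; and maps $\mu_{ijk}\colon A_{jk}\times_{A_j}A_{ij}\to A_{ik}$ (domain the pullback of $\sigma_{jk}$ along $\tau_{ij}$) with $\sigma_{ik}\mu_{ijk}=\sigma_{ij}\pi_2$, $\tau_{ik}\mu_{ijk}=\tau_{jk}\pi_1$, satisfying $\mu_{iij}(1,\eta_i\sigma_{ij})=1=\mu_{ijj}(\eta_j\tau_{ij},1)$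 and $\mu_{ik\ell}(1\times\mu_{ijk})=\mu_{ij\ell}(\mu_{jk\ell}\times 1)$. It is source-étale if every $\sigma_{ij}$ is a local homeomorphism. A partite cofunctor $F\colon\mathbb A\rightsquigarrow\mathbb B$ from an $I$-partite to a $J$-partite internal category comprises a function $I\to J$, $i\mapsto Fi$; total maps $F_i\colon B_{Fi}\to A_i$; and total maps $F_{ij}\colon A_{ij}\times_{A_i}B_{Fi}\to B_{Fi,Fj}$ (domain the pullback of $\sigma_{ij}$ along $F_i$) with $\sigma_{Fi,Fj}F_{ij}=\pi_2$, $F_j\tau_{Fi,Fj}F_{ij}=\tau_{ij}\pi_1$, $F_{ii}(\eta_iF_i,1)=\eta_{Fi}$, and $F_{ik}(\mu_{ijk}\times1)=\mu_{Fi,Fj,Fk}(F_{jk}\times1)(1\times F_{ij})$ on $A_{jk}\times_{A_j}A_{ij}\times_{A_i}B_{Fi}$ (using $A_{jk}\times_{A_j}B_{Fi,Fj}\cong(A_{jk}\times_{A_j}B_{Fj})\times_{B_{Fj}}B_{Fi,Fj}$). Composition: $(GF)i=G(Fi)$, $(GF)_i=F_iG_{Fi}$, $(GF)_{ij}=G_{Fi,Fj}(F_{ij}\times1)$ up to the canonical isomorphism of pullbacks. $\mathrm{peCat}_c(\mathcal C)$ is the category of source-étale partite internal categories and partite cofunctors. COVERING FUNCTORS. A partite internal functor $G\colon\mathbb B\to\mathbb A$ comprises a function on components $i\mapsto Gi$ and total maps $G_i\colon B_i\to A_{Gi}$, $G_{ij}\colon B_{ij}\to A_{Gi,Gj}$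 with $G_i\sigma_{ij}=\sigma_{Gi,Gj}G_{ij}$, $G_j\tau_{ij}=\tau_{Gi,Gj}G_{ij}$, $G_{ii}\eta_i=\eta_{Gi}G_i$, $G_{ik}\mu_{ijk}=\mu_{Gi,Gj,Gk}(G_{jk}\times_{G_j}G_{ij})$. It is a covering functor if $i\mapsto Gi$ is bijective and each square $G_i\sigma_{ij}=\sigma_{Gi,Gj}G_{ij}$ is a pullback. $\mathrm{peCat}_{\mathrm{cov}}(\mathcal C)$ is the category of source-étale partite internal categories and covering functors. Covering functors $G\colon\mathbb B\to\mathbb A$ are identified with those partite cofunctors $F\colon\mathbb A\rightsquigarrow\mathbb B$ for which $i\mapsto Fi$ is bijective and each $F_{ij}$ is invertible: $F(Gi)=i$, $F_{Gi}=G_i$, and $F_{Gi,Gj}\colon A_{Gi,Gj}\times_{A_{Gi}}B_i\cong B_{ij}$ is the isomorphism induced by the pullback property. CATEGORIES OVER $\mathcal C$. $\mathrm{jrCat}/\!/_h\,\mathcal C$ has as objects pairs $(\mathcal A,P)$ of a join restriction category and a hyperconnected restriction functor $P\colon\mathcal A\to\mathcal C$; a map $(F,\alpha)\colon(\mathcal A,P)\to(\mathcal B,Q)$ is a restriction functor $F\colon\mathcal A\to\mathcal B$ (automatically join-preserving) and a natural transformation $\alpha\colon QF\Rightarrow P$ with total components; $(G,\beta)(F,\alpha)=(GF,\alpha\circ\beta F)$. A join restriction functor $F\colon\mathcal A\to\mathcal B$ is localic if it is bijective on objects, $Ff\wedge Fg=F(f\wedge g)$ for all $f,g\in\mathcal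 A(i,j)$, and $g=\bigvee_{f\in\mathcal A(i,j)}(g\wedge Ff)$ for all $g\in\mathcal B(Fi,Fj)$. A map $(F,\alpha)$ is localic if $F$ is. THE FUNCTORS. $\Phi(\mathbb A)=(\Phi\mathbb A,\pi_{\mathbb A})$: $\Phi\mathbb A$ has object-set $I$; $\Phi\mathbb A(i,j)$ is the set of partial sections of $\sigma_{ij}$; identities are $\eta_i$; the composite of $s\in\Phi\mathbb A(i,j)$, $t\in\Phi\mathbb A(j,k)$ is $\mu_{ijk}\circ\tau_{ij}^*(t)\circ s$ where $\tau_{ij}^*(t)=(t\tau_{ij},\overline{t\tau_{ij}})\colon A_{ij}\to A_{jk}\times_{A_j}A_{ij}$; the restriction of $s$ is $\eta_i\bar s$; $\pi_{\mathbb A}(i)=A_i$, $\pi_{\mathbb A}(s)=\tau_{ij}s$. For a cofunctor $F$, $\Phi(F)=(\Phi F,\varpi^F)$ with $\Phi F(i)=Fi$, $\Phi F(s)=F_{ij}\circ(sF_i,\overline{sF_i})$, $\varpi^F_i=F_i$. Given $(\mathcal A,P)$ and $f,g\in\mathcal A(i,j)$ put $[\![f=_Pg]\!]=\bigvee\{Pe: e\in\mathcal O(i),\ e\leqslant\bar f\bar g,\ fe=ge\}\in\mathcal O(Pi)$. $\Psi P$ is the $\mathrm{ob}(\mathcal A)$-partite internal category with objects $Pi$; $\sigma_{ij}\colon\Psi P_{ij}\to Pi$ a glueing of the local atlas $([\![f=_Pg]\!])_{f,g\in\mathcal A(i,j)}$, with associated partial sections $s_f$; $\tau_{ij}$ unique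 with $\tau_{ij}s_f=Pf$; $\eta_i=s_{1_i}$; $\mu_{ijk}$ unique with $\mu_{ijk}\tau_{ij}^*(s_g)s_f=s_{gf}$. These give the equivalence $\mathrm{peCat}_c(\mathcal C)\simeq\mathrm{jrCat}/\!/_h\,\mathcal C$, with $\Psi$ left adjoint to $\Phi$ via the unit $f\mapsto s_f$. *)

theory Defs
  imports "HOL-Library.FuncSet" "HOL-Library.Equipollence"
begin

section \<open>Categories, functors, adjoint equivalences\<close>

record ('o,'m) cat =
  Obj :: "'o set"
  Arr :: "'m set"
  Dom :: "'m \<Rightarrow> 'o"
  Cod :: "'m \<Rightarrow> 'o"
  Ide :: "'o \<Rightarrow> 'm"
  Cmp :: "'m \<Rightarrow> 'm \<Rightarrow> 'm"  (infixl "\<cdot>\<index>" 70)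

definition Hom :: "('o,'m,'z) cat_scheme \<Rightarrow> 'o \<Rightarrow> 'o \<Rightarrow> 'm set" where
  "Hom C X Y = {f \<in> Arr C. Dom C f = X \<and> Cod C f = Y}"

locale category =
  fixes C :: "('o,'m,'z) cat_scheme" (structure)
  assumes Dom_in: "f \<in> Arr C \<Longrightarrow> Dom C f \<in> Obj C"
    and Cod_in: "f \<in> Arr C \<Longrightarrow> Cod C f \<in> Obj C"
    and Ide_in: "X \<in> Obj C \<Longrightarrow> Ide C X \<in> Hom C X X"
    and Cmp_in: "\<lbrakk>f \<in> Hom C X Y; g \<in> Hom C Y Z\<rbrakk> \<Longrightarrow> g \<cdot> f \<in> Hom C X Z"
    and Cmp_Ide: "f \<in> Hom C X Y \<Longrightarrow> f \<cdot> Ide C X = f"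
    and Ide_Cmp: "f \<in> Hom C X Y \<Longrightarrow> Ide C Y \<cdot> f = f"
    and Cmp_assoc: "\<lbrakk>f \<in> Hom C W X; g \<in> Hom C X Y; h \<in> Hom C Y Z\<rbrakk>
                      \<Longrightarrow> h \<cdot> (g \<cdot> f) = h \<cdot> g \<cdot> f"

definition invertible :: "('o,'m,'z) cat_scheme \<Rightarrow> 'm \<Rightarrow> bool" where
  "invertible C f \<longleftrightarrow> f \<in> Arr C \<and>
     (\<exists>g \<in> Hom C (Cod C f) (Dom C f). g \<cdot>\<^bsub>C\<^esub> f = Ide C (Dom C f) \<and> f \<cdot>\<^bsub>C\<^esub> g = Ide C (Cod C f))"

definition opposite :: "('o,'m) cat \<Rightarrow> ('o,'m) cat" where
  "opposite C = \<lparr>Obj = Obj C, Arr = Arr C, Dom = Cod C, Cod = Dom C, Ide = Ide C,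
                 Cmp = (\<lambda>g f. f \<cdot>\<^bsub>C\<^esub> g)\<rparr>"

record ('o,'m,'p,'n) fctr =
  fob :: "'o \<Rightarrow> 'p"
  far :: "'m \<Rightarrow> 'n"

definition is_functor ::
  "('o,'m,'z) cat_scheme \<Rightarrow> ('p,'n,'y) cat_scheme \<Rightarrow> ('o,'m,'p,'n) fctr \<Rightarrow> bool" where
  "is_functor X Y F \<longleftrightarrow>
     (\<forall>x \<in> Obj X. fob F x \<in> Obj Y) \<and>
     (\<forall>f \<in> Arr X. far F f \<in> Hom Y (fob F (Dom X f)) (fob F (Cod X f))) \<and>
     (\<forall>x \<in> Obj X. far F (Ide X x) = Ide Y (fob F x)) \<and>
     (\<forall>f \<in> Arr X. \<forall>g \<in> Arr X. Dom X g = Cod X f \<longrightarrow>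
        far F (g \<cdot>\<^bsub>X\<^esub> f) = far F g \<cdot>\<^bsub>Y\<^esub> far F f)"

definition fid :: "('o,'m,'o,'m) fctr" where
  "fid = \<lparr>fob = (\<lambda>x. x), far = (\<lambda>f. f)\<rparr>"

definition fcomp :: "('p,'n,'q,'l) fctr \<Rightarrow> ('o,'m,'p,'n) fctr \<Rightarrow> ('o,'m,'q,'l) fctr" where
  "fcomp G F = \<lparr>fob = fob G \<circ> fob F, far = far G \<circ> far F\<rparr>"

definition nat_trans ::
  "('o,'m,'z) cat_scheme \<Rightarrow> ('p,'n,'y) cat_scheme \<Rightarrow> ('o,'m,'p,'n) fctr \<Rightarrow> ('o,'m,'p,'n) fctr
    \<Rightarrow> ('o \<Rightarrow> 'n) \<Rightarrow> bool" where
  "nat_trans X Y F G t \<longleftrightarrow>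
     (\<forall>x \<in> Obj X. t x \<in> Hom Y (fob F x) (fob G x)) \<and>
     (\<forall>f \<in> Arr X. far G f \<cdot>\<^bsub>Y\<^esub> t (Dom X f) = t (Cod X f) \<cdot>\<^bsub>Y\<^esub> far F f)"

text \<open>\<open>L : Y \<rightarrow> X\<close> is left adjoint to \<open>R : X \<rightarrow> Y\<close> with invertible unit \<open>u\<close> and counit \<open>e\<close>.\<close>

definition adjoint_equivalence ::
  "('o,'m) cat \<Rightarrow> ('p,'n) cat \<Rightarrow> ('p,'n,'o,'m) fctr \<Rightarrow> ('o,'m,'p,'n) fctr
    \<Rightarrow> ('p \<Rightarrow> 'n) \<Rightarrow> ('o \<Rightarrow> 'm) \<Rightarrow> bool" where
  "adjoint_equivalence X Y L R u e \<longleftrightarrow>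
     category X \<and> category Y \<and> is_functor Y X L \<and> is_functor X Y R \<and>
     nat_trans Y Y fid (fcomp R L) u \<and> (\<forall>y \<in> Obj Y. invertible Y (u y)) \<and>
     nat_trans X X (fcomp L R) fid e \<and> (\<forall>x \<in> Obj X. invertible X (e x)) \<and>
     (\<forall>x \<in> Obj X. far R (e x) \<cdot>\<^bsub>Y\<^esub> u (fob R x) = Ide Y (fob R x)) \<and>
     (\<forall>y \<in> Obj Y. e (fob L y) \<cdot>\<^bsub>X\<^esub> far L (u y) = Ide X (fob L y))"

definition embedding ::
  "('o,'m) cat \<Rightarrow> ('p,'n) cat \<Rightarrow> ('o,'m,'p,'n) fctr \<Rightarrow> bool" where
  "embedding X Y J \<longleftrightarrow> is_functor X Y J \<and> inj_on (fob J) (Obj X) \<and> inj_on (far J) (Arr X)"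

text \<open>The equivalence between \<open>X\<close> and \<open>Y\<close> restricts to the category \<open>X'\<close>, identified with a
  subcategory of \<open>X\<close> along \<open>J\<close>, and the subcategory \<open>Y'\<close> of \<open>Y\<close>: both functors, the unit and
  the counit restrict.\<close>

definition restricts_to_equivalence ::
  "('o,'m) cat \<Rightarrow> ('p,'n) cat \<Rightarrow> ('p,'n,'o,'m) fctr \<Rightarrow> ('o,'m,'p,'n) fctr
    \<Rightarrow> ('p \<Rightarrow> 'n) \<Rightarrow> ('o \<Rightarrow> 'm) \<Rightarrow> ('q,'l) cat \<Rightarrow> ('q,'l,'o,'m) fctr \<Rightarrow> ('p,'n) cat \<Rightarrow> bool" where
  "restricts_to_equivalence X Y L R u e X' J Y' \<longleftrightarrow>
     embedding X' X J \<and> embedding Y' Y fid \<and>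
     (\<exists>L' e'. adjoint_equivalence X' Y' L' (fcomp R J) u e' \<and>
        (\<forall>y \<in> Obj Y'. fob J (fob L' y) = fob L y) \<and>
        (\<forall>f \<in> Arr Y'. far J (far L' f) = far L f) \<and>
        (\<forall>x \<in> Obj X'. far J (e' x) = e (fob J x)))"


section \<open>Restriction categories\<close>

record ('o,'m) rcat = "('o,'m) cat" +
  Rst :: "'m \<Rightarrow> 'm"

locale restriction_category = category C
  for C :: "('o,'m) rcat" (structure) +
  assumes Rst_in: "f \<in> Hom C A B \<Longrightarrow> Rst C f \<in> Hom C A A"
    and Cmp_Rst: "f \<in> Hom C A B \<Longrightarrow> f \<cdot> Rst C f = f"
    and Rst_commute: "\<lbrakk>f \<in> Hom C A B; g \<in> Hom C A D\<rbrakk> \<Longrightarrow> Rst C f \<cdot> Rst C g = Rst C g \<cdot> Rst C f"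
    and Rst_Cmp_Rst: "\<lbrakk>f \<in> Hom C A B; g \<in> Hom C A D\<rbrakk> \<Longrightarrow> Rst C (g \<cdot> Rst C f) = Rst C g \<cdot> Rst C f"
    and Rst_Cmp: "\<lbrakk>f \<in> Hom C A B; g \<in> Hom C B D\<rbrakk> \<Longrightarrow> Rst C g \<cdot> f = f \<cdot> Rst C (g \<cdot> f)"

definition RI :: "('o,'m) rcat \<Rightarrow> 'o \<Rightarrow> 'm set" where
  "RI C A = {e \<in> Hom C A A. Rst C e = e}"

definition total :: "('o,'m) rcat \<Rightarrow> 'm \<Rightarrow> bool" where
  "total C f \<longleftrightarrow> f \<in> Arr C \<and> Rst C f = Ide C (Dom C f)"

text \<open>The order and compatibility are only meaningful for parallel maps.\<close>

definition le :: "('o,'m) rcat \<Rightarrow> 'm \<Rightarrow> 'm \<Rightarrow> bool" where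
  "le C f g \<longleftrightarrow> f = g \<cdot>\<^bsub>C\<^esub> Rst C f"

definition compatible :: "('o,'m) rcat \<Rightarrow> 'm \<Rightarrow> 'm \<Rightarrow> bool" where
  "compatible C f g \<longleftrightarrow> f \<cdot>\<^bsub>C\<^esub> Rst C g = g \<cdot>\<^bsub>C\<^esub> Rst C f"

definition is_join :: "('o,'m) rcat \<Rightarrow> 'o \<Rightarrow> 'o \<Rightarrow> 'm set \<Rightarrow> 'm \<Rightarrow> bool" where
  "is_join C A B S h \<longleftrightarrow> S \<subseteq> Hom C A B \<and> h \<in> Hom C A B \<and> (\<forall>f \<in> S. le C f h) \<and>
     (\<forall>k \<in> Hom C A B. (\<forall>f \<in> S. le C f k) \<longrightarrow> le C h k)"

definition join :: "('o,'m) rcat \<Rightarrow> 'o \<Rightarrow> 'o \<Rightarrow> 'm set \<Rightarrow> 'm" where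
  "join C A B S = (THE h. is_join C A B S h)"

definition is_meet :: "('o,'m) rcat \<Rightarrow> 'm \<Rightarrow> 'm \<Rightarrow> 'm \<Rightarrow> bool" where
  "is_meet C f g h \<longleftrightarrow> h \<in> Hom C (Dom C f) (Cod C f) \<and> le C h f \<and> le C h g \<and>
     (\<forall>k \<in> Hom C (Dom C f) (Cod C f). le C k f \<and> le C k g \<longrightarrow> le C k h)"

definition meet :: "('o,'m) rcat \<Rightarrow> 'm \<Rightarrow> 'm \<Rightarrow> 'm" where
  "meet C f g = (THE h. is_meet C f g h)"

locale join_restriction_category = restriction_category C
  for C :: "('o,'m) rcat" (structure) +
  assumes join_exists:
      "\<lbrakk>A \<in> Obj C; B \<in> Obj C; S \<subseteq> Hom C A B; \<And>f g. \<lbrakk>f \<in> S; g \<in> S\<rbrakk> \<Longrightarrow> compatible C f g\<rbrakk>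
        \<Longrightarrow> \<exists>h. is_join C A B S h"
    and join_precomp:
      "\<lbrakk>is_join C A B S h; g \<in> Hom C D A\<rbrakk> \<Longrightarrow> is_join C D B ((\<lambda>f. f \<cdot> g) ` S) (h \<cdot> g)"

definition restriction_functor ::
  "('o,'m) rcat \<Rightarrow> ('p,'n) rcat \<Rightarrow> ('o,'m,'p,'n) fctr \<Rightarrow> bool" where
  "restriction_functor A B F \<longleftrightarrow> is_functor A B F \<and> (\<forall>f \<in> Arr A. far F (Rst A f) = Rst B (far F f))"

definition join_restriction_functor ::
  "('o,'m) rcat \<Rightarrow> ('p,'n) rcat \<Rightarrow> ('o,'m,'p,'n) fctr \<Rightarrow> bool" where
  "join_restriction_functor A B F \<longleftrightarrow> restriction_functor A B F \<and>
     (\<forall>X \<in> Obj A. \<forall>Y \<in> Obj A. \<forall>S h. is_join A X Y S h \<longrightarrow>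
        is_join B (fob F X) (fob F Y) (far F ` S) (far F h))"

text \<open>Functors preserve the composition, i.e. the binary meets, of restriction idempotents, so a
  bijective comparison of semilattices is an isomorphism.\<close>

definition hyperconnected ::
  "('o,'m) rcat \<Rightarrow> ('p,'n) rcat \<Rightarrow> ('o,'m,'p,'n) fctr \<Rightarrow> bool" where
  "hyperconnected A B F \<longleftrightarrow> (\<forall>X \<in> Obj A. bij_betw (far F) (RI A X) (RI B (fob F X)))"

definition localic ::
  "('o,'m) rcat \<Rightarrow> ('p,'n) rcat \<Rightarrow> ('o,'m,'p,'n) fctr \<Rightarrow> bool" where
  "localic A B F \<longleftrightarrow> join_restriction_functor A B F \<and> bij_betw (fob F) (Obj A) (Obj B) \<and>
     (\<forall>i \<in> Obj A. \<forall>j \<in> Obj A. \<forall>f \<in> Hom A i j. \<forall>g \<in> Hom A i j.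
        meet B (far F f) (far F g) = far F (meet A f g)) \<and>
     (\<forall>i \<in> Obj A. \<forall>j \<in> Obj A. \<forall>g \<in> Hom B (fob F i) (fob F j).
        is_join B (fob F i) (fob F j) ((\<lambda>f. meet B g (far F f)) ` Hom A i j) g)"

definition partial_inverse :: "('o,'m) rcat \<Rightarrow> 'm \<Rightarrow> 'm \<Rightarrow> bool" where
  "partial_inverse C s t \<longleftrightarrow> s \<in> Arr C \<and> t \<in> Hom C (Cod C s) (Dom C s) \<and>
     t \<cdot>\<^bsub>C\<^esub> s = Rst C s \<and> s \<cdot>\<^bsub>C\<^esub> t = Rst C t"

definition partial_iso :: "('o,'m) rcat \<Rightarrow> 'm \<Rightarrow> bool" where
  "partial_iso C s \<longleftrightarrow> (\<exists>t. partial_inverse C s t)"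

definition local_homeo :: "('o,'m) rcat \<Rightarrow> 'm \<Rightarrow> bool" where
  "local_homeo C p \<longleftrightarrow> total C p \<and>
     (\<exists>S. (\<forall>s \<in> S. partial_iso C s) \<and> is_join C (Dom C p) (Cod C p) S p)"

definition partial_section :: "('o,'m) rcat \<Rightarrow> 'm \<Rightarrow> 'm \<Rightarrow> bool" where
  "partial_section C p s \<longleftrightarrow> s \<in> Hom C (Cod C p) (Dom C p) \<and> p \<cdot>\<^bsub>C\<^esub> s = Rst C s"

definition local_atlas :: "('o,'m) rcat \<Rightarrow> 'o \<Rightarrow> 'k set \<Rightarrow> ('k \<Rightarrow> 'k \<Rightarrow> 'm) \<Rightarrow> bool" where
  "local_atlas C X I \<phi> \<longleftrightarrow> (\<forall>i \<in> I. \<forall>j \<in> I. \<phi> i j \<in> RI C X \<and> \<phi> i j = \<phi> j i) \<and>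
     (\<forall>i \<in> I. \<forall>j \<in> I. \<forall>k \<in> I. le C (\<phi> j k \<cdot>\<^bsub>C\<^esub> \<phi> i j) (\<phi> i k))"

definition glueing :: "('o,'m) rcat \<Rightarrow> 'o \<Rightarrow> 'k set \<Rightarrow> ('k \<Rightarrow> 'k \<Rightarrow> 'm)
    \<Rightarrow> 'm \<Rightarrow> ('k \<Rightarrow> 'm) \<Rightarrow> ('k \<Rightarrow> 'm) \<Rightarrow> bool" where
  "glueing C X I \<phi> p q s \<longleftrightarrow> local_homeo C p \<and> Cod C p = X \<and>
     (\<forall>i \<in> I. q i \<in> Hom C (Dom C p) X \<and> partial_inverse C (q i) (s i)) \<and>
     is_join C (Dom C p) X (q ` I) p \<and>
     (\<forall>i \<in> I. \<forall>j \<in> I. \<phi> i j = q j \<cdot>\<^bsub>C\<^esub> s i)"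

text \<open>Size. A set is small if it is of strictly smaller cardinality than a fixed set \<open>K\<close> (e.g. one
  of inaccessible cardinality). The base category is large but locally small, and only its local
  atlases indexed by small sets need have glueings: glueings of all atlases indexed by sets as
  large as the category itself would force it to be trivial. Up to bijection, the small sets are
  the small subsets of the type of elements of \<open>K\<close>.\<close>

definition locally_small :: "'k set \<Rightarrow> ('o,'m) rcat \<Rightarrow> bool" where
  "locally_small K C \<longleftrightarrow> (\<forall>X \<in> Obj C. \<forall>Y \<in> Obj C. Hom C X Y \<prec> K)"

definition has_local_glueings :: "'k set \<Rightarrow> ('o,'m) rcat \<Rightarrow> bool" where
  "has_local_glueings K C \<longleftrightarrow>
     (\<forall>X \<in> Obj C. \<forall>(I :: 'k set) \<phi>. I \<prec> K \<and> local_atlas C X I \<phi> \<longrightarrow> (\<exists>p q s. glueing C X I \<phi> p q s))"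


section \<open>Pullbacks\<close>

text \<open>Ordinary pullbacks in the category, with respect to all maps and not only total ones.\<close>

definition is_pullback :: "('o,'m) rcat \<Rightarrow> 'm \<Rightarrow> 'm \<Rightarrow> 'm \<Rightarrow> 'm \<Rightarrow> bool" where
  "is_pullback C f g p q \<longleftrightarrow>
     f \<in> Arr C \<and> g \<in> Arr C \<and> Cod C f = Cod C g \<and>
     p \<in> Hom C (Dom C p) (Dom C f) \<and> q \<in> Hom C (Dom C p) (Dom C g) \<and>
     f \<cdot>\<^bsub>C\<^esub> p = g \<cdot>\<^bsub>C\<^esub> q \<and>
     (\<forall>U \<in> Obj C. \<forall>u \<in> Hom C U (Dom C f). \<forall>v \<in> Hom C U (Dom C g). f \<cdot>\<^bsub>C\<^esub> u = g \<cdot>\<^bsub>C\<^esub> v \<longrightarrow>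
        (\<exists>!h. h \<in> Hom C U (Dom C p) \<and> p \<cdot>\<^bsub>C\<^esub> h = u \<and> q \<cdot>\<^bsub>C\<^esub> h = v))"

text \<open>A fixed choice of pullback for every cospan that has one.\<close>

definition pb :: "('o,'m) rcat \<Rightarrow> 'm \<Rightarrow> 'm \<Rightarrow> 'm \<times> 'm" where
  "pb C f g = (SOME pq. is_pullback C f g (fst pq) (snd pq))"

definition pr1 :: "('o,'m) rcat \<Rightarrow> 'm \<Rightarrow> 'm \<Rightarrow> 'm" where "pr1 C f g = fst (pb C f g)"
definition pr2 :: "('o,'m) rcat \<Rightarrow> 'm \<Rightarrow> 'm \<Rightarrow> 'm" where "pr2 C f g = snd (pb C f g)"
definition pbo :: "('o,'m) rcat \<Rightarrow> 'm \<Rightarrow> 'm \<Rightarrow> 'o" where "pbo C f g = Dom C (pr1 C f g)"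

definition pairing :: "('o,'m) rcat \<Rightarrow> 'm \<Rightarrow> 'm \<Rightarrow> 'm \<Rightarrow> 'm \<Rightarrow> 'm" where
  "pairing C f g u v = (THE h. h \<in> Hom C (Dom C u) (pbo C f g) \<and>
     pr1 C f g \<cdot>\<^bsub>C\<^esub> h = u \<and> pr2 C f g \<cdot>\<^bsub>C\<^esub> h = v)"

text \<open>For a partial section \<open>s\<close> of \<open>\<sigma>\<close>, the induced partial section of the second projection of
  the pullback of \<open>\<sigma>\<close> along \<open>f\<close>.\<close>

definition pull_section :: "('o,'m) rcat \<Rightarrow> 'm \<Rightarrow> 'm \<Rightarrow> 'm \<Rightarrow> 'm" where
  "pull_section C \<sigma> f s = pairing C \<sigma> f (s \<cdot>\<^bsub>C\<^esub> f) (Rst C (s \<cdot>\<^bsub>C\<^esub> f))"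


section \<open>Partite internal categories\<close>

record ('i,'o,'m) pcat =
  Cpt :: "'i set"
  P0 :: "'i \<Rightarrow> 'o"
  P1 :: "'i \<Rightarrow> 'i \<Rightarrow> 'o"
  sor :: "'i \<Rightarrow> 'i \<Rightarrow> 'm"
  tgt :: "'i \<Rightarrow> 'i \<Rightarrow> 'm"
  unt :: "'i \<Rightarrow> 'm"
  mul :: "'i \<Rightarrow> 'i \<Rightarrow> 'i \<Rightarrow> 'm"

text \<open>In the associativity law the triple pullback is bracketed to the right.\<close>

definition pcategory :: "('o,'m) rcat \<Rightarrow> ('i,'o,'m) pcat \<Rightarrow> bool" where
  "pcategory C A \<longleftrightarrow>
     (\<forall>i \<in> Cpt A. P0 A i \<in> Obj C) \<and>
     (\<forall>i \<in> Cpt A. \<forall>j \<in> Cpt A.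
        P1 A i j \<in> Obj C \<and>
        sor A i j \<in> Hom C (P1 A i j) (P0 A i) \<and> total C (sor A i j) \<and>
        tgt A i j \<in> Hom C (P1 A i j) (P0 A j) \<and> total C (tgt A i j) \<and>
        (\<forall>f. total C f \<and> Cod C f = P0 A i \<longrightarrow> (\<exists>p q. is_pullback C (sor A i j) f p q))) \<and>
     (\<forall>i \<in> Cpt A. unt A i \<in> Hom C (P0 A i) (P1 A i i) \<and>
        sor A i i \<cdot>\<^bsub>C\<^esub> unt A i = Ide C (P0 A i) \<and> tgt A i i \<cdot>\<^bsub>C\<^esub> unt A i = Ide C (P0 A i)) \<and>
     (\<forall>i \<in> Cpt A. \<forall>j \<in> Cpt A. \<forall>k \<in> Cpt A.
        mul A i j k \<in> Hom C (pbo C (sor A j k) (tgt A i j)) (P1 A i k) \<and>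
        sor A i k \<cdot>\<^bsub>C\<^esub> mul A i j k = sor A i j \<cdot>\<^bsub>C\<^esub> pr2 C (sor A j k) (tgt A i j) \<and>
        tgt A i k \<cdot>\<^bsub>C\<^esub> mul A i j k = tgt A j k \<cdot>\<^bsub>C\<^esub> pr1 C (sor A j k) (tgt A i j)) \<and>
     (\<forall>i \<in> Cpt A. \<forall>j \<in> Cpt A.
        mul A i i j \<cdot>\<^bsub>C\<^esub> pairing C (sor A i j) (tgt A i i) (Ide C (P1 A i j)) (unt A i \<cdot>\<^bsub>C\<^esub> sor A i j)
          = Ide C (P1 A i j) \<and>
        mul A i j j \<cdot>\<^bsub>C\<^esub> pairing C (sor A j j) (tgt A i j) (unt A j \<cdot>\<^bsub>C\<^esub> tgt A i j) (Ide C (P1 A i j))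
          = Ide C (P1 A i j)) \<and>
     (\<forall>i \<in> Cpt A. \<forall>j \<in> Cpt A. \<forall>k \<in> Cpt A. \<forall>l \<in> Cpt A.
        let p1 = pr1 C (sor A j k) (tgt A i j);
            p2 = pr2 C (sor A j k) (tgt A i j);
            q1 = pr1 C (sor A k l) (tgt A j k \<cdot>\<^bsub>C\<^esub> p1);
            q2 = pr2 C (sor A k l) (tgt A j k \<cdot>\<^bsub>C\<^esub> p1);
            one_mul = pairing C (sor A k l) (tgt A i k) q1 (mul A i j k \<cdot>\<^bsub>C\<^esub> q2);
            mul_one = pairing C (sor A j l) (tgt A i j)
              (mul A j k l \<cdot>\<^bsub>C\<^esub> pairing C (sor A k l) (tgt A j k) q1 (p1 \<cdot>\<^bsub>C\<^esub> q2)) (p2 \<cdot>\<^bsub>C\<^esub> q2)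
        in mul A i k l \<cdot>\<^bsub>C\<^esub> one_mul = mul A i j l \<cdot>\<^bsub>C\<^esub> mul_one)"

definition source_etale :: "('o,'m) rcat \<Rightarrow> ('i,'o,'m) pcat \<Rightarrow> bool" where
  "source_etale C A \<longleftrightarrow> pcategory C A \<and> (\<forall>i \<in> Cpt A. \<forall>j \<in> Cpt A. local_homeo C (sor A i j))"

text \<open>Common shape of the data of a partite cofunctor and of a partite functor from \<open>Src\<close> to
  \<open>Trg\<close>. The data are undefined off the components of \<open>Src\<close>, so that equality of morphisms is
  equality of the data on components.\<close>

record ('i,'o,'m) pmor =
  Src :: "('i,'o,'m) pcat"
  Trg :: "('i,'o,'m) pcat"
  onC :: "'i \<Rightarrow> 'i"
  on0 :: "'i \<Rightarrow> 'm"
  on1 :: "'i \<Rightarrow> 'i \<Rightarrow> 'm"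

definition pmor_extensional :: "('i,'o,'m) pmor \<Rightarrow> bool" where
  "pmor_extensional F \<longleftrightarrow> onC F \<in> extensional (Cpt (Src F)) \<and> on0 F \<in> extensional (Cpt (Src F)) \<and>
     (\<forall>i j. \<not> (i \<in> Cpt (Src F) \<and> j \<in> Cpt (Src F)) \<longrightarrow> on1 F i j = undefined)"

text \<open>In the last law, \<open>q1\<close> and \<open>q2\<close> are the projections of the triple pullback bracketed to the
  right, \<open>one_F\<close> maps it to the pullback of \<open>\<sigma>\<close> along \<open>\<rho> = F\<^sub>j \<cdot> \<tau>\<close>, and \<open>F_one\<close> is defined on the
  latter.\<close>

definition cofunctor :: "('o,'m) rcat \<Rightarrow> ('i,'o,'m) pmor \<Rightarrow> bool" where
  "cofunctor C F \<longleftrightarrow> pmor_extensional F \<and>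
     (let A = Src F; B = Trg F; c = onC F in
     (\<forall>i \<in> Cpt A. c i \<in> Cpt B) \<and>
     (\<forall>i \<in> Cpt A. on0 F i \<in> Hom C (P0 B (c i)) (P0 A i) \<and> total C (on0 F i)) \<and>
     (\<forall>i \<in> Cpt A. \<forall>j \<in> Cpt A.
        on1 F i j \<in> Hom C (pbo C (sor A i j) (on0 F i)) (P1 B (c i) (c j)) \<and>
        total C (on1 F i j) \<and>
        sor B (c i) (c j) \<cdot>\<^bsub>C\<^esub> on1 F i j = pr2 C (sor A i j) (on0 F i) \<and>
        on0 F j \<cdot>\<^bsub>C\<^esub> tgt B (c i) (c j) \<cdot>\<^bsub>C\<^esub> on1 F i j = tgt A i j \<cdot>\<^bsub>C\<^esub> pr1 C (sor A i j) (on0 F i)) \<and>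
     (\<forall>i \<in> Cpt A.
        on1 F i i \<cdot>\<^bsub>C\<^esub> pairing C (sor A i i) (on0 F i) (unt A i \<cdot>\<^bsub>C\<^esub> on0 F i) (Ide C (P0 B (c i)))
          = unt B (c i)) \<and>
     (\<forall>i \<in> Cpt A. \<forall>j \<in> Cpt A. \<forall>k \<in> Cpt A.
        let p1 = pr1 C (sor A i j) (on0 F i);
            p2 = pr2 C (sor A i j) (on0 F i);
            q1 = pr1 C (sor A j k) (tgt A i j \<cdot>\<^bsub>C\<^esub> p1);
            q2 = pr2 C (sor A j k) (tgt A i j \<cdot>\<^bsub>C\<^esub> p1);
            mul_one = pairing C (sor A i k) (on0 F i)
              (mul A i j k \<cdot>\<^bsub>C\<^esub> pairing C (sor A j k) (tgt A i j) q1 (p1 \<cdot>\<^bsub>C\<^esub> q2)) (p2 \<cdot>\<^bsub>C\<^esub> q2);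
            \<rho> = on0 F j \<cdot>\<^bsub>C\<^esub> tgt B (c i) (c j);
            one_F = pairing C (sor A j k) \<rho> q1 (on1 F i j \<cdot>\<^bsub>C\<^esub> q2);
            r1 = pr1 C (sor A j k) \<rho>;
            r2 = pr2 C (sor A j k) \<rho>;
            F_one = pairing C (sor B (c j) (c k)) (tgt B (c i) (c j))
              (on1 F j k \<cdot>\<^bsub>C\<^esub> pairing C (sor A j k) (on0 F j) r1 (tgt B (c i) (c j) \<cdot>\<^bsub>C\<^esub> r2)) r2
        in on1 F i k \<cdot>\<^bsub>C\<^esub> mul_one = mul B (c i) (c j) (c k) \<cdot>\<^bsub>C\<^esub> (F_one \<cdot>\<^bsub>C\<^esub> one_F)))"

definition cofunctor_id :: "('o,'m) rcat \<Rightarrow> ('i,'o,'m) pcat \<Rightarrow> ('i,'o,'m) pmor" where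
  "cofunctor_id C A = \<lparr>Src = A, Trg = A,
     onC = (\<lambda>i \<in> Cpt A. i),
     on0 = (\<lambda>i \<in> Cpt A. Ide C (P0 A i)),
     on1 = (\<lambda>i j. if i \<in> Cpt A \<and> j \<in> Cpt A
              then pr1 C (sor A i j) (Ide C (P0 A i)) else undefined)\<rparr>"

definition cofunctor_comp :: "('o,'m) rcat \<Rightarrow> ('i,'o,'m) pmor \<Rightarrow> ('i,'o,'m) pmor \<Rightarrow> ('i,'o,'m) pmor" where
  "cofunctor_comp C G F = (let A = Src F; B = Trg F; c = onC F in
     \<lparr>Src = A, Trg = Trg G,
      onC = (\<lambda>i \<in> Cpt A. onC G (c i)),
      on0 = (\<lambda>i \<in> Cpt A. on0 F i \<cdot>\<^bsub>C\<^esub> on0 G (c i)),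
      on1 = (\<lambda>i j. if i \<in> Cpt A \<and> j \<in> Cpt A then
         (let FG = on0 F i \<cdot>\<^bsub>C\<^esub> on0 G (c i);
              p1 = pr1 C (sor A i j) FG;
              p2 = pr2 C (sor A i j) FG
          in on1 G (c i) (c j) \<cdot>\<^bsub>C\<^esub> pairing C (sor B (c i) (c j)) (on0 G (c i))
               (on1 F i j \<cdot>\<^bsub>C\<^esub> pairing C (sor A i j) (on0 F i) p1 (on0 G (c i) \<cdot>\<^bsub>C\<^esub> p2)) p2)
         else undefined)\<rparr>)"

definition peCat_c :: "'k set \<Rightarrow> ('o,'m) rcat \<Rightarrow> (('i,'o,'m) pcat, ('i,'o,'m) pmor) cat" where
  "peCat_c K C = (let X = {A. source_etale C A \<and> Cpt A \<prec> K} in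
     \<lparr>Obj = X, Arr = {F. Src F \<in> X \<and> Trg F \<in> X \<and> cofunctor C F},
      Dom = Src, Cod = Trg, Ide = cofunctor_id C, Cmp = cofunctor_comp C\<rparr>)"

definition pfunctor :: "('o,'m) rcat \<Rightarrow> ('i,'o,'m) pmor \<Rightarrow> bool" where
  "pfunctor C G \<longleftrightarrow> pmor_extensional G \<and>
     (let B = Src G; A = Trg G; c = onC G in
     (\<forall>i \<in> Cpt B. c i \<in> Cpt A) \<and>
     (\<forall>i \<in> Cpt B. on0 G i \<in> Hom C (P0 B i) (P0 A (c i)) \<and> total C (on0 G i)) \<and>
     (\<forall>i \<in> Cpt B. \<forall>j \<in> Cpt B.
        on1 G i j \<in> Hom C (P1 B i j) (P1 A (c i) (c j)) \<and> total C (on1 G i j) \<and>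
        on0 G i \<cdot>\<^bsub>C\<^esub> sor B i j = sor A (c i) (c j) \<cdot>\<^bsub>C\<^esub> on1 G i j \<and>
        on0 G j \<cdot>\<^bsub>C\<^esub> tgt B i j = tgt A (c i) (c j) \<cdot>\<^bsub>C\<^esub> on1 G i j) \<and>
     (\<forall>i \<in> Cpt B. on1 G i i \<cdot>\<^bsub>C\<^esub> unt B i = unt A (c i) \<cdot>\<^bsub>C\<^esub> on0 G i) \<and>
     (\<forall>i \<in> Cpt B. \<forall>j \<in> Cpt B. \<forall>k \<in> Cpt B.
        on1 G i k \<cdot>\<^bsub>C\<^esub> mul B i j k = mul A (c i) (c j) (c k) \<cdot>\<^bsub>C\<^esub>
          pairing C (sor A (c j) (c k)) (tgt A (c i) (c j))
            (on1 G j k \<cdot>\<^bsub>C\<^esub> pr1 C (sor B j k) (tgt B i j))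
            (on1 G i j \<cdot>\<^bsub>C\<^esub> pr2 C (sor B j k) (tgt B i j))))"

definition covering :: "('o,'m) rcat \<Rightarrow> ('i,'o,'m) pmor \<Rightarrow> bool" where
  "covering C G \<longleftrightarrow> pfunctor C G \<and> bij_betw (onC G) (Cpt (Src G)) (Cpt (Trg G)) \<and>
     (\<forall>i \<in> Cpt (Src G). \<forall>j \<in> Cpt (Src G).
        is_pullback C (sor (Trg G) (onC G i) (onC G j)) (on0 G i) (on1 G i j) (sor (Src G) i j))"

definition pfunctor_id :: "('o,'m) rcat \<Rightarrow> ('i,'o,'m) pcat \<Rightarrow> ('i,'o,'m) pmor" where
  "pfunctor_id C A = \<lparr>Src = A, Trg = A,
     onC = (\<lambda>i \<in> Cpt A. i),
     on0 = (\<lambda>i \<in> Cpt A. Ide C (P0 A i)),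
     on1 = (\<lambda>i j. if i \<in> Cpt A \<and> j \<in> Cpt A then Ide C (P1 A i j) else undefined)\<rparr>"

definition pfunctor_comp :: "('o,'m) rcat \<Rightarrow> ('i,'o,'m) pmor \<Rightarrow> ('i,'o,'m) pmor \<Rightarrow> ('i,'o,'m) pmor" where
  "pfunctor_comp C H G = (let B = Src G; c = onC G in
     \<lparr>Src = B, Trg = Trg H,
      onC = (\<lambda>i \<in> Cpt B. onC H (c i)),
      on0 = (\<lambda>i \<in> Cpt B. on0 H (c i) \<cdot>\<^bsub>C\<^esub> on0 G i),
      on1 = (\<lambda>i j. if i \<in> Cpt B \<and> j \<in> Cpt B
               then on1 H (c i) (c j) \<cdot>\<^bsub>C\<^esub> on1 G i j else undefined)\<rparr>)"

definition peCat_cov :: "'k set \<Rightarrow> ('o,'m) rcat \<Rightarrow> (('i,'o,'m) pcat, ('i,'o,'m) pmor) cat" where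
  "peCat_cov K C = (let X = {A. source_etale C A \<and> Cpt A \<prec> K} in
     \<lparr>Obj = X, Arr = {G. Src G \<in> X \<and> Trg G \<in> X \<and> covering C G},
      Dom = Src, Cod = Trg, Ide = pfunctor_id C, Cmp = pfunctor_comp C\<rparr>)"

text \<open>The identification of covering functors with certain partite cofunctors in the opposite
  direction.\<close>

definition cofunctor_of_covering :: "('o,'m) rcat \<Rightarrow> ('i,'o,'m) pmor \<Rightarrow> ('i,'o,'m) pmor" where
  "cofunctor_of_covering C G = (let B = Src G; A = Trg G; c = inv_into (Cpt B) (onC G) in
     \<lparr>Src = A, Trg = B,
      onC = (\<lambda>k \<in> Cpt A. c k),
      on0 = (\<lambda>k \<in> Cpt A. on0 G (c k)),
      on1 = (\<lambda>k l. if k \<in> Cpt A \<and> l \<in> Cpt A then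
         (THE h. h \<in> Hom C (pbo C (sor A k l) (on0 G (c k))) (P1 B (c k) (c l)) \<and>
            on1 G (c k) (c l) \<cdot>\<^bsub>C\<^esub> h = pr1 C (sor A k l) (on0 G (c k)) \<and>
            sor B (c k) (c l) \<cdot>\<^bsub>C\<^esub> h = pr2 C (sor A k l) (on0 G (c k)))
         else undefined)\<rparr>)"

definition cov_inclusion ::
  "('o,'m) rcat \<Rightarrow> (('i,'o,'m) pcat, ('i,'o,'m) pmor, ('i,'o,'m) pcat, ('i,'o,'m) pmor) fctr" where
  "cov_inclusion C = \<lparr>fob = (\<lambda>A. A), far = cofunctor_of_covering C\<rparr>"


section \<open>Categories hyperconnected over the base\<close>

type_synonym ('i,'a,'o,'m) jr_obj = "('i,'a) rcat \<times> ('i,'a,'o,'m) fctr"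

record ('i,'a,'o,'m) jr_mor =
  JSrc :: "('i,'a,'o,'m) jr_obj"
  JTrg :: "('i,'a,'o,'m) jr_obj"
  JF :: "('i,'a,'i,'a) fctr"
  Jnt :: "'i \<Rightarrow> 'm"

definition is_jr_obj :: "'k set \<Rightarrow> ('o,'m) rcat \<Rightarrow> ('i,'a,'o,'m) jr_obj \<Rightarrow> bool" where
  "is_jr_obj K C = (\<lambda>(A, P). join_restriction_category A \<and> Obj A \<prec> K \<and> locally_small K A \<and>
     restriction_functor A C P \<and> hyperconnected A C P)"

definition is_jr_mor :: "('o,'m) rcat \<Rightarrow> ('i,'a,'o,'m) jr_mor \<Rightarrow> bool" where
  "is_jr_mor C h \<longleftrightarrow> (let (A, P) = JSrc h; (B, Q) = JTrg h in
     restriction_functor A B (JF h) \<and>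
     fob (JF h) \<in> extensional (Obj A) \<and> far (JF h) \<in> extensional (Arr A) \<and>
     nat_trans A C (fcomp Q (JF h)) P (Jnt h) \<and> (\<forall>i \<in> Obj A. total C (Jnt h i)) \<and>
     Jnt h \<in> extensional (Obj A))"

definition jr_id :: "('o,'m) rcat \<Rightarrow> ('i,'a,'o,'m) jr_obj \<Rightarrow> ('i,'a,'o,'m) jr_mor" where
  "jr_id C = (\<lambda>(A, P). \<lparr>JSrc = (A, P), JTrg = (A, P),
     JF = \<lparr>fob = (\<lambda>i \<in> Obj A. i), far = (\<lambda>f \<in> Arr A. f)\<rparr>,
     Jnt = (\<lambda>i \<in> Obj A. Ide C (fob P i))\<rparr>)"

definition jr_comp :: "('o,'m) rcat \<Rightarrow> ('i,'a,'o,'m) jr_mor \<Rightarrow> ('i,'a,'o,'m) jr_mor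
    \<Rightarrow> ('i,'a,'o,'m) jr_mor" where
  "jr_comp C g f = (let A = fst (JSrc f) in
     \<lparr>JSrc = JSrc f, JTrg = JTrg g,
      JF = \<lparr>fob = (\<lambda>i \<in> Obj A. fob (JF g) (fob (JF f) i)),
            far = (\<lambda>a \<in> Arr A. far (JF g) (far (JF f) a))\<rparr>,
      Jnt = (\<lambda>i \<in> Obj A. Jnt f i \<cdot>\<^bsub>C\<^esub> Jnt g (fob (JF f) i))\<rparr>)"

definition jrCat_h :: "'k set \<Rightarrow> ('o,'m) rcat \<Rightarrow> (('i,'a,'o,'m) jr_obj, ('i,'a,'o,'m) jr_mor) cat" where
  "jrCat_h K C = \<lparr>Obj = {X. is_jr_obj K C X},
     Arr = {h. is_jr_obj K C (JSrc h) \<and> is_jr_obj K C (JTrg h) \<and> is_jr_mor C h},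
     Dom = JSrc, Cod = JTrg, Ide = jr_id C, Cmp = jr_comp C\<rparr>"

definition jrCat_hl :: "'k set \<Rightarrow> ('o,'m) rcat \<Rightarrow> (('i,'a,'o,'m) jr_obj, ('i,'a,'o,'m) jr_mor) cat" where
  "jrCat_hl K C = (jrCat_h K C)
     \<lparr>Arr := {h \<in> Arr (jrCat_h K C). localic (fst (JSrc h)) (fst (JTrg h)) (JF h)}\<rparr>"


section \<open>The functor from partite internal categories\<close>

text \<open>A map from \<open>i\<close> to \<open>j\<close> is a partial section of the source map \<open>\<sigma>\<^sub>i\<^sub>j\<close>, tagged with \<open>i\<close> and \<open>j\<close>
  to make the hom-sets disjoint.\<close>

definition Phi_cat :: "('o,'m) rcat \<Rightarrow> ('i,'o,'m) pcat \<Rightarrow> ('i, 'i \<times> 'i \<times> 'm) rcat" where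
  "Phi_cat C A = \<lparr>Obj = Cpt A,
     Arr = {(i, j, s). i \<in> Cpt A \<and> j \<in> Cpt A \<and> partial_section C (sor A i j) s},
     Dom = (\<lambda>(i, j, s). i), Cod = (\<lambda>(i, j, s). j),
     Ide = (\<lambda>i. (i, i, unt A i)),
     Cmp = (\<lambda>(j', k, t) (i, j, s).
       (i, k, mul A i j k \<cdot>\<^bsub>C\<^esub> pull_section C (sor A j k) (tgt A i j) t \<cdot>\<^bsub>C\<^esub> s)),
     Rst = (\<lambda>(i, j, s). (i, i, unt A i \<cdot>\<^bsub>C\<^esub> Rst C s))\<rparr>"

definition Phi_proj :: "('o,'m) rcat \<Rightarrow> ('i,'o,'m) pcat \<Rightarrow> ('i, 'i \<times> 'i \<times> 'm, 'o, 'm) fctr" where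
  "Phi_proj C A = \<lparr>fob = P0 A, far = (\<lambda>(i, j, s). tgt A i j \<cdot>\<^bsub>C\<^esub> s)\<rparr>"

definition Phi_obj :: "('o,'m) rcat \<Rightarrow> ('i,'o,'m) pcat \<Rightarrow> ('i, 'i \<times> 'i \<times> 'm, 'o, 'm) jr_obj" where
  "Phi_obj C A = (Phi_cat C A, Phi_proj C A)"

definition Phi_mor :: "('o,'m) rcat \<Rightarrow> ('i,'o,'m) pmor \<Rightarrow> ('i, 'i \<times> 'i \<times> 'm, 'o, 'm) jr_mor" where
  "Phi_mor C F = (let A = Src F in
     \<lparr>JSrc = Phi_obj C A, JTrg = Phi_obj C (Trg F),
      JF = \<lparr>fob = (\<lambda>i \<in> Cpt A. onC F i),
            far = (\<lambda>(i, j, s) \<in> Arr (Phi_cat C A).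
              (onC F i, onC F j, on1 F i j \<cdot>\<^bsub>C\<^esub> pull_section C (sor A i j) (on0 F i) s))\<rparr>,
      Jnt = (\<lambda>i \<in> Cpt A. on0 F i)\<rparr>)"

definition Phi :: "('o,'m) rcat \<Rightarrow> (('i,'o,'m) pcat, ('i,'o,'m) pmor,
    ('i, 'i \<times> 'i \<times> 'm, 'o, 'm) jr_obj, ('i, 'i \<times> 'i \<times> 'm, 'o, 'm) jr_mor) fctr" where
  "Phi C = \<lparr>fob = Phi_obj C, far = Phi_mor C\<rparr>"


section \<open>The functor to partite internal categories\<close>

definition eq_locus :: "('o,'m) rcat \<Rightarrow> ('i,'a,'o,'m) jr_obj \<Rightarrow> 'a \<Rightarrow> 'a \<Rightarrow> 'm" where
  "eq_locus C = (\<lambda>(A, P) f g. join C (fob P (Dom A f)) (fob P (Dom A f))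
     (far P ` {e \<in> RI A (Dom A f). le A e (Rst A f \<cdot>\<^bsub>A\<^esub> Rst A g) \<and> f \<cdot>\<^bsub>A\<^esub> e = g \<cdot>\<^bsub>A\<^esub> e}))"

definition Psi_glueing :: "('o,'m) rcat \<Rightarrow> ('i,'a,'o,'m) jr_obj \<Rightarrow> 'i \<Rightarrow> 'i
    \<Rightarrow> 'm \<times> ('a \<Rightarrow> 'm) \<times> ('a \<Rightarrow> 'm)" where
  "Psi_glueing C X i j = (SOME (p, q, s).
     glueing C (fob (snd X) i) (Hom (fst X) i j) (eq_locus C X) p q s)"

definition Psi_sor :: "('o,'m) rcat \<Rightarrow> ('i,'a,'o,'m) jr_obj \<Rightarrow> 'i \<Rightarrow> 'i \<Rightarrow> 'm" where
  "Psi_sor C X i j = fst (Psi_glueing C X i j)"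

definition Psi_sec :: "('o,'m) rcat \<Rightarrow> ('i,'a,'o,'m) jr_obj \<Rightarrow> 'a \<Rightarrow> 'm" where
  "Psi_sec C X f = snd (snd (Psi_glueing C X (Dom (fst X) f) (Cod (fst X) f))) f"

definition Psi_tgt :: "('o,'m) rcat \<Rightarrow> ('i,'a,'o,'m) jr_obj \<Rightarrow> 'i \<Rightarrow> 'i \<Rightarrow> 'm" where
  "Psi_tgt C = (\<lambda>(A, P) i j. THE t. t \<in> Hom C (Dom C (Psi_sor C (A, P) i j)) (fob P j) \<and>
     (\<forall>f \<in> Hom A i j. t \<cdot>\<^bsub>C\<^esub> Psi_sec C (A, P) f = far P f))"

definition Psi_mul :: "('o,'m) rcat \<Rightarrow> ('i,'a,'o,'m) jr_obj \<Rightarrow> 'i \<Rightarrow> 'i \<Rightarrow> 'i \<Rightarrow> 'm" where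
  "Psi_mul C X i j k = (let A = fst X; \<sigma> = Psi_sor C X j k; \<tau> = Psi_tgt C X i j in
     THE m. m \<in> Hom C (pbo C \<sigma> \<tau>) (Dom C (Psi_sor C X i k)) \<and>
       (\<forall>f \<in> Hom A i j. \<forall>g \<in> Hom A j k.
          m \<cdot>\<^bsub>C\<^esub> pull_section C \<sigma> \<tau> (Psi_sec C X g) \<cdot>\<^bsub>C\<^esub> Psi_sec C X f = Psi_sec C X (g \<cdot>\<^bsub>A\<^esub> f)))"

definition Psi_obj :: "('o,'m) rcat \<Rightarrow> ('i,'a,'o,'m) jr_obj \<Rightarrow> ('i,'o,'m) pcat" where
  "Psi_obj C X = \<lparr>Cpt = Obj (fst X), P0 = fob (snd X),
     P1 = (\<lambda>i j. Dom C (Psi_sor C X i j)),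
     sor = Psi_sor C X, tgt = Psi_tgt C X,
     unt = (\<lambda>i. Psi_sec C X (Ide (fst X) i)), mul = Psi_mul C X\<rparr>"

text \<open>The unit \<open>f \<mapsto> s\<^sub>f\<close>.\<close>

definition Psi_unit :: "('o,'m) rcat \<Rightarrow> ('i, 'i \<times> 'i \<times> 'm, 'o, 'm) jr_obj
    \<Rightarrow> ('i, 'i \<times> 'i \<times> 'm, 'o, 'm) jr_mor" where
  "Psi_unit C X = (let A = fst X in
     \<lparr>JSrc = X, JTrg = Phi_obj C (Psi_obj C X),
      JF = \<lparr>fob = (\<lambda>i \<in> Obj A. i), far = (\<lambda>f \<in> Arr A. (Dom A f, Cod A f, Psi_sec C X f))\<rparr>,
      Jnt = (\<lambda>i \<in> Obj A. Ide C (fob (snd X) i))\<rparr>)"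

text \<open>On morphisms, the functor is determined by being left adjoint to \<^const>\<open>Phi\<close> via the unit.\<close>

definition Psi_mor :: "'k set \<Rightarrow> ('o,'m) rcat \<Rightarrow> ('i, 'i \<times> 'i \<times> 'm, 'o, 'm) jr_mor
    \<Rightarrow> ('i,'o,'m) pmor" where
  "Psi_mor K C h = (THE F. F \<in> Hom (peCat_c K C) (Psi_obj C (JSrc h)) (Psi_obj C (JTrg h)) \<and>
     jr_comp C (Phi_mor C F) (Psi_unit C (JSrc h)) = jr_comp C (Psi_unit C (JTrg h)) h)"

definition Psi :: "'k set \<Rightarrow> ('o,'m) rcat \<Rightarrow> (('i, 'i \<times> 'i \<times> 'm, 'o, 'm) jr_obj,
    ('i, 'i \<times> 'i \<times> 'm, 'o, 'm) jr_mor, ('i,'o,'m) pcat, ('i,'o,'m) pmor) fctr" where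
  "Psi K C = \<lparr>fob = Psi_obj C, far = Psi_mor K C\<rparr>"

end

theory Submission
  imports Defs
begin

text \<open>A local homeomorphism \<open>p\<close> is a join of partial isomorphisms \<open>q\<^sub>i\<close>, so maps out of its domain can be
  tested, and constructed, on the partial sections inverse to the \<open>q\<^sub>i\<close>; such presentations are stable under
  composition and pullback. On sections, a partite cofunctor is the same thing as a map of
  categories over the base, so \<^const>\<open>Phi\<close> is fully faithful, and \<^const>\<open>Psi_unit\<close> is invertible since every
  partial section of a glueing is a join of restrictions of the sections \<open>s\<^sub>f\<close>, hence itself of this
  form as \<open>f\<close> ranges over a hom-set with joins. A fully faithful functor with invertible units is an
  adjoint equivalence.

  The functor induced by a cofunctor \<open>F\<close> is localic iff \<open>F\<close> is bijective on components and all
  \<open>F\<^sub>i\<^sub>j\<close> are invertible: preservation of meets makes \<open>F\<^sub>i\<^sub>j\<close> injective on sections, the join condition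
  allows its inverse to be glued from the sections of the codomain. Such cofunctors are exactly
  those that come from covering functors. Hence the same criterion applies to covering functors and localic
  morphisms, and uniqueness of transposes identifies the resulting left adjoint and counit with
  restrictions of \<^const>\<open>Psi\<close> and of its counit.\<close>

section \<open>Restriction categories\<close>

text \<open>Equality here is local, and \<open>agree\<close>, the largest idempotent on which two
  parallel maps are defined and coincide, makes it explicit: the meet of \<open>f\<close> and
  \<open>g\<close> is \<open>f\<close> restricted to it, and the atlas behind \<open>Psi_sor\<close>
  is its image under the hyperconnected functor. As that functor is an isomorphism on restriction
  idempotents, covers move between \<open>A\<close> and \<open>C\<close> in both directions; this is
  how sections of a glueing are lifted to arrows. The obstacle is that agreement loci of arbitrary
  maps need not be stable under pullback. For sections of a local homeomorphism they are, because
  two sections with the same value pass through a common chart.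

  Internal laws live on iterated pullbacks. They are evaluated on composites of pulled-back
  sections, and the evaluations never presuppose the law in question, so they serve both to read
  laws off an internal category and to establish them for a constructed one. The laws for identities
  and composites of cofunctors and of covering functors are reflected along a faithful
  functor.\<close>

context category
begin

lemma Hom_iff: "f \<in> Hom C X Y \<longleftrightarrow> f \<in> Arr C \<and> Dom C f = X \<and> Cod C f = Y"
  by (simp add: Hom_def)

lemma Dom_Obj [simp]: "f \<in> Arr C \<Longrightarrow> Dom C f \<in> Obj C"
  by (rule Dom_in)

lemma Cod_Obj [simp]: "f \<in> Arr C \<Longrightarrow> Cod C f \<in> Obj C"
  by (rule Cod_in)

lemma Arr_Cmp [simp]: "\<lbrakk>f \<in> Arr C; g \<in> Arr C; Dom C g = Cod C f\<rbrakk> \<Longrightarrow> g \<cdot> f \<in> Arr C"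
  and Dom_Cmp [simp]: "\<lbrakk>f \<in> Arr C; g \<in> Arr C; Dom C g = Cod C f\<rbrakk> \<Longrightarrow> Dom C (g \<cdot> f) = Dom C f"
  and Cod_Cmp [simp]: "\<lbrakk>f \<in> Arr C; g \<in> Arr C; Dom C g = Cod C f\<rbrakk> \<Longrightarrow> Cod C (g \<cdot> f) = Cod C g"
  using Cmp_in[of f "Dom C f" "Cod C f" g "Cod C g"] by (auto simp: Hom_iff)

lemma Arr_Ide [simp]: "X \<in> Obj C \<Longrightarrow> Ide C X \<in> Arr C"
  and Dom_Ide [simp]: "X \<in> Obj C \<Longrightarrow> Dom C (Ide C X) = X"
  and Cod_Ide [simp]: "X \<in> Obj C \<Longrightarrow> Cod C (Ide C X) = X"
  using Ide_in[of X] by (auto simp: Hom_iff)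

lemma Cmp_Ide' [simp]: "\<lbrakk>f \<in> Arr C; Dom C f = X\<rbrakk> \<Longrightarrow> f \<cdot> Ide C X = f"
  using Cmp_Ide by (auto simp: Hom_iff)

lemma Ide_Cmp' [simp]: "\<lbrakk>f \<in> Arr C; Cod C f = X\<rbrakk> \<Longrightarrow> Ide C X \<cdot> f = f"
  using Ide_Cmp by (auto simp: Hom_iff)

lemma assoc [simp]: "\<lbrakk>f \<in> Arr C; g \<in> Arr C; h \<in> Arr C; Dom C g = Cod C f; Dom C h = Cod C g\<rbrakk>
    \<Longrightarrow> h \<cdot> g \<cdot> f = h \<cdot> (g \<cdot> f)"
  using Cmp_assoc[of f "Dom C f" "Cod C f" g "Cod C g" h "Cod C h"] by (auto simp: Hom_iff)

text \<open>Turns an equation between composites into a rewrite rule that also applies inside a longer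
  composite bracketed to the right.\<close>

lemma under: "\<lbrakk>g \<cdot> f = k; x \<in> Arr C; Cod C x = Dom C f; f \<in> Arr C; g \<in> Arr C; Dom C g = Cod C f\<rbrakk>
    \<Longrightarrow> g \<cdot> (f \<cdot> x) = k \<cdot> x"
  using assoc[of x f g] by simp

lemma under2: "\<lbrakk>g \<cdot> f = k \<cdot> l; x \<in> Arr C; Cod C x = Dom C f; f \<in> Arr C; g \<in> Arr C; Dom C g = Cod C f;
    l \<in> Arr C; k \<in> Arr C; Dom C k = Cod C l; Cod C x = Dom C l\<rbrakk>
    \<Longrightarrow> g \<cdot> (f \<cdot> x) = k \<cdot> (l \<cdot> x)"
  using assoc[of x f g] by simp

end

context restriction_category
begin

lemma Arr_Rst [simp]: "f \<in> Arr C \<Longrightarrow> Rst C f \<in> Arr C"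
  and Dom_Rst [simp]: "f \<in> Arr C \<Longrightarrow> Dom C (Rst C f) = Dom C f"
  and Cod_Rst [simp]: "f \<in> Arr C \<Longrightarrow> Cod C (Rst C f) = Dom C f"
  using Rst_in[of f "Dom C f" "Cod C f"] by (auto simp: Hom_iff)

lemma Cmp_Rst_self [simp]: "f \<in> Arr C \<Longrightarrow> f \<cdot> Rst C f = f"
  using Cmp_Rst by (auto simp: Hom_iff)

lemma Cmp_Rst_self_Cmp [simp]: "\<lbrakk>f \<in> Arr C; x \<in> Arr C; Cod C x = Dom C f\<rbrakk> \<Longrightarrow> f \<cdot> (Rst C f \<cdot> x) = f \<cdot> x"
  by (rule under) auto

lemma Rst_comm: "\<lbrakk>f \<in> Arr C; g \<in> Arr C; Dom C f = Dom C g\<rbrakk> \<Longrightarrow> Rst C f \<cdot> Rst C g = Rst C g \<cdot> Rst C f"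
  using Rst_commute by (auto simp: Hom_iff)

lemma Rst_Cmp_Rst' [simp]: "\<lbrakk>f \<in> Arr C; g \<in> Arr C; Dom C f = Dom C g\<rbrakk>
    \<Longrightarrow> Rst C (g \<cdot> Rst C f) = Rst C g \<cdot> Rst C f"
  using Rst_Cmp_Rst by (auto simp: Hom_iff)

lemma Rst_slide: "\<lbrakk>f \<in> Arr C; g \<in> Arr C; Dom C g = Cod C f\<rbrakk> \<Longrightarrow> Rst C g \<cdot> f = f \<cdot> Rst C (g \<cdot> f)"
  using Rst_Cmp by (auto simp: Hom_iff)

lemma Rst_Ide [simp]: "X \<in> Obj C \<Longrightarrow> Rst C (Ide C X) = Ide C X"
  by (metis Arr_Ide Arr_Rst Cmp_Rst_self Cod_Rst Dom_Ide Ide_Cmp')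

lemma Rst_Rst [simp]: "f \<in> Arr C \<Longrightarrow> Rst C (Rst C f) = Rst C f"
  using Rst_Cmp_Rst'[of f "Ide C (Dom C f)"] by simp

lemma Rst_idem [simp]: "f \<in> Arr C \<Longrightarrow> Rst C f \<cdot> Rst C f = Rst C f"
  using Rst_Cmp_Rst'[of f f] by simp

lemma Rst_idem_Cmp [simp]: "\<lbrakk>f \<in> Arr C; x \<in> Arr C; Cod C x = Dom C f\<rbrakk>
    \<Longrightarrow> Rst C f \<cdot> (Rst C f \<cdot> x) = Rst C f \<cdot> x"
  by (rule under) auto

lemma Rst_Cmp_le [simp]: "\<lbrakk>f \<in> Arr C; g \<in> Arr C; Dom C g = Cod C f\<rbrakk>
    \<Longrightarrow> Rst C (g \<cdot> f) \<cdot> Rst C f = Rst C (g \<cdot> f)"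
  using Rst_Cmp_Rst'[of f "g \<cdot> f"] by simp

lemma Rst_Cmp_le' [simp]: "\<lbrakk>f \<in> Arr C; g \<in> Arr C; Dom C g = Cod C f\<rbrakk>
    \<Longrightarrow> Rst C f \<cdot> Rst C (g \<cdot> f) = Rst C (g \<cdot> f)"
  by (subst Rst_comm) auto

lemma Rst_Rst_Cmp [simp]: "\<lbrakk>f \<in> Arr C; g \<in> Arr C; Dom C g = Cod C f\<rbrakk>
    \<Longrightarrow> Rst C (Rst C g \<cdot> f) = Rst C (g \<cdot> f)"
  by (subst Rst_slide) auto

lemma total_Rst: "total C f \<Longrightarrow> Rst C f = Ide C (Dom C f)"
  by (simp add: total_def)

lemma Rst_total_Cmp: "\<lbrakk>total C g; f \<in> Arr C; Dom C g = Cod C f\<rbrakk> \<Longrightarrow> Rst C (g \<cdot> f) = Rst C f"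
  using Rst_Rst_Cmp[of f g] by (simp add: total_def)

lemma total_Cmp: "\<lbrakk>total C g; total C f; Dom C g = Cod C f\<rbrakk> \<Longrightarrow> total C (g \<cdot> f)"
  using Rst_total_Cmp[of g f] by (simp add: total_def)

lemma total_Ide [simp]: "X \<in> Obj C \<Longrightarrow> total C (Ide C X)"
  by (simp add: total_def)

lemma RI_D: assumes "e \<in> RI C X" shows "e \<in> Arr C" "Dom C e = X" "Cod C e = X" "Rst C e = e" "X \<in> Obj C"
  using assms Dom_Obj[of e] by (auto simp: RI_def Hom_iff simp del: Dom_Obj)

lemma RI_I: "\<lbrakk>e \<in> Arr C; Dom C e = X; Cod C e = X; Rst C e = e\<rbrakk> \<Longrightarrow> e \<in> RI C X"
  by (auto simp: RI_def Hom_iff)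

lemma RI_Rst [simp]: "\<lbrakk>f \<in> Arr C; Dom C f = X\<rbrakk> \<Longrightarrow> Rst C f \<in> RI C X"
  by (auto intro: RI_I)

lemma RI_Ide [simp]: "X \<in> Obj C \<Longrightarrow> Ide C X \<in> RI C X"
  by (auto intro: RI_I)

lemma RI_idem: "e \<in> RI C X \<Longrightarrow> e \<cdot> e = e"
  using Rst_idem[of e] by (simp add: RI_D)

lemma RI_comm: "\<lbrakk>d \<in> RI C X; e \<in> RI C X\<rbrakk> \<Longrightarrow> d \<cdot> e = e \<cdot> d"
  using Rst_comm[of d e] by (simp add: RI_D)

lemma RI_lcomm: "\<lbrakk>d \<in> RI C X; e \<in> RI C X; x \<in> Arr C; Cod C x = X\<rbrakk> \<Longrightarrow> d \<cdot> (e \<cdot> x) = e \<cdot> (d \<cdot> x)"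
  using under2[OF RI_comm, of d X e x] by (simp add: RI_D)

lemma RI_idem_Cmp: "\<lbrakk>e \<in> RI C X; x \<in> Arr C; Cod C x = X\<rbrakk> \<Longrightarrow> e \<cdot> (e \<cdot> x) = e \<cdot> x"
  using Rst_idem_Cmp[of e x] by (simp add: RI_D)

lemma RI_Cmp: "\<lbrakk>d \<in> RI C X; e \<in> RI C X\<rbrakk> \<Longrightarrow> d \<cdot> e \<in> RI C X"
  using Rst_Cmp_Rst'[of e d] by (intro RI_I) (auto simp: RI_D)

lemma RI_slide: "\<lbrakk>e \<in> RI C Y; f \<in> Arr C; Cod C f = Y\<rbrakk> \<Longrightarrow> e \<cdot> f = f \<cdot> Rst C (e \<cdot> f)"
  using Rst_slide[of f e] by (simp add: RI_D)

lemma Rst_Cmp_RI: "\<lbrakk>e \<in> RI C X; f \<in> Arr C; Dom C f = X\<rbrakk> \<Longrightarrow> Rst C (f \<cdot> e) = Rst C f \<cdot> e"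
  using Rst_Cmp_Rst'[of e f] by (simp add: RI_D)

lemma RI_eqI: "\<lbrakk>d \<in> RI C X; e \<in> RI C X; d \<cdot> e = d; e \<cdot> d = e\<rbrakk> \<Longrightarrow> d = e"
  using RI_comm by metis

lemma le_D: "le C f g \<Longrightarrow> g \<cdot> Rst C f = f"
  by (simp add: le_def)

lemma le_I: "g \<cdot> Rst C f = f \<Longrightarrow> le C f g"
  by (simp add: le_def)

lemma le_refl: "f \<in> Arr C \<Longrightarrow> le C f f"
  by (simp add: le_def)

lemma le_Rst: "\<lbrakk>le C f g; f \<in> Arr C; g \<in> Arr C; Dom C f = Dom C g\<rbrakk> \<Longrightarrow> Rst C g \<cdot> Rst C f = Rst C f"
  using Rst_Cmp_Rst'[of f g] by (simp add: le_D)

lemma le_Rst_Rst: "\<lbrakk>le C f g; f \<in> Arr C; g \<in> Arr C; Dom C f = Dom C g\<rbrakk> \<Longrightarrow> le C (Rst C f) (Rst C g)"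
  using le_Rst[of f g] by (simp add: le_def[of _ "Rst C f"])

lemma le_antisym: "\<lbrakk>le C f g; le C g f; f \<in> Arr C; g \<in> Arr C; Dom C f = Dom C g\<rbrakk> \<Longrightarrow> f = g"
  using le_Rst[of f g] le_Rst[of g f] Rst_comm[of f g] by (metis Cmp_Rst_self le_def)

lemma le_trans:
  assumes "le C f g" "le C g h" "f \<in> Arr C" "g \<in> Arr C" "h \<in> Arr C" "Dom C f = Dom C g" "Dom C g = Dom C h"
  shows "le C f h"
proof -
  have "h \<cdot> Rst C f = h \<cdot> (Rst C g \<cdot> Rst C f)" using le_Rst[of f g] assms by simp
  also have "\<dots> = h \<cdot> Rst C g \<cdot> Rst C f" using assms by simp
  also have "\<dots> = f" using le_D[OF assms(1)] le_D[OF assms(2)] by simp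
  finally show ?thesis by (rule le_I)
qed

lemma le_RI: "\<lbrakk>e \<in> RI C X; f \<in> Arr C; Dom C f = X\<rbrakk> \<Longrightarrow> le C (f \<cdot> e) f"
  using Rst_Cmp_RI[of e X f] Cmp_Rst_self_Cmp[of f e] by (simp add: le_def RI_D)

lemma le_RI_iff: "\<lbrakk>d \<in> RI C X; e \<in> RI C X\<rbrakk> \<Longrightarrow> le C d e \<longleftrightarrow> d \<cdot> e = d"
  using RI_comm[of d X e] by (auto simp: le_def RI_D)

lemma le_Ide: "e \<in> RI C X \<Longrightarrow> le C e (Ide C X)"
  by (simp add: le_def RI_D)

text \<open>The slide axiom moves the restriction of \<open>f\<close> past \<open>x\<close>:
  \<open>g \<cdot> Rst C f \<cdot> x = g \<cdot> x \<cdot> Rst C (f \<cdot> x)\<close>.\<close>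

lemma le_precomp:
  assumes "le C f g" "f \<in> Arr C" "g \<in> Arr C" "Dom C f = Dom C g" "x \<in> Arr C" "Cod C x = Dom C f"
  shows "le C (f \<cdot> x) (g \<cdot> x)"
proof -
  have "f \<cdot> x = g \<cdot> Rst C f \<cdot> x" using le_D[OF assms(1)] by simp
  also have "\<dots> = g \<cdot> x \<cdot> Rst C (f \<cdot> x)" using assms(2-) by (simp add: Rst_slide[of x f])
  finally show ?thesis by (intro le_I) simp
qed

lemma le_postcomp:
  assumes "le C f g" "f \<in> Arr C" "g \<in> Arr C" "Dom C f = Dom C g" "x \<in> Arr C" "Dom C x = Cod C g" "Cod C f = Cod C g"
  shows "le C (x \<cdot> f) (x \<cdot> g)"
proof -
  have 2: "x \<cdot> g \<cdot> Rst C f = x \<cdot> f" using le_D[OF assms(1)] assms(2-) by simp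
  then have "x \<cdot> g \<cdot> Rst C (x \<cdot> f) = x \<cdot> g \<cdot> Rst C (x \<cdot> g \<cdot> Rst C f)" by simp
  also have "\<dots> = x \<cdot> g \<cdot> (Rst C (x \<cdot> g) \<cdot> Rst C f)" using assms by (subst Rst_Cmp_Rst') auto
  also have "\<dots> = x \<cdot> g \<cdot> Rst C f" using assms by (subst Cmp_Rst_self_Cmp) auto
  finally show ?thesis using 2 by (intro le_I) simp
qed

end

section \<open>Joins and their domains of definition\<close>

context join_restriction_category
begin

lemma is_join_Hom: assumes "is_join C A B S h"
  shows "S \<subseteq> Hom C A B" "h \<in> Hom C A B" "h \<in> Arr C" "Dom C h = A" "Cod C h = B" "A \<in> Obj C" "B \<in> Obj C"
  using assms Dom_Obj[of h] Cod_Obj[of h] by (auto simp: is_join_def Hom_iff simp del: Dom_Obj Cod_Obj)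

lemma is_join_upper: "\<lbrakk>is_join C A B S h; f \<in> S\<rbrakk> \<Longrightarrow> le C f h"
  by (simp add: is_join_def)

lemma is_join_least: "\<lbrakk>is_join C A B S h; k \<in> Hom C A B; \<And>f. f \<in> S \<Longrightarrow> le C f k\<rbrakk> \<Longrightarrow> le C h k"
  by (simp add: is_join_def)

lemma is_join_unique: "\<lbrakk>is_join C A B S h; is_join C A B S h'\<rbrakk> \<Longrightarrow> h = h'"
  by (rule le_antisym[OF is_join_least is_join_least])
    (auto simp: is_join_Hom is_join_upper)

lemma join_eq: "is_join C A B S h \<Longrightarrow> join C A B S = h"
  unfolding join_def by (rule the_equality) (auto intro: is_join_unique)

lemma compatible_RI: "\<lbrakk>d \<in> RI C X; e \<in> RI C X\<rbrakk> \<Longrightarrow> compatible C d e"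
  using RI_comm by (simp add: compatible_def RI_D)

text \<open>The identity bounds the family, and every map below an identity equals its own
  restriction.\<close>

lemma join_RI:
  assumes "E \<subseteq> RI C X" "is_join C X X E d" shows "d \<in> RI C X"
proof -
  have "le C d (Ide C X)"
    using is_join_Hom[OF assms(2)] by (intro is_join_least[OF assms(2)] le_Ide[of _ X] subsetD[OF assms(1)]) (auto simp: Hom_iff)
  from le_D[OF this] show ?thesis using is_join_Hom[OF assms(2)]
    by (intro RI_I) auto
qed

text \<open>Only precomposition is assumed to preserve joins. Let \<open>e\<close> be the join of
  the domains: each \<open>f\<close> is unchanged by \<open>e\<close>, so \<open>h \<cdot> e\<close>
  is again a join of \<open>S\<close> and equals \<open>h\<close>, whence the domain of
  \<open>h\<close> lies below \<open>e\<close>. The other inequality is monotonicity of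
  restriction.\<close>

lemma join_Rst:
  assumes "is_join C A B S h"
  shows "is_join C A A (Rst C ` S) (Rst C h)"
proof -
  note h = is_join_Hom[OF assms]
  have S: "\<And>f. f \<in> S \<Longrightarrow> f \<in> Arr C \<and> Dom C f = A \<and> Cod C f = B" using h(1) by (auto simp: Hom_iff)
  have E: "Rst C ` S \<subseteq> RI C A" using S by auto
  have "\<exists>e. is_join C A A (Rst C ` S) e"
    using h(6) E by (intro join_exists) (auto intro!: compatible_RI[of _ A] simp: RI_D[of _ A] Hom_iff)
  then obtain e where e: "is_join C A A (Rst C ` S) e" ..
  have eR: "e \<in> RI C A" using join_RI[OF E e] .
  have fe: "f \<cdot> e = f" if "f \<in> S" for f
  proof -
    have "e \<cdot> Rst C f = Rst C f" using le_D[OF is_join_upper[OF e, of "Rst C f"]] that S by simp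
    then have "Rst C f \<cdot> e = Rst C f" using RI_comm[OF eR, of "Rst C f"] S[OF that] by simp
    then show ?thesis using S[OF that] Cmp_Rst_self_Cmp[of f e] eR by (simp add: RI_D)
  qed
  have "is_join C A B ((\<lambda>f. f \<cdot> e) ` S) (h \<cdot> e)"
    using join_precomp[OF assms] eR by (auto simp: RI_def)
  moreover have "(\<lambda>f. f \<cdot> e) ` S = S" using fe by force
  ultimately have "is_join C A B S (h \<cdot> e)" by simp
  then have he: "h \<cdot> e = h" using is_join_unique assms by blast
  have 1: "Rst C h \<cdot> e = Rst C h" using Rst_Cmp_RI[OF eR, of h] he h by simp
  have "le C e (Rst C h)"
    by (rule is_join_least[OF e])
      (use is_join_upper[OF assms] S h in \<open>auto simp: Hom_iff intro!: le_Rst_Rst\<close>)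
  from le_D[OF this] have "Rst C h \<cdot> e = e" using eR by (simp add: RI_D)
  with 1 e show ?thesis by simp
qed

text \<open>Separation for families of idempotents: the maps \<open>f \<cdot> e\<close> and
  \<open>g \<cdot> e\<close> form one and the same family, whose join is both
  \<open>f \<cdot> d\<close> and \<open>g \<cdot> d\<close>.\<close>

lemma join_postcomp_RI:
  assumes E: "E \<subseteq> RI C X" "is_join C X X E d" and f: "f \<in> Hom C X Y" and g: "g \<in> Hom C X Y"
    and eq: "\<And>e. e \<in> E \<Longrightarrow> f \<cdot> e = g \<cdot> e"
  shows "f \<cdot> d = g \<cdot> d"
proof -
  have d: "d \<in> RI C X" using join_RI[OF E] .
  have eE: "e \<in> RI C X" "e \<in> Arr C" "Dom C e = X" "Cod C e = X" "e \<cdot> d = e" "d \<cdot> e = e" if "e \<in> E" for e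
  proof -
    show e: "e \<in> RI C X" using E(1) that by blast
    then show "e \<in> Arr C" "Dom C e = X" "Cod C e = X" by (auto simp: RI_D)
    show "e \<cdot> d = e" using is_join_upper[OF E(2) that] le_RI_iff[OF e d] by simp
    then show "d \<cdot> e = e" using RI_comm[OF d e] by simp
  qed
  have dD: "d \<in> Arr C" "Dom C d = X" "Cod C d = X" using d by (auto simp: RI_D)
  have fD: "f \<in> Arr C" "Dom C f = X" "Cod C f = Y" "g \<in> Arr C" "Dom C g = X" "Cod C g = Y" using f g by (auto simp: Hom_iff)
  text \<open>Joins of restriction idempotents are preserved by postcomposition, because the join of the
    family \<open>f e\<close> has the same domain of definition as \<open>f d\<close>.\<close>
  have J: "is_join C X Y ((\<lambda>e. k \<cdot> e) ` E) (k \<cdot> d)" if k: "k \<in> Hom C X Y" for k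
  proof -
    have kD: "k \<in> Arr C" "Dom C k = X" "Cod C k = Y" using k by (auto simp: Hom_iff)
    have sub: "(\<lambda>e. k \<cdot> e) ` E \<subseteq> Hom C X Y" using eE kD by (auto simp: Hom_iff)
    have comp: "compatible C (k \<cdot> e) (k \<cdot> e')" if "e \<in> E" "e' \<in> E" for e e'
    proof -
      have "k \<cdot> (e \<cdot> (Rst C k \<cdot> e')) = k \<cdot> (e' \<cdot> (Rst C k \<cdot> e))"
        using eE that kD RI_lcomm[of e X "Rst C k" e'] RI_lcomm[of e' X "Rst C k" e] RI_comm[of e X e'] by simp
      then show ?thesis using eE that kD by (simp add: compatible_def Rst_Cmp_RI[of _ X])
    qed
    have "\<exists>j. is_join C X Y ((\<lambda>e. k \<cdot> e) ` E) j"
      by (rule join_exists) (use sub comp kD Dom_Obj[of k] Cod_Obj[of k] in auto)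
    then obtain j where j: "is_join C X Y ((\<lambda>e. k \<cdot> e) ` E) j" ..
    note jD = is_join_Hom[OF j]
    have jle: "le C j (k \<cdot> d)"
    proof (rule is_join_least[OF j])
      show "k \<cdot> d \<in> Hom C X Y" using kD dD by (auto simp: Hom_iff)
      fix x assume "x \<in> (\<lambda>e. k \<cdot> e) ` E"
      then obtain e where e: "e \<in> E" "x = k \<cdot> e" by auto
      show "le C x (k \<cdot> d)"
        using e eE[OF e(1)] le_postcomp[of e d k] kD dD is_join_upper[OF E(2) e(1)] by auto
    qed
    have "is_join C X X (Rst C ` (\<lambda>e. k \<cdot> e) ` E) (Rst C j)" using join_Rst[OF j] .
    moreover have "is_join C X X ((\<lambda>e. e \<cdot> Rst C k) ` E) (d \<cdot> Rst C k)"
      using join_precomp[OF E(2), of "Rst C k" X] kD by (auto simp: Hom_iff)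
    moreover have "Rst C ` (\<lambda>e. k \<cdot> e) ` E = (\<lambda>e. e \<cdot> Rst C k) ` E"
    proof -
      have "Rst C (k \<cdot> e) = e \<cdot> Rst C k" if "e \<in> E" for e
        using eE[OF that] kD RI_comm[of e X "Rst C k"] by (simp add: Rst_Cmp_RI[of _ X])
      then show ?thesis by (auto simp: image_image)
    qed
    ultimately have "Rst C j = d \<cdot> Rst C k" using is_join_unique by metis
    also have "\<dots> = Rst C (k \<cdot> d)" using d kD RI_comm[of d X "Rst C k"] by (simp add: Rst_Cmp_RI[of _ X])
    finally have "j = k \<cdot> d" using le_D[OF jle] jD kD dD RI_comm[OF d, of "Rst C k"] Cmp_Rst_self_Cmp[of k d] by simp
    with j show ?thesis by simp
  qed
  have "(\<lambda>e. f \<cdot> e) ` E = (\<lambda>e. g \<cdot> e) ` E" using eq by auto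
  then show ?thesis using J[OF f] J[OF g] is_join_unique by metis
qed

end

section \<open>Covers by restriction idempotents\<close>

text \<open>Indexed families are used instead of sets, so that inverse images along maps and
  refinements by a product of index sets keep track of their indices.\<close>

definition cover :: "('o,'m) rcat \<Rightarrow> 'o \<Rightarrow> 'k set \<Rightarrow> ('k \<Rightarrow> 'm) \<Rightarrow> 'm \<Rightarrow> bool" where
  "cover C X I c d \<longleftrightarrow> (\<forall>i \<in> I. c i \<in> RI C X) \<and> is_join C X X (c ` I) d"

context join_restriction_category
begin

lemma cover_D: assumes "cover C X I c d"
  shows "\<And>i. i \<in> I \<Longrightarrow> c i \<in> RI C X" "d \<in> RI C X" "\<And>i. i \<in> I \<Longrightarrow> c i \<cdot> d = c i"
    "\<And>i. i \<in> I \<Longrightarrow> d \<cdot> c i = c i" "is_join C X X (c ` I) d"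
proof -
  show c: "\<And>i. i \<in> I \<Longrightarrow> c i \<in> RI C X" and j: "is_join C X X (c ` I) d" using assms by (auto simp: cover_def)
  show d: "d \<in> RI C X" by (rule join_RI[OF _ j]) (use c in auto)
  show 1: "c i \<cdot> d = c i" if "i \<in> I" for i
    using is_join_upper[OF j, of "c i"] le_RI_iff[OF c[OF that] d] that by simp
  show "d \<cdot> c i = c i" if "i \<in> I" for i using 1[OF that] RI_comm[OF d c[OF that]] by simp
qed

lemma cover_ext:
  assumes "cover C X I c d" "f \<in> Arr C" "g \<in> Arr C" "Dom C f = X" "Dom C g = X" "Cod C f = Cod C g"
    "\<And>i. i \<in> I \<Longrightarrow> f \<cdot> c i = g \<cdot> c i"
  shows "f \<cdot> d = g \<cdot> d"
  by (rule join_postcomp_RI[of "c ` I" X d f "Cod C g"]) (use assms cover_D[OF assms(1)] in \<open>auto simp: Hom_iff\<close>)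

lemma cover_exists:
  assumes "X \<in> Obj C" "\<And>i. i \<in> I \<Longrightarrow> c i \<in> RI C X"
  shows "\<exists>d. cover C X I c d"
proof -
  have "\<exists>d. is_join C X X (c ` I) d"
    by (rule join_exists) (use assms in \<open>auto simp: RI_D[of _ X] Hom_iff intro!: compatible_RI[of _ X]\<close>)
  then show ?thesis using assms(2) by (auto simp: cover_def)
qed

text \<open>It suffices to compare \<open>d\<close> with idempotent upper bounds: the join of the
  family exists, since idempotents are always compatible, and it is itself such a bound.\<close>

lemma coverI:
  assumes "d \<in> RI C X" "\<And>i. i \<in> I \<Longrightarrow> c i \<in> RI C X" "\<And>i. i \<in> I \<Longrightarrow> c i \<cdot> d = c i"
    "\<And>k. \<lbrakk>k \<in> RI C X; \<And>i. i \<in> I \<Longrightarrow> c i \<cdot> k = c i\<rbrakk> \<Longrightarrow> d \<cdot> k = d"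
  shows "cover C X I c d"
proof -
  obtain d' where d': "cover C X I c d'" using cover_exists[of X I c] assms(1,2) RI_D(5) by blast
  note D = cover_D[OF d']
  have 1: "d \<cdot> d' = d" using assms(4)[OF D(2)] D by blast
  have "le C d' d"
    by (rule is_join_least[OF D(5)]) (use assms in \<open>auto simp: RI_D Hom_iff le_RI_iff[of _ X]\<close>)
  then have "d' \<cdot> d = d'" using le_RI_iff[OF D(2) assms(1)] by simp
  then have "d = d'" using 1 RI_eqI[OF assms(1) D(2)] by simp
  then show ?thesis using d' by simp
qed

text \<open>Covers have inverse images along any partial map: precomposition preserves the join, and
  \<open>join_Rst\<close> passes from the maps \<open>c i \<cdot> g\<close> to their
  domains.\<close>

lemma cover_precomp:
  assumes "cover C X I c d" "g \<in> Arr C" "Cod C g = X"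
  shows "cover C (Dom C g) I (\<lambda>i. Rst C (c i \<cdot> g)) (Rst C (d \<cdot> g))"
proof -
  note D = cover_D[OF assms(1)]
  have "is_join C (Dom C g) X ((\<lambda>f. f \<cdot> g) ` c ` I) (d \<cdot> g)"
    using join_precomp[OF D(5)] assms by (auto simp: Hom_iff)
  from join_Rst[OF this] show ?thesis using assms D by (auto simp: cover_def image_image RI_D[OF D(1)])
qed

lemma cover_cong:
  "\<lbrakk>cover C X I c d; \<And>i. i \<in> I \<Longrightarrow> c i = c' i; d = d'\<rbrakk> \<Longrightarrow> cover C X I c' d'"
  by (auto simp: cover_def cong: image_cong)

text \<open>Transitivity of covers. One index set \<open>J\<close> refines every piece, so a product
  replaces a dependent sum of index sets.\<close>

lemma cover_Sigma:
  assumes "cover C X I c d" "\<And>i. i \<in> I \<Longrightarrow> cover C X J (c' i) (c i)"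
  shows "cover C X (I \<times> J) (\<lambda>(i, j). c' i j) d"
proof (rule coverI)
  note D = cover_D[OF assms(1)] and D' = cover_D[OF assms(2)]
  show "d \<in> RI C X" by (rule D)
  show c': "(case p of (i, j) \<Rightarrow> c' i j) \<in> RI C X" if "p \<in> I \<times> J" for p using that D' by auto
  show "(case p of (i, j) \<Rightarrow> c' i j) \<cdot> d = (case p of (i, j) \<Rightarrow> c' i j)" if "p \<in> I \<times> J" for p
  proof -
    obtain i j where p: "p = (i, j)" "i \<in> I" "j \<in> J" using \<open>p \<in> I \<times> J\<close> by auto
    then have "c' i j \<cdot> d = c' i j \<cdot> (c i \<cdot> d)"
      using D D'(3)[of i j] D'(1)[of i j] by (metis RI_D(1-3) assoc)
    then show ?thesis using D D' p by simp
  qed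
  fix k assume k: "k \<in> RI C X" and p: "\<And>p. p \<in> I \<times> J \<Longrightarrow> (case p of (i, j) \<Rightarrow> c' i j) \<cdot> k = (case p of (i, j) \<Rightarrow> c' i j)"
  have X: "X \<in> Obj C" using k by (rule RI_D)
  \<comment> \<open>An upper bound of the refined family acts as the identity on each
    \<open>c i\<close>, and hence on \<open>d\<close>.\<close>
  have "k \<cdot> c i = Ide C X \<cdot> c i" if i: "i \<in> I" for i
  proof (rule cover_ext[OF assms(2)[OF i]])
    fix j assume j: "j \<in> J"
    have "c' i j \<cdot> k = c' i j" using p[of "(i, j)"] i j by simp
    then show "k \<cdot> c' i j = Ide C X \<cdot> c' i j" using RI_comm[OF k D'(1)[OF i j]] D'(1)[OF i j] by (simp add: RI_D[of _ X])
  qed (use k X in \<open>auto simp: RI_D\<close>)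
  then have "k \<cdot> d = Ide C X \<cdot> d"
    by (intro cover_ext[OF assms(1)]) (use k X in \<open>auto simp: RI_D\<close>)
  then show "d \<cdot> k = d" using RI_comm[OF k D(2)] D(2) by (simp add: RI_D[of _ X])
qed

text \<open>The sheaf condition: maps supported on the pieces and equal on overlaps form a
  compatible family, and its join is the glued map.\<close>

lemma cover_glue:
  assumes "cover C X I c d" "Y \<in> Obj C" "\<And>i. i \<in> I \<Longrightarrow> f i \<in> Hom C X Y" "\<And>i. i \<in> I \<Longrightarrow> f i \<cdot> c i = f i"
    "\<And>i j. \<lbrakk>i \<in> I; j \<in> I\<rbrakk> \<Longrightarrow> f i \<cdot> c j = f j \<cdot> c i"
  shows "\<exists>h \<in> Hom C X Y. h \<cdot> d = h \<and> (\<forall>i \<in> I. h \<cdot> c i = f i)"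
proof -
  note D = cover_D[OF assms(1)]
  have f: "f i \<in> Arr C" "Dom C (f i) = X" "Cod C (f i) = Y" if "i \<in> I" for i using assms(3)[OF that] by (auto simp: Hom_iff)
  note c = RI_D[OF D(1)] and d = RI_D[OF D(2)]
  \<comment> \<open>The map \<open>f j\<close> may be undefined on part of \<open>c j\<close>, so
    agreement on overlaps has to be rewritten in terms of the domains of the \<open>f j\<close>
    before compatibility can be read off.\<close>
  have 1: "f i \<cdot> Rst C (f j) = f j \<cdot> c i" if i: "i \<in> I" and j: "j \<in> I" for i j
  proof -
    have "Rst C (f j) \<cdot> c j = Rst C (f j)"
      using Rst_Cmp_RI[OF D(1)[OF j], of "f j"] assms(4)[OF j] f j by simp
    then have a: "c j \<cdot> Rst C (f j) = Rst C (f j)" using RI_comm[OF D(1)[OF j], of "Rst C (f j)"] f j by simp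
    have "f i \<cdot> Rst C (f j) = f i \<cdot> c j \<cdot> Rst C (f j)" using a f c i j by simp
    also have "\<dots> = f j \<cdot> (c i \<cdot> Rst C (f j))" using assms(5)[OF i j] f c i j by simp
    also have "\<dots> = f j \<cdot> (Rst C (f j) \<cdot> c i)" using RI_comm[OF D(1)[OF i], of "Rst C (f j)"] f j by simp
    finally show ?thesis using f c i j by simp
  qed
  have "\<exists>h. is_join C X Y (f ` I) h"
  proof (rule join_exists)
    show "f ` I \<subseteq> Hom C X Y" using assms(3) by auto
    fix u v assume "u \<in> f ` I" "v \<in> f ` I"
    then show "compatible C u v" using 1 assms(5) by (auto simp: compatible_def)
  qed (use d assms in auto)
  then obtain h where h: "is_join C X Y (f ` I) h" ..
  note hD = is_join_Hom[OF h]
  have "is_join C X Y ((\<lambda>k. k \<cdot> d) ` f ` I) (h \<cdot> d)" using join_precomp[OF h] d by (auto simp: Hom_iff)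
  moreover have "(\<lambda>k. k \<cdot> d) ` f ` I = f ` I"
  proof -
    have "f i \<cdot> d = f i" if i: "i \<in> I" for i
    proof -
      have "f i \<cdot> d = f i \<cdot> (c i \<cdot> d)" using assms(4)[OF i] f c d i by (metis assoc)
      then show ?thesis using D(3)[OF i] assms(4)[OF i] by simp
    qed
    then show ?thesis by (auto simp: image_image)
  qed
  ultimately have "is_join C X Y (f ` I) (h \<cdot> d)" by simp
  then have hd: "h \<cdot> d = h" using is_join_unique h by blast
  \<comment> \<open>By stability \<open>h \<cdot> c i\<close> is the join of the maps
    \<open>f j \<cdot> c i = f i \<cdot> c j\<close>, all of which lie below \<open>f i\<close>;
    conversely \<open>f i\<close> lies below \<open>h\<close> and is supported on
    \<open>c i\<close>.\<close>
  have "h \<cdot> c i = f i" if i: "i \<in> I" for i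
  proof (rule le_antisym)
    have "is_join C X Y ((\<lambda>k. k \<cdot> c i) ` f ` I) (h \<cdot> c i)" using join_precomp[OF h] c i by (auto simp: Hom_iff)
    then show "le C (h \<cdot> c i) (f i)"
    proof (rule is_join_least)
      fix k assume "k \<in> (\<lambda>k. k \<cdot> c i) ` f ` I"
      then obtain j where "j \<in> I" "k = f i \<cdot> c j" using assms(5) i by auto
      then show "le C k (f i)" using le_RI[OF D(1)] f i by simp
    qed (use assms i in auto)
    have "le C (f i \<cdot> c i) (h \<cdot> c i)"
      by (rule le_precomp) (use is_join_upper[OF h] f c i hD in auto)
    then show "le C (f i) (h \<cdot> c i)" using assms(4)[OF i] by simp
  qed (use f c hD i in auto)
  then show ?thesis using hD hd by blast
qed

text \<open>Joins are recognised on domains: any other upper bound agrees with \<open>h\<close> on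
  the domain of each member, hence on the join of these domains.\<close>

lemma is_joinI:
  assumes "S \<subseteq> Hom C A B" "h \<in> Hom C A B" "\<And>f. f \<in> S \<Longrightarrow> le C f h" "is_join C A A (Rst C ` S) (Rst C h)"
  shows "is_join C A B S h"
  unfolding is_join_def
proof (intro conjI ballI impI)
  fix k assume k: "k \<in> Hom C A B" "\<forall>f \<in> S. le C f k"
  have "k \<cdot> Rst C h = h \<cdot> Rst C h"
  proof (rule join_postcomp_RI[OF _ assms(4) k(1) assms(2)])
    show "Rst C ` S \<subseteq> RI C A" using assms(1) by (auto simp: Hom_iff)
    fix e assume "e \<in> Rst C ` S"
    then show "k \<cdot> e = h \<cdot> e" using assms(3) k(2) le_D by force
  qed
  then show "le C h k" using assms(2) by (intro le_I) (auto simp: Hom_iff)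
qed (use assms in auto)

lemma is_join_coverI:
  assumes "\<And>i. i \<in> I \<Longrightarrow> f i \<in> Hom C A B" "h \<in> Hom C A B" "\<And>i. i \<in> I \<Longrightarrow> le C (f i) h"
    "cover C A I (\<lambda>i. Rst C (f i)) (Rst C h)"
  shows "is_join C A B (f ` I) h"
  by (rule is_joinI) (use assms cover_D(5)[OF assms(4)] in \<open>auto simp: image_image\<close>)

lemma is_join_cover: "is_join C A B (f ` I) h \<Longrightarrow> cover C A I (\<lambda>i. Rst C (f i)) (Rst C h)"
  using join_Rst[of A B "f ` I" h] is_join_Hom[of A B "f ` I" h]
  by (auto simp: cover_def image_image Hom_iff)

end

text \<open>The equality locus of two parallel maps inside their common domain of definition. The
  choice operator selects a join, which is unique.\<close>

definition agree :: "('o,'m) rcat \<Rightarrow> 'm \<Rightarrow> 'm \<Rightarrow> 'm" where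
  "agree C f g = (SOME d. cover C (Dom C f)
     {e \<in> RI C (Dom C f). Rst C f \<cdot>\<^bsub>C\<^esub> e = e \<and> f \<cdot>\<^bsub>C\<^esub> e = g \<cdot>\<^bsub>C\<^esub> e} (\<lambda>e. e) d)"

context join_restriction_category
begin

lemma agree:
  assumes f: "f \<in> Arr C" and g: "g \<in> Arr C" and fg: "Dom C g = Dom C f" "Cod C g = Cod C f"
  shows agree_RI: "agree C f g \<in> RI C (Dom C f)" and agree_eq: "f \<cdot> agree C f g = g \<cdot> agree C f g"
    and agree_le: "Rst C f \<cdot> agree C f g = agree C f g"
    and agree_le': "Rst C g \<cdot> agree C f g = agree C f g"
    and agree_greatest: "\<And>e. \<lbrakk>e \<in> RI C (Dom C f); Rst C f \<cdot> e = e; f \<cdot> e = g \<cdot> e\<rbrakk> \<Longrightarrow> e \<cdot> agree C f g = e"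
proof -
  let ?E = "{e \<in> RI C (Dom C f). Rst C f \<cdot> e = e \<and> f \<cdot> e = g \<cdot> e}"
  have "\<exists>d. cover C (Dom C f) ?E (\<lambda>e. e) d" by (rule cover_exists) (use f in auto)
  then have c: "cover C (Dom C f) ?E (\<lambda>e. e) (agree C f g)" unfolding agree_def by (rule someI_ex)
  note D = cover_D[OF c]
  show "agree C f g \<in> RI C (Dom C f)" by (rule D)
  show "f \<cdot> agree C f g = g \<cdot> agree C f g" by (rule cover_ext[OF c]) (use f g fg in auto)
  have "Rst C f \<cdot> agree C f g = Ide C (Dom C f) \<cdot> agree C f g"
    by (rule cover_ext[OF c]) (use f in \<open>auto simp: RI_D\<close>)
  then show "Rst C f \<cdot> agree C f g = agree C f g" using D(2) by (simp add: RI_D)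
  \<comment> \<open>On each such \<open>e\<close> the maps \<open>f\<close> and \<open>g\<close>
    restrict to the same map, so their domains meet \<open>e\<close> in the same idempotent.\<close>
  have "Rst C g \<cdot> agree C f g = Ide C (Dom C f) \<cdot> agree C f g"
  proof (rule cover_ext[OF c])
    fix e assume e: "e \<in> ?E"
    then have "Rst C g \<cdot> e = Rst C f \<cdot> e"
      using Rst_Cmp_RI[of e "Dom C f" f] Rst_Cmp_RI[of e "Dom C f" g] f g fg by simp
    then show "Rst C g \<cdot> e = Ide C (Dom C f) \<cdot> e" using e RI_D[of e "Dom C f"] by simp
  qed (use f g fg in auto)
  then show "Rst C g \<cdot> agree C f g = agree C f g" using D(2) by (simp add: RI_D)
  show "\<And>e. \<lbrakk>e \<in> RI C (Dom C f); Rst C f \<cdot> e = e; f \<cdot> e = g \<cdot> e\<rbrakk> \<Longrightarrow> e \<cdot> agree C f g = e"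
    using D(3) by simp
qed

text \<open>A common lower bound of \<open>f\<close> and \<open>g\<close> is the restriction of
  \<open>f\<close> to an idempotent on which the two coincide, and \<open>agree\<close> is the
  largest of these.\<close>

lemma is_meet_agree:
  assumes f: "f \<in> Hom C A B" and g: "g \<in> Hom C A B"
  shows "is_meet C f g (f \<cdot> agree C f g)"
proof -
  have h: "f \<in> Arr C" "g \<in> Arr C" "Dom C g = Dom C f" "Cod C g = Cod C f" using f g by (auto simp: Hom_iff)
  note a = agree[OF h] and aR = RI_D[OF agree_RI[OF h]]
  show ?thesis unfolding is_meet_def
  proof (intro conjI ballI impI)
    show "f \<cdot> agree C f g \<in> Hom C (Dom C f) (Cod C f)" using h aR by (auto simp: Hom_iff)
    show "le C (f \<cdot> agree C f g) f" using le_RI[OF a(1)] h by simp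
    show "le C (f \<cdot> agree C f g) g" using le_RI[OF a(1)] h a(2) by simp
    fix k assume "k \<in> Hom C (Dom C f) (Cod C f)" and k: "le C k f \<and> le C k g"
    then have kD: "k \<in> Arr C" "Dom C k = Dom C f" by (auto simp: Hom_iff)
    have 1: "f \<cdot> Rst C k = k" "g \<cdot> Rst C k = k" using le_D k by auto
    have "Rst C f \<cdot> Rst C k = Rst C k" using le_Rst[of k f] k kD h by simp
    then have "Rst C k \<cdot> agree C f g = Rst C k" using a(5)[of "Rst C k"] kD 1 by simp
    then have "agree C f g \<cdot> Rst C k = Rst C k" using RI_comm[OF a(1), of "Rst C k"] kD by simp
    then show "le C k (f \<cdot> agree C f g)" using 1 h aR kD by (intro le_I) simp
  qed
qed

lemma is_meet_unique: "\<lbrakk>is_meet C f g h; is_meet C f g h'\<rbrakk> \<Longrightarrow> h = h'"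
  unfolding is_meet_def by (metis Hom_iff le_antisym)

lemma meet_is_meet: assumes "f \<in> Hom C A B" "g \<in> Hom C A B" shows "is_meet C f g (meet C f g)"
  unfolding meet_def
  by (rule theI[where a = "f \<cdot> agree C f g"]) (use is_meet_unique is_meet_agree[OF assms] in blast)+

lemma meet_eqI: "is_meet C f g h \<Longrightarrow> meet C f g = h"
  unfolding meet_def by (rule the_equality) (auto intro: is_meet_unique)

end

section \<open>Pullbacks and local homeomorphisms\<close>

definition has_pb :: "('o,'m) rcat \<Rightarrow> 'm \<Rightarrow> 'm \<Rightarrow> bool" where
  "has_pb C f g \<longleftrightarrow> is_pullback C f g (pr1 C f g) (pr2 C f g)"

lemma has_pbI: "is_pullback C f g p q \<Longrightarrow> has_pb C f g"
  unfolding has_pb_def pr1_def pr2_def pb_def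
  by (rule someI_ex[where P = "\<lambda>pq. is_pullback C f g (fst pq) (snd pq)"]) auto

lemma Dom_pr1 [simp]: "Dom C (pr1 C f g) = pbo C f g"
  by (simp add: pbo_def)

context restriction_category
begin

lemma pullback_D: assumes "is_pullback C f g p q"
  shows "f \<in> Arr C" "g \<in> Arr C" "p \<in> Arr C" "q \<in> Arr C" "Cod C g = Cod C f" "Cod C p = Dom C f"
    "Cod C q = Dom C g" "Dom C q = Dom C p" "f \<cdot> p = g \<cdot> q"
  using assms by (auto simp: is_pullback_def Hom_iff)

lemma pullback_ext:
  assumes "is_pullback C f g p q" "h \<in> Arr C" "h' \<in> Arr C" "Cod C h = Dom C p" "Cod C h' = Dom C p"
    "p \<cdot> h = p \<cdot> h'" "q \<cdot> h = q \<cdot> h'"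
  shows "h = h'"
proof -
  note D = pullback_D[OF assms(1)]
  have d: "Dom C h' = Dom C h" using arg_cong[OF assms(6), of "Dom C"] assms(2-5) D by simp
  have "f \<cdot> (p \<cdot> h) = g \<cdot> (q \<cdot> h)"
    using under2[OF D(9), of h] assms(2-5) D by simp
  moreover have "Dom C h \<in> Obj C" "p \<cdot> h \<in> Hom C (Dom C h) (Dom C f)" "q \<cdot> h \<in> Hom C (Dom C h) (Dom C g)"
    using assms(2-5) D by (auto simp: Hom_iff)
  ultimately have "\<exists>!k. k \<in> Hom C (Dom C h) (Dom C p) \<and> p \<cdot> k = p \<cdot> h \<and> q \<cdot> k = q \<cdot> h"
    using assms(1) unfolding is_pullback_def by blast
  moreover have "h \<in> Hom C (Dom C h) (Dom C p)" "h' \<in> Hom C (Dom C h) (Dom C p)"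
    using assms d by (auto simp: Hom_iff)
  ultimately show ?thesis using assms by metis
qed

lemma pullback_ex:
  assumes "is_pullback C f g p q" "u \<in> Arr C" "v \<in> Arr C" "Dom C v = Dom C u" "Cod C u = Dom C f" "Cod C v = Dom C g"
    "f \<cdot> u = g \<cdot> v"
  shows "\<exists>h. h \<in> Hom C (Dom C u) (Dom C p) \<and> p \<cdot> h = u \<and> q \<cdot> h = v"
proof -
  have "Dom C u \<in> Obj C" "u \<in> Hom C (Dom C u) (Dom C f)" "v \<in> Hom C (Dom C u) (Dom C g)"
    using assms by (auto simp: Hom_iff)
  then show ?thesis using assms(1,7) unfolding is_pullback_def by blast
qed

text \<open>The two projections have the same domain of definition, because \<open>f\<close> and
  \<open>g\<close> are total. That idempotent is fixed by both projections, so uniqueness of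
  mediating maps makes it the identity.\<close>

lemma pullback_total:
  assumes "is_pullback C f g p q" "total C f" "total C g"
  shows "total C p" "total C q"
proof -
  note D = pullback_D[OF assms(1)]
  have 1: "Rst C p = Rst C q"
    using Rst_total_Cmp[OF assms(2), of p] Rst_total_Cmp[OF assms(3), of q] D by simp
  have "Rst C p = Ide C (Dom C p)"
  proof (rule pullback_ext[OF assms(1)])
    show "q \<cdot> Rst C p = q \<cdot> Ide C (Dom C p)" unfolding 1 using D by simp
  qed (use D in auto)
  then show "total C p" "total C q" using D 1 by (auto simp: total_def)
qed

lemma pb_D: assumes "has_pb C f g"
  shows "f \<in> Arr C" "g \<in> Arr C" "pr1 C f g \<in> Arr C" "pr2 C f g \<in> Arr C" "Cod C g = Cod C f" "Cod C (pr1 C f g) = Dom C f"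
    "Cod C (pr2 C f g) = Dom C g" "Dom C (pr2 C f g) = pbo C f g" "f \<cdot> pr1 C f g = g \<cdot> pr2 C f g"
  using pullback_D[OF assms[unfolded has_pb_def]] by auto

lemma pb_square: "\<lbrakk>has_pb C f g; x \<in> Arr C; Cod C x = pbo C f g\<rbrakk> \<Longrightarrow> f \<cdot> (pr1 C f g \<cdot> x) = g \<cdot> (pr2 C f g \<cdot> x)"
  using under2[OF pb_D(9)] by (simp add: pb_D)

lemma pb_total: assumes "has_pb C f g" "total C f" "total C g"
  shows "total C (pr1 C f g)" "total C (pr2 C f g)"
  using pullback_total[OF assms(1)[unfolded has_pb_def]] assms by auto

lemma pb_ext:
  assumes "has_pb C f g" "h \<in> Arr C" "h' \<in> Arr C" "Cod C h = pbo C f g" "Cod C h' = pbo C f g"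
    "pr1 C f g \<cdot> h = pr1 C f g \<cdot> h'" "pr2 C f g \<cdot> h = pr2 C f g \<cdot> h'"
  shows "h = h'"
  using pullback_ext[OF assms(1)[unfolded has_pb_def]] assms by simp

lemma pairing:
  assumes "has_pb C f g" "u \<in> Arr C" "v \<in> Arr C" "Dom C v = Dom C u" "Cod C u = Dom C f" "Cod C v = Dom C g"
    "f \<cdot> u = g \<cdot> v"
  shows pairing_Arr: "pairing C f g u v \<in> Arr C" and Dom_pairing: "Dom C (pairing C f g u v) = Dom C u"
    and Cod_pairing: "Cod C (pairing C f g u v) = pbo C f g"
    and pr1_pairing: "pr1 C f g \<cdot> pairing C f g u v = u"
    and pr2_pairing: "pr2 C f g \<cdot> pairing C f g u v = v"
proof -
  obtain h where h: "h \<in> Arr C" "Dom C h = Dom C u" "Cod C h = pbo C f g" "pr1 C f g \<cdot> h = u" "pr2 C f g \<cdot> h = v"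
    using pullback_ex[OF assms(1)[unfolded has_pb_def] assms(2-)] unfolding Hom_iff Dom_pr1 by blast
  have "pairing C f g u v = h"
    unfolding pairing_def
  proof (rule the_equality)
    fix k assume "k \<in> Hom C (Dom C u) (pbo C f g) \<and> pr1 C f g \<cdot> k = u \<and> pr2 C f g \<cdot> k = v"
    then have k: "k \<in> Arr C" "Cod C k = pbo C f g" "pr1 C f g \<cdot> k = u" "pr2 C f g \<cdot> k = v"
      unfolding Hom_iff by blast+
    show "k = h" by (rule pb_ext[OF assms(1)]) (use h k in simp_all)
  qed (use h in \<open>simp add: Hom_iff\<close>)
  then show "pairing C f g u v \<in> Arr C" "Dom C (pairing C f g u v) = Dom C u" "Cod C (pairing C f g u v) = pbo C f g"
    "pr1 C f g \<cdot> pairing C f g u v = u" "pr2 C f g \<cdot> pairing C f g u v = v"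
    using h by simp_all
qed

lemma pairing_eqI:
  assumes "has_pb C f g" "h \<in> Arr C" "Cod C h = pbo C f g" "pr1 C f g \<cdot> h = u" "pr2 C f g \<cdot> h = v"
  shows "pairing C f g u v = h"
proof -
  have p: "u \<in> Arr C" "v \<in> Arr C" "Dom C v = Dom C u" "Cod C u = Dom C f" "Cod C v = Dom C g" "f \<cdot> u = g \<cdot> v"
    "Dom C u = Dom C h"
    using assms(2-3) pb_D[OF assms(1)] pb_square[OF assms(1), of h] unfolding assms(4-5)[symmetric] by auto
  show ?thesis
    by (rule pb_ext[OF assms(1)]) (use assms p pairing[OF assms(1) p(1-6)] in auto)
qed

lemma psec_D: assumes "partial_section C p s" "p \<in> Arr C"
  shows "s \<in> Arr C" "Dom C s = Cod C p" "Cod C s = Dom C p" "p \<cdot> s = Rst C s"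
  using assms by (auto simp: partial_section_def Hom_iff)

lemma psecI: "\<lbrakk>s \<in> Arr C; Dom C s = Cod C p; Cod C s = Dom C p; p \<cdot> s = Rst C s\<rbrakk> \<Longrightarrow> partial_section C p s"
  by (auto simp: partial_section_def Hom_iff)

lemma psec_RI:
  assumes s: "partial_section C p s" and p: "p \<in> Arr C" and e: "e \<in> RI C (Cod C p)"
  shows "partial_section C p (s \<cdot> e)"
proof -
  note sD = psec_D[OF s p] and eD = RI_D[OF e]
  show ?thesis
    using sD eD p under[OF sD(4), of e] Rst_Cmp_RI[OF e, of s] by (intro psecI) auto
qed

text \<open>The pairing exists because \<open>\<sigma> \<cdot> s \<cdot> f = Rst C s \<cdot> f = f
  \<cdot> Rst C (s \<cdot> f)\<close>, by the section property and the slide law.\<close>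

lemma pull_section:
  assumes h: "has_pb C \<sigma> f" and f: "total C f" and s: "partial_section C \<sigma> s"
  shows pull_Arr: "pull_section C \<sigma> f s \<in> Arr C" and Dom_pull: "Dom C (pull_section C \<sigma> f s) = Dom C f"
    and Cod_pull: "Cod C (pull_section C \<sigma> f s) = pbo C \<sigma> f"
    and pr1_pull: "pr1 C \<sigma> f \<cdot> pull_section C \<sigma> f s = s \<cdot> f"
    and pr2_pull: "pr2 C \<sigma> f \<cdot> pull_section C \<sigma> f s = Rst C (s \<cdot> f)"
proof -
  note D = pb_D[OF h] and sD = psec_D[OF s pb_D(1)[OF h]]
  have "\<sigma> \<cdot> (s \<cdot> f) = f \<cdot> Rst C (s \<cdot> f)"
    using D sD under[OF sD(4), of f] Rst_slide[of f s] by simp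
  then have a: "s \<cdot> f \<in> Arr C" "Rst C (s \<cdot> f) \<in> Arr C" "Dom C (Rst C (s \<cdot> f)) = Dom C (s \<cdot> f)"
    "Cod C (s \<cdot> f) = Dom C \<sigma>" "Cod C (Rst C (s \<cdot> f)) = Dom C f" "\<sigma> \<cdot> (s \<cdot> f) = f \<cdot> Rst C (s \<cdot> f)"
    using D sD by auto
  show "pull_section C \<sigma> f s \<in> Arr C" "Dom C (pull_section C \<sigma> f s) = Dom C f"
    "Cod C (pull_section C \<sigma> f s) = pbo C \<sigma> f" "pr1 C \<sigma> f \<cdot> pull_section C \<sigma> f s = s \<cdot> f"
    "pr2 C \<sigma> f \<cdot> pull_section C \<sigma> f s = Rst C (s \<cdot> f)"
    unfolding pull_section_def using pairing[OF h a] D sD by auto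
qed

lemma pull_Cmp:
  assumes h: "has_pb C \<sigma> f" and f: "total C f" and s: "partial_section C \<sigma> s" and x: "x \<in> Arr C" "Cod C x = Dom C f"
  shows pr1_pull_Cmp: "pr1 C \<sigma> f \<cdot> (pull_section C \<sigma> f s \<cdot> x) = s \<cdot> (f \<cdot> x)"
    and pr2_pull_Cmp: "pr2 C \<sigma> f \<cdot> (pull_section C \<sigma> f s \<cdot> x) = x \<cdot> Rst C (s \<cdot> (f \<cdot> x))"
proof -
  note D = pb_D[OF h] and sD = psec_D[OF s pb_D(1)[OF h]] and p = pull_section[OF h f s]
  show "pr1 C \<sigma> f \<cdot> (pull_section C \<sigma> f s \<cdot> x) = s \<cdot> (f \<cdot> x)"
    using under[OF p(4), of x] D p sD x by simp
  show "pr2 C \<sigma> f \<cdot> (pull_section C \<sigma> f s \<cdot> x) = x \<cdot> Rst C (s \<cdot> (f \<cdot> x))"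
    using under[OF p(5), of x] Rst_slide[of x "s \<cdot> f"] D p sD x by simp
qed

lemma pull_Cmp_eqI:
  assumes "has_pb C \<sigma> f" "total C f" "partial_section C \<sigma> s" "x \<in> Arr C" "Cod C x = Dom C f"
    "h \<in> Arr C" "Cod C h = pbo C \<sigma> f" "pr1 C \<sigma> f \<cdot> h = s \<cdot> (f \<cdot> x)" "pr2 C \<sigma> f \<cdot> h = x \<cdot> Rst C (s \<cdot> (f \<cdot> x))"
  shows "pull_section C \<sigma> f s \<cdot> x = h"
  by (rule pb_ext[OF assms(1)])
    (use assms pull_Cmp[OF assms(1-5)] pull_section[OF assms(1-3)] pb_D[OF assms(1)] in auto)

lemma Rst_pull:
  assumes "has_pb C \<sigma> f" "total C \<sigma>" "total C f" "partial_section C \<sigma> s"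
  shows "Rst C (pull_section C \<sigma> f s) = Rst C (s \<cdot> f)"
    and "partial_section C (pr2 C \<sigma> f) (pull_section C \<sigma> f s)"
proof -
  note p = pull_section[OF assms(1,3,4)] and D = pb_D[OF assms(1)] and sD = psec_D[OF assms(4) pb_D(1)[OF assms(1)]]
  show 1: "Rst C (pull_section C \<sigma> f s) = Rst C (s \<cdot> f)"
    using Rst_total_Cmp[OF pb_total(2)[OF assms(1-3)], of "pull_section C \<sigma> f s"] D p sD by simp
  show "partial_section C (pr2 C \<sigma> f) (pull_section C \<sigma> f s)"
    by (rule psecI) (use D p sD 1 in auto)
qed

text \<open>Here \<open>Rst C (e \<cdot> f)\<close> is the inverse image of \<open>e\<close> along
  \<open>f\<close>. This naturality in \<open>s\<close> is what the glueing lemma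
  \<open>pull_glue\<close> asks of a family indexed by sections.\<close>

lemma pull_RI:
  assumes "has_pb C \<sigma> f" "total C \<sigma>" "total C f" "partial_section C \<sigma> s" "e \<in> RI C (Cod C \<sigma>)"
  shows "pull_section C \<sigma> f (s \<cdot> e) = pull_section C \<sigma> f s \<cdot> Rst C (e \<cdot> f)"
proof -
  note D = pb_D[OF assms(1)] and sD = psec_D[OF assms(4) pb_D(1)[OF assms(1)]] and eD = RI_D[OF assms(5)]
  note se = psec_RI[OF assms(4) D(1) assms(5)]
  note p = pull_section[OF assms(1,3,4)] and pe = pull_section[OF assms(1,3) se]
  show ?thesis
  proof (rule pb_ext[OF assms(1)])
    show "pr1 C \<sigma> f \<cdot> pull_section C \<sigma> f (s \<cdot> e) = pr1 C \<sigma> f \<cdot> (pull_section C \<sigma> f s \<cdot> Rst C (e \<cdot> f))"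
      using pe under[OF p(4), of "Rst C (e \<cdot> f)"] D sD eD p RI_slide[OF assms(5), of f] by simp
    have "Rst C (s \<cdot> (e \<cdot> f)) = Rst C (s \<cdot> f) \<cdot> Rst C (e \<cdot> f)"
      using D sD eD RI_slide[OF assms(5), of f] Rst_Cmp_Rst'[of "e \<cdot> f" "s \<cdot> f"] by simp
    then show "pr2 C \<sigma> f \<cdot> pull_section C \<sigma> f (s \<cdot> e) = pr2 C \<sigma> f \<cdot> (pull_section C \<sigma> f s \<cdot> Rst C (e \<cdot> f))"
      using pe under[OF p(5), of "Rst C (e \<cdot> f)"] D sD eD p by simp
  qed (use D sD eD p pe in auto)
qed

end

text \<open>A presentation of a local homeomorphism by charts \<open>q i\<close> with inverse
  sections \<open>s i\<close>. That \<open>p\<close> is the join of the charts is expressed by each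
  \<open>q i\<close> lying below \<open>p\<close> and the domains of the charts covering.\<close>

definition etale :: "('o,'m) rcat \<Rightarrow> 'm \<Rightarrow> 'k set \<Rightarrow> ('k \<Rightarrow> 'm) \<Rightarrow> ('k \<Rightarrow> 'm) \<Rightarrow> bool" where
  "etale C p I q s \<longleftrightarrow> total C p \<and>
     (\<forall>i \<in> I. q i \<in> Hom C (Dom C p) (Cod C p) \<and> s i \<in> Hom C (Cod C p) (Dom C p) \<and>
        q i \<cdot>\<^bsub>C\<^esub> s i = Rst C (s i) \<and> s i \<cdot>\<^bsub>C\<^esub> q i = Rst C (q i) \<and> p \<cdot>\<^bsub>C\<^esub> Rst C (q i) = q i) \<and>
     cover C (Dom C p) I (\<lambda>i. Rst C (q i)) (Ide C (Dom C p))"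

context join_restriction_category
begin

lemma etale_D: assumes "etale C p I q s"
  shows "total C p" "p \<in> Arr C" "\<And>i. i \<in> I \<Longrightarrow> q i \<in> Arr C" "\<And>i. i \<in> I \<Longrightarrow> Dom C (q i) = Dom C p"
    "\<And>i. i \<in> I \<Longrightarrow> Cod C (q i) = Cod C p" "\<And>i. i \<in> I \<Longrightarrow> s i \<in> Arr C" "\<And>i. i \<in> I \<Longrightarrow> Dom C (s i) = Cod C p"
    "\<And>i. i \<in> I \<Longrightarrow> Cod C (s i) = Dom C p" "\<And>i. i \<in> I \<Longrightarrow> q i \<cdot> s i = Rst C (s i)"
    "\<And>i. i \<in> I \<Longrightarrow> s i \<cdot> q i = Rst C (q i)" "\<And>i. i \<in> I \<Longrightarrow> p \<cdot> Rst C (q i) = q i"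
    "cover C (Dom C p) I (\<lambda>i. Rst C (q i)) (Ide C (Dom C p))"
  using assms by (auto simp: etale_def Hom_iff total_def)

lemma etale_Rst_section: assumes e: "etale C p I q s" and i: "i \<in> I" shows "Rst C (q i) \<cdot> s i = s i"
proof -
  note D = etale_D[OF e]
  have "Rst C (q i) \<cdot> s i = s i \<cdot> q i \<cdot> s i" using D(10)[OF i] by simp
  also have "\<dots> = s i" using D(3-9) i by simp
  finally show ?thesis .
qed

lemma etale_section: assumes e: "etale C p I q s" and i: "i \<in> I" shows "partial_section C p (s i)"
proof -
  note D = etale_D[OF e]
  have "p \<cdot> s i = p \<cdot> (Rst C (q i) \<cdot> s i)" by (simp add: etale_Rst_section[OF e i])
  also have "\<dots> = Rst C (s i)" by (simp add: under[OF D(11)[OF i]] D(2-9) i)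
  finally have "p \<cdot> s i = Rst C (s i)" .
  then show ?thesis using i by (intro psecI) (simp_all add: D(2-8))
qed

text \<open>The composite \<open>q i \<cdot> t\<close> lies below \<open>p \<cdot> t\<close>, hence
  is an idempotent: the region over which \<open>t\<close> passes through the chart
  \<open>i\<close>. On that region \<open>t\<close> coincides with \<open>s i\<close>.\<close>

lemma etale_at_section: assumes e: "etale C p I q s" and t: "partial_section C p t" and i: "i \<in> I"
  shows "Rst C (q i \<cdot> t) = q i \<cdot> t" "q i \<cdot> t \<in> RI C (Cod C p)" "s i \<cdot> (q i \<cdot> t) = t \<cdot> (q i \<cdot> t)"
    "Rst C t \<cdot> (q i \<cdot> t) = q i \<cdot> t"
proof -
  note D = etale_D[OF e] and tD = psec_D[OF t etale_D(2)[OF e]]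
  have "q i \<cdot> t = p \<cdot> (Rst C (q i) \<cdot> t)" by (simp add: under[OF D(11)[OF i]] D i tD)
  also have "\<dots> = Rst C t \<cdot> Rst C (q i \<cdot> t)"
    by (simp add: under[OF tD(4)] D i tD Rst_slide[of t "q i"])
  also have "\<dots> = Rst C (q i \<cdot> t)" using D i tD by simp
  finally show 1: "Rst C (q i \<cdot> t) = q i \<cdot> t" by simp
  then show "q i \<cdot> t \<in> RI C (Cod C p)" using D i tD by (intro RI_I) auto
  have "s i \<cdot> (q i \<cdot> t) = Rst C (q i) \<cdot> t" by (simp add: under[OF D(10)[OF i]] D i tD)
  also have "\<dots> = t \<cdot> (q i \<cdot> t)" using Rst_slide[of t "q i"] D i tD 1 by simp
  finally show "s i \<cdot> (q i \<cdot> t) = t \<cdot> (q i \<cdot> t)" .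
  show "Rst C t \<cdot> (q i \<cdot> t) = q i \<cdot> t"
    using Rst_Cmp_le'[of t "q i"] D i tD 1 by simp
qed

text \<open>The inverse image of the chart cover along \<open>t\<close>: every partial section is
  locally one of the \<open>s i\<close>.\<close>

lemma etale_cover_section: assumes e: "etale C p I q s" and t: "partial_section C p t"
  shows "cover C (Cod C p) I (\<lambda>i. q i \<cdot> t) (Rst C t)"
proof -
  note D = etale_D[OF e] and tD = psec_D[OF t etale_D(2)[OF e]]
  have "cover C (Dom C t) I (\<lambda>i. Rst C (Rst C (q i) \<cdot> t)) (Rst C (Ide C (Dom C p) \<cdot> t))"
    by (rule cover_precomp[OF D(12)]) (use tD in auto)
  then show ?thesis
    using tD D etale_at_section[OF e t] by (auto elim!: cover_cong)
qed

text \<open>Both sides are idempotents describing where \<open>s i\<close> and \<open>s j\<close>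
  coincide; each absorbs the other, and idempotents commute.\<close>

lemma etale_sym: assumes e: "etale C p I q s" and i: "i \<in> I" and j: "j \<in> I"
  shows "q i \<cdot> s j = q j \<cdot> s i"
proof -
  note D = etale_D[OF e] 
  have le: "(q a \<cdot> s b) \<cdot> (q b \<cdot> s a) = q b \<cdot> s a" if a: "a \<in> I" and b: "b \<in> I" for a b
  proof -
    note x = etale_at_section[OF e etale_section[OF e a] b]
    have "q a \<cdot> s b \<cdot> (q b \<cdot> s a) = q a \<cdot> (s b \<cdot> (q b \<cdot> s a))" using D a b by simp
    also have "\<dots> = q a \<cdot> (s a \<cdot> (q b \<cdot> s a))" using x by simp
    also have "\<dots> = Rst C (s a) \<cdot> (q b \<cdot> s a)" by (simp add: under[OF D(9)[OF a]] D a b)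
    also have "\<dots> = q b \<cdot> s a" by (rule x)
    finally show ?thesis .
  qed
  show ?thesis
    using RI_comm[OF etale_at_section(2)[OF e etale_section[OF e i] j] etale_at_section(2)[OF e etale_section[OF e j] i]]
      le[OF i j] le[OF j i] by simp
qed

text \<open>The composite \<open>s i \<cdot> q i\<close> is the domain of the chart
  \<open>q i\<close>, and these domains cover.\<close>

lemma etale_ext:
  assumes e: "etale C p I q s" and h: "h \<in> Arr C" "h' \<in> Arr C" "Dom C h = Dom C p" "Dom C h' = Dom C p" "Cod C h = Cod C h'"
    and eq: "\<And>i. i \<in> I \<Longrightarrow> h \<cdot> s i = h' \<cdot> s i"
  shows "h = h'"
proof -
  note D = etale_D[OF e] 
  have "h \<cdot> Ide C (Dom C p) = h' \<cdot> Ide C (Dom C p)"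
  proof (rule cover_ext[OF D(12)])
    fix i assume i: "i \<in> I"
    have "h \<cdot> (s i \<cdot> q i) = h' \<cdot> (s i \<cdot> q i)"
      by (simp add: under2[OF eq[OF i]] D(2-8) i h)
    then show "h \<cdot> Rst C (q i) = h' \<cdot> Rst C (q i)" using D i by simp
  qed (use h in auto)
  then show ?thesis using h by simp
qed

text \<open>On the chart \<open>i\<close> the map is forced to be \<open>z i \<cdot> q i\<close>,
  and the hypothesis on the transition idempotents \<open>q j \<cdot> s i\<close> becomes the
  overlap condition of \<open>cover_glue\<close>.\<close>

lemma etale_glue:
  assumes e: "etale C p I q s" and Z: "Z \<in> Obj C"
    and z: "\<And>i. i \<in> I \<Longrightarrow> z i \<in> Hom C (Cod C p) Z" "\<And>i. i \<in> I \<Longrightarrow> z i \<cdot> Rst C (s i) = z i"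
    and eq: "\<And>i j. \<lbrakk>i \<in> I; j \<in> I\<rbrakk> \<Longrightarrow> z i \<cdot> (q j \<cdot> s i) = z j \<cdot> (q j \<cdot> s i)"
  shows "\<exists>h \<in> Hom C (Dom C p) Z. \<forall>i \<in> I. h \<cdot> s i = z i"
proof -
  note D = etale_D[OF e]
  have zD: "\<And>i. i \<in> I \<Longrightarrow> z i \<in> Arr C" "\<And>i. i \<in> I \<Longrightarrow> Dom C (z i) = Cod C p" "\<And>i. i \<in> I \<Longrightarrow> Cod C (z i) = Z"
    using z by (auto simp: Hom_iff)
  have "\<exists>h \<in> Hom C (Dom C p) Z. h \<cdot> Ide C (Dom C p) = h \<and> (\<forall>i \<in> I. h \<cdot> Rst C (q i) = z i \<cdot> q i)"
  proof (rule cover_glue[OF D(12) Z])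
    show "z i \<cdot> q i \<in> Hom C (Dom C p) Z" if "i \<in> I" for i using that D zD by (auto simp: Hom_iff)
    show "z i \<cdot> q i \<cdot> Rst C (q i) = z i \<cdot> q i" if "i \<in> I" for i using that D zD by simp
    fix i j assume i: "i \<in> I" and j: "j \<in> I"
    \<comment> \<open>Both charts are restrictions of \<open>p\<close>, so they coincide on the
      intersection of their domains.\<close>
    have qq: "q j \<cdot> Rst C (q i) = q i \<cdot> Rst C (q j)"
    proof -
      have "q j \<cdot> Rst C (q i) = p \<cdot> Rst C (q j) \<cdot> Rst C (q i)" using D i j by simp
      also have "\<dots> = p \<cdot> (Rst C (q i) \<cdot> Rst C (q j))" using D(2-8) i j Rst_comm[of "q i" "q j"] by simp
      also have "\<dots> = q i \<cdot> Rst C (q j)" by (simp add: under[OF D(11)[OF i]] D(2-8) i j)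
      finally show ?thesis .
    qed
    have 1: "q i \<cdot> Rst C (q j) = q i \<cdot> s j \<cdot> q j" using D i j by simp
    have "z i \<cdot> q i \<cdot> Rst C (q j) = z i \<cdot> (q i \<cdot> s j) \<cdot> q j" using 1 D(3-8) zD i j by simp
    also have "\<dots> = z j \<cdot> (q i \<cdot> s j) \<cdot> q j" using eq[OF j i] by simp
    also have "\<dots> = z j \<cdot> (q i \<cdot> Rst C (q j))" using 1 D(3-8) zD i j by simp
    also have "\<dots> = z j \<cdot> q j \<cdot> Rst C (q i)" using qq D(3-8) zD i j by simp
    finally show "z i \<cdot> q i \<cdot> Rst C (q j) = z j \<cdot> q j \<cdot> Rst C (q i)" .
  qed
  then obtain h where h: "h \<in> Arr C" "Dom C h = Dom C p" "Cod C h = Z" "\<And>i. i \<in> I \<Longrightarrow> h \<cdot> Rst C (q i) = z i \<cdot> q i"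
    by (auto simp: Hom_iff)
  have "h \<cdot> s i = z i" if i: "i \<in> I" for i
  proof -
    note a = etale_Rst_section[OF e i]
    have "h \<cdot> s i = h \<cdot> (Rst C (q i) \<cdot> s i)" by (simp add: a)
    also have "\<dots> = z i \<cdot> (q i \<cdot> s i)" by (simp add: under[OF h(4)[OF i]] h D(3-8) zD i)
    finally show ?thesis by (simp add: D(9)[OF i] z(2)[OF i])
  qed
  then show ?thesis using h by (intro bexI[of _ h]) (auto simp: Hom_iff)
qed

text \<open>By the slide law \<open>Rst C h\<close> acts as the identity on every
  \<open>s i\<close>, and the sections \<open>s i\<close> detect equality of maps.\<close>

lemma etale_total:
  assumes e: "etale C p I q s" and h: "h \<in> Arr C" "Dom C h = Dom C p"
    and eq: "\<And>i. i \<in> I \<Longrightarrow> Rst C (h \<cdot> s i) = Rst C (s i)"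
  shows "total C h"
proof -
  note D = etale_D[OF e]
  have "Rst C h = Ide C (Dom C p)"
  proof (rule etale_ext[OF e])
    fix i assume i: "i \<in> I"
    have "Rst C h \<cdot> s i = s i \<cdot> Rst C (s i)" using Rst_slide[of "s i" h] h D i eq by simp
    then show "Rst C h \<cdot> s i = Ide C (Dom C p) \<cdot> s i" using D i by simp
  qed (use h D in auto)
  then show ?thesis using h by (simp add: total_def)
qed

lemma etale_Cmp:
  assumes e: "etale C p I q s" and e': "etale C p' J q' s'" and c: "Cod C p' = Dom C p"
  shows "etale C (p \<cdot> p') (I \<times> J) (\<lambda>(i, j). q i \<cdot> q' j) (\<lambda>(i, j). s' j \<cdot> s i)"
proof -
  note D = etale_D[OF e] and D' = etale_D[OF e']
  have 1: "q i \<cdot> q' j \<cdot> (s' j \<cdot> s i) = Rst C (s' j \<cdot> s i)" if i: "i \<in> I" and j: "j \<in> J" for i j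
  proof -
    have "q i \<cdot> q' j \<cdot> (s' j \<cdot> s i) = q i \<cdot> (Rst C (s' j) \<cdot> s i)"
      by (simp add: under[OF D'(9)[OF j]] D(3-8) D'(3-8) i j c)
    also have "\<dots> = Rst C (s i) \<cdot> Rst C (s' j \<cdot> s i)"
      by (simp add: under[OF D(9)[OF i]] Rst_slide[of "s i" "s' j"] D(3-8) D'(3-8) i j c)
    finally show ?thesis using D(3-8) D'(3-8) i j c by simp
  qed
  have 2: "s' j \<cdot> s i \<cdot> (q i \<cdot> q' j) = Rst C (q i \<cdot> q' j)" if i: "i \<in> I" and j: "j \<in> J" for i j
  proof -
    have "s' j \<cdot> s i \<cdot> (q i \<cdot> q' j) = s' j \<cdot> (Rst C (q i) \<cdot> q' j)"
      by (simp add: under[OF D(10)[OF i]] D(3-8) D'(3-8) i j c)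
    also have "\<dots> = Rst C (q' j) \<cdot> Rst C (q i \<cdot> q' j)"
      by (simp add: under[OF D'(10)[OF j]] Rst_slide[of "q' j" "q i"] D(3-8) D'(3-8) i j c)
    finally show ?thesis using D(3-8) D'(3-8) i j c by simp
  qed
  have 3: "p \<cdot> p' \<cdot> Rst C (q i \<cdot> q' j) = q i \<cdot> q' j" if i: "i \<in> I" and j: "j \<in> J" for i j
  proof -
    have "q i \<cdot> q' j = p \<cdot> (Rst C (q i) \<cdot> q' j)" by (simp add: under[OF D(11)[OF i]] D(2-8) D'(3-8) i j c)
    also have "\<dots> = p \<cdot> (q' j \<cdot> Rst C (q i \<cdot> q' j))" using Rst_slide[of "q' j" "q i"] D(3-8) D'(3-8) i j c by simp
    also have "\<dots> = p \<cdot> (p' \<cdot> Rst C (q' j) \<cdot> Rst C (q i \<cdot> q' j))" using D'(11)[OF j] by simp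
    finally show ?thesis using D(2-8) D'(2-8) i j c by simp
  qed
  \<comment> \<open>The domain is covered by the charts of \<open>p'\<close>, each refined by the
    inverse image along \<open>q' j\<close> of the charts of \<open>p\<close>. This produces the
    indices in the opposite order, which is undone afterwards.\<close>
  have "cover C (Dom C p') (J \<times> I) (\<lambda>(j, i). Rst C (q i \<cdot> q' j)) (Ide C (Dom C p'))"
  proof (rule cover_Sigma[OF D'(12)])
    fix j assume j: "j \<in> J"
    show "cover C (Dom C p') I (\<lambda>i. Rst C (q i \<cdot> q' j)) (Rst C (q' j))"
      using cover_precomp[OF D(12), of "q' j"] D(2-8) D'(3-8) j c
      by (auto elim!: cover_cong)
  qed
  then have "cover C (Dom C p') (I \<times> J) (\<lambda>(i, j). Rst C (q i \<cdot> q' j)) (Ide C (Dom C p'))"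
  proof -
    have "(\<lambda>(j, i). Rst C (q i \<cdot> q' j)) ` (J \<times> I) = (\<lambda>(i, j). Rst C (q i \<cdot> q' j)) ` (I \<times> J)" by force
    then show ?thesis using \<open>cover C (Dom C p') (J \<times> I) _ _\<close> unfolding cover_def by auto
  qed
  then have 4: "cover C (Dom C p') (I \<times> J) (\<lambda>x. Rst C (case x of (i, j) \<Rightarrow> q i \<cdot> q' j)) (Ide C (Dom C p'))"
    by (simp add: case_prod_unfold)
  show ?thesis unfolding etale_def
    using D(1-8) D'(1-8) c 1 2 3 4 by (auto simp: Hom_iff total_Cmp)
qed

lemma partial_inverse_D: assumes "partial_inverse C q t" "q \<in> Hom C A B"
  shows "q \<in> Arr C" "Dom C q = A" "Cod C q = B" "t \<in> Arr C" "Dom C t = B" "Cod C t = A" "t \<cdot> q = Rst C q" "q \<cdot> t = Rst C t"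
  using assms by (auto simp: partial_inverse_def Hom_iff)

lemma etaleI:
  assumes p: "total C p" and j: "is_join C (Dom C p) (Cod C p) (q ` I) p"
    and qs: "\<And>i. i \<in> I \<Longrightarrow> partial_inverse C (q i) (s i)"
  shows "etale C p I q s"
proof -
  have q: "q i \<in> Hom C (Dom C p) (Cod C p)" if "i \<in> I" for i using is_join_Hom(1)[OF j] that by auto
  note D = partial_inverse_D[OF qs q]
  show ?thesis unfolding etale_def
    using is_join_cover[OF j] p q D le_D[OF is_join_upper[OF j]] by (auto simp: Hom_iff total_Rst)
qed

lemma etale_glueing: "glueing C X I \<phi> p q s \<Longrightarrow> etale C p I q s"
  by (rule etaleI) (auto simp: glueing_def local_homeo_def)

text \<open>The set of partial isomorphisms indexes itself, so in presentations of this form a chart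
  and its index are the same map.\<close>

lemma local_homeo_etale: assumes "local_homeo C p" shows "\<exists>I s. etale C p I (\<lambda>q. q) s"
proof -
  obtain S where S: "\<forall>s \<in> S. partial_iso C s" "is_join C (Dom C p) (Cod C p) S p" and p: "total C p"
    using assms by (auto simp: local_homeo_def)
  then have "\<exists>f. \<forall>s \<in> S. partial_inverse C s (f s)" unfolding partial_iso_def by (intro bchoice) blast
  then obtain f where f: "\<forall>s \<in> S. partial_inverse C s (f s)" ..
  have "etale C p S (\<lambda>q. q) f" by (rule etaleI) (use f S p in auto)
  then show ?thesis by blast
qed

text \<open>On the domain of \<open>q i \<cdot> pr1 C p f\<close> the second projection is a chart,
  because there the first coordinate is recovered from the second as the value of
  \<open>s i \<cdot> f\<close>.\<close>

lemma etale_pull: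
  assumes e: "etale C p I q s" and h: "has_pb C p f" and f: "total C f"
  shows "etale C (pr2 C p f) I (\<lambda>i. pr2 C p f \<cdot> Rst C (q i \<cdot> pr1 C p f)) (\<lambda>i. pull_section C p f (s i))"
proof -
  let ?a = "pr1 C p f" and ?b = "pr2 C p f" and ?s = "\<lambda>i. pull_section C p f (s i)"
  note D = etale_D[OF e] and B = pb_D[OF h] and t = pb_total[OF h etale_D(1)[OF e] f]
  note sec = etale_section[OF e]
  note P = pull_section[OF h f sec] and RP = Rst_pull[OF h D(1) f sec] and Rb = Rst_total_Cmp[OF t(2)] and Ra = Rst_total_Cmp[OF t(1)]
  have Rq: "Rst C (?b \<cdot> Rst C (q i \<cdot> ?a)) = Rst C (q i \<cdot> ?a)" if "i \<in> I" for i
    using D(3-5) B that by (simp add: total_Rst[OF t(2)])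
  have 1: "?b \<cdot> Rst C (q i \<cdot> ?a) \<cdot> ?s i = Rst C (?s i)" if i: "i \<in> I" for i
  proof -
    have "q i \<cdot> (?a \<cdot> ?s i) = Rst C (s i) \<cdot> f"
      by (simp add: under[OF D(9)[OF i]] P[OF i] D(2-8) B i)
    then have "Rst C (q i \<cdot> ?a) \<cdot> ?s i = ?s i \<cdot> Rst C (?s i)"
      using Rst_slide[of "?s i" "q i \<cdot> ?a"] P[OF i] RP(1)[OF i] D(2-8) B i by simp
    then show ?thesis by (simp add: under[OF P(5)[OF i]] P[OF i] RP[OF i] D(2-8) B i)
  qed
  have 2: "?s i \<cdot> (?b \<cdot> Rst C (q i \<cdot> ?a)) = Rst C (q i \<cdot> ?a)" if i: "i \<in> I" for i
  proof (rule pull_Cmp_eqI[OF h f sec[OF i]])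
    let ?e = "Rst C (q i \<cdot> ?a)"
    have "s i \<cdot> (f \<cdot> (?b \<cdot> ?e)) = s i \<cdot> (p \<cdot> (?a \<cdot> ?e))" using pb_square[OF h, of ?e] D(2-8) B i by simp
    also have "\<dots> = s i \<cdot> (p \<cdot> (Rst C (q i) \<cdot> ?a))" using D(2-8) B i by (simp add: Rst_slide[of ?a "q i"])
    also have "\<dots> = s i \<cdot> (q i \<cdot> ?a)" by (simp add: under[OF D(11)[OF i]] D(2-8) B i)
    also have "\<dots> = Rst C (q i) \<cdot> ?a" by (simp add: under[OF D(10)[OF i]] D(2-8) B i)
    also have "\<dots> = ?a \<cdot> ?e" using D(2-8) B i by (simp add: Rst_slide[of ?a "q i"])
    finally have x: "s i \<cdot> (f \<cdot> (?b \<cdot> ?e)) = ?a \<cdot> ?e" .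
    then show "?a \<cdot> ?e = s i \<cdot> (f \<cdot> (?b \<cdot> ?e))" ..
    show "?b \<cdot> ?e = ?b \<cdot> ?e \<cdot> Rst C (s i \<cdot> (f \<cdot> (?b \<cdot> ?e)))"
      unfolding x using D(2-8) B i by (simp add: Ra)
  qed (use D(2-8) B i in auto)
  have 3: "cover C (pbo C p f) I (\<lambda>i. Rst C (?b \<cdot> Rst C (q i \<cdot> ?a))) (Ide C (pbo C p f))"
    using cover_precomp[OF D(12), of ?a] D(1-8) B t(1)
    by (auto elim!: cover_cong simp: total_Rst[OF t(1)] total_Rst[OF t(2)])
  show ?thesis unfolding etale_def
    using D(1-8) B t 1 2 3 P RP Rq by (auto simp: Hom_iff total_Rst[OF t(2)])
qed

end

text \<open>Glueings are assumed for index sets inside the type of elements of \<open>K\<close>; any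
  other small index set is transported along an injection into \<open>K\<close>.\<close>

lemma glueing_exists:
  fixes K :: "'k set" and I :: "'j set"
  assumes "has_local_glueings K C" "X \<in> Obj C" "I \<prec> K" "local_atlas C X I \<phi>"
  shows "\<exists>p q s. glueing C X I \<phi> p q s"
proof -
  obtain f where f: "inj_on f I" "f ` I \<subseteq> K" using assms(3) unfolding lesspoll_def lepoll_def by blast
  let ?g = "inv_into I f"
  have g: "?g (f i) = i" if "i \<in> I" for i using f that by simp
  have "f ` I \<prec> K" using eq_lesspoll_trans[OF inj_on_image_eqpoll_self[OF f(1)] assms(3)] .
  moreover have "local_atlas C X (f ` I) (\<lambda>a b. \<phi> (?g a) (?g b))"
    using assms(4) unfolding local_atlas_def by (auto simp: f(1))
  ultimately obtain p q s where "glueing C X (f ` I) (\<lambda>a b. \<phi> (?g a) (?g b)) p q s"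
    using assms(1,2) unfolding has_local_glueings_def by blast
  then have "glueing C X I \<phi> p (q \<circ> f) (s \<circ> f)"
    unfolding glueing_def by (auto simp: f(1) image_comp)
  then show ?thesis by blast
qed

context restriction_category
begin

text \<open>Inverse image along \<open>f\<close> sends composites of idempotents, which are
  intersections, to intersections.\<close>

lemma Rst_Cmp_mult: assumes "a \<in> RI C Y" "b \<in> RI C Y" "f \<in> Arr C" "Cod C f = Y"
  shows "Rst C (a \<cdot> (b \<cdot> f)) = Rst C (a \<cdot> f) \<cdot> Rst C (b \<cdot> f)"
proof -
  note D = RI_D[OF assms(1)] RI_D[OF assms(2)]
  have "a \<cdot> (b \<cdot> f) = a \<cdot> f \<cdot> Rst C (b \<cdot> f)" using RI_slide[OF assms(2-4)] D assms(3-4) by simp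
  then show ?thesis using D assms(3-4) Rst_Cmp_Rst'[of "b \<cdot> f" "a \<cdot> f"] by simp
qed

end

section \<open>Pullbacks of local homeomorphisms along total maps\<close>

context join_restriction_category
begin

text \<open>The pullback is built as a glueing over the domain of \<open>f\<close>. The transition
  idempotents of the presentation, pulled back along \<open>f\<close>, form a local atlas, and its
  glueing \<open>r\<close> carries a comparison map to the domain of \<open>p\<close>.\<close>

lemma etale_has_pb:
  assumes e: "etale C p I q s" and f: "total C f" "Cod C f = Cod C p"
    and gl: "\<And>\<phi>. local_atlas C (Dom C f) I \<phi> \<Longrightarrow> \<exists>r q t. glueing C (Dom C f) I \<phi> r q t"
  shows "has_pb C p f"
proof -
  note D = etale_D[OF e] 
  note S = etale_at_section[OF e etale_section[OF e]]
  note sec = psec_D[OF etale_section[OF e] D(2)]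
  have fA: "f \<in> Arr C" using f by (simp add: total_def)
  \<comment> \<open>The inverse image along \<open>f\<close> of the transition idempotent
    \<open>q j \<cdot> s i\<close>.\<close>
  define \<psi> where "\<psi> i j = Rst C (q j \<cdot> (s i \<cdot> f))" for i j
  have sym: "\<psi> i j = \<psi> j i" if "i \<in> I" "j \<in> I" for i j
  proof -
    have "\<psi> i j = Rst C (q j \<cdot> s i \<cdot> f)" using D(3-8) that fA f by (simp add: \<psi>_def)
    also have "\<dots> = Rst C (q i \<cdot> s j \<cdot> f)" using etale_sym[OF e that] by simp
    finally show ?thesis using D(3-8) that fA f by (simp add: \<psi>_def)
  qed
  have \<psi>: "\<psi> i j \<in> RI C (Dom C f)" "\<psi> i j \<in> Arr C" "Dom C (\<psi> i j) = Dom C f" "Cod C (\<psi> i j) = Dom C f" "Rst C (\<psi> i j) = \<psi> i j"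
    if "i \<in> I" "j \<in> I" for i j using D(3-8) that fA f by (auto simp: \<psi>_def)
  have "local_atlas C (Dom C f) I \<psi>"
    unfolding local_atlas_def
  proof (intro conjI ballI)
    fix i j k assume ijk: "i \<in> I" "j \<in> I" "k \<in> I"
    \<comment> \<open>Where \<open>s i\<close> and \<open>s j\<close> coincide, membership in the
      chart \<open>k\<close> can be tested on either of them; this is the cocycle
      inequality.\<close>
    have "q k \<cdot> (s j \<cdot> (q j \<cdot> s i)) \<cdot> f = q k \<cdot> (s i \<cdot> (q j \<cdot> s i)) \<cdot> f"
      using S(3)[OF ijk(1,2)] by simp
    then have "Rst C (q k \<cdot> (s j \<cdot> (q j \<cdot> (s i \<cdot> f)))) = Rst C (q k \<cdot> (s i \<cdot> (q j \<cdot> (s i \<cdot> f))))"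
      using D(3-8) ijk fA f by simp
    then have 1: "\<psi> j k \<cdot> \<psi> i j = \<psi> i k \<cdot> \<psi> i j"
      using Rst_Cmp_mult[OF S(2)[OF ijk(2,3)] S(2)[OF ijk(1,2)] fA f(2)]
        Rst_Cmp_mult[OF S(2)[OF ijk(1,3)] S(2)[OF ijk(1,2)] fA f(2)] D(3-8) ijk fA f
      by (simp add: \<psi>_def)
    have "\<psi> j k \<cdot> \<psi> i j \<cdot> \<psi> i k = \<psi> i k \<cdot> \<psi> i j" 
      unfolding 1 using RI_comm[OF \<psi>(1) \<psi>(1), of i j i k] RI_idem_Cmp[OF \<psi>(1), of i k "\<psi> i j"] \<psi> ijk by simp
    then show "le C (\<psi> j k \<cdot> \<psi> i j) (\<psi> i k)"
      using 1 \<psi> ijk RI_Cmp[OF \<psi>(1) \<psi>(1), of j k i j] by (simp add: le_RI_iff[of _ "Dom C f"])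
  qed (use sym \<psi> in auto)
  from gl[OF this] obtain r rq t where G: "glueing C (Dom C f) I \<psi> r rq t" by blast
  note er = etale_glueing[OF G]
  note R = etale_D[OF er] and RS = etale_at_section[OF er etale_section[OF er]]
  have rf: "Cod C r = Dom C f" and rt: "\<And>i j. \<lbrakk>i \<in> I; j \<in> I\<rbrakk> \<Longrightarrow> rq j \<cdot> t i = \<psi> i j"
    using G by (auto simp: glueing_def)
  note T = R(2-8)[unfolded rf] rf
  have Rt: "Rst C (t i) = \<psi> i i" if "i \<in> I" for i using R(9)[OF that] rt that by simp
  have \<psi>ii: "\<psi> i i = Rst C (s i \<cdot> f)" if "i \<in> I" for i
    by (simp add: \<psi>_def under[OF D(9)] D(3-8) that fA f)
  have s\<psi>: "s i \<cdot> (f \<cdot> \<psi> i j) = s j \<cdot> (f \<cdot> \<psi> i j)" if ij: "i \<in> I" "j \<in> I" for i j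
  proof -
    have 1: "f \<cdot> \<psi> i j = q j \<cdot> s i \<cdot> f"
      using RI_slide[OF S(2)[OF ij] fA f(2)] D(3-8) ij fA f by (simp add: \<psi>_def)
    have "s i \<cdot> (q j \<cdot> s i) \<cdot> f = s j \<cdot> (q j \<cdot> s i) \<cdot> f" using S(3)[OF ij] by simp
    then show ?thesis unfolding 1 using D(3-8) ij fA f by simp
  qed
  \<comment> \<open>The other projection is forced on sections: over the piece \<open>i\<close> the
    point in the domain of \<open>p\<close> has to be \<open>s i \<cdot> f\<close>.\<close>
  have "\<exists>g \<in> Hom C (Dom C r) (Dom C p). \<forall>i \<in> I. g \<cdot> t i = s i \<cdot> f"
  proof (rule etale_glue[OF er])
    show "s i \<cdot> f \<in> Hom C (Cod C r) (Dom C p)" if "i \<in> I" for i using that D(3-8) fA f rf by (auto simp: Hom_iff)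
    show "s i \<cdot> f \<cdot> Rst C (t i) = s i \<cdot> f" if "i \<in> I" for i using that D(3-8) fA f Rt \<psi>ii by simp
    fix i j assume ij: "i \<in> I" "j \<in> I"
    then show "s i \<cdot> f \<cdot> (rq j \<cdot> t i) = s j \<cdot> f \<cdot> (rq j \<cdot> t i)" using rt s\<psi> D(3-8) fA f \<psi> by simp
  qed (use D in auto)
  then obtain g where g: "g \<in> Arr C" "Dom C g = Dom C r" "Cod C g = Dom C p" "\<And>i. i \<in> I \<Longrightarrow> g \<cdot> t i = s i \<cdot> f"
    by (auto simp: Hom_iff)
  have pg: "p \<cdot> g = f \<cdot> r"
  proof (rule etale_ext[OF er])
    fix i assume i: "i \<in> I"
    have "p \<cdot> g \<cdot> t i = p \<cdot> s i \<cdot> f" using g D(2-8) T i fA f by simp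
    also have "\<dots> = f \<cdot> Rst C (s i \<cdot> f)" using sec(4)[OF i] Rst_slide[of f "s i"] D(2-8) i fA f by simp
    also have "\<dots> = f \<cdot> (r \<cdot> t i)"
      using psec_D[OF etale_section[OF er i] R(2)] Rt[OF i] \<psi>ii[OF i] by simp
    finally show "p \<cdot> g \<cdot> t i = f \<cdot> r \<cdot> t i" using T i fA f by simp
  qed (use g D(2-8) T fA f in auto)
  \<comment> \<open>The chart domains of the glueing are the inverse images under \<open>g\<close>
    of those of \<open>p\<close>. This is the source of uniqueness of mediating maps.\<close>
  have qg: "Rst C (q i \<cdot> g) = Rst C (rq i)" if i: "i \<in> I" for i
  proof (rule etale_ext[OF er])
    fix j assume j: "j \<in> I"
    have "Rst C (q i \<cdot> g) \<cdot> t j = t j \<cdot> \<psi> j i"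
      using Rst_slide[of "t j" "q i \<cdot> g"] g D(2-8) T i j by (simp add: \<psi>_def)
    also have "\<dots> = Rst C (rq i) \<cdot> t j"
      using Rst_slide[of "t j" "rq i"] T i j rt \<psi> by simp
    finally show "Rst C (q i \<cdot> g) \<cdot> t j = Rst C (rq i) \<cdot> t j" .
  qed (use g D(2-8) T i in auto)
  have "is_pullback C p f g r"
    unfolding is_pullback_def
  proof (intro conjI ballI impI)
    fix U u v assume U: "U \<in> Obj C" and "u \<in> Hom C U (Dom C p)" "v \<in> Hom C U (Dom C f)" and uv: "p \<cdot> u = f \<cdot> v"
    then have u: "u \<in> Arr C" "Dom C u = U" "Cod C u = Dom C p" and v: "v \<in> Arr C" "Dom C v = U" "Cod C v = Dom C f"
      by (auto simp: Hom_iff)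
    have Ruv: "Rst C v = Rst C u"
      using Rst_total_Cmp[OF D(1), of u] Rst_total_Cmp[OF f(1), of v] u v uv by simp
    \<comment> \<open>The cover of the domain of \<open>u\<close> by the regions on which
      \<open>u\<close> lands in the chart \<open>i\<close>.\<close>
    define c where "c i = Rst C (q i \<cdot> u)" for i
    have c: "c i \<in> RI C U" "c i \<in> Arr C" "Dom C (c i) = U" "Cod C (c i) = U" "Rst C (c i) = c i" if "i \<in> I" for i
      using that D(3-8) u by (auto simp: c_def)
    have cov: "cover C U I c (Rst C u)"
      using cover_precomp[OF D(12), of u] u D(2-8) by (auto elim!: cover_cong simp: c_def)
    have quc: "p \<cdot> (u \<cdot> c i) = q i \<cdot> u" if i: "i \<in> I" for i
    proof -
      have "u \<cdot> c i = Rst C (q i) \<cdot> u" using Rst_slide[of u "q i"] D(2-8) i u by (simp add: c_def)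
      then show ?thesis by (simp add: under[OF D(11)[OF i]] D(2-8) i u)
    qed
    have fvc: "f \<cdot> (v \<cdot> c i) = q i \<cdot> u" if i: "i \<in> I" for i
      using quc[OF i] under2[OF uv, of "c i"] c[OF i] u v D(2) fA f by simp
    have squ: "s i \<cdot> (q i \<cdot> u) = u \<cdot> c i" if i: "i \<in> I" for i
      using Rst_slide[of u "q i"] D(2-8) i u by (simp add: c_def under[OF D(10)[OF i]])
    \<comment> \<open>Over \<open>c i\<close>, the inverse image of \<open>\<psi> i j\<close> along
      \<open>v\<close> is the region where \<open>u\<close> lands in the chart \<open>j\<close> as
      well: both legs of the cone see the same transition idempotents.\<close>
    have F: "Rst C (\<psi> i j \<cdot> v) \<cdot> c i = c j \<cdot> c i" if ij: "i \<in> I" "j \<in> I" for i j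
    proof -
      have "Rst C (\<psi> i j \<cdot> v) = Rst C (q j \<cdot> (s i \<cdot> (f \<cdot> v)))"
        using Rst_Rst_Cmp[of v "q j \<cdot> (s i \<cdot> f)"] D(3-8) ij fA f v by (simp add: \<psi>_def)
      then have "Rst C (\<psi> i j \<cdot> v) \<cdot> c i = Rst C (q j \<cdot> (s i \<cdot> (f \<cdot> (v \<cdot> c i))))"
        using Rst_Cmp_RI[OF c(1)[OF ij(1)], of "q j \<cdot> (s i \<cdot> (f \<cdot> v))"] D(3-8) ij fA f v c[OF ij(1)] by simp
      also have "\<dots> = Rst C (q j \<cdot> u \<cdot> c i)"
        using fvc[OF ij(1)] squ[OF ij(1)] D(3-8) ij u c[OF ij(1)] by simp
      also have "\<dots> = c j \<cdot> c i" using Rst_Cmp_RI[OF c(1)[OF ij(1)], of "q j \<cdot> u"] D(3-8) ij u by (simp add: c_def)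
      finally show ?thesis .
    qed
    have vF: "v \<cdot> (c j \<cdot> c i) = \<psi> i j \<cdot> (v \<cdot> c i)" if ij: "i \<in> I" "j \<in> I" for i j
      unfolding F[OF ij, symmetric] using under2[OF RI_slide[OF \<psi>(1)[OF ij] v(1) v(3)], of "c i"] \<psi>[OF ij] v c[OF ij(1)] by simp
    \<comment> \<open>On \<open>c i\<close> the mediating map has to be
      \<open>t i \<cdot> v\<close>; by \<open>vF\<close> these candidates agree on overlaps.\<close>
    have "\<exists>h \<in> Hom C U (Dom C r). h \<cdot> Rst C u = h \<and> (\<forall>i \<in> I. h \<cdot> c i = t i \<cdot> (v \<cdot> c i))"
    proof (rule cover_glue[OF cov])
      show "t i \<cdot> (v \<cdot> c i) \<in> Hom C U (Dom C r)" if "i \<in> I" for i using that T v c by (auto simp: Hom_iff)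
      show "t i \<cdot> (v \<cdot> c i) \<cdot> c i = t i \<cdot> (v \<cdot> c i)" if "i \<in> I" for i
        using that T v c RI_idem[OF c(1)] by simp
      fix i j assume ij: "i \<in> I" "j \<in> I"
      have "t i \<cdot> (v \<cdot> c i) \<cdot> c j = t i \<cdot> (v \<cdot> (c j \<cdot> c i))"
        using RI_comm[OF c(1)[OF ij(1)] c(1)[OF ij(2)]] T v c ij by simp
      also have "\<dots> = t i \<cdot> (rq j \<cdot> t i) \<cdot> (v \<cdot> c i)" using vF[OF ij] rt[OF ij] T v c ij \<psi> by simp
      also have "\<dots> = t j \<cdot> (rq j \<cdot> t i) \<cdot> (v \<cdot> c i)" using RS(3)[OF ij] by simp
      also have "\<dots> = t j \<cdot> (v \<cdot> c j) \<cdot> c i" using vF[OF ij] rt[OF ij] T v c ij \<psi> by simp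
      finally show "t i \<cdot> (v \<cdot> c i) \<cdot> c j = t j \<cdot> (v \<cdot> c j) \<cdot> c i" .
    qed (use R in auto)
    then obtain h where h: "h \<in> Arr C" "Dom C h = U" "Cod C h = Dom C r" "h \<cdot> Rst C u = h"
      "\<And>i. i \<in> I \<Longrightarrow> h \<cdot> c i = t i \<cdot> (v \<cdot> c i)" by (auto simp: Hom_iff)
    have gh: "g \<cdot> h = u"
    proof -
      have "g \<cdot> h \<cdot> Rst C u = u \<cdot> Rst C u"
      proof (rule cover_ext[OF cov])
        fix i assume i: "i \<in> I"
        have "g \<cdot> h \<cdot> c i = s i \<cdot> (f \<cdot> (v \<cdot> c i))"
          using h g i c T v D(2-8) fA f by (simp add: under2[OF g(4)[OF i]])
        then show "g \<cdot> h \<cdot> c i = u \<cdot> c i" using fvc[OF i] squ[OF i] by simp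
      qed (use g h u in auto)
      then show ?thesis using g h u by simp
    qed
    have rsec: "r \<cdot> t i = \<psi> i i" if i: "i \<in> I" for i
      using psec_D(4)[OF etale_section[OF er i] R(2)] Rt[OF i] by simp
    have rh: "r \<cdot> h = v"
    proof -
      have "r \<cdot> h \<cdot> Rst C u = v \<cdot> Rst C u"
      proof (rule cover_ext[OF cov])
        fix i assume i: "i \<in> I"
        have "r \<cdot> h \<cdot> c i = \<psi> i i \<cdot> (v \<cdot> c i)"
          by (simp add: under[OF rsec[OF i]] h i c T v \<psi>)
        then show "r \<cdot> h \<cdot> c i = v \<cdot> c i" using vF[OF i i] RI_idem[OF c(1)[OF i]] by simp
      qed (use h v u T in auto)
      moreover have "v \<cdot> Rst C u = v" unfolding Ruv[symmetric] using v by simp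
      ultimately show ?thesis using T h u by simp
    qed
    show "\<exists>!h. h \<in> Hom C U (Dom C g) \<and> g \<cdot> h = u \<and> r \<cdot> h = v"
    proof (rule ex1I[of _ h])
      fix k assume "k \<in> Hom C U (Dom C g) \<and> g \<cdot> k = u \<and> r \<cdot> k = v"
      then have k: "k \<in> Arr C" "Dom C k = U" "Cod C k = Dom C r" "g \<cdot> k = u" "r \<cdot> k = v"
        using g by (simp_all add: Hom_iff)
      \<comment> \<open>By \<open>qg\<close> a mediating map passes through the chart of
        \<open>t i\<close> precisely on \<open>c i\<close>, and inside a chart it is determined by
        its base component \<open>v\<close>.\<close>
      have kc: "k \<cdot> c i = t i \<cdot> (v \<cdot> c i)" if i: "i \<in> I" for i
      proof -
        have 1: "c i = Rst C (rq i \<cdot> k)"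
        proof -
          have "c i = Rst C (q i \<cdot> g \<cdot> k)" unfolding c_def using k(4) D(3-8) i g k(1-3) by simp
          also have "\<dots> = Rst C (Rst C (rq i) \<cdot> k)" 
            using Rst_Rst_Cmp[of k "q i \<cdot> g"] D(3-8) i g k(1-3) unfolding qg[OF i] by simp
          finally show ?thesis using T i k(1-3) by simp
        qed
        have "k \<cdot> c i = Rst C (rq i) \<cdot> k" unfolding 1 using Rst_slide[of k "rq i"] T i k by simp
        also have "\<dots> = t i \<cdot> (rq i \<cdot> k)" by (simp add: under[OF R(10)[OF i]] T i k(1-3))
        also have "rq i \<cdot> k = r \<cdot> (Rst C (rq i) \<cdot> k)" by (simp add: under[OF R(11)[OF i]] T i k(1-3))
        also have "\<dots> = r \<cdot> k \<cdot> c i" unfolding 1 using Rst_slide[of k "rq i"] T i k(1-3) by simp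
        finally show ?thesis using k by simp
      qed
      have "Rst C k = Rst C u" using Rst_total_Cmp[OF R(1), of k] k Ruv by simp
      then have "k \<cdot> Rst C u = k" using Cmp_Rst_self[OF k(1)] by simp
      moreover have "k \<cdot> Rst C u = h \<cdot> Rst C u"
        by (rule cover_ext[OF cov]) (use k(1-3) h kc in auto)
      ultimately show "k = h" using h by simp
    qed (use g h gh rh in \<open>auto simp: Hom_iff\<close>)
  qed (use pg g D fA f T in \<open>auto simp: Hom_iff\<close>)
  then show ?thesis by (rule has_pbI)
qed

lemma local_homeo_ext:
  assumes p: "local_homeo C p" and h: "h \<in> Arr C" "h' \<in> Arr C" "Dom C h = Dom C p" "Dom C h' = Dom C p" "Cod C h = Cod C h'"
    and eq: "\<And>s. partial_section C p s \<Longrightarrow> h \<cdot> s = h' \<cdot> s"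
  shows "h = h'"
proof -
  obtain I s where e: "etale C p I (\<lambda>q. q) s" using local_homeo_etale[OF p] by blast
  show ?thesis by (rule etale_ext[OF e h]) (use etale_section[OF e] eq in blast)
qed

end

section \<open>Composition of partial sections\<close>

text \<open>The composition of \<open>Phi_cat\<close> without tags. It is also applied to maps
  \<open>s\<close> that are not sections, such as a section precomposed with a component of a
  morphism.\<close>

definition scomp :: "('o,'m) rcat \<Rightarrow> ('i,'o,'m) pcat \<Rightarrow> 'i \<Rightarrow> 'i \<Rightarrow> 'i \<Rightarrow> 'm \<Rightarrow> 'm \<Rightarrow> 'm" where
  "scomp C A i j k t s = mul A i j k \<cdot>\<^bsub>C\<^esub> pull_section C (sor A j k) (tgt A i j) t \<cdot>\<^bsub>C\<^esub> s"

definition is_pcat_structure :: "('o,'m) rcat \<Rightarrow> ('i,'o,'m) pcat \<Rightarrow> bool" where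
  "is_pcat_structure C A \<longleftrightarrow>
     (\<forall>i \<in> Cpt A. P0 A i \<in> Obj C) \<and>
     (\<forall>i \<in> Cpt A. \<forall>j \<in> Cpt A.
        P1 A i j \<in> Obj C \<and>
        sor A i j \<in> Hom C (P1 A i j) (P0 A i) \<and> total C (sor A i j) \<and> local_homeo C (sor A i j) \<and>
        tgt A i j \<in> Hom C (P1 A i j) (P0 A j) \<and> total C (tgt A i j) \<and>
        (\<forall>f. total C f \<and> Cod C f = P0 A i \<longrightarrow> has_pb C (sor A i j) f)) \<and>
     (\<forall>i \<in> Cpt A. unt A i \<in> Hom C (P0 A i) (P1 A i i) \<and>
        sor A i i \<cdot>\<^bsub>C\<^esub> unt A i = Ide C (P0 A i) \<and> tgt A i i \<cdot>\<^bsub>C\<^esub> unt A i = Ide C (P0 A i)) \<and>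
     (\<forall>i \<in> Cpt A. \<forall>j \<in> Cpt A. \<forall>k \<in> Cpt A.
        mul A i j k \<in> Hom C (pbo C (sor A j k) (tgt A i j)) (P1 A i k) \<and>
        sor A i k \<cdot>\<^bsub>C\<^esub> mul A i j k = sor A i j \<cdot>\<^bsub>C\<^esub> pr2 C (sor A j k) (tgt A i j) \<and>
        tgt A i k \<cdot>\<^bsub>C\<^esub> mul A i j k = tgt A j k \<cdot>\<^bsub>C\<^esub> pr1 C (sor A j k) (tgt A i j))"

text \<open>The laws of a partite internal category are separated from its structure, as for the value of
  \<^const>\<open>Psi\<close> they are verified on partial sections.\<close>

locale pcat_structure = join_restriction_category C
  for C :: "('o,'m) rcat" (structure) +
  fixes A :: "('i,'o,'m) pcat"
  assumes pcat_structure: "is_pcat_structure C A"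
begin

lemma P0_Obj [simp]: "i \<in> Cpt A \<Longrightarrow> P0 A i \<in> Obj C"
  using pcat_structure by (simp add: is_pcat_structure_def)

lemma sor [simp]: assumes "i \<in> Cpt A" "j \<in> Cpt A"
  shows "sor A i j \<in> Arr C" "Dom C (sor A i j) = P1 A i j" "Cod C (sor A i j) = P0 A i" "total C (sor A i j)"
    "local_homeo C (sor A i j)"
  using assms pcat_structure by (auto simp: is_pcat_structure_def Hom_iff)

lemma tgt [simp]: assumes "i \<in> Cpt A" "j \<in> Cpt A"
  shows "tgt A i j \<in> Arr C" "Dom C (tgt A i j) = P1 A i j" "Cod C (tgt A i j) = P0 A j" "total C (tgt A i j)"
  using assms pcat_structure by (auto simp: is_pcat_structure_def Hom_iff)

lemma P1_Obj [simp]: "\<lbrakk>i \<in> Cpt A; j \<in> Cpt A\<rbrakk> \<Longrightarrow> P1 A i j \<in> Obj C"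
  using pcat_structure by (simp add: is_pcat_structure_def)

lemma sor_pb: assumes "i \<in> Cpt A" "j \<in> Cpt A" "total C f" "Cod C f = P0 A i"
  shows "has_pb C (sor A i j) f"
  using assms pcat_structure by (simp add: is_pcat_structure_def)

lemma sor_tgt_pb [simp]: "\<lbrakk>i \<in> Cpt A; j \<in> Cpt A; k \<in> Cpt A\<rbrakk> \<Longrightarrow> has_pb C (sor A j k) (tgt A i j)"
  by (rule sor_pb) auto

lemma unt [simp]: assumes "i \<in> Cpt A"
  shows "unt A i \<in> Arr C" "Dom C (unt A i) = P0 A i" "Cod C (unt A i) = P1 A i i"
    "sor A i i \<cdot> unt A i = Ide C (P0 A i)" "tgt A i i \<cdot> unt A i = Ide C (P0 A i)"
  using assms pcat_structure by (auto simp: is_pcat_structure_def Hom_iff)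

lemma unt_under [simp]: assumes "i \<in> Cpt A" "x \<in> Arr C" "Cod C x = P0 A i"
  shows "sor A i i \<cdot> (unt A i \<cdot> x) = x" "tgt A i i \<cdot> (unt A i \<cdot> x) = x"
  using assms by (simp_all add: under[OF unt(4)] under[OF unt(5)])

lemma unt_total [simp]: "i \<in> Cpt A \<Longrightarrow> total C (unt A i)"
  using Rst_total_Cmp[of "sor A i i" "unt A i"] by (simp add: total_def[of _ "unt A i"])

lemma mul [simp]: assumes "i \<in> Cpt A" "j \<in> Cpt A" "k \<in> Cpt A"
  shows "mul A i j k \<in> Arr C" "Dom C (mul A i j k) = pbo C (sor A j k) (tgt A i j)" "Cod C (mul A i j k) = P1 A i k"
  using assms pcat_structure unfolding is_pcat_structure_def Hom_iff by blast+

lemma mul_sor_tgt: assumes "i \<in> Cpt A" "j \<in> Cpt A" "k \<in> Cpt A"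
  shows "sor A i k \<cdot> mul A i j k = sor A i j \<cdot> pr2 C (sor A j k) (tgt A i j)"
    "tgt A i k \<cdot> mul A i j k = tgt A j k \<cdot> pr1 C (sor A j k) (tgt A i j)"
  using assms pcat_structure unfolding is_pcat_structure_def by blast+

abbreviation sec where "sec i j s \<equiv> partial_section C (sor A i j) s"

lemma sec_D: assumes "i \<in> Cpt A" "j \<in> Cpt A" "sec i j s"
  shows "s \<in> Arr C" "Dom C s = P0 A i" "Cod C s = P1 A i j" "sor A i j \<cdot> s = Rst C s"
  using psec_D[OF assms(3)] assms by auto

lemma secI: "\<lbrakk>i \<in> Cpt A; j \<in> Cpt A; s \<in> Arr C; Dom C s = P0 A i; Cod C s = P1 A i j; sor A i j \<cdot> s = Rst C s\<rbrakk> \<Longrightarrow> sec i j s"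
  by (rule psecI) auto

lemma sec_unt: assumes "i \<in> Cpt A" "e \<in> RI C (P0 A i)" shows "sec i i (unt A i \<cdot> e)"
  using assms RI_D[OF assms(2)] Rst_total_Cmp[of "unt A i" e] by (intro secI) auto

lemma sec_unt': "i \<in> Cpt A \<Longrightarrow> sec i i (unt A i)"
  using sec_unt[of i "Ide C (P0 A i)"] by simp

lemma Rst_unt: "\<lbrakk>i \<in> Cpt A; e \<in> RI C (P0 A i)\<rbrakk> \<Longrightarrow> Rst C (unt A i \<cdot> e) = e"
  using Rst_total_Cmp[of "unt A i" e] by (simp add: RI_D)

lemma sec_RI: "\<lbrakk>i \<in> Cpt A; j \<in> Cpt A; sec i j s; e \<in> RI C (P0 A i)\<rbrakk> \<Longrightarrow> sec i j (s \<cdot> e)"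
  by (rule psec_RI) auto

text \<open>A map into the pullback of composable pairs is identified by its two projections. All
  internal laws are evaluated through this lemma: once the projections are known, applying
  \<open>mul\<close> yields a composite of sections.\<close>

lemma mul_eq_scomp:
  assumes "i \<in> Cpt A" "j \<in> Cpt A" "k \<in> Cpt A" "sec j k t" "x \<in> Arr C" "Cod C x = P1 A i j"
    "h \<in> Arr C" "Cod C h = pbo C (sor A j k) (tgt A i j)" "pr1 C (sor A j k) (tgt A i j) \<cdot> h = t \<cdot> (tgt A i j \<cdot> x)"
    "pr2 C (sor A j k) (tgt A i j) \<cdot> h = x \<cdot> Rst C (t \<cdot> (tgt A i j \<cdot> x))"
  shows "mul A i j k \<cdot> h = scomp C A i j k t x"
proof -
  have "pull_section C (sor A j k) (tgt A i j) t \<cdot> x = h"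
    by (rule pull_Cmp_eqI) (use assms in auto)
  moreover have "scomp C A i j k t x = mul A i j k \<cdot> (pull_section C (sor A j k) (tgt A i j) t \<cdot> x)"
    unfolding scomp_def
    using assms pull_section[of "sor A j k" "tgt A i j" t] by simp
  ultimately show ?thesis by simp
qed

text \<open>Everything is read off the two projections of the pulled-back section; the composite is
  defined where \<open>t\<close> is defined at the target of \<open>s\<close>.\<close>

lemma scomp:
  assumes "i \<in> Cpt A" "j \<in> Cpt A" "k \<in> Cpt A" "sec i j s" "sec j k t"
  shows scomp_sec: "sec i k (scomp C A i j k t s)"
    and Rst_scomp: "Rst C (scomp C A i j k t s) = Rst C (t \<cdot> (tgt A i j \<cdot> s))"
    and tgt_scomp: "tgt A i k \<cdot> scomp C A i j k t s = tgt A j k \<cdot> (t \<cdot> (tgt A i j \<cdot> s))"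
    and scomp_eq: "scomp C A i j k t s = mul A i j k \<cdot> (pull_section C (sor A j k) (tgt A i j) t \<cdot> s)"
proof -
  let ?p = "pull_section C (sor A j k) (tgt A i j) t"
  note s = sec_D[OF assms(1,2,4)] and t = sec_D[OF assms(2,3,5)]
  have pb: "has_pb C (sor A j k) (tgt A i j)" using assms by simp
  have P: "?p \<in> Arr C" "Dom C ?p = P1 A i j" "Cod C ?p = pbo C (sor A j k) (tgt A i j)"
    using pull_section[OF pb tgt(4)[OF assms(1,2)] assms(5)] assms by auto
  have PC: "pr1 C (sor A j k) (tgt A i j) \<cdot> (?p \<cdot> s) = t \<cdot> (tgt A i j \<cdot> s)"
    "pr2 C (sor A j k) (tgt A i j) \<cdot> (?p \<cdot> s) = s \<cdot> Rst C (t \<cdot> (tgt A i j \<cdot> s))"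
    using pull_Cmp[OF pb tgt(4)[OF assms(1,2)] assms(5), of s] s assms by auto
  note B = pb_D[OF pb]
  show eq: "scomp C A i j k t s = mul A i j k \<cdot> (?p \<cdot> s)" using P s assms by (simp add: scomp_def)
  have A: "scomp C A i j k t s \<in> Arr C" "Dom C (scomp C A i j k t s) = P0 A i" "Cod C (scomp C A i j k t s) = P1 A i k"
    unfolding eq using P s assms by simp_all
  have "sor A i k \<cdot> scomp C A i j k t s = sor A i j \<cdot> (s \<cdot> Rst C (t \<cdot> (tgt A i j \<cdot> s)))"
    unfolding eq using P PC s assms B by (simp add: under2[OF mul_sor_tgt(1)])
  also have "\<dots> = Rst C (t \<cdot> (tgt A i j \<cdot> s))"
  proof -
    have "Rst C s \<cdot> Rst C (t \<cdot> tgt A i j \<cdot> s) = Rst C (t \<cdot> tgt A i j \<cdot> s)"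
      by (rule Rst_Cmp_le') (use assms s t in auto)
    then show ?thesis using assms s t by (simp add: under[OF s(4)])
  qed
  finally have 1: "sor A i k \<cdot> scomp C A i j k t s = Rst C (t \<cdot> (tgt A i j \<cdot> s))" .
  then show R: "Rst C (scomp C A i j k t s) = Rst C (t \<cdot> (tgt A i j \<cdot> s))"
    using Rst_total_Cmp[of "sor A i k" "scomp C A i j k t s"] A assms s t by simp
  show "sec i k (scomp C A i j k t s)" by (rule secI) (use A R 1 assms in auto)
  show "tgt A i k \<cdot> scomp C A i j k t s = tgt A j k \<cdot> (t \<cdot> (tgt A i j \<cdot> s))"
    unfolding eq using P PC s assms B by (simp add: under2[OF mul_sor_tgt(2)])
qed

text \<open>An evaluation that does not presuppose the unit law. Hence it gives the law for sections
  when the internal law is known, and the internal law, in \<open>source_etaleI\<close>, when it is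
  known for sections.\<close>

lemma unit_right_at_section:
  assumes ij: "i \<in> Cpt A" "j \<in> Cpt A"
  defines "h \<equiv> pairing C (sor A i j) (tgt A i i) (Ide C (P1 A i j)) (unt A i \<cdot> sor A i j)"
  shows "h \<in> Arr C" "Dom C h = P1 A i j" "Cod C h = pbo C (sor A i j) (tgt A i i)"
    "\<And>t e. \<lbrakk>sec i j t; e \<in> RI C (P0 A i)\<rbrakk> \<Longrightarrow>
      mul A i i j \<cdot> (h \<cdot> (t \<cdot> e)) = scomp C A i i j t (unt A i \<cdot> e)"
proof -
  have pb: "has_pb C (sor A i j) (tgt A i i)" using ij by simp
  have H: "h \<in> Arr C" "Dom C h = P1 A i j" "Cod C h = pbo C (sor A i j) (tgt A i i)"
    "pr1 C (sor A i j) (tgt A i i) \<cdot> h = Ide C (P1 A i j)"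
    "pr2 C (sor A i j) (tgt A i i) \<cdot> h = unt A i \<cdot> sor A i j"
    using ij unfolding h_def by (subst pairing[OF pb]; simp)+
  then show "h \<in> Arr C" "Dom C h = P1 A i j" "Cod C h = pbo C (sor A i j) (tgt A i i)" by simp_all
  note B = pb_D[OF pb]
  fix t e assume se: "sec i j t" "e \<in> RI C (P0 A i)"
  note t = sec_D[OF ij se(1)] and e = RI_D[OF se(2)]
  have te: "sor A i j \<cdot> (t \<cdot> e) = Rst C t \<cdot> e" using t e ij se by (simp add: under[OF t(4)])
  have ee: "e \<cdot> (Rst C t \<cdot> e) = Rst C t \<cdot> e" 
    using RI_lcomm[OF se(2) RI_Rst[of t "P0 A i"], of e] RI_idem[OF se(2)] t e by simp
  show "mul A i i j \<cdot> (h \<cdot> (t \<cdot> e)) = scomp C A i i j t (unt A i \<cdot> e)"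
  proof (rule mul_eq_scomp)
    show "pr1 C (sor A i j) (tgt A i i) \<cdot> (h \<cdot> (t \<cdot> e)) = t \<cdot> (tgt A i i \<cdot> (unt A i \<cdot> e))"
      using ij se t e H B by (simp add: under[OF H(4)])
    show "pr2 C (sor A i j) (tgt A i i) \<cdot> (h \<cdot> (t \<cdot> e)) = unt A i \<cdot> e \<cdot> Rst C (t \<cdot> (tgt A i i \<cdot> (unt A i \<cdot> e)))"
      using ij se t e H B te ee Rst_Cmp_RI[OF se(2), of t] by (simp add: under[OF H(5)])
  qed (use ij se t e H in auto)
qed

text \<open>A restricted identity on the left cuts \<open>s\<close> down at its target, so the test
  element is \<open>s\<close> restricted to the inverse image of \<open>e\<close> along
  \<open>tgt A i j \<cdot> s\<close>.\<close>

lemma unit_left_at_section: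
  assumes ij: "i \<in> Cpt A" "j \<in> Cpt A"
  defines "h \<equiv> pairing C (sor A j j) (tgt A i j) (unt A j \<cdot> tgt A i j) (Ide C (P1 A i j))"
  shows "h \<in> Arr C" "Dom C h = P1 A i j" "Cod C h = pbo C (sor A j j) (tgt A i j)"
    "\<And>s e. \<lbrakk>sec i j s; e \<in> RI C (P0 A j)\<rbrakk> \<Longrightarrow>
      mul A i j j \<cdot> (h \<cdot> (s \<cdot> Rst C (e \<cdot> (tgt A i j \<cdot> s)))) = scomp C A i j j (unt A j \<cdot> e) s"
proof -
  have pb: "has_pb C (sor A j j) (tgt A i j)" using ij by simp
  have H: "h \<in> Arr C" "Dom C h = P1 A i j" "Cod C h = pbo C (sor A j j) (tgt A i j)"
    "pr1 C (sor A j j) (tgt A i j) \<cdot> h = unt A j \<cdot> tgt A i j"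
    "pr2 C (sor A j j) (tgt A i j) \<cdot> h = Ide C (P1 A i j)"
    using ij unfolding h_def by (subst pairing[OF pb]; simp)+
  then show "h \<in> Arr C" "Dom C h = P1 A i j" "Cod C h = pbo C (sor A j j) (tgt A i j)" by simp_all
  note B = pb_D[OF pb]
  fix s e assume se: "sec i j s" "e \<in> RI C (P0 A j)"
  note s = sec_D[OF ij se(1)] and e = RI_D[OF se(2)]
  let ?x = "s \<cdot> Rst C (e \<cdot> (tgt A i j \<cdot> s))"
  have tx: "tgt A i j \<cdot> ?x = e \<cdot> (tgt A i j \<cdot> s)" using RI_slide[OF se(2), of "tgt A i j \<cdot> s"] ij se s e by simp
  have Ru: "Rst C (unt A j \<cdot> (e \<cdot> (tgt A i j \<cdot> s))) = Rst C (e \<cdot> (tgt A i j \<cdot> s))"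
    by (rule Rst_total_Cmp) (use ij se s e in auto)
  show "mul A i j j \<cdot> (h \<cdot> ?x) = scomp C A i j j (unt A j \<cdot> e) s"
  proof (rule mul_eq_scomp)
    show "pr1 C (sor A j j) (tgt A i j) \<cdot> (h \<cdot> ?x) = unt A j \<cdot> e \<cdot> (tgt A i j \<cdot> s)"
      using ij se s e H B tx by (simp add: under[OF H(4)])
    show "pr2 C (sor A j j) (tgt A i j) \<cdot> (h \<cdot> ?x) = s \<cdot> Rst C (unt A j \<cdot> e \<cdot> (tgt A i j \<cdot> s))"
      using ij se s e H B Ru by (simp add: under[OF H(5)])
  qed (use ij se s e H sec_unt in auto)
qed

text \<open>The map \<open>w u t s\<close> is a generalised element of the triple pullback built
  from three consecutive sections. On it the two sides of associativity evaluate to the two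
  bracketings of the composite of sections; the law itself is not presupposed.\<close>

lemma assoc_at_sections:
  assumes I: "i \<in> Cpt A" "j \<in> Cpt A" "k \<in> Cpt A" "l \<in> Cpt A"
  defines "p1 \<equiv> pr1 C (sor A j k) (tgt A i j)" and "p2 \<equiv> pr2 C (sor A j k) (tgt A i j)"
  defines "f \<equiv> tgt A j k \<cdot> p1"
  defines "q1 \<equiv> pr1 C (sor A k l) f" and "q2 \<equiv> pr2 C (sor A k l) f"
  defines "om \<equiv> pairing C (sor A k l) (tgt A i k) q1 (mul A i j k \<cdot> q2)"
  defines "mo \<equiv> pairing C (sor A j l) (tgt A i j)
     (mul A j k l \<cdot> pairing C (sor A k l) (tgt A j k) q1 (p1 \<cdot> q2)) (p2 \<cdot> q2)"
  defines "w \<equiv> \<lambda>u t s. pull_section C (sor A k l) f u \<cdot> (pull_section C (sor A j k) (tgt A i j) t \<cdot> s)"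
  shows "om \<in> Hom C (pbo C (sor A k l) f) (pbo C (sor A k l) (tgt A i k))"
    and "mo \<in> Hom C (pbo C (sor A k l) f) (pbo C (sor A j l) (tgt A i j))"
    and "total C f" "has_pb C (sor A k l) f" "Dom C f = pbo C (sor A j k) (tgt A i j)"
    and "\<And>s t u. \<lbrakk>sec i j s; sec j k t; sec k l u\<rbrakk> \<Longrightarrow> w u t s \<in> Arr C \<and> Cod C (w u t s) = pbo C (sor A k l) f"
    and "\<And>s t u. \<lbrakk>sec i j s; sec j k t; sec k l u\<rbrakk> \<Longrightarrow>
      mul A i k l \<cdot> (om \<cdot> w u t s) = scomp C A i k l u (scomp C A i j k t s)"
    and "\<And>s t u. \<lbrakk>sec i j s; sec j k t; sec k l u\<rbrakk> \<Longrightarrow>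
      mul A i j l \<cdot> (mo \<cdot> w u t s) = scomp C A i j l (scomp C A j k l u t) s"
proof -
  let ?a = "sor A j k" and ?b = "tgt A i j"
  let ?p1 = "pr1 C ?a ?b" and ?p2 = "pr2 C ?a ?b"
  let ?f = "tgt A j k \<cdot> ?p1"
  let ?q1 = "pr1 C (sor A k l) ?f" and ?q2 = "pr2 C (sor A k l) ?f"
  let ?om = "pairing C (sor A k l) (tgt A i k) ?q1 (mul A i j k \<cdot> ?q2)"
  let ?x = "pairing C (sor A k l) (tgt A j k) ?q1 (?p1 \<cdot> ?q2)"
  let ?mo = "pairing C (sor A j l) (tgt A i j) (mul A j k l \<cdot> ?x) (?p2 \<cdot> ?q2)"
  note defs = om_def mo_def f_def q1_def q2_def p1_def p2_def w_def
  have pb1: "has_pb C ?a ?b" using I by simp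
  note B1 = pb_D[OF pb1] and t1 = pb_total[OF pb1 sor(4)[OF I(2,3)] tgt(4)[OF I(1,2)]]
  have tf: "total C ?f" using total_Cmp t1 I B1 by simp
  have fD: "?f \<in> Arr C" "Dom C ?f = pbo C ?a ?b" "Cod C ?f = P0 A k" using I B1 by simp_all
  have pb2: "has_pb C (sor A k l) ?f" by (rule sor_pb) (use I tf fD in auto)
  note B2 = pb_D[OF pb2]
  have pbik: "has_pb C (sor A k l) (tgt A i k)" and pbjk: "has_pb C (sor A k l) (tgt A j k)" and pbjl: "has_pb C (sor A j l) (tgt A i j)"
    using I by simp_all
  note Bik = pb_D[OF pbik] and Bjk = pb_D[OF pbjk] and Bjl = pb_D[OF pbjl]
  have o: "sor A k l \<cdot> ?q1 = tgt A i k \<cdot> (mul A i j k \<cdot> ?q2)"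
    using B2 B1 I by (simp add: under2[OF mul_sor_tgt(2)])
  have OM: "?om \<in> Arr C" "Dom C ?om = pbo C (sor A k l) ?f" "Cod C ?om = pbo C (sor A k l) (tgt A i k)"
    "pr1 C (sor A k l) (tgt A i k) \<cdot> ?om = ?q1" "pr2 C (sor A k l) (tgt A i k) \<cdot> ?om = mul A i j k \<cdot> ?q2"
    using pairing[OF pbik _ _ _ _ _ o] I B1 B2 by simp_all
  have xx: "sor A k l \<cdot> ?q1 = tgt A j k \<cdot> (?p1 \<cdot> ?q2)" using B2 B1 I by simp
  have X: "?x \<in> Arr C" "Dom C ?x = pbo C (sor A k l) ?f" "Cod C ?x = pbo C (sor A k l) (tgt A j k)"
    "pr1 C (sor A k l) (tgt A j k) \<cdot> ?x = ?q1" "pr2 C (sor A k l) (tgt A j k) \<cdot> ?x = ?p1 \<cdot> ?q2"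
    using pairing[OF pbjk _ _ _ _ _ xx] I B1 B2 by simp_all
  have mm: "sor A j l \<cdot> (mul A j k l \<cdot> ?x) = tgt A i j \<cdot> (?p2 \<cdot> ?q2)"
    using X B1 B2 Bjk I by (simp add: under2[OF mul_sor_tgt(1)] pb_square)
  have MO: "?mo \<in> Arr C" "Dom C ?mo = pbo C (sor A k l) ?f" "Cod C ?mo = pbo C (sor A j l) (tgt A i j)"
    "pr1 C (sor A j l) (tgt A i j) \<cdot> ?mo = mul A j k l \<cdot> ?x" "pr2 C (sor A j l) (tgt A i j) \<cdot> ?mo = ?p2 \<cdot> ?q2"
    using pairing[OF pbjl _ _ _ _ _ mm] I X B1 B2 by simp_all
  show "om \<in> Hom C (pbo C (sor A k l) f) (pbo C (sor A k l) (tgt A i k))"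
    "mo \<in> Hom C (pbo C (sor A k l) f) (pbo C (sor A j l) (tgt A i j))"
    unfolding defs using OM MO by (auto simp: Hom_iff)
  show "total C f" "has_pb C (sor A k l) f" "Dom C f = pbo C (sor A j k) (tgt A i j)"
    unfolding defs using tf pb2 fD by auto
  fix s t u assume s: "sec i j s" and t: "sec j k t" and u: "sec k l u"
  note sD = sec_D[OF I(1,2) s] and tD = sec_D[OF I(2,3) t] and uD = sec_D[OF I(3,4) u]
  let ?t = "pull_section C ?a ?b t" and ?u = "pull_section C (sor A k l) ?f u"
  have T: "?t \<in> Arr C" "Dom C ?t = P1 A i j" "Cod C ?t = pbo C ?a ?b"
    using pull_section[OF pb1 tgt(4)[OF I(1,2)] t] I by auto
  have U: "?u \<in> Arr C" "Dom C ?u = pbo C ?a ?b" "Cod C ?u = pbo C (sor A k l) ?f"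
    using pull_section[OF pb2 tf u] fD by auto
  let ?y = "?t \<cdot> s"
  have Y: "?y \<in> Arr C" "Dom C ?y = P0 A i" "Cod C ?y = pbo C ?a ?b"
    and Y1: "?p1 \<cdot> ?y = t \<cdot> (?b \<cdot> s)" and Y2: "?p2 \<cdot> ?y = s \<cdot> Rst C (t \<cdot> (?b \<cdot> s))"
    using pull_Cmp[OF pb1 tgt(4)[OF I(1,2)] t, of s] sD T I by simp_all
  let ?w = "?u \<cdot> ?y"
  have W: "?w \<in> Arr C" "Dom C ?w = P0 A i" "Cod C ?w = pbo C (sor A k l) ?f" using U Y by simp_all
  then show "w u t s \<in> Arr C \<and> Cod C (w u t s) = pbo C (sor A k l) f" unfolding defs by simp
  let ?r = "u \<cdot> (tgt A j k \<cdot> (t \<cdot> (?b \<cdot> s)))"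
  have W1: "?q1 \<cdot> ?w = ?r" and W2: "?q2 \<cdot> ?w = ?y \<cdot> Rst C ?r"
    using pull_Cmp[OF pb2 tf u, of ?y] Y Y1 B1 I fD by simp_all
  have r: "?r \<in> Arr C" "Dom C ?r = P0 A i" "Cod C ?r = P1 A k l" using uD tD sD I by simp_all
  have 1: "scomp C A i k l u (scomp C A i j k t s) = mul A i k l \<cdot> (?om \<cdot> ?w)"
  proof (rule mul_eq_scomp[OF I(1,3,4) u, symmetric])
    note S = scomp[OF I(1-3) s t] 
    show "pr1 C (sor A k l) (tgt A i k) \<cdot> (?om \<cdot> ?w) = u \<cdot> (tgt A i k \<cdot> scomp C A i j k t s)"
      using OM W W1 Bik S(3) by (simp add: under[OF OM(4)])
    show "pr2 C (sor A k l) (tgt A i k) \<cdot> (?om \<cdot> ?w) =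
        scomp C A i j k t s \<cdot> Rst C (u \<cdot> (tgt A i k \<cdot> scomp C A i j k t s))"
      using OM W W2 Bik S(3,4) B2 fD I Y r T sD by (simp add: under[OF OM(5)])
    show "scomp C A i j k t s \<in> Arr C" "Cod C (scomp C A i j k t s) = P1 A i k"
      using sec_D[OF I(1,3) S(1)] by simp_all
  qed (use OM W in auto)
  have 2: "scomp C A i j l (scomp C A j k l u t) s = mul A i j l \<cdot> (?mo \<cdot> ?w)"
  proof (rule mul_eq_scomp[OF I(1,2,4), symmetric])
    note S = scomp[OF I(2-4) t u] 
    show "sec j l (scomp C A j k l u t)" by (rule S)
    \<comment> \<open>The pairing inside \<open>mul_one\<close>, at the element \<open>?w\<close>,
      is the section \<open>u\<close> pulled back along the target map and evaluated at
      \<open>t \<cdot> (?b \<cdot> s)\<close>.\<close>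
    have xw: "?x \<cdot> ?w = pull_section C (sor A k l) (tgt A j k) u \<cdot> (t \<cdot> (?b \<cdot> s))"
    proof (rule pull_Cmp_eqI[OF pbjk tgt(4)[OF I(2,3)] u, symmetric])
      show "pr1 C (sor A k l) (tgt A j k) \<cdot> (?x \<cdot> ?w) = u \<cdot> (tgt A j k \<cdot> (t \<cdot> (?b \<cdot> s)))"
        using X W W1 Bjk by (simp add: under[OF X(4)])
      show "pr2 C (sor A k l) (tgt A j k) \<cdot> (?x \<cdot> ?w) = t \<cdot> (?b \<cdot> s) \<cdot> Rst C ?r"
        using X W W2 Bjk B1 B2 fD Y Y1 r tD sD I T by (simp add: under[OF X(5)] pull_Cmp(1)[OF pb1 tgt(4)[OF I(1,2)] t])
    qed (use X W tD sD I in auto)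
    have m: "mul A j k l \<cdot> (?x \<cdot> ?w) = scomp C A j k l u t \<cdot> (?b \<cdot> s)"
      unfolding xw S(4)
      using pull_section[OF pbjk tgt(4)[OF I(2,3)] u] tD sD I by simp
    show "pr1 C (sor A j l) (tgt A i j) \<cdot> (?mo \<cdot> ?w) = scomp C A j k l u t \<cdot> (tgt A i j \<cdot> s)"
      using MO W Bjl X I m by (simp add: under[OF MO(4)])
    have Rm: "Rst C (scomp C A j k l u t \<cdot> (tgt A i j \<cdot> s)) = Rst C ?r"
      using Rst_Rst_Cmp[of "tgt A i j \<cdot> s" "scomp C A j k l u t"] S(2) sec_D[OF I(2,4) S(1)] tD uD sD I
        Rst_Rst_Cmp[of "tgt A i j \<cdot> s" "u \<cdot> (tgt A j k \<cdot> t)"] by simp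
    have "?p2 \<cdot> ?y \<cdot> Rst C ?r = s \<cdot> Rst C (t \<cdot> (?b \<cdot> s)) \<cdot> Rst C ?r" unfolding Y2 ..
    then have Y2': "?p2 \<cdot> (?t \<cdot> (s \<cdot> Rst C ?r)) = s \<cdot> (Rst C (t \<cdot> (?b \<cdot> s)) \<cdot> Rst C ?r)"
      using T B1 r sD tD I by simp
    have "Rst C (t \<cdot> (?b \<cdot> s)) \<cdot> Rst C ?r = Rst C ?r"
      using Rst_Cmp_le'[of "t \<cdot> (?b \<cdot> s)" "u \<cdot> tgt A j k"] tD uD sD I by simp
    then show "pr2 C (sor A j l) (tgt A i j) \<cdot> (?mo \<cdot> ?w) = s \<cdot> Rst C (scomp C A j k l u t \<cdot> (tgt A i j \<cdot> s))"
      unfolding Rm using MO W W2 Bjl B1 B2 fD Y Y2' r sD tD T I by (simp add: under[OF MO(5)])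
  qed (use MO W sD in auto)
  show "mul A i k l \<cdot> (om \<cdot> w u t s) = scomp C A i k l u (scomp C A i j k t s)"
    "mul A i j l \<cdot> (mo \<cdot> w u t s) = scomp C A i j l (scomp C A j k l u t) s"
    unfolding defs using 1 2 by simp_all
qed

end

section \<open>Consequences of the internal laws for composition of sections\<close>

locale etale_pcat = join_restriction_category C
  for C :: "('o,'m) rcat" (structure) +
  fixes A :: "('i,'o,'m) pcat"
  assumes source_etale: "source_etale C A"
begin

sublocale pcat_structure C A
proof
  have "has_pb C (sor A i j) f" if f: "i \<in> Cpt A" "j \<in> Cpt A" "total C f" "Cod C f = P0 A i" for i j f
  proof -
    have "\<forall>i \<in> Cpt A. \<forall>j \<in> Cpt A. \<forall>f. total C f \<and> Cod C f = P0 A i \<longrightarrow> (\<exists>p q. is_pullback C (sor A i j) f p q)"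
      using source_etale by (simp add: source_etale_def pcategory_def)
    then obtain p q where "is_pullback C (sor A i j) f p q" using f by blast
    then show ?thesis by (rule has_pbI)
  qed
  then show "is_pcat_structure C A"
    using source_etale by (simp add: source_etale_def pcategory_def is_pcat_structure_def)
qed

lemma mul_unt: assumes "i \<in> Cpt A" "j \<in> Cpt A"
  shows "mul A i i j \<cdot> pairing C (sor A i j) (tgt A i i) (Ide C (P1 A i j)) (unt A i \<cdot> sor A i j) = Ide C (P1 A i j)"
    "mul A i j j \<cdot> pairing C (sor A j j) (tgt A i j) (unt A j \<cdot> tgt A i j) (Ide C (P1 A i j)) = Ide C (P1 A i j)"
  using assms source_etale unfolding source_etale_def pcategory_def by blast+

text \<open>The sections \<open>unt A i \<cdot> e\<close> are the restriction idempotents of the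
  section category, so on the right they act by restriction.\<close>

lemma scomp_unt_right:
  assumes "i \<in> Cpt A" "j \<in> Cpt A" "sec i j t" "e \<in> RI C (P0 A i)"
  shows "scomp C A i i j t (unt A i \<cdot> e) = t \<cdot> e"
  unfolding unit_right_at_section(4)[OF assms, symmetric]
  using assms unit_right_at_section(1-3)[OF assms(1,2)] sec_D[OF assms(1-3)] RI_D[OF assms(4)]
  by (simp add: under[OF mul_unt(1)])

text \<open>On the left such an idempotent keeps the part of the section whose target lies in
  \<open>e\<close>.\<close>

lemma scomp_unt_left:
  assumes "i \<in> Cpt A" "j \<in> Cpt A" "sec i j s" "e \<in> RI C (P0 A j)"
  shows "scomp C A i j j (unt A j \<cdot> e) s = s \<cdot> Rst C (e \<cdot> (tgt A i j \<cdot> s))"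
  unfolding unit_left_at_section(4)[OF assms, symmetric]
  using assms unit_left_at_section(1-3)[OF assms(1,2)] sec_D[OF assms(1-3)] RI_D[OF assms(4)]
  by (simp add: under[OF mul_unt(2)])

lemma scomp_assoc:
  assumes I: "i \<in> Cpt A" "j \<in> Cpt A" "k \<in> Cpt A" "l \<in> Cpt A" and s: "sec i j s" and t: "sec j k t" and u: "sec k l u"
  shows "scomp C A i k l u (scomp C A i j k t s) = scomp C A i j l (scomp C A j k l u t) s"
proof -
  note L = assoc_at_sections[OF I]
  note L1 = L(1,2)[unfolded Hom_iff]
  have law: "\<And>i j k l. \<lbrakk>i \<in> Cpt A; j \<in> Cpt A; k \<in> Cpt A; l \<in> Cpt A\<rbrakk> \<Longrightarrow>
     mul A i k l \<cdot> pairing C (sor A k l) (tgt A i k)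
       (pr1 C (sor A k l) (tgt A j k \<cdot> pr1 C (sor A j k) (tgt A i j)))
       (mul A i j k \<cdot> pr2 C (sor A k l) (tgt A j k \<cdot> pr1 C (sor A j k) (tgt A i j))) =
     mul A i j l \<cdot> pairing C (sor A j l) (tgt A i j)
       (mul A j k l \<cdot> pairing C (sor A k l) (tgt A j k)
         (pr1 C (sor A k l) (tgt A j k \<cdot> pr1 C (sor A j k) (tgt A i j)))
         (pr1 C (sor A j k) (tgt A i j) \<cdot> pr2 C (sor A k l) (tgt A j k \<cdot> pr1 C (sor A j k) (tgt A i j))))
       (pr2 C (sor A j k) (tgt A i j) \<cdot> pr2 C (sor A k l) (tgt A j k \<cdot> pr1 C (sor A j k) (tgt A i j)))"
    using source_etale unfolding source_etale_def pcategory_def Let_def by blast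
  show ?thesis
    unfolding L(7)[OF s t u, symmetric] L(8)[OF s t u, symmetric]
    by (rule under2[OF law[OF I]]) (use L1 L(6)[OF s t u] I in auto)
qed

end

section \<open>The category of partial sections\<close>

lemma Phi_cat_simps [simp]:
  "Obj (Phi_cat C A) = Cpt A"
  "(i, j, s) \<in> Arr (Phi_cat C A) \<longleftrightarrow> i \<in> Cpt A \<and> j \<in> Cpt A \<and> partial_section C (sor A i j) s"
  "Dom (Phi_cat C A) (i, j, s) = i" "Cod (Phi_cat C A) (i, j, s) = j" "Ide (Phi_cat C A) i = (i, i, unt A i)"
  "Cmp (Phi_cat C A) (j', k, t) (i, j, s) = (i, k, scomp C A i j k t s)"
  "Rst (Phi_cat C A) (i, j, s) = (i, i, unt A i \<cdot>\<^bsub>C\<^esub> Rst C s)"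
  by (auto simp: Phi_cat_def scomp_def)

lemma Phi_proj_simps [simp]: "fob (Phi_proj C A) = P0 A" "far (Phi_proj C A) (i, j, s) = tgt A i j \<cdot>\<^bsub>C\<^esub> s"
  by (auto simp: Phi_proj_def)

lemma Phi_Hom: "f \<in> Hom (Phi_cat C A) i j \<longleftrightarrow>
    i \<in> Cpt A \<and> j \<in> Cpt A \<and> (\<exists>s. f = (i, j, s) \<and> partial_section C (sor A i j) s)"
  by (cases f) (auto simp: Hom_def)

lemma is_functorI:
  assumes "\<And>x. x \<in> Obj X \<Longrightarrow> fob F x \<in> Obj Y"
    "\<And>f. f \<in> Arr X \<Longrightarrow> far F f \<in> Hom Y (fob F (Dom X f)) (fob F (Cod X f))"
    "\<And>x. x \<in> Obj X \<Longrightarrow> far F (Ide X x) = Ide Y (fob F x)"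
    "\<And>f g. \<lbrakk>f \<in> Arr X; g \<in> Arr X; Dom X g = Cod X f\<rbrakk> \<Longrightarrow> far F (g \<cdot>\<^bsub>X\<^esub> f) = far F g \<cdot>\<^bsub>Y\<^esub> far F f"
  shows "is_functor X Y F"
  using assms by (simp add: is_functor_def)

context join_restriction_category
begin

text \<open>Being a section is a local property: \<open>p \<cdot> h\<close> and
  \<open>Rst C h\<close> coincide on the domain of each member of the family.\<close>

lemma section_join:
  assumes p: "p \<in> Arr C" and S: "\<And>s. s \<in> S \<Longrightarrow> partial_section C p s" and h: "is_join C (Cod C p) (Dom C p) S h"
  shows "partial_section C p h"
proof -
  note hD = is_join_Hom[OF h]
  have c: "cover C (Cod C p) S (\<lambda>s. Rst C s) (Rst C h)" using is_join_cover[of "Cod C p" "Dom C p" "\<lambda>s. s" S h] h by simp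
  have "p \<cdot> h \<cdot> Rst C h = Rst C h \<cdot> Rst C h"
  proof (rule cover_ext[OF c])
    fix s assume s: "s \<in> S"
    note sD = psec_D[OF S[OF s] p]
    have hs: "h \<cdot> Rst C s = s" using le_D[OF is_join_upper[OF h s]] .
    have "Rst C h \<cdot> Rst C s = Rst C s" using cover_D(4)[OF c s] .
    then show "p \<cdot> h \<cdot> Rst C s = Rst C h \<cdot> Rst C s" using hs sD hD p by simp
  qed (use hD p in auto)
  then show ?thesis using hD p by (intro psecI) auto
qed

end

context etale_pcat
begin

lemma category_Phi: "category (Phi_cat C A)"
proof
  fix W X Y Z f g h
  show "f \<in> Arr (Phi_cat C A) \<Longrightarrow> Dom (Phi_cat C A) f \<in> Obj (Phi_cat C A)"
    "f \<in> Arr (Phi_cat C A) \<Longrightarrow> Cod (Phi_cat C A) f \<in> Obj (Phi_cat C A)" by (cases f; simp)+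
  show "X \<in> Obj (Phi_cat C A) \<Longrightarrow> Ide (Phi_cat C A) X \<in> Hom (Phi_cat C A) X X" by (simp add: Phi_Hom sec_unt')
  show "f \<cdot>\<^bsub>Phi_cat C A\<^esub> Ide (Phi_cat C A) X = f" if f0: "f \<in> Hom (Phi_cat C A) X Y"
  proof -
    obtain s where f: "f = (X, Y, s)" "X \<in> Cpt A" "Y \<in> Cpt A" "sec X Y s" using f0 by (auto simp: Phi_Hom)
    then show ?thesis using scomp_unt_right[OF f(2-4), of "Ide C (P0 A X)"] sec_D[OF f(2-4)] by simp
  qed
  show "Ide (Phi_cat C A) Y \<cdot>\<^bsub>Phi_cat C A\<^esub> f = f" if f0: "f \<in> Hom (Phi_cat C A) X Y"
  proof -
    obtain s where f: "f = (X, Y, s)" "X \<in> Cpt A" "Y \<in> Cpt A" "sec X Y s" using f0 by (auto simp: Phi_Hom)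
    note sD = sec_D[OF f(2-4)]
    have "Rst C (tgt A X Y \<cdot> s) = Rst C s" using Rst_total_Cmp f sD by simp
    then show ?thesis using scomp_unt_left[OF f(2-4), of "Ide C (P0 A Y)"] sD f by simp
  qed
  show "g \<cdot>\<^bsub>Phi_cat C A\<^esub> f \<in> Hom (Phi_cat C A) X Z" if "f \<in> Hom (Phi_cat C A) X Y" "g \<in> Hom (Phi_cat C A) Y Z"
    using that by (auto simp: Phi_Hom scomp_sec)
  show "h \<cdot>\<^bsub>Phi_cat C A\<^esub> (g \<cdot>\<^bsub>Phi_cat C A\<^esub> f) = h \<cdot>\<^bsub>Phi_cat C A\<^esub> g \<cdot>\<^bsub>Phi_cat C A\<^esub> f"
    if "f \<in> Hom (Phi_cat C A) W X" "g \<in> Hom (Phi_cat C A) X Y" "h \<in> Hom (Phi_cat C A) Y Z"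
    using that by (auto simp: Phi_Hom scomp_assoc)
qed

lemma restriction_category_Phi: "restriction_category (Phi_cat C A)"
proof (intro restriction_category.intro category_Phi restriction_category_axioms.intro)
  fix f g i j k
  assume f: "f \<in> Hom (Phi_cat C A) i j"
  then obtain s where s: "f = (i, j, s)" "i \<in> Cpt A" "j \<in> Cpt A" "sec i j s" by (auto simp: Phi_Hom)
  note sD = sec_D[OF s(2-4)]
  show "Rst (Phi_cat C A) f \<in> Hom (Phi_cat C A) i i" using s sD by (simp add: Phi_Hom sec_unt)
  show "f \<cdot>\<^bsub>Phi_cat C A\<^esub> Rst (Phi_cat C A) f = f" using s sD by (simp add: scomp_unt_right)
  { assume g: "g \<in> Hom (Phi_cat C A) i k"
    then obtain t where t: "g = (i, k, t)" "k \<in> Cpt A" "sec i k t" by (auto simp: Phi_Hom)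
    note tD = sec_D[OF s(2) t(2,3)]
    show "Rst (Phi_cat C A) f \<cdot>\<^bsub>Phi_cat C A\<^esub> Rst (Phi_cat C A) g = Rst (Phi_cat C A) g \<cdot>\<^bsub>Phi_cat C A\<^esub> Rst (Phi_cat C A) f"
      using s sD t tD Rst_comm[of s t] by (simp add: scomp_unt_right sec_unt)
    show "Rst (Phi_cat C A) (g \<cdot>\<^bsub>Phi_cat C A\<^esub> Rst (Phi_cat C A) f) = Rst (Phi_cat C A) g \<cdot>\<^bsub>Phi_cat C A\<^esub> Rst (Phi_cat C A) f"
      using s sD t tD by (simp add: scomp_unt_right sec_unt) }
  { assume g: "g \<in> Hom (Phi_cat C A) j k"
    then obtain t where t: "g = (j, k, t)" "k \<in> Cpt A" "sec j k t" by (auto simp: Phi_Hom)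
    note tD = sec_D[OF s(3) t(2,3)]
    have "Rst C (Rst C t \<cdot> (tgt A i j \<cdot> s)) = Rst C (t \<cdot> (tgt A i j \<cdot> s))" using s sD tD by simp
    then show "Rst (Phi_cat C A) g \<cdot>\<^bsub>Phi_cat C A\<^esub> f = f \<cdot>\<^bsub>Phi_cat C A\<^esub> Rst (Phi_cat C A) (g \<cdot>\<^bsub>Phi_cat C A\<^esub> f)"
      using s sD t tD by (simp add: scomp_unt_right scomp_unt_left Rst_scomp) }
qed

lemma le_Phi:
  assumes "i \<in> Cpt A" "j \<in> Cpt A" "sec i j s" "sec i j t"
  shows "le (Phi_cat C A) (i, j, s) (i, j, t) \<longleftrightarrow> le C s t"
proof -
  note sD = sec_D[OF assms(1-3)]
  show ?thesis using assms scomp_unt_right[OF assms(1,2,4), of "Rst C s"] sD by (simp add: le_def)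
qed

text \<open>In the section category only sections compete as upper bounds, so the two notions of
  join might differ. They do not, since the join in \<open>C\<close> of a family of sections is
  again a section.\<close>

lemma is_join_Phi:
  assumes ij: "i \<in> Cpt A" "j \<in> Cpt A" and S: "\<And>s. s \<in> S \<Longrightarrow> sec i j s" and h: "sec i j h"
  shows "is_join (Phi_cat C A) i j ((\<lambda>s. (i, j, s)) ` S) (i, j, h) \<longleftrightarrow> is_join C (P0 A i) (P1 A i j) S h"
proof -
  have 1: "is_join (Phi_cat C A) i j ((\<lambda>s. (i, j, s)) ` S) (i, j, h)" if c: "is_join C (P0 A i) (P1 A i j) S h" for h
  proof -
    have h: "sec i j h" by (rule section_join[OF _ S]) (use ij c in auto)
    show ?thesis unfolding is_join_def
    proof (intro conjI ballI impI)
      fix k assume "k \<in> Hom (Phi_cat C A) i j" and le: "\<forall>f\<in>(\<lambda>s. (i, j, s)) ` S. le (Phi_cat C A) f k"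
      then obtain u where u: "k = (i, j, u)" "sec i j u" by (auto simp: Phi_Hom)
      note uD = sec_D[OF ij u(2)]
      have "le C h u" by (rule is_join_least[OF c]) (use uD u le S ij in \<open>auto simp: Hom_iff le_Phi\<close>)
      then show "le (Phi_cat C A) (i, j, h) k" using u h ij by (simp add: le_Phi)
    qed (use ij S h is_join_upper[OF c] in \<open>auto simp: Phi_Hom le_Phi\<close>)
  qed
  have "is_join C (P0 A i) (P1 A i j) S h" if j: "is_join (Phi_cat C A) i j ((\<lambda>s. (i, j, s)) ` S) (i, j, h)"
  proof -
    \<comment> \<open>A family with an upper bound is compatible, so its join in \<open>C\<close>
      exists; being a section, that join has to be \<open>h\<close>.\<close>
    have "\<exists>h. is_join C (P0 A i) (P1 A i j) S h"
    proof (rule join_exists)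
      show "S \<subseteq> Hom C (P0 A i) (P1 A i j)" using sec_D[OF ij S] by (auto simp: Hom_iff)
      fix s t assume st: "s \<in> S" "t \<in> S"
      note sD = sec_D[OF ij S[OF st(1)]] and tD = sec_D[OF ij S[OF st(2)]] and hD = sec_D[OF ij h]
      have "le C s h" "le C t h" using j st S h ij by (auto simp: is_join_def le_Phi)
      then have "h \<cdot> Rst C s = s" "h \<cdot> Rst C t = t" by (auto simp: le_D)
      then have "s \<cdot> Rst C t = h \<cdot> Rst C s \<cdot> Rst C t" "t \<cdot> Rst C s = h \<cdot> Rst C t \<cdot> Rst C s" by simp_all
      then show "compatible C s t" unfolding compatible_def using sD tD hD Rst_comm[of s t] by simp
    qed (use ij in auto)
    then obtain k where k: "is_join C (P0 A i) (P1 A i j) S k" ..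
    have "sec i j k" by (rule section_join[OF _ S]) (use ij k in auto)
    then have "le C h k" "le C k h" using 1[OF k] j ij h
      by (auto simp: is_join_def le_Phi[symmetric])
    then have "h = k" using sec_D[OF ij \<open>sec i j k\<close>] sec_D[OF ij h] by (intro le_antisym) auto
    then show ?thesis using k by simp
  qed
  then show ?thesis using 1 by blast
qed

lemma join_restriction_category_Phi: "join_restriction_category (Phi_cat C A)"
proof (intro join_restriction_category.intro restriction_category_Phi join_restriction_category_axioms.intro)
  fix i j S
  assume ij: "i \<in> Obj (Phi_cat C A)" "j \<in> Obj (Phi_cat C A)" and S: "S \<subseteq> Hom (Phi_cat C A) i j"
    and comp: "\<And>f g. \<lbrakk>f \<in> S; g \<in> S\<rbrakk> \<Longrightarrow> compatible (Phi_cat C A) f g"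
  define T where "T = {s. (i, j, s) \<in> S}"
  have ij': "i \<in> Cpt A" "j \<in> Cpt A" using ij by auto
  have ST: "S = (\<lambda>s. (i, j, s)) ` T" using S by (force simp: T_def Phi_Hom)
  have T: "\<And>s. s \<in> T \<Longrightarrow> sec i j s" using S by (auto simp: T_def Phi_Hom)
  note TD = sec_D[OF ij' T]
  have "\<exists>h. is_join C (P0 A i) (P1 A i j) T h"
  proof (rule join_exists)
    fix s t assume st: "s \<in> T" "t \<in> T"
    then have "compatible (Phi_cat C A) (i, j, s) (i, j, t)" using comp by (auto simp: T_def)
    then show "compatible C s t" unfolding compatible_def using T TD st ij' by (simp add: scomp_unt_right)
  qed (use ij' TD in \<open>auto simp: Hom_iff\<close>)
  then obtain h where h: "is_join C (P0 A i) (P1 A i j) T h" ..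
  have "sec i j h" by (rule section_join[OF _ T]) (use ij' h in auto)
  then show "\<exists>h. is_join (Phi_cat C A) i j S h" using is_join_Phi[OF ij' T] h ST by blast
next
  fix i j S h g k
  assume J: "is_join (Phi_cat C A) i j S h" and "g \<in> Hom (Phi_cat C A) k i"
  then obtain r where r: "g = (k, i, r)" "k \<in> Cpt A" "sec k i r" by (auto simp: Phi_Hom)
  define T where "T = {s. (i, j, s) \<in> S}"
  obtain h' where h': "h = (i, j, h')" "sec i j h'" and ij: "i \<in> Cpt A" "j \<in> Cpt A" using J by (auto simp: is_join_def Phi_Hom)
  have S: "S \<subseteq> Hom (Phi_cat C A) i j" using J by (simp add: is_join_def)
  have ST: "S = (\<lambda>s. (i, j, s)) ` T" using S by (force simp: T_def Phi_Hom)
  have T: "\<And>s. s \<in> T \<Longrightarrow> sec i j s" using S by (auto simp: T_def Phi_Hom)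
  note TD = sec_D[OF ij T] and hD = sec_D[OF ij h'(2)] and rD = sec_D[OF r(2) ij(1) r(3)]
  note cs = scomp[OF r(2) ij r(3) T] and ch = scomp[OF r(2) ij r(3) h'(2)]
  note csD = sec_D[OF r(2) ij(2) cs(1)] and chD = sec_D[OF r(2) ij(2) ch(1)]
  have J': "is_join C (P0 A i) (P1 A i j) T h'" using J is_join_Phi[OF ij T h'(2)] ST h' by simp
  let ?x = "tgt A k i \<cdot> r"
  have x: "?x \<in> Arr C" "Dom C ?x = P0 A k" "Cod C ?x = P0 A i" using rD r ij by simp_all
  \<comment> \<open>Joins are recognised on domains, and the domain of a composite with
    \<open>r\<close> is the inverse image along \<open>?x\<close> of the domain of the section
    composed with it; inverse images preserve covers.\<close>
  have "is_join C (P0 A k) (P1 A k j) ((\<lambda>s. scomp C A k i j s r) ` T) (scomp C A k i j h' r)"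
  proof (rule is_join_coverI)
    fix s assume s: "s \<in> T"
    note pr = pull_section[OF _ tgt(4)[OF r(2) ij(1)], of "sor A i j"]
    have le: "h' \<cdot> Rst C s = s" using le_D[OF is_join_upper[OF J' s]] .
    have pb: "has_pb C (sor A i j) (tgt A k i)" using r ij by simp
    have P: "pull_section C (sor A i j) (tgt A k i) s
        = pull_section C (sor A i j) (tgt A k i) h' \<cdot> Rst C (Rst C s \<cdot> tgt A k i)"
      using pull_RI[OF pb _ _ h'(2), of "Rst C s"] le TD[OF s] r ij by simp
    have "scomp C A k i j s r = scomp C A k i j h' r \<cdot> Rst C (s \<cdot> ?x)"
      unfolding cs(4)[OF s] ch(4) P
      using TD[OF s] pr[OF pb h'(2)] rD r ij pb Rst_slide[of r "Rst C s \<cdot> tgt A k i"] by simp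
    then show "le C (scomp C A k i j s r) (scomp C A k i j h' r)" 
      using cs(2)[OF s] by (intro le_I) simp
    show "scomp C A k i j s r \<in> Hom C (P0 A k) (P1 A k j)" using csD[OF s] by (auto simp: Hom_iff)
  next
    show "scomp C A k i j h' r \<in> Hom C (P0 A k) (P1 A k j)" using chD by (auto simp: Hom_iff)
    have "cover C (P0 A i) T (\<lambda>s. Rst C s) (Rst C h')" using is_join_cover[of "P0 A i" "P1 A i j" "\<lambda>s. s" T h'] J' by simp
    from cover_precomp[OF this x(1,3)]
    show "cover C (P0 A k) T (\<lambda>s. Rst C (scomp C A k i j s r)) (Rst C (scomp C A k i j h' r))"
      using x TD hD cs(2) ch(2) by (auto elim!: cover_cong)
  qed
  then have "is_join (Phi_cat C A) k j ((\<lambda>s. (k, j, s)) ` (\<lambda>s. scomp C A k i j s r) ` T) (k, j, scomp C A k i j h' r)"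
    using is_join_Phi[OF r(2) ij(2), of "(\<lambda>s. scomp C A k i j s r) ` T"] cs ch by blast
  moreover have "(\<lambda>f. f \<cdot>\<^bsub>Phi_cat C A\<^esub> g) ` S = (\<lambda>s. (k, j, s)) ` (\<lambda>s. scomp C A k i j s r) ` T"
    unfolding ST r by (simp add: image_image)
  ultimately show "is_join (Phi_cat C A) k j ((\<lambda>f. f \<cdot>\<^bsub>Phi_cat C A\<^esub> g) ` S) (h \<cdot>\<^bsub>Phi_cat C A\<^esub> g)"
    using h' r by simp
qed

lemma RI_Phi: "i \<in> Cpt A \<Longrightarrow> RI (Phi_cat C A) i = (\<lambda>e. (i, i, unt A i \<cdot> e)) ` RI C (P0 A i)"
proof (intro set_eqI iffI)
  fix f assume i: "i \<in> Cpt A" and "f \<in> RI (Phi_cat C A) i"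
  then obtain s where s: "f = (i, i, s)" "sec i i s" "unt A i \<cdot> Rst C s = s" by (auto simp: RI_def Phi_Hom)
  then show "f \<in> (\<lambda>e. (i, i, unt A i \<cdot> e)) ` RI C (P0 A i)"
    using sec_D[OF i i s(2)] by (intro image_eqI[of _ _ "Rst C s"]) auto
next
  fix f assume i: "i \<in> Cpt A" and "f \<in> (\<lambda>e. (i, i, unt A i \<cdot> e)) ` RI C (P0 A i)"
  then show "f \<in> RI (Phi_cat C A) i" by (auto simp: RI_def[of "Phi_cat C A"] Phi_Hom sec_unt Rst_unt)
qed

lemma restriction_functor_Phi_proj: "restriction_functor (Phi_cat C A) C (Phi_proj C A)"
  unfolding restriction_functor_def
proof (intro conjI is_functorI ballI)
  fix f assume "f \<in> Arr (Phi_cat C A)"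
  then obtain i j s where f: "f = (i, j, s)" "i \<in> Cpt A" "j \<in> Cpt A" "sec i j s" by (cases f) auto
  note sD = sec_D[OF f(2-4)]
  show "far (Phi_proj C A) f \<in> Hom C (fob (Phi_proj C A) (Dom (Phi_cat C A) f)) (fob (Phi_proj C A) (Cod (Phi_cat C A) f))"
    using f sD by (simp add: Hom_iff)
  show "far (Phi_proj C A) (Rst (Phi_cat C A) f) = Rst C (far (Phi_proj C A) f)"
    using f sD by (simp add: Rst_total_Cmp)
  fix g assume "g \<in> Arr (Phi_cat C A)" "Dom (Phi_cat C A) g = Cod (Phi_cat C A) f"
  then obtain k t where g: "g = (j, k, t)" "k \<in> Cpt A" "sec j k t" using f by (cases g) auto
  show "far (Phi_proj C A) (g \<cdot>\<^bsub>Phi_cat C A\<^esub> f) = far (Phi_proj C A) g \<cdot> far (Phi_proj C A) f"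
    using f g sD sec_D[OF f(3) g(2,3)] by (simp add: tgt_scomp)
qed auto

text \<open>The target map cancels \<open>unt\<close>, which inverts the description of the
  idempotents in \<open>RI_Phi\<close>.\<close>

lemma hyperconnected_Phi_proj: "hyperconnected (Phi_cat C A) C (Phi_proj C A)"
  unfolding hyperconnected_def
proof
  fix i assume "i \<in> Obj (Phi_cat C A)"
  then have i: "i \<in> Cpt A" by simp
  have 1: "far (Phi_proj C A) (i, i, unt A i \<cdot> e) = e" if "e \<in> RI C (P0 A i)" for e
    using RI_D[OF that] i by simp
  show "bij_betw (far (Phi_proj C A)) (RI (Phi_cat C A) i) (RI C (fob (Phi_proj C A) i))"
    unfolding RI_Phi[OF i] bij_betw_def
  proof
    show "inj_on (far (Phi_proj C A)) ((\<lambda>e. (i, i, unt A i \<cdot> e)) ` RI C (P0 A i))"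
      by (rule inj_onI) (use 1 in auto)
    show "far (Phi_proj C A) ` (\<lambda>e. (i, i, unt A i \<cdot> e)) ` RI C (P0 A i) = RI C (fob (Phi_proj C A) i)"
      unfolding image_image using 1 by simp
  qed
qed

lemma is_jr_obj_Phi:
  assumes "locally_small K C" "Cpt A \<prec> K"
  shows "is_jr_obj K C (Phi_obj C A)"
proof -
  have "Hom (Phi_cat C A) i j \<prec> K" if "i \<in> Cpt A" "j \<in> Cpt A" for i j
  proof -
    have "Hom (Phi_cat C A) i j \<lesssim> Hom C (P0 A i) (P1 A i j)"
      unfolding lepoll_def
      by (rule exI[of _ "\<lambda>f. snd (snd f)"]) (use sec_D[OF that] in \<open>auto simp: inj_on_def Phi_Hom Hom_iff\<close>)
    moreover have "Hom C (P0 A i) (P1 A i j) \<prec> K" using assms that by (simp add: locally_small_def)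
    ultimately show ?thesis by (rule lesspoll_trans1)
  qed
  then show ?thesis
    using assms join_restriction_category_Phi restriction_functor_Phi_proj hyperconnected_Phi_proj
    by (simp add: is_jr_obj_def Phi_obj_def locally_small_def)
qed

end

section \<open>Partite morphisms on partial sections\<close>

context join_restriction_category
begin

text \<open>By \<open>etale_pull\<close>, pulling back the sections of a presentation gives a
  presentation of the second projection.\<close>

lemma pull_ext:
  assumes p: "local_homeo C p" and pb: "has_pb C p f" and f: "total C f"
    and h: "h \<in> Arr C" "h' \<in> Arr C" "Dom C h = pbo C p f" "Dom C h' = pbo C p f" "Cod C h = Cod C h'"
    and eq: "\<And>s. partial_section C p s \<Longrightarrow> h \<cdot> pull_section C p f s = h' \<cdot> pull_section C p f s"
  shows "h = h'"
proof -
  obtain I s where e: "etale C p I (\<lambda>q. q) s" using local_homeo_etale[OF p] by blast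
  show ?thesis
    by (rule etale_ext[OF etale_pull[OF e pb f]]) (use h pb_D[OF pb] eq etale_section[OF e] in auto)
qed

text \<open>The family is indexed by all partial sections instead of a chosen presentation, so its
  compatibility takes the form of naturality under restriction. The overlap condition follows
  because \<open>s i\<close> and \<open>s j\<close> coincide on their transition idempotent.\<close>

lemma pull_glue:
  assumes p: "local_homeo C p" and pb: "has_pb C p f" and f: "total C f" and Z: "Z \<in> Obj C"
    and \<phi>: "\<And>s. partial_section C p s \<Longrightarrow> \<phi> s \<in> Hom C (Dom C f) Z"
    and \<phi>e: "\<And>s e. \<lbrakk>partial_section C p s; e \<in> RI C (Cod C p)\<rbrakk> \<Longrightarrow> \<phi> (s \<cdot> e) = \<phi> s \<cdot> Rst C (e \<cdot> f)"
  shows "\<exists>h \<in> Hom C (pbo C p f) Z. \<forall>s. partial_section C p s \<longrightarrow> h \<cdot> pull_section C p f s = \<phi> s"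
proof -
  obtain I s where e: "etale C p I (\<lambda>q. q) s" using local_homeo_etale[OF p] by blast
  let ?P = "pull_section C p f" and ?b = "pr2 C p f" and ?a = "pr1 C p f"
  note ep = etale_pull[OF e pb f]
  note D = etale_D[OF e] and B = pb_D[OF pb] and tot = pb_total[OF pb D(1) f]
  have \<phi>D: "\<phi> t \<in> Arr C" "Dom C (\<phi> t) = Dom C f" "Cod C (\<phi> t) = Z" if "partial_section C p t" for t
    using \<phi>[OF that] by (auto simp: Hom_iff)
  have PD: "?P t \<in> Arr C" "Dom C (?P t) = Dom C f" "Cod C (?P t) = pbo C p f" "Rst C (?P t) = Rst C (t \<cdot> f)"
    "?b \<cdot> ?P t = Rst C (t \<cdot> f)" "?a \<cdot> ?P t = t \<cdot> f" if "partial_section C p t" for t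
    using pull_section[OF pb f that] Rst_pull[OF pb D(1) f that] by auto
  have \<phi>R: "\<phi> t \<cdot> Rst C (t \<cdot> f) = \<phi> t" if t: "partial_section C p t" for t
  proof -
    have "Rst C t \<in> RI C (Cod C p)" using psec_D[OF t B(1)] by simp
    then have "\<phi> (t \<cdot> Rst C t) = \<phi> t \<cdot> Rst C (Rst C t \<cdot> f)" by (rule \<phi>e[OF t])
    then show ?thesis using psec_D[OF t B(1)] B by simp
  qed
  have "\<exists>h \<in> Hom C (Dom C ?b) Z. \<forall>i \<in> I. h \<cdot> ?P (s i) = \<phi> (s i)"
  proof (rule etale_glue[OF ep Z])
    show "\<phi> (s i) \<in> Hom C (Cod C ?b) Z" if "i \<in> I" for i
      using \<phi>[OF etale_section[OF e that]] B by simp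
    show "\<phi> (s i) \<cdot> Rst C (?P (s i)) = \<phi> (s i)" if "i \<in> I" for i
      using etale_section[OF e that] PD \<phi>R by simp
    fix i j assume ij: "i \<in> I" "j \<in> I"
    note si = etale_section[OF e ij(1)] and sj = etale_section[OF e ij(2)]
    note x = etale_at_section[OF e si ij(2)]
    \<comment> \<open>Charts are indexed by themselves, so \<open>j\<close> is a chart. The
      transition idempotent of the pulled-back presentation is the inverse image along
      \<open>f\<close> of \<open>j \<cdot> s i\<close>.\<close>
    have "?b \<cdot> Rst C (j \<cdot> ?a) \<cdot> ?P (s i) = ?b \<cdot> (?P (s i) \<cdot> Rst C (j \<cdot> s i \<cdot> f))"
      using Rst_slide[of "?P (s i)" "j \<cdot> ?a"] PD[OF si] B D(3-8) ij by simp
    also have "\<dots> = Rst C (s i \<cdot> f) \<cdot> Rst C (j \<cdot> (s i \<cdot> f))"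
      using PD[OF si] B D(3-8) ij by (simp add: under[OF PD(5)[OF si]])
    also have "\<dots> = Rst C (j \<cdot> s i \<cdot> f)"
      using Rst_Cmp_le'[of "s i \<cdot> f" j] B D(3-8) ij by simp
    finally have q: "?b \<cdot> Rst C (j \<cdot> ?a) \<cdot> ?P (s i) = Rst C (j \<cdot> s i \<cdot> f)" .
    show "\<phi> (s i) \<cdot> (?b \<cdot> Rst C (j \<cdot> ?a) \<cdot> ?P (s i)) = \<phi> (s j) \<cdot> (?b \<cdot> Rst C (j \<cdot> ?a) \<cdot> ?P (s i))"
      unfolding q \<phi>e[OF si x(2), symmetric] \<phi>e[OF sj x(2), symmetric] x(3) ..
  qed
  then obtain h where h: "h \<in> Arr C" "Dom C h = pbo C p f" "Cod C h = Z" "\<And>i. i \<in> I \<Longrightarrow> h \<cdot> ?P (s i) = \<phi> (s i)"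
    using B by (auto simp: Hom_iff)
  \<comment> \<open>The glued map was prescribed on the sections of the presentation. For an
    arbitrary \<open>t\<close> the claim is checked on the cover of its domain by the regions where
    \<open>t\<close> equals some \<open>s i\<close>.\<close>
  have "h \<cdot> ?P t = \<phi> t" if t: "partial_section C p t" for t
  proof -
    note tD = psec_D[OF t B(1)] 
    have "cover C (Dom C f) I (\<lambda>i. Rst C (i \<cdot> t \<cdot> f)) (Rst C (Rst C t \<cdot> f))"
      by (rule cover_precomp[OF etale_cover_section[OF e t]]) (use B in auto)
    then have "h \<cdot> ?P t \<cdot> Rst C (Rst C t \<cdot> f) = \<phi> t \<cdot> Rst C (Rst C t \<cdot> f)"
    proof (rule cover_ext)
      fix i assume i: "i \<in> I"
      note si = etale_section[OF e i]
      note x = etale_at_section[OF e t i]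
      have R: "Rst C (i \<cdot> t \<cdot> f) \<in> Arr C" "Cod C (Rst C (i \<cdot> t \<cdot> f)) = Dom C f" using D(3-8) i tD B by simp_all
      have "h \<cdot> ?P t \<cdot> Rst C (i \<cdot> t \<cdot> f) = h \<cdot> ?P (t \<cdot> (i \<cdot> t))"
        using pull_RI[OF pb D(1) f t x(2)] h(1-3) PD[OF t] R by simp
      also have "\<dots> = h \<cdot> (?P (s i) \<cdot> Rst C (i \<cdot> t \<cdot> f))"
        unfolding x(3)[symmetric] pull_RI[OF pb D(1) f si x(2)] ..
      also have "\<dots> = \<phi> (s i) \<cdot> Rst C (i \<cdot> t \<cdot> f)" 
        using under[OF h(4)[OF i] R(1)] PD[OF si] R(2) h(1-3) by simp
      also have "\<dots> = \<phi> (t \<cdot> (i \<cdot> t))" unfolding x(3)[symmetric] \<phi>e[OF si x(2)] ..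
      also have "\<dots> = \<phi> t \<cdot> Rst C (i \<cdot> t \<cdot> f)" by (rule \<phi>e[OF t x(2)])
      finally show "h \<cdot> ?P t \<cdot> Rst C (i \<cdot> t \<cdot> f) = \<phi> t \<cdot> Rst C (i \<cdot> t \<cdot> f)" .
    qed (use h(1-3) PD[OF t] \<phi>D[OF t] in auto)
    moreover have "Rst C (Rst C t \<cdot> f) = Rst C (t \<cdot> f)" using tD B by simp
    moreover have "?P t \<cdot> Rst C (t \<cdot> f) = ?P t" using PD[OF t] Cmp_Rst_self by metis
    ultimately show ?thesis using \<phi>R[OF t] h(1-3) PD[OF t] tD B by simp
  qed
  then show ?thesis using h by (intro bexI[of _ h]) (auto simp: Hom_iff)
qed

end

text \<open>The arrow part of \<open>Phi_mor\<close> without tags.\<close>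

definition sact :: "('o,'m) rcat \<Rightarrow> ('i,'o,'m) pmor \<Rightarrow> 'i \<Rightarrow> 'i \<Rightarrow> 'm \<Rightarrow> 'm" where
  "sact C F i j s = on1 F i j \<cdot>\<^bsub>C\<^esub> pull_section C (sor (Src F) i j) (on0 F i) s"

text \<open>Records the typing of the data alone: candidates for cofunctors are built at this level,
  and their laws are obtained afterwards from the action on sections.\<close>

definition typed_pmor :: "('o,'m) rcat \<Rightarrow> ('i,'o,'m) pmor \<Rightarrow> bool" where
  "typed_pmor C F \<longleftrightarrow> pmor_extensional F \<and>
     (\<forall>i \<in> Cpt (Src F). onC F i \<in> Cpt (Trg F) \<and> on0 F i \<in> Hom C (P0 (Trg F) (onC F i)) (P0 (Src F) i) \<and> total C (on0 F i)) \<and>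
     (\<forall>i \<in> Cpt (Src F). \<forall>j \<in> Cpt (Src F).
        on1 F i j \<in> Hom C (pbo C (sor (Src F) i j) (on0 F i)) (P1 (Trg F) (onC F i) (onC F j)))"

locale pcat_pair = A: etale_pcat C A + B: etale_pcat C B
  for C :: "('o,'m) rcat" (structure) and A B :: "('i,'o,'m) pcat"

locale pmor = pcat_pair +
  fixes F
  assumes typed_pmor: "typed_pmor C F" and Src [simp]: "Src F = A" and Trg [simp]: "Trg F = B"
begin

lemma onC [simp]: "i \<in> Cpt A \<Longrightarrow> onC F i \<in> Cpt B"
  using typed_pmor by (simp add: typed_pmor_def)

lemma on0 [simp]: assumes "i \<in> Cpt A"
  shows "on0 F i \<in> Arr C" "Dom C (on0 F i) = P0 B (onC F i)" "Cod C (on0 F i) = P0 A i" "total C (on0 F i)"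
  using typed_pmor assms by (auto simp: typed_pmor_def A.Hom_iff)

lemma on1 [simp]: assumes "i \<in> Cpt A" "j \<in> Cpt A"
  shows "on1 F i j \<in> Arr C" "Dom C (on1 F i j) = pbo C (sor A i j) (on0 F i)" "Cod C (on1 F i j) = P1 B (onC F i) (onC F j)"
  using typed_pmor assms by (auto simp: typed_pmor_def A.Hom_iff)

lemma on0_pb [simp]: "\<lbrakk>i \<in> Cpt A; j \<in> Cpt A\<rbrakk> \<Longrightarrow> has_pb C (sor A i j) (on0 F i)"
  by (rule A.sor_pb) auto

lemma pull: assumes "i \<in> Cpt A" "j \<in> Cpt A" "A.sec i j s"
  shows "pull_section C (sor A i j) (on0 F i) s \<in> Arr C" "Dom C (pull_section C (sor A i j) (on0 F i) s) = P0 B (onC F i)"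
    "Cod C (pull_section C (sor A i j) (on0 F i) s) = pbo C (sor A i j) (on0 F i)"
    "pr1 C (sor A i j) (on0 F i) \<cdot> pull_section C (sor A i j) (on0 F i) s = s \<cdot> on0 F i"
    "pr2 C (sor A i j) (on0 F i) \<cdot> pull_section C (sor A i j) (on0 F i) s = Rst C (s \<cdot> on0 F i)"
    "Rst C (pull_section C (sor A i j) (on0 F i) s) = Rst C (s \<cdot> on0 F i)"
  using A.pull_section[of "sor A i j" "on0 F i" s] A.Rst_pull[of "sor A i j" "on0 F i" s] assms by auto

lemma sact_Arr: assumes "i \<in> Cpt A" "j \<in> Cpt A" "A.sec i j s"
  shows "sact C F i j s \<in> Arr C" "Dom C (sact C F i j s) = P0 B (onC F i)" "Cod C (sact C F i j s) = P1 B (onC F i) (onC F j)"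
  using pull[OF assms] assms by (auto simp: sact_def)

lemma sact_RI: assumes "i \<in> Cpt A" "j \<in> Cpt A" "A.sec i j s" "e \<in> RI C (P0 A i)"
  shows "sact C F i j (s \<cdot> e) = sact C F i j s \<cdot> Rst C (e \<cdot> on0 F i)"
  using A.pull_RI[of "sor A i j" "on0 F i" s e] pull[OF assms(1-3)] assms A.RI_D[OF assms(4)] by (simp add: sact_def)

lemma on1_ext:
  assumes "i \<in> Cpt A" "j \<in> Cpt A" "h \<in> Arr C" "h' \<in> Arr C" "Dom C h = pbo C (sor A i j) (on0 F i)"
    "Dom C h' = pbo C (sor A i j) (on0 F i)" "Cod C h = Cod C h'"
    "\<And>s. A.sec i j s \<Longrightarrow> h \<cdot> pull_section C (sor A i j) (on0 F i) s = h' \<cdot> pull_section C (sor A i j) (on0 F i) s"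
  shows "h = h'"
  by (rule A.pull_ext[of "sor A i j" "on0 F i"]) (use assms in auto)

end

locale pmor_st = pmor +
  assumes sor_on1: "\<lbrakk>i \<in> Cpt A; j \<in> Cpt A\<rbrakk> \<Longrightarrow> sor B (onC F i) (onC F j) \<cdot> on1 F i j = pr2 C (sor A i j) (on0 F i)"
    and tgt_on1: "\<lbrakk>i \<in> Cpt A; j \<in> Cpt A\<rbrakk> \<Longrightarrow>
      on0 F j \<cdot> (tgt B (onC F i) (onC F j) \<cdot> on1 F i j) = tgt A i j \<cdot> pr1 C (sor A i j) (on0 F i)"
begin

text \<open>Postcomposition with the total source map does not change the domain of definition, and
  it produces a projection of a pullback of total maps.\<close>

lemma on1_total: assumes "i \<in> Cpt A" "j \<in> Cpt A" shows "total C (on1 F i j)"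
proof -
  have "Rst C (on1 F i j) = Rst C (pr2 C (sor A i j) (on0 F i))"
    using A.Rst_total_Cmp[of "sor B (onC F i) (onC F j)" "on1 F i j"] sor_on1[OF assms] assms by simp
  moreover have "total C (pr2 C (sor A i j) (on0 F i))" "Dom C (pr2 C (sor A i j) (on0 F i)) = pbo C (sor A i j) (on0 F i)"
    using A.pb_total[of "sor A i j" "on0 F i"] A.pb_D[of "sor A i j" "on0 F i"] assms by auto
  ultimately show ?thesis using assms by (simp add: total_def)
qed

lemma sact: assumes ij: "i \<in> Cpt A" "j \<in> Cpt A" and s: "A.sec i j s"
  shows sact_sec: "B.sec (onC F i) (onC F j) (sact C F i j s)"
    and Rst_sact: "Rst C (sact C F i j s) = Rst C (s \<cdot> on0 F i)"
    and tgt_sact: "on0 F j \<cdot> (tgt B (onC F i) (onC F j) \<cdot> sact C F i j s) = tgt A i j \<cdot> (s \<cdot> on0 F i)"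
proof -
  note P = pull[OF ij s] and sD = A.sec_D[OF ij s]
  have pb: "has_pb C (sor A i j) (on0 F i)" using ij by simp
  note Bd = A.pb_D[OF pb]
  show R: "Rst C (sact C F i j s) = Rst C (s \<cdot> on0 F i)"
    using A.Rst_total_Cmp[OF on1_total[OF ij], of "pull_section C (sor A i j) (on0 F i) s"] P ij by (simp add: sact_def)
  have "sor B (onC F i) (onC F j) \<cdot> sact C F i j s = Rst C (sact C F i j s)"
    unfolding R using P ij by (simp add: sact_def A.under[OF sor_on1])
  then show "B.sec (onC F i) (onC F j) (sact C F i j s)" using sact_Arr[OF ij s] ij by (intro B.secI) auto
  have "on0 F j \<cdot> (tgt B (onC F i) (onC F j) \<cdot> on1 F i j) \<cdot> pull_section C (sor A i j) (on0 F i) s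
     = tgt A i j \<cdot> pr1 C (sor A i j) (on0 F i) \<cdot> pull_section C (sor A i j) (on0 F i) s"
    unfolding tgt_on1[OF ij] ..
  then show "on0 F j \<cdot> (tgt B (onC F i) (onC F j) \<cdot> sact C F i j s) = tgt A i j \<cdot> (s \<cdot> on0 F i)"
    using P ij Bd by (simp add: sact_def)
qed

text \<open>The two sides of the composition law at the generalised element \<open>w t s\<close> of
  the triple pullback become the action on a composite and the composite of the actions. The
  composition law is not presupposed, so both implications between cofunctors and functors on
  sections can use this.\<close>

lemma law_at_sections:
  assumes I: "i \<in> Cpt A" "j \<in> Cpt A" "k \<in> Cpt A"
  defines "c \<equiv> onC F"
  defines "p1 \<equiv> pr1 C (sor A i j) (on0 F i)" and "p2 \<equiv> pr2 C (sor A i j) (on0 F i)"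
  defines "q1 \<equiv> pr1 C (sor A j k) (tgt A i j \<cdot> p1)" and "q2 \<equiv> pr2 C (sor A j k) (tgt A i j \<cdot> p1)"
  defines "mul_one \<equiv> pairing C (sor A i k) (on0 F i)
              (mul A i j k \<cdot> pairing C (sor A j k) (tgt A i j) q1 (p1 \<cdot> q2)) (p2 \<cdot> q2)"
  defines "\<rho> \<equiv> on0 F j \<cdot> tgt B (c i) (c j)"
  defines "one_F \<equiv> pairing C (sor A j k) \<rho> q1 (on1 F i j \<cdot> q2)"
  defines "r1 \<equiv> pr1 C (sor A j k) \<rho>" and "r2 \<equiv> pr2 C (sor A j k) \<rho>"
  defines "F_one \<equiv> pairing C (sor B (c j) (c k)) (tgt B (c i) (c j))
              (on1 F j k \<cdot> pairing C (sor A j k) (on0 F j) r1 (tgt B (c i) (c j) \<cdot> r2)) r2"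
  defines "w \<equiv> \<lambda>t s. pull_section C (sor A j k) (tgt A i j \<cdot> p1) t \<cdot> pull_section C (sor A i j) (on0 F i) s"
  shows "mul_one \<in> Hom C (pbo C (sor A j k) (tgt A i j \<cdot> p1)) (pbo C (sor A i k) (on0 F i))"
    and "F_one \<cdot> one_F \<in> Hom C (pbo C (sor A j k) (tgt A i j \<cdot> p1)) (pbo C (sor B (c j) (c k)) (tgt B (c i) (c j)))"
    and "\<And>s t. \<lbrakk>A.sec i j s; A.sec j k t\<rbrakk> \<Longrightarrow> on1 F i k \<cdot> (mul_one \<cdot> w t s) = sact C F i k (scomp C A i j k t s)"
    and "\<And>s t. \<lbrakk>A.sec i j s; A.sec j k t\<rbrakk> \<Longrightarrow>
      mul B (c i) (c j) (c k) \<cdot> (F_one \<cdot> one_F \<cdot> w t s) = scomp C B (c i) (c j) (c k) (sact C F j k t) (sact C F i j s)"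
    and "\<And>s t. \<lbrakk>A.sec i j s; A.sec j k t\<rbrakk> \<Longrightarrow> w t s \<in> Arr C \<and> Cod C (w t s) = pbo C (sor A j k) (tgt A i j \<cdot> p1)"
    and "total C (tgt A i j \<cdot> p1)" and "has_pb C (sor A j k) (tgt A i j \<cdot> p1)" and "Dom C (tgt A i j \<cdot> p1) = pbo C (sor A i j) (on0 F i)"
proof -
  have J: "c i \<in> Cpt B" "c j \<in> Cpt B" "c k \<in> Cpt B" using I by (simp_all add: c_def)
  have pb1: "has_pb C (sor A i j) (on0 F i)" using I by simp
  note B1 = A.pb_D[OF pb1, folded p1_def p2_def] and tp = A.pb_total[OF pb1, folded p1_def p2_def]
  let ?f = "tgt A i j \<cdot> p1"
  show tf: "total C ?f" using A.total_Cmp tp I B1 by simp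
  have fD: "?f \<in> Arr C" "Dom C ?f = pbo C (sor A i j) (on0 F i)" "Cod C ?f = P0 A j" using I B1 by (simp_all add: p1_def)
  show pb2: "has_pb C (sor A j k) ?f" by (rule A.sor_pb) (use I tf fD in auto)
  show "Dom C ?f = pbo C (sor A i j) (on0 F i)" by (rule fD)
  note B2 = A.pb_D[OF pb2, folded q1_def q2_def] and sq2 = A.pb_square[OF pb2, folded q1_def q2_def]
  have d1: "Dom C p1 = pbo C (sor A i j) (on0 F i)" "Dom C q1 = pbo C (sor A j k) ?f" by (simp_all add: p1_def q1_def)
  have pbjk: "has_pb C (sor A j k) (tgt A i j)" and pbik: "has_pb C (sor A i k) (on0 F i)" using I by simp_all
  note Bjk = A.pb_D[OF pbjk] and Bik = A.pb_D[OF pbik]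
  let ?x = "pairing C (sor A j k) (tgt A i j) q1 (p1 \<cdot> q2)"
  have xx: "sor A j k \<cdot> q1 = tgt A i j \<cdot> (p1 \<cdot> q2)" using B2 B1 I d1 by simp
  have X: "?x \<in> Arr C" "Dom C ?x = pbo C (sor A j k) ?f" "Cod C ?x = pbo C (sor A j k) (tgt A i j)"
    "pr1 C (sor A j k) (tgt A i j) \<cdot> ?x = q1" "pr2 C (sor A j k) (tgt A i j) \<cdot> ?x = p1 \<cdot> q2"
    using A.pairing[OF pbjk _ _ _ _ _ xx] I B1 B2 d1 by simp_all
  have mm: "sor A i k \<cdot> (mul A i j k \<cdot> ?x) = on0 F i \<cdot> (p2 \<cdot> q2)"
    using X B1 B2 Bjk I d1 A.pb_square[OF pb1, folded p1_def p2_def, of q2] by (simp add: A.under2[OF A.mul_sor_tgt(1)])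
  have MO: "mul_one \<in> Arr C" "Dom C mul_one = pbo C (sor A j k) ?f" "Cod C mul_one = pbo C (sor A i k) (on0 F i)"
    "pr1 C (sor A i k) (on0 F i) \<cdot> mul_one = mul A i j k \<cdot> ?x" "pr2 C (sor A i k) (on0 F i) \<cdot> mul_one = p2 \<cdot> q2"
    unfolding mul_one_def
    using A.pairing[OF pbik _ _ _ _ _ mm] I X B1 B2 d1 by simp_all
  then show "mul_one \<in> Hom C (pbo C (sor A j k) (tgt A i j \<cdot> p1)) (pbo C (sor A i k) (on0 F i))" by (simp add: A.Hom_iff)
  have \<rho>: "total C \<rho>" "\<rho> \<in> Arr C" "Dom C \<rho> = P1 B (c i) (c j)" "Cod C \<rho> = P0 A j"
    using I J A.total_Cmp[of "on0 F j" "tgt B (c i) (c j)"] by (simp_all add: \<rho>_def c_def)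
  have pb\<rho>: "has_pb C (sor A j k) \<rho>" by (rule A.sor_pb) (use I \<rho> in auto)
  note B\<rho> = A.pb_D[OF pb\<rho>, folded r1_def r2_def]
  have dr: "Dom C r1 = pbo C (sor A j k) \<rho>" by (simp add: r1_def)
  have oo: "sor A j k \<cdot> q1 = \<rho> \<cdot> (on1 F i j \<cdot> q2)"
  proof -
    have "\<rho> \<cdot> (on1 F i j \<cdot> q2) = on0 F j \<cdot> (tgt B (c i) (c j) \<cdot> on1 F i j) \<cdot> q2"
      using I J B2 fD by (simp add: \<rho>_def c_def)
    also have "\<dots> = ?f \<cdot> q2" unfolding c_def tgt_on1[OF I(1,2)] p1_def ..
    finally show ?thesis using B2 by simp
  qed
  have OF: "one_F \<in> Arr C" "Dom C one_F = pbo C (sor A j k) ?f" "Cod C one_F = pbo C (sor A j k) \<rho>"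
    "r1 \<cdot> one_F = q1" "r2 \<cdot> one_F = on1 F i j \<cdot> q2"
    unfolding one_F_def r1_def r2_def
    using A.pairing[OF pb\<rho> _ _ _ _ _ oo] I J B2 d1 fD \<rho> by (simp_all add: c_def)
  have pbj: "has_pb C (sor A j k) (on0 F j)" using I by simp
  note Bj = A.pb_D[OF pbj]
  let ?z = "pairing C (sor A j k) (on0 F j) r1 (tgt B (c i) (c j) \<cdot> r2)"
  have zz: "sor A j k \<cdot> r1 = on0 F j \<cdot> (tgt B (c i) (c j) \<cdot> r2)"
    using B\<rho> I J \<rho> by (simp add: \<rho>_def c_def)
  have Zz: "?z \<in> Arr C" "Dom C ?z = pbo C (sor A j k) \<rho>" "Cod C ?z = pbo C (sor A j k) (on0 F j)"
    "pr1 C (sor A j k) (on0 F j) \<cdot> ?z = r1" "pr2 C (sor A j k) (on0 F j) \<cdot> ?z = tgt B (c i) (c j) \<cdot> r2"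
    using A.pairing[OF pbj _ _ _ _ _ zz] I J B\<rho> \<rho> dr by (simp_all add: c_def)
  have pbB: "has_pb C (sor B (c j) (c k)) (tgt B (c i) (c j))" using J by simp
  note BB = A.pb_D[OF pbB]
  have ff: "sor B (c j) (c k) \<cdot> (on1 F j k \<cdot> ?z) = tgt B (c i) (c j) \<cdot> r2"
    using Zz I J by (simp add: A.under[OF sor_on1[OF I(2,3)]] c_def)
  have FO: "F_one \<in> Arr C" "Dom C F_one = pbo C (sor A j k) \<rho>" "Cod C F_one = pbo C (sor B (c j) (c k)) (tgt B (c i) (c j))"
    "pr1 C (sor B (c j) (c k)) (tgt B (c i) (c j)) \<cdot> F_one = on1 F j k \<cdot> ?z"
    "pr2 C (sor B (c j) (c k)) (tgt B (c i) (c j)) \<cdot> F_one = r2"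
    unfolding F_one_def
    using A.pairing[OF pbB _ _ _ _ _ ff] I J Zz B\<rho> \<rho> dr by (simp_all add: c_def)
  show "F_one \<cdot> one_F \<in> Hom C (pbo C (sor A j k) (tgt A i j \<cdot> p1)) (pbo C (sor B (c j) (c k)) (tgt B (c i) (c j)))"
    using FO OF by (simp add: A.Hom_iff)
  fix s t assume s: "A.sec i j s" and t: "A.sec j k t"
  note sD = A.sec_D[OF I(1,2) s] and tD = A.sec_D[OF I(2,3) t]
  note S = A.scomp[OF I s t] and SD = A.sec_D[OF I(1,3) A.scomp_sec[OF I s t]]
  let ?y = "pull_section C (sor A i j) (on0 F i) s" and ?t = "pull_section C (sor A j k) ?f t"
  note Y = pull[OF I(1,2) s, folded p1_def p2_def]
  have T: "?t \<in> Arr C" "Dom C ?t = pbo C (sor A i j) (on0 F i)" "Cod C ?t = pbo C (sor A j k) ?f"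
    using A.pull_section[OF pb2 tf t] fD by auto
  have w: "w t s = ?t \<cdot> ?y" by (simp add: w_def)
  have W: "w t s \<in> Arr C" "Dom C (w t s) = P0 B (c i)" "Cod C (w t s) = pbo C (sor A j k) ?f" 
    unfolding w c_def using T Y by simp_all
  then show "w t s \<in> Arr C \<and> Cod C (w t s) = pbo C (sor A j k) (tgt A i j \<cdot> p1)" by simp
  let ?r = "t \<cdot> (tgt A i j \<cdot> (s \<cdot> on0 F i))"
  have r: "?r \<in> Arr C" "Dom C ?r = P0 B (c i)" "Cod C ?r = P1 A j k" using tD sD I by (simp_all add: c_def)
  have W1: "q1 \<cdot> w t s = ?r" and W2: "q2 \<cdot> w t s = ?y \<cdot> Rst C ?r"
    using A.pull_Cmp[OF pb2 tf t, of ?y] Y B1 I fD unfolding w q1_def q2_def by simp_all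
  have W3: "p1 \<cdot> (?y \<cdot> Rst C ?r) = s \<cdot> (on0 F i \<cdot> Rst C ?r)"
    using Y r I sD B1 d1 by (simp add: A.under[OF Y(4)] c_def)
  have Rr: "Rst C (s \<cdot> on0 F i) \<cdot> Rst C ?r = Rst C ?r"
    using A.Rst_Cmp_le'[of "s \<cdot> on0 F i" "t \<cdot> tgt A i j"] tD sD I by simp
  have W4: "p2 \<cdot> (?y \<cdot> Rst C ?r) = Rst C ?r"
    using Y r I sD B1 d1 Rr by (simp add: A.under[OF Y(5)] c_def)
  have xw: "mul A i j k \<cdot> (?x \<cdot> w t s) = scomp C A i j k t s \<cdot> on0 F i"
  proof -
    have "mul A i j k \<cdot> (?x \<cdot> w t s) = scomp C A i j k t (s \<cdot> on0 F i)"
    proof (rule A.mul_eq_scomp[OF I t])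
      show "pr1 C (sor A j k) (tgt A i j) \<cdot> (?x \<cdot> w t s) = t \<cdot> (tgt A i j \<cdot> (s \<cdot> on0 F i))"
        using X W W1 Bjk by (simp add: A.under[OF X(4)])
      show "pr2 C (sor A j k) (tgt A i j) \<cdot> (?x \<cdot> w t s) = s \<cdot> on0 F i \<cdot> Rst C ?r"
        using X W W2 W3 Bjk B1 B2 fD I sD r d1 by (simp add: A.under[OF X(5)] c_def)
    qed (use X W sD I in auto)
    also have "\<dots> = scomp C A i j k t s \<cdot> on0 F i"
      using A.pull_section[OF pbjk A.tgt(4)[OF I(1,2)] t] sD I by (simp add: scomp_def)
    finally show ?thesis .
  qed
  have "mul_one \<cdot> w t s = pull_section C (sor A i k) (on0 F i) (scomp C A i j k t s)"
  proof (rule A.pb_ext[OF pbik])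
    note Q = pull[OF I(1,3) S(1)]
    show "pr1 C (sor A i k) (on0 F i) \<cdot> (mul_one \<cdot> w t s) = pr1 C (sor A i k) (on0 F i) \<cdot> pull_section C (sor A i k) (on0 F i) (scomp C A i j k t s)"
      unfolding Q(4) using MO W X Bik xw I by (simp add: A.under[OF MO(4)])
    have "Rst C (scomp C A i j k t s \<cdot> on0 F i) = Rst C ?r"
      using A.Rst_Rst_Cmp[of "on0 F i" "scomp C A i j k t s"] S(2) SD
        A.Rst_Rst_Cmp[of "on0 F i" "t \<cdot> (tgt A i j \<cdot> s)"] tD sD I by simp
    then show "pr2 C (sor A i k) (on0 F i) \<cdot> (mul_one \<cdot> w t s) = pr2 C (sor A i k) (on0 F i) \<cdot> pull_section C (sor A i k) (on0 F i) (scomp C A i j k t s)"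
      unfolding Q(5) using MO W W2 W4 Bik B1 B2 fD by (simp add: A.under[OF MO(5)])
  qed (use MO W pull[OF I(1,3) S(1)] in auto)
  then show "on1 F i k \<cdot> (mul_one \<cdot> w t s) = sact C F i k (scomp C A i j k t s)" by (simp add: sact_def)
  let ?s = "sact C F i j s"
  note s' = sact_sec[OF I(1,2) s, folded c_def] and t' = sact_sec[OF I(2,3) t, folded c_def]
  note s'D = B.sec_D[OF J(1,2) s'] and t'D = B.sec_D[OF J(2,3) t']
  have o1: "r1 \<cdot> (one_F \<cdot> w t s) = ?r" using OF W W1 B\<rho> dr by (simp add: A.under[OF OF(4)])
  have o2: "r2 \<cdot> (one_F \<cdot> w t s) = ?s \<cdot> Rst C ?r"
    using OF W W2 B\<rho> B2 fD I Y r by (simp add: A.under[OF OF(5)] sact_def c_def)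
  have ts: "on0 F j \<cdot> (tgt B (c i) (c j) \<cdot> ?s) = tgt A i j \<cdot> (s \<cdot> on0 F i)"
    using tgt_sact[OF I(1,2) s] by (simp add: c_def)
  \<comment> \<open>The pairing inside \<open>F_one\<close>, at this element, is the section
    \<open>t\<close> pulled back along \<open>on0 F j\<close> and evaluated at the target of
    \<open>sact C F i j s\<close>.\<close>
  have zw: "on1 F j k \<cdot> (?z \<cdot> (one_F \<cdot> w t s)) = sact C F j k t \<cdot> (tgt B (c i) (c j) \<cdot> ?s)"
  proof -
    note Q = pull[OF I(2,3) t, folded c_def]
    have "pull_section C (sor A j k) (on0 F j) t \<cdot> (tgt B (c i) (c j) \<cdot> ?s) = ?z \<cdot> (one_F \<cdot> w t s)"
    proof (rule A.pull_Cmp_eqI[OF pbj on0(4)[OF I(2)] t])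
      show "pr1 C (sor A j k) (on0 F j) \<cdot> (?z \<cdot> (one_F \<cdot> w t s)) = t \<cdot> (on0 F j \<cdot> (tgt B (c i) (c j) \<cdot> ?s))"
        unfolding ts using Zz OF W o1 Bj by (simp add: A.under[OF Zz(4)])
      show "pr2 C (sor A j k) (on0 F j) \<cdot> (?z \<cdot> (one_F \<cdot> w t s)) = tgt B (c i) (c j) \<cdot> ?s \<cdot> Rst C (t \<cdot> (on0 F j \<cdot> (tgt B (c i) (c j) \<cdot> ?s)))"
        unfolding ts using Zz OF W o2 Bj B\<rho> \<rho> I J s'D r by (simp add: A.under[OF Zz(5)[unfolded c_def]] c_def)
    qed (use Zz OF W I J s'D in \<open>auto simp: c_def\<close>)
    then show ?thesis using Q I J s'D by (simp add: sact_def c_def)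
  qed
  have Rs: "Rst C (sact C F j k t \<cdot> (tgt B (c i) (c j) \<cdot> ?s)) = Rst C ?r"
  proof -
    have "Rst C (sact C F j k t \<cdot> (tgt B (c i) (c j) \<cdot> ?s)) = Rst C (Rst C (t \<cdot> on0 F j) \<cdot> (tgt B (c i) (c j) \<cdot> ?s))"
      unfolding Rst_sact[OF I(2,3) t, symmetric] using t'D s'D J by simp
    also have "\<dots> = Rst C (t \<cdot> (on0 F j \<cdot> (tgt B (c i) (c j) \<cdot> ?s)))"
      using tD s'D I J by (simp add: c_def)
    finally show ?thesis unfolding ts .
  qed
  show "mul B (c i) (c j) (c k) \<cdot> (F_one \<cdot> one_F \<cdot> w t s) = scomp C B (c i) (c j) (c k) (sact C F j k t) ?s"
  proof (rule B.mul_eq_scomp[OF J t'])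
    show "pr1 C (sor B (c j) (c k)) (tgt B (c i) (c j)) \<cdot> (F_one \<cdot> one_F \<cdot> w t s) = sact C F j k t \<cdot> (tgt B (c i) (c j) \<cdot> ?s)"
      using FO OF W BB Zz I zw by (simp add: A.under[OF FO(4)[unfolded c_def]] c_def)
    show "pr2 C (sor B (c j) (c k)) (tgt B (c i) (c j)) \<cdot> (F_one \<cdot> one_F \<cdot> w t s) = ?s \<cdot> Rst C (sact C F j k t \<cdot> (tgt B (c i) (c j) \<cdot> ?s))"
      unfolding Rs using FO OF W BB o2 by (simp add: A.under[OF FO(5)])
  qed (use FO OF W s'D in auto)
qed

end

text \<open>The middle term between \<open>cofunctor C F\<close> and
  \<open>is_jr_mor C (Phi_mor C F)\<close>: functoriality, the formula for domains and compatibility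
  with targets, all in terms of \<open>sact\<close>.\<close>

definition section_functor :: "('o,'m) rcat \<Rightarrow> ('i,'o,'m) pmor \<Rightarrow> bool" where
  "section_functor C F \<longleftrightarrow> (let A = Src F; B = Trg F; c = onC F in
     (\<forall>i \<in> Cpt A. \<forall>j \<in> Cpt A. \<forall>s. partial_section C (sor A i j) s \<longrightarrow>
        partial_section C (sor B (c i) (c j)) (sact C F i j s) \<and>
        Rst C (sact C F i j s) = Rst C (s \<cdot>\<^bsub>C\<^esub> on0 F i) \<and>
        on0 F j \<cdot>\<^bsub>C\<^esub> (tgt B (c i) (c j) \<cdot>\<^bsub>C\<^esub> sact C F i j s) = tgt A i j \<cdot>\<^bsub>C\<^esub> (s \<cdot>\<^bsub>C\<^esub> on0 F i)) \<and>
     (\<forall>i \<in> Cpt A. sact C F i i (unt A i) = unt B (c i)) \<and>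
     (\<forall>i \<in> Cpt A. \<forall>j \<in> Cpt A. \<forall>k \<in> Cpt A. \<forall>s t. partial_section C (sor A i j) s \<longrightarrow> partial_section C (sor A j k) t \<longrightarrow>
        sact C F i k (scomp C A i j k t s) = scomp C B (c i) (c j) (c k) (sact C F j k t) (sact C F i j s)))"

lemma Phi_mor_simps [simp]:
  "JSrc (Phi_mor C F) = Phi_obj C (Src F)" "JTrg (Phi_mor C F) = Phi_obj C (Trg F)"
  "fob (JF (Phi_mor C F)) = (\<lambda>i \<in> Cpt (Src F). onC F i)" "Jnt (Phi_mor C F) = (\<lambda>i \<in> Cpt (Src F). on0 F i)"
  "far (JF (Phi_mor C F)) \<in> extensional (Arr (Phi_cat C (Src F)))"
  "\<lbrakk>i \<in> Cpt (Src F); j \<in> Cpt (Src F); partial_section C (sor (Src F) i j) s\<rbrakk> \<Longrightarrow>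
     far (JF (Phi_mor C F)) (i, j, s) = (onC F i, onC F j, sact C F i j s)"
  by (auto simp: Phi_mor_def Let_def sact_def)

lemma Phi_obj_simps [simp]: "fst (Phi_obj C A) = Phi_cat C A" "snd (Phi_obj C A) = Phi_proj C A"
  by (auto simp: Phi_obj_def)

lemma is_jr_mor_alt: "is_jr_mor C h \<longleftrightarrow>
     restriction_functor (fst (JSrc h)) (fst (JTrg h)) (JF h) \<and>
     fob (JF h) \<in> extensional (Obj (fst (JSrc h))) \<and> far (JF h) \<in> extensional (Arr (fst (JSrc h))) \<and>
     nat_trans (fst (JSrc h)) C (fcomp (snd (JTrg h)) (JF h)) (snd (JSrc h)) (Jnt h) \<and>
     (\<forall>i \<in> Obj (fst (JSrc h)). total C (Jnt h i)) \<and> Jnt h \<in> extensional (Obj (fst (JSrc h)))"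
  by (simp add: is_jr_mor_def Let_def case_prod_unfold)

lemma fcomp_simps [simp]: "fob (fcomp G F) x = fob G (fob F x)" "far (fcomp G F) f = far G (far F f)"
  by (auto simp: fcomp_def)

lemma fid_simps [simp]: "fob fid x = x" "far fid f = f"
  by (auto simp: fid_def)

section \<open>Morphisms over the base between categories of partial sections\<close>

context pcat_pair
begin

text \<open>The last two facts carry the content. Preservation of restrictions forces the image of
  \<open>unt A i \<cdot> e\<close> to be a restricted unit, and naturality with the total component
  \<open>Jnt h i\<close> identifies the restriction as the inverse image of \<open>e\<close>. A
  general section restricted to \<open>e\<close> is its composite with
  \<open>unt A i \<cdot> e\<close>.\<close>

lemma jr_mor_sections:
  assumes h: "is_jr_mor C h" "JSrc h = Phi_obj C A" "JTrg h = Phi_obj C B"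
  defines "c \<equiv> fob (JF h)" and "\<phi> \<equiv> \<lambda>i j s. snd (snd (far (JF h) (i, j, s)))"
  shows "\<And>i. i \<in> Cpt A \<Longrightarrow> c i \<in> Cpt B"
    and "\<And>i. i \<in> Cpt A \<Longrightarrow> Jnt h i \<in> Hom C (P0 B (c i)) (P0 A i) \<and> total C (Jnt h i)"
    and "\<And>i j s. \<lbrakk>i \<in> Cpt A; j \<in> Cpt A; A.sec i j s\<rbrakk> \<Longrightarrow> far (JF h) (i, j, s) = (c i, c j, \<phi> i j s)"
    and "\<And>i j s. \<lbrakk>i \<in> Cpt A; j \<in> Cpt A; A.sec i j s\<rbrakk> \<Longrightarrow> B.sec (c i) (c j) (\<phi> i j s)"
    and "\<And>i. i \<in> Cpt A \<Longrightarrow> \<phi> i i (unt A i) = unt B (c i)"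
    and "\<And>i j k s t. \<lbrakk>i \<in> Cpt A; j \<in> Cpt A; k \<in> Cpt A; A.sec i j s; A.sec j k t\<rbrakk> \<Longrightarrow>
      \<phi> i k (scomp C A i j k t s) = scomp C B (c i) (c j) (c k) (\<phi> j k t) (\<phi> i j s)"
    and "\<And>i j s. \<lbrakk>i \<in> Cpt A; j \<in> Cpt A; A.sec i j s\<rbrakk> \<Longrightarrow>
      Jnt h j \<cdot> (tgt B (c i) (c j) \<cdot> \<phi> i j s) = tgt A i j \<cdot> (s \<cdot> Jnt h i)"
    and "\<And>i j s e. \<lbrakk>i \<in> Cpt A; j \<in> Cpt A; A.sec i j s; e \<in> RI C (P0 A i)\<rbrakk> \<Longrightarrow>
      \<phi> i j (s \<cdot> e) = \<phi> i j s \<cdot> Rst C (e \<cdot> Jnt h i)"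
    and "\<And>i j s. \<lbrakk>i \<in> Cpt A; j \<in> Cpt A; A.sec i j s\<rbrakk> \<Longrightarrow> Rst C (\<phi> i j s) = Rst C (s \<cdot> Jnt h i)"
proof -
  have rf: "is_functor (Phi_cat C A) (Phi_cat C B) (JF h)"
    and rr: "\<And>f. f \<in> Arr (Phi_cat C A) \<Longrightarrow> far (JF h) (Rst (Phi_cat C A) f) = Rst (Phi_cat C B) (far (JF h) f)"
    and nt: "nat_trans (Phi_cat C A) C (fcomp (Phi_proj C B) (JF h)) (Phi_proj C A) (Jnt h)"
    and tt: "\<And>i. i \<in> Cpt A \<Longrightarrow> total C (Jnt h i)"
    using h by (auto simp: is_jr_mor_alt restriction_functor_def)
  show c: "c i \<in> Cpt B" if "i \<in> Cpt A" for i using rf that by (simp add: is_functor_def c_def)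
  show J: "Jnt h i \<in> Hom C (P0 B (c i)) (P0 A i) \<and> total C (Jnt h i)" if "i \<in> Cpt A" for i
    using nt tt that by (simp add: nat_trans_def c_def)
  have FH: "far (JF h) (i, j, s) \<in> Hom (Phi_cat C B) (c i) (c j)" if "i \<in> Cpt A" "j \<in> Cpt A" "A.sec i j s" for i j s
  proof -
    have "(i, j, s) \<in> Arr (Phi_cat C A)" using that by simp
    then have "far (JF h) (i, j, s) \<in> Hom (Phi_cat C B) (fob (JF h) (Dom (Phi_cat C A) (i, j, s))) (fob (JF h) (Cod (Phi_cat C A) (i, j, s)))"
      using rf unfolding is_functor_def by blast
    then show ?thesis by (simp add: c_def)
  qed
  show far: "far (JF h) (i, j, s) = (c i, c j, \<phi> i j s)" if "i \<in> Cpt A" "j \<in> Cpt A" "A.sec i j s" for i j s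
    using FH[OF that] by (auto simp: Phi_Hom \<phi>_def)
  show sec: "B.sec (c i) (c j) (\<phi> i j s)" if "i \<in> Cpt A" "j \<in> Cpt A" "A.sec i j s" for i j s
    using FH[OF that] by (auto simp: Phi_Hom \<phi>_def)
  show un: "\<phi> i i (unt A i) = unt B (c i)" if i: "i \<in> Cpt A" for i
  proof -
    have "far (JF h) (Ide (Phi_cat C A) i) = Ide (Phi_cat C B) (fob (JF h) i)" using rf i by (simp add: is_functor_def)
    then show ?thesis by (simp add: \<phi>_def c_def)
  qed
  show sc: "\<phi> i k (scomp C A i j k t s) = scomp C B (c i) (c j) (c k) (\<phi> j k t) (\<phi> i j s)"
    if I: "i \<in> Cpt A" "j \<in> Cpt A" "k \<in> Cpt A" and s: "A.sec i j s" and t: "A.sec j k t" for i j k s t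
  proof -
    have "(i, j, s) \<in> Arr (Phi_cat C A)" "(j, k, t) \<in> Arr (Phi_cat C A)"
      "Dom (Phi_cat C A) (j, k, t) = Cod (Phi_cat C A) (i, j, s)" using I s t by simp_all
    then have "far (JF h) ((j, k, t) \<cdot>\<^bsub>Phi_cat C A\<^esub> (i, j, s)) = far (JF h) (j, k, t) \<cdot>\<^bsub>Phi_cat C B\<^esub> far (JF h) (i, j, s)"
      using rf unfolding is_functor_def by blast
    then show ?thesis unfolding far[OF I(1,2) s] far[OF I(2,3) t] by (simp add: \<phi>_def)
  qed
  show nat: "Jnt h j \<cdot> (tgt B (c i) (c j) \<cdot> \<phi> i j s) = tgt A i j \<cdot> (s \<cdot> Jnt h i)"
    if I: "i \<in> Cpt A" "j \<in> Cpt A" and s: "A.sec i j s" for i j s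
  proof -
    have "(i, j, s) \<in> Arr (Phi_cat C A)" using I s by simp
    then have "far (Phi_proj C A) (i, j, s) \<cdot> Jnt h (Dom (Phi_cat C A) (i, j, s)) =
      Jnt h (Cod (Phi_cat C A) (i, j, s)) \<cdot> far (fcomp (Phi_proj C B) (JF h)) (i, j, s)"
      using nt unfolding nat_trans_def by blast
    then show ?thesis using far[OF I s] A.sec_D[OF I s] J[OF I(1)] I by (simp add: A.Hom_iff)
  qed
  have ue: "\<phi> i i (unt A i \<cdot> e) = unt B (c i) \<cdot> Rst C (\<phi> i i (unt A i \<cdot> e))" 
    "Rst C (\<phi> i i (unt A i \<cdot> e)) = Rst C (e \<cdot> Jnt h i)" if i: "i \<in> Cpt A" and e: "e \<in> RI C (P0 A i)" for i e
  proof -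
    note s = A.sec_unt[OF i e] and eD = A.RI_D[OF e] and ci = c[OF i]
    note fD = B.sec_D[OF ci ci sec[OF i i s]] and JD = J[OF i, unfolded A.Hom_iff]
    have "(i, i, unt A i \<cdot> e) \<in> Arr (Phi_cat C A)" using i s by simp
    from rr[OF this] have "far (JF h) (i, i, unt A i \<cdot> e) = Rst (Phi_cat C B) (far (JF h) (i, i, unt A i \<cdot> e))"
      using A.Rst_unt[OF i e] by simp
    then show 1: "\<phi> i i (unt A i \<cdot> e) = unt B (c i) \<cdot> Rst C (\<phi> i i (unt A i \<cdot> e))"
      unfolding far[OF i i s] by simp
    have "Rst C (Jnt h i \<cdot> (tgt B (c i) (c i) \<cdot> (unt B (c i) \<cdot> Rst C (\<phi> i i (unt A i \<cdot> e))))) = Rst C (tgt A i i \<cdot> (unt A i \<cdot> e \<cdot> Jnt h i))"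
      unfolding 1[symmetric] nat[OF i i s] ..
    then show "Rst C (\<phi> i i (unt A i \<cdot> e)) = Rst C (e \<cdot> Jnt h i)"
      using fD ci i eD JD A.Rst_total_Cmp[of "Jnt h i" "Rst C (\<phi> i i (unt A i \<cdot> e))"] by simp
  qed
  show RI: "\<phi> i j (s \<cdot> e) = \<phi> i j s \<cdot> Rst C (e \<cdot> Jnt h i)"
    if I: "i \<in> Cpt A" "j \<in> Cpt A" and s: "A.sec i j s" and e: "e \<in> RI C (P0 A i)" for i j s e
  proof -
    have JD: "Rst C (e \<cdot> Jnt h i) \<in> RI C (P0 B (c i))" using J[OF I(1)] A.RI_D[OF e] by (simp add: A.Hom_iff)
    have "\<phi> i j (s \<cdot> e) = \<phi> i j (scomp C A i i j s (unt A i \<cdot> e))" using A.scomp_unt_right[OF I s e] by simp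
    also have "\<dots> = scomp C B (c i) (c i) (c j) (\<phi> i j s) (unt B (c i) \<cdot> Rst C (e \<cdot> Jnt h i))"
      unfolding sc[OF I(1,1,2) A.sec_unt[OF I(1) e] s] ue(2)[OF I(1) e, symmetric] ue(1)[OF I(1) e, symmetric] ..
    also have "\<dots> = \<phi> i j s \<cdot> Rst C (e \<cdot> Jnt h i)"
      by (rule B.scomp_unt_right[OF c[OF I(1)] c[OF I(2)] sec[OF I s] JD])
    finally show ?thesis .
  qed
  show "Rst C (\<phi> i j s) = Rst C (s \<cdot> Jnt h i)"
    if I: "i \<in> Cpt A" "j \<in> Cpt A" and s: "A.sec i j s" for i j s
  proof -
    note sD = A.sec_D[OF I s] and fD = B.sec_D[OF c[OF I(1)] c[OF I(2)] sec[OF I s]]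
    have e: "Rst C s \<in> RI C (P0 A i)" using sD by simp
    have "(i, j, s) \<in> Arr (Phi_cat C A)" using I s by simp
    from rr[OF this] have "far (JF h) (i, i, unt A i \<cdot> Rst C s) = Rst (Phi_cat C B) (far (JF h) (i, j, s))" by simp
    then have "\<phi> i i (unt A i \<cdot> Rst C s) = unt B (c i) \<cdot> Rst C (\<phi> i j s)"
      unfolding far[OF I s] far[OF I(1,1) A.sec_unt[OF I(1) e]] by simp
    then have "Rst C (Rst C s \<cdot> Jnt h i) = Rst C (unt B (c i) \<cdot> Rst C (\<phi> i j s))" using ue(2)[OF I(1) e] by simp
    then show ?thesis using B.Rst_unt[OF c[OF I(1)], of "Rst C (\<phi> i j s)"] fD sD J[OF I(1)] by (simp add: A.Hom_iff)
  qed
qed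

end

context pmor
begin

lemma section_functor_D: assumes "section_functor C F"
  shows "\<And>i j s. \<lbrakk>i \<in> Cpt A; j \<in> Cpt A; A.sec i j s\<rbrakk> \<Longrightarrow> B.sec (onC F i) (onC F j) (sact C F i j s)"
    and "\<And>i j s. \<lbrakk>i \<in> Cpt A; j \<in> Cpt A; A.sec i j s\<rbrakk> \<Longrightarrow> Rst C (sact C F i j s) = Rst C (s \<cdot> on0 F i)"
    and "\<And>i j s. \<lbrakk>i \<in> Cpt A; j \<in> Cpt A; A.sec i j s\<rbrakk> \<Longrightarrow>
        on0 F j \<cdot> (tgt B (onC F i) (onC F j) \<cdot> sact C F i j s) = tgt A i j \<cdot> (s \<cdot> on0 F i)"
    and "\<And>i. i \<in> Cpt A \<Longrightarrow> sact C F i i (unt A i) = unt B (onC F i)"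
    and "\<And>i j k s t. \<lbrakk>i \<in> Cpt A; j \<in> Cpt A; k \<in> Cpt A; A.sec i j s; A.sec j k t\<rbrakk> \<Longrightarrow>
      sact C F i k (scomp C A i j k t s) = scomp C B (onC F i) (onC F j) (onC F k) (sact C F j k t) (sact C F i j s)"
  using assms unfolding section_functor_def Let_def Src Trg by blast+

lemma section_functor_iff_jr_mor: "section_functor C F \<longleftrightarrow> is_jr_mor C (Phi_mor C F)"
proof
  assume sf: "section_functor C F"
  note D = section_functor_D[OF sf]
  have "restriction_functor (Phi_cat C A) (Phi_cat C B) (JF (Phi_mor C F))"
    unfolding restriction_functor_def
  proof (intro conjI is_functorI ballI)
    fix f assume "f \<in> Arr (Phi_cat C A)"
    then obtain i j s where f: "f = (i, j, s)" "i \<in> Cpt A" "j \<in> Cpt A" "A.sec i j s" by (cases f) auto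
    note sD = A.sec_D[OF f(2-4)]
    show "far (JF (Phi_mor C F)) f \<in> Hom (Phi_cat C B) (fob (JF (Phi_mor C F)) (Dom (Phi_cat C A) f)) (fob (JF (Phi_mor C F)) (Cod (Phi_cat C A) f))"
      using f D by (simp add: Phi_Hom)
    have "sact C F i i (unt A i \<cdot> Rst C s) = unt B (onC F i) \<cdot> Rst C (s \<cdot> on0 F i)"
      using sact_RI[OF f(2,2) A.sec_unt'[OF f(2)], of "Rst C s"] D(4)[OF f(2)] f sD by simp
    then show "far (JF (Phi_mor C F)) (Rst (Phi_cat C A) f) = Rst (Phi_cat C B) (far (JF (Phi_mor C F)) f)"
      using f sD D A.sec_unt[OF f(2), of "Rst C s"] by simp
    fix g assume "g \<in> Arr (Phi_cat C A)" "Dom (Phi_cat C A) g = Cod (Phi_cat C A) f"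
    then obtain k t where g: "g = (j, k, t)" "k \<in> Cpt A" "A.sec j k t" using f by (cases g) auto
    show "far (JF (Phi_mor C F)) (g \<cdot>\<^bsub>Phi_cat C A\<^esub> f) = far (JF (Phi_mor C F)) g \<cdot>\<^bsub>Phi_cat C B\<^esub> far (JF (Phi_mor C F)) f"
      using f g D A.scomp_sec[OF f(2,3) g(2) f(4) g(3)] by simp
  qed (use D A.sec_unt' in auto)
  moreover have "nat_trans (Phi_cat C A) C (fcomp (Phi_proj C B) (JF (Phi_mor C F))) (Phi_proj C A) (Jnt (Phi_mor C F))"
    unfolding nat_trans_def
  proof (intro conjI ballI)
    fix f assume "f \<in> Arr (Phi_cat C A)"
    then obtain i j s where f: "f = (i, j, s)" "i \<in> Cpt A" "j \<in> Cpt A" "A.sec i j s" by (cases f) auto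
    show "far (Phi_proj C A) f \<cdot> Jnt (Phi_mor C F) (Dom (Phi_cat C A) f) =
      Jnt (Phi_mor C F) (Cod (Phi_cat C A) f) \<cdot> far (fcomp (Phi_proj C B) (JF (Phi_mor C F))) f"
      using f D(3)[OF f(2-4)] A.sec_D[OF f(2-4)] by simp
  qed (auto simp: A.Hom_iff)
  ultimately show "is_jr_mor C (Phi_mor C F)"
    using Phi_mor_simps(5)[of C F] by (simp add: is_jr_mor_alt)
next
  assume h: "is_jr_mor C (Phi_mor C F)"
  have *: "JSrc (Phi_mor C F) = Phi_obj C A" "JTrg (Phi_mor C F) = Phi_obj C B" by simp_all
  note D = jr_mor_sections[OF h *]
  have S: "A.sec i k (scomp C A i j k t s)" if "i \<in> Cpt A" "j \<in> Cpt A" "k \<in> Cpt A" "A.sec i j s" "A.sec j k t" for i j k s t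
    using A.scomp_sec that by simp
  show "section_functor C F"
    unfolding section_functor_def Let_def
    using D(4-7,9) A.sec_unt' S by simp
qed

text \<open>Each equation between maps out of a pullback in the definition of a cofunctor is tested
  on pulled-back sections.\<close>

lemma section_functor_cofunctor: assumes sf: "section_functor C F" shows "cofunctor C F"
proof -
  note D = section_functor_D[OF sf]
  have st: "pmor_st C A B F"
  proof (intro pmor_st.intro pmor_axioms pmor_st_axioms.intro)
    fix i j assume ij: "i \<in> Cpt A" "j \<in> Cpt A"
    note Bd = A.pb_D[OF on0_pb[OF ij]]
    show "sor B (onC F i) (onC F j) \<cdot> on1 F i j = pr2 C (sor A i j) (on0 F i)"
    proof (rule on1_ext[OF ij])
      fix s assume s: "A.sec i j s"
      note sD = B.sec_D[OF _ _ D(1)[OF ij s]]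
      show "sor B (onC F i) (onC F j) \<cdot> on1 F i j \<cdot> pull_section C (sor A i j) (on0 F i) s =
        pr2 C (sor A i j) (on0 F i) \<cdot> pull_section C (sor A i j) (on0 F i) s"
        using pull[OF ij s] sD(4) D(2)[OF ij s] ij by (simp add: sact_def)
    qed (use ij Bd in auto)
    show "on0 F j \<cdot> (tgt B (onC F i) (onC F j) \<cdot> on1 F i j) = tgt A i j \<cdot> pr1 C (sor A i j) (on0 F i)"
    proof (rule on1_ext[OF ij])
      fix s assume s: "A.sec i j s"
      show "on0 F j \<cdot> (tgt B (onC F i) (onC F j) \<cdot> on1 F i j) \<cdot> pull_section C (sor A i j) (on0 F i) s =
        tgt A i j \<cdot> pr1 C (sor A i j) (on0 F i) \<cdot> pull_section C (sor A i j) (on0 F i) s"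
        using pull[OF ij s] D(3)[OF ij s] ij Bd by (simp add: sact_def)
    qed (use ij Bd in auto)
  qed
  then interpret pmor_st C A B F .
  \<comment> \<open>As \<open>unt A i \<cdot> on0 F i\<close> is total, its pairing with the
    identity is the pulled-back section of \<open>unt A i\<close>.\<close>
  have unit: "on1 F i i \<cdot> pairing C (sor A i i) (on0 F i) (unt A i \<cdot> on0 F i) (Ide C (P0 B (onC F i))) = unt B (onC F i)"
    if i: "i \<in> Cpt A" for i
  proof -
    have "total C (unt A i \<cdot> on0 F i)" by (rule A.total_Cmp) (use i in auto)
    then have "Rst C (unt A i \<cdot> on0 F i) = Ide C (P0 B (onC F i))" using i by (simp add: total_def)
    then show ?thesis using D(4)[OF i] by (simp add: sact_def pull_section_def)
  qed
  show ?thesis unfolding cofunctor_def Let_def Src Trg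
  proof (intro conjI ballI)
    show "pmor_extensional F" using typed_pmor by (simp add: typed_pmor_def)
    fix i assume i: "i \<in> Cpt A"
    show "onC F i \<in> Cpt B" "on0 F i \<in> Hom C (P0 B (onC F i)) (P0 A i)" "total C (on0 F i)" using i by (auto simp: A.Hom_iff)
    show "on1 F i i \<cdot> pairing C (sor A i i) (on0 F i) (unt A i \<cdot> on0 F i) (Ide C (P0 B (onC F i))) = unt B (onC F i)"
      by (rule unit[OF i])
    fix j assume j: "j \<in> Cpt A"
    show "on1 F i j \<in> Hom C (pbo C (sor A i j) (on0 F i)) (P1 B (onC F i) (onC F j))" using i j by (auto simp: A.Hom_iff)
    show "total C (on1 F i j)" by (rule on1_total[OF i j])
    show "sor B (onC F i) (onC F j) \<cdot> on1 F i j = pr2 C (sor A i j) (on0 F i)" by (rule sor_on1[OF i j])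
    show "on0 F j \<cdot> tgt B (onC F i) (onC F j) \<cdot> on1 F i j = tgt A i j \<cdot> pr1 C (sor A i j) (on0 F i)"
      using tgt_on1[OF i j] i j by simp
    fix k assume k: "k \<in> Cpt A"
    note L = law_at_sections[OF i j k]
    note L1 = L(1,2)[unfolded A.Hom_iff]
    show "on1 F i k \<cdot> pairing C (sor A i k) (on0 F i)
          (mul A i j k \<cdot> pairing C (sor A j k) (tgt A i j) (pr1 C (sor A j k) (tgt A i j \<cdot> pr1 C (sor A i j) (on0 F i)))
            (pr1 C (sor A i j) (on0 F i) \<cdot> pr2 C (sor A j k) (tgt A i j \<cdot> pr1 C (sor A i j) (on0 F i))))
          (pr2 C (sor A i j) (on0 F i) \<cdot> pr2 C (sor A j k) (tgt A i j \<cdot> pr1 C (sor A i j) (on0 F i))) =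
       mul B (onC F i) (onC F j) (onC F k) \<cdot> (pairing C (sor B (onC F j) (onC F k)) (tgt B (onC F i) (onC F j))
          (on1 F j k \<cdot> pairing C (sor A j k) (on0 F j) (pr1 C (sor A j k) (on0 F j \<cdot> tgt B (onC F i) (onC F j)))
            (tgt B (onC F i) (onC F j) \<cdot> pr2 C (sor A j k) (on0 F j \<cdot> tgt B (onC F i) (onC F j))))
          (pr2 C (sor A j k) (on0 F j \<cdot> tgt B (onC F i) (onC F j))) \<cdot>
         pairing C (sor A j k) (on0 F j \<cdot> tgt B (onC F i) (onC F j)) (pr1 C (sor A j k) (tgt A i j \<cdot> pr1 C (sor A i j) (on0 F i)))
          (on1 F i j \<cdot> pr2 C (sor A j k) (tgt A i j \<cdot> pr1 C (sor A i j) (on0 F i))))" (is "_ \<cdot> ?m = _ \<cdot> ?n")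
    \<comment> \<open>The triple pullback is tested in two stages, on sections \<open>t\<close> of
      the outer source map and on sections \<open>s\<close> of the inner one.\<close>
    proof (rule A.pull_ext[OF A.sor(5)[OF j k] L(7) L(6)])
      fix t assume t: "A.sec j k t"
      note T = A.pull_section[OF L(7) L(6) t]
      let ?t = "pull_section C (sor A j k) (tgt A i j \<cdot> pr1 C (sor A i j) (on0 F i)) t"
      show "on1 F i k \<cdot> ?m \<cdot> ?t = mul B (onC F i) (onC F j) (onC F k) \<cdot> ?n \<cdot> ?t"
      proof (rule on1_ext[OF i j])
        fix s assume s: "A.sec i j s"
        note P = pull[OF i j s]
        have "on1 F i k \<cdot> (?m \<cdot> (?t \<cdot> pull_section C (sor A i j) (on0 F i) s)) = 
          mul B (onC F i) (onC F j) (onC F k) \<cdot> (?n \<cdot> (?t \<cdot> pull_section C (sor A i j) (on0 F i) s))"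
          using L(3,4)[OF s t] D(5)[OF i j k s t] by simp
        then show "on1 F i k \<cdot> ?m \<cdot> ?t \<cdot> pull_section C (sor A i j) (on0 F i) s = mul B (onC F i) (onC F j) (onC F k) \<cdot> ?n \<cdot> ?t \<cdot> pull_section C (sor A i j) (on0 F i) s"
          using L1 T P i j k L(8) by (simp del: A.pairing_Arr)
      qed (use L1 T i j k L(8) in auto)
    qed (use L1 i j k in auto)
  qed
qed

end

lemma cofunctor_typed: "cofunctor C F \<Longrightarrow> typed_pmor C F"
  by (simp add: cofunctor_def typed_pmor_def Let_def)

context pmor
begin

lemma cofunctor_st: assumes "cofunctor C F" shows "pmor_st C A B F"
proof (intro pmor_st.intro pmor_axioms pmor_st_axioms.intro)
  fix i j assume ij: "i \<in> Cpt A" "j \<in> Cpt A"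
  show "sor B (onC F i) (onC F j) \<cdot> on1 F i j = pr2 C (sor A i j) (on0 F i)"
    using assms ij by (simp add: cofunctor_def Let_def)
  have "on0 F j \<cdot> tgt B (onC F i) (onC F j) \<cdot> on1 F i j = tgt A i j \<cdot> pr1 C (sor A i j) (on0 F i)"
    using assms ij by (simp add: cofunctor_def Let_def)
  then show "on0 F j \<cdot> (tgt B (onC F i) (onC F j) \<cdot> on1 F i j) = tgt A i j \<cdot> pr1 C (sor A i j) (on0 F i)"
    using ij by simp
qed

text \<open>The same evaluations in the other direction: the internal laws, applied at generalised
  elements, give functoriality on sections.\<close>

lemma cofunctor_section_functor: assumes cf: "cofunctor C F" shows "section_functor C F"
proof -
  interpret pmor_st C A B F by (rule cofunctor_st[OF cf])
  have unit: "sact C F i i (unt A i) = unt B (onC F i)" if i: "i \<in> Cpt A" for i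
  proof -
    have "total C (unt A i \<cdot> on0 F i)" by (rule A.total_Cmp) (use i in auto)
    then have "Rst C (unt A i \<cdot> on0 F i) = Ide C (P0 B (onC F i))" using i by (simp add: total_def)
    then show ?thesis using cf i by (simp add: cofunctor_def Let_def sact_def pull_section_def)
  qed
  have comp: "sact C F i k (scomp C A i j k t s) = scomp C B (onC F i) (onC F j) (onC F k) (sact C F j k t) (sact C F i j s)"
    if I: "i \<in> Cpt A" "j \<in> Cpt A" "k \<in> Cpt A" and s: "A.sec i j s" and t: "A.sec j k t" for i j k s t
  proof -
    note L = law_at_sections[OF I]
    note L1 = L(1,2)[unfolded A.Hom_iff]
    note law = cf[unfolded cofunctor_def Let_def Src Trg, THEN conjunct2, THEN conjunct2, THEN conjunct2, THEN conjunct2, THEN conjunct2, rule_format, OF I]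
    show ?thesis
      unfolding L(3)[OF s t, symmetric] L(4)[OF s t, symmetric]
      by (rule A.under2[OF law]) (use L1 L(5)[OF s t] I in auto)
  qed
  show ?thesis
    unfolding section_functor_def Let_def Src Trg using sact unit comp by blast
qed

lemma cofunctor_iff: "cofunctor C F \<longleftrightarrow> is_jr_mor C (Phi_mor C F)"
  using section_functor_cofunctor cofunctor_section_functor section_functor_iff_jr_mor by blast

end

lemma pmor_eqI:
  assumes "typed_pmor C F" "typed_pmor C G" "Src F = Src G" "Trg F = Trg G"
    "\<And>i. i \<in> Cpt (Src G) \<Longrightarrow> onC F i = onC G i" "\<And>i. i \<in> Cpt (Src G) \<Longrightarrow> on0 F i = on0 G i"
    "\<And>i j. \<lbrakk>i \<in> Cpt (Src G); j \<in> Cpt (Src G)\<rbrakk> \<Longrightarrow> on1 F i j = on1 G i j"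
  shows "F = G"
proof (rule pmor.equality)
  show "onC F = onC G" "on0 F = on0 G"
    using assms by (auto simp: typed_pmor_def pmor_extensional_def intro!: extensionalityI[of _ "Cpt (Src G)"])
  show "on1 F = on1 G"
  proof (intro ext)
    fix i j show "on1 F i j = on1 G i j"
      using assms by (cases "i \<in> Cpt (Src G) \<and> j \<in> Cpt (Src G)") (auto simp: typed_pmor_def pmor_extensional_def)
  qed
qed (use assms in auto)

context pcat_pair
begin

lemma Phi_mor_inj:
  assumes "typed_pmor C F" "Src F = A" "Trg F = B" "typed_pmor C G" "Src G = A" "Trg G = B" "Phi_mor C F = Phi_mor C G"
  shows "F = G"
proof -
  interpret F: pmor C A B F using assms by unfold_locales auto
  interpret G: pmor C A B G using assms by unfold_locales auto
  have c: "onC F i = onC G i" and o: "on0 F i = on0 G i" if "i \<in> Cpt A" for i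
  proof -
    have "fob (JF (Phi_mor C F)) i = fob (JF (Phi_mor C G)) i" "Jnt (Phi_mor C F) i = Jnt (Phi_mor C G) i" using assms(7) by simp_all
    then show "onC F i = onC G i" "on0 F i = on0 G i" using that by simp_all
  qed
  show ?thesis
  proof (rule pmor_eqI[OF assms(1,4)])
    fix i j assume "i \<in> Cpt (Src G)" "j \<in> Cpt (Src G)"
    then have ij: "i \<in> Cpt A" "j \<in> Cpt A" by simp_all
    show "on1 F i j = on1 G i j"
    proof (rule F.on1_ext[OF ij])
      fix s assume s: "A.sec i j s"
      have "far (JF (Phi_mor C F)) (i, j, s) = far (JF (Phi_mor C G)) (i, j, s)" using assms(7) by simp
      then have "sact C F i j s = sact C G i j s" using ij s by simp
      then show "on1 F i j \<cdot> pull_section C (sor A i j) (on0 F i) s = on1 G i j \<cdot> pull_section C (sor A i j) (on0 F i) s"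
        using o[OF ij(1)] by (simp add: sact_def)
    qed (use ij c o in \<open>auto simp flip: c o\<close>)
  qed (use c o in auto)
qed

text \<open>Fullness: each \<open>on1 F i j\<close> is glued by \<open>pull_glue\<close> from the
  values of \<open>h\<close> on sections, the required naturality under restriction being part of
  \<open>jr_mor_sections\<close>. The laws of a cofunctor then come from
  \<open>cofunctor_iff\<close>.\<close>

lemma Phi_mor_surj:
  assumes h: "is_jr_mor C h" "JSrc h = Phi_obj C A" "JTrg h = Phi_obj C B"
  shows "\<exists>F. typed_pmor C F \<and> Src F = A \<and> Trg F = B \<and> Phi_mor C F = h"
proof -
  define \<phi> where "\<phi> i j s = snd (snd (far (JF h) (i, j, s)))" for i j s
  let ?c = "fob (JF h)"
  note D = jr_mor_sections[OF h, folded \<phi>_def]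
  define P where "P i j g \<longleftrightarrow> g \<in> Hom C (pbo C (sor A i j) (Jnt h i)) (P1 B (?c i) (?c j)) \<and>
    (\<forall>s. A.sec i j s \<longrightarrow> g \<cdot> pull_section C (sor A i j) (Jnt h i) s = \<phi> i j s)" for i j g
  define F where "F = \<lparr>Src = A, Trg = B, onC = ?c, on0 = Jnt h,
    on1 = (\<lambda>i j. if i \<in> Cpt A \<and> j \<in> Cpt A then SOME g. P i j g else undefined)\<rparr>"
  have F: "Src F = A" "Trg F = B" "onC F = ?c" "on0 F = Jnt h" by (simp_all add: F_def)
  have ext: "?c \<in> extensional (Cpt A)" "Jnt h \<in> extensional (Cpt A)" "far (JF h) \<in> extensional (Arr (Phi_cat C A))"
    using h by (auto simp: is_jr_mor_alt)
  have P: "P i j (on1 F i j)" if ij: "i \<in> Cpt A" "j \<in> Cpt A" for i j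
  proof -
    note J = D(2)[OF ij(1), unfolded A.Hom_iff]
    have pb: "has_pb C (sor A i j) (Jnt h i)" by (rule A.sor_pb) (use ij J in auto)
    have "\<exists>g \<in> Hom C (pbo C (sor A i j) (Jnt h i)) (P1 B (?c i) (?c j)).
      \<forall>s. A.sec i j s \<longrightarrow> g \<cdot> pull_section C (sor A i j) (Jnt h i) s = \<phi> i j s"
    proof (rule A.pull_glue[OF A.sor(5)[OF ij] pb])
      show "\<phi> i j s \<in> Hom C (Dom C (Jnt h i)) (P1 B (?c i) (?c j))" if "A.sec i j s" for s
        using B.sec_D[OF D(1)[OF ij(1)] D(1)[OF ij(2)] D(4)[OF ij that]] J by (auto simp: A.Hom_iff)
      show "\<phi> i j (s \<cdot> e) = \<phi> i j s \<cdot> Rst C (e \<cdot> Jnt h i)" if "A.sec i j s" "e \<in> RI C (Cod C (sor A i j))" for s e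
        using D(8)[OF ij that(1)] that(2) ij by simp
    qed (use J D(1) ij in auto)
    then have "\<exists>g. P i j g" by (auto simp: P_def)
    then have "P i j (SOME g. P i j g)" by (rule someI_ex)
    then show ?thesis using ij by (simp add: F_def)
  qed
  have typed: "typed_pmor C F"
    unfolding typed_pmor_def pmor_extensional_def F
    using ext D(1,2) P by (auto simp: P_def) (auto simp: F_def)
  interpret F: pmor C A B F using typed F by unfold_locales auto
  have "Phi_mor C F = h"
  proof (rule jr_mor.equality)
    show "JF (Phi_mor C F) = JF h"
    proof (rule fctr.equality)
      show "fob (JF (Phi_mor C F)) = fob (JF h)" using ext by (simp add: F extensional_restrict)
      show "far (JF (Phi_mor C F)) = far (JF h)"
      proof (rule extensionalityI)
        fix f assume "f \<in> Arr (Phi_cat C A)"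
        then obtain i j s where f: "f = (i, j, s)" "i \<in> Cpt A" "j \<in> Cpt A" "A.sec i j s" by (cases f) auto
        then show "far (JF (Phi_mor C F)) f = far (JF h) f"
          using D(3)[OF f(2-4)] P[OF f(2,3)] F by (simp add: P_def sact_def)
      qed (use ext Phi_mor_simps(5)[of C F] F in auto)
    qed simp
    show "Jnt (Phi_mor C F) = Jnt h" using ext by (simp add: F extensional_restrict)
  qed (use h F in auto)
  then show ?thesis using typed F by blast
qed

end

section \<open>Fully faithful functors with invertible units\<close>

text \<open>Unit and associativity laws are reflected along an assignment that is injective on
  hom-sets and preserves identities and composites. This spares direct verification with iterated
  pullbacks for cofunctors and covering functors.\<close>

lemma category_of_faithful:
  assumes Y: "category Y"
    and Dom: "\<And>f. f \<in> Arr X \<Longrightarrow> Dom X f \<in> Obj X" and Cod: "\<And>f. f \<in> Arr X \<Longrightarrow> Cod X f \<in> Obj X"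
    and Ide: "\<And>x. x \<in> Obj X \<Longrightarrow> Ide X x \<in> Hom X x x"
    and Cmp: "\<And>x y z f g. \<lbrakk>f \<in> Hom X x y; g \<in> Hom X y z\<rbrakk> \<Longrightarrow> g \<cdot>\<^bsub>X\<^esub> f \<in> Hom X x z"
    and R: "\<And>x y f. f \<in> Hom X x y \<Longrightarrow> far R f \<in> Hom Y (fob R x) (fob R y)"
    and RIde: "\<And>x. x \<in> Obj X \<Longrightarrow> far R (Ide X x) = Ide Y (fob R x)"
    and RCmp: "\<And>x y z f g. \<lbrakk>f \<in> Hom X x y; g \<in> Hom X y z\<rbrakk> \<Longrightarrow> far R (g \<cdot>\<^bsub>X\<^esub> f) = far R g \<cdot>\<^bsub>Y\<^esub> far R f"
    and inj: "\<And>x y. \<lbrakk>x \<in> Obj X; y \<in> Obj X\<rbrakk> \<Longrightarrow> inj_on (far R) (Hom X x y)"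
  shows "category X" and "is_functor X Y R"
proof -
  interpret Y: category Y by (rule Y)
  have ob: "x \<in> Obj X" "y \<in> Obj X" if "f \<in> Hom X x y" for f x y using that Dom Cod by (auto simp: Hom_def)
  have eqI: "f = g" if "f \<in> Hom X x y" "g \<in> Hom X x y" "far R f = far R g" for f g x y
    using inj[OF ob[OF that(1)]] that by (auto dest: inj_onD)
  show "category X"
  proof
    fix f x y assume f: "f \<in> Hom X x y"
    show "f \<cdot>\<^bsub>X\<^esub> Ide X x = f"
      by (rule eqI[of _ x y]) (use f ob[OF f] R[OF f] Cmp[OF Ide f] RCmp[OF Ide f] RIde Y.Cmp_Ide in auto)
    show "Ide X y \<cdot>\<^bsub>X\<^esub> f = f"
      by (rule eqI[of _ x y]) (use f ob[OF f] R[OF f] Cmp[OF f Ide] RCmp[OF f Ide] RIde Y.Ide_Cmp in auto)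
    fix g z h w assume g: "g \<in> Hom X y z" and h: "h \<in> Hom X z w"
    show "h \<cdot>\<^bsub>X\<^esub> (g \<cdot>\<^bsub>X\<^esub> f) = h \<cdot>\<^bsub>X\<^esub> g \<cdot>\<^bsub>X\<^esub> f"
    proof (rule eqI[of _ x w])
      show "far R (h \<cdot>\<^bsub>X\<^esub> (g \<cdot>\<^bsub>X\<^esub> f)) = far R (h \<cdot>\<^bsub>X\<^esub> g \<cdot>\<^bsub>X\<^esub> f)"
        unfolding RCmp[OF Cmp[OF f g] h] RCmp[OF f g] RCmp[OF f Cmp[OF g h]] RCmp[OF g h]
        by (rule Y.Cmp_assoc[OF R[OF f] R[OF g] R[OF h]])
    qed (use f g h Cmp in blast)+
  qed (use Dom Cod Ide Cmp in auto)
  show "is_functor X Y R"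
  proof (rule is_functorI)
    show "fob R x \<in> Obj Y" if "x \<in> Obj X" for x
      using R[OF Ide[OF that]] Y.Dom_in[of "far R (Ide X x)"] by (auto simp: Hom_def simp del: Y.Dom_Obj Y.Cod_Obj)
    show "far R f \<in> Hom Y (fob R (Dom X f)) (fob R (Cod X f))" if "f \<in> Arr X" for f
      using R[of f "Dom X f" "Cod X f"] that by (simp add: Hom_def)
    show "far R (g \<cdot>\<^bsub>X\<^esub> f) = far R g \<cdot>\<^bsub>Y\<^esub> far R f" if "f \<in> Arr X" "g \<in> Arr X" "Dom X g = Cod X f" for f g
      using RCmp[of f "Dom X f" "Cod X f" g "Cod X g"] that by (simp add: Hom_def)
  qed (rule RIde)
qed

text \<open>Here \<open>L\<close> is a mere function on objects; its action on arrows and the counit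
  arise as transposes along the unit.\<close>

locale ff_with_units =
  X: category X + Y: category Y
  for X :: "('o,'m) cat" and Y :: "('p,'n) cat" +
  fixes R :: "('o,'m,'p,'n) fctr" and L :: "'p \<Rightarrow> 'o" and u :: "'p \<Rightarrow> 'n"
  assumes R_functor: "is_functor X Y R"
    and full_faithful: "\<lbrakk>x \<in> Obj X; x' \<in> Obj X\<rbrakk> \<Longrightarrow> bij_betw (far R) (Hom X x x') (Hom Y (fob R x) (fob R x'))"
    and L_Obj: "y \<in> Obj Y \<Longrightarrow> L y \<in> Obj X"
    and unit: "y \<in> Obj Y \<Longrightarrow> u y \<in> Hom Y y (fob R (L y))"
    and unit_iso: "y \<in> Obj Y \<Longrightarrow> invertible Y (u y)"
begin

lemma R_Obj: "x \<in> Obj X \<Longrightarrow> fob R x \<in> Obj Y"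
  using R_functor by (simp add: is_functor_def)

lemma R_Hom: "f \<in> Hom X x y \<Longrightarrow> far R f \<in> Hom Y (fob R x) (fob R y)"
  using R_functor by (auto simp: is_functor_def X.Hom_iff)

lemma R_Ide: "x \<in> Obj X \<Longrightarrow> far R (Ide X x) = Ide Y (fob R x)"
  using R_functor by (simp add: is_functor_def)

lemma R_Cmp: "\<lbrakk>f \<in> Hom X x y; g \<in> Hom X y z\<rbrakk> \<Longrightarrow> far R (g \<cdot>\<^bsub>X\<^esub> f) = far R g \<cdot>\<^bsub>Y\<^esub> far R f"
  using R_functor by (auto simp: is_functor_def X.Hom_iff)

lemma X_Hom_Obj: "f \<in> Hom X x y \<Longrightarrow> x \<in> Obj X" "f \<in> Hom X x y \<Longrightarrow> y \<in> Obj X"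
  using X.Dom_in X.Cod_in by (auto simp: X.Hom_iff)

lemma Y_Hom_Obj: "f \<in> Hom Y x y \<Longrightarrow> x \<in> Obj Y" "f \<in> Hom Y x y \<Longrightarrow> y \<in> Obj Y"
  using Y.Dom_in Y.Cod_in by (auto simp: Y.Hom_iff)

lemma unit_inverse:
  assumes "y \<in> Obj Y"
  obtains v where "v \<in> Hom Y (fob R (L y)) y" "v \<cdot>\<^bsub>Y\<^esub> u y = Ide Y y" "u y \<cdot>\<^bsub>Y\<^esub> v = Ide Y (fob R (L y))"
proof -
  have "Dom Y (u y) = y" "Cod Y (u y) = fob R (L y)" using unit[OF assms] by (auto simp: Y.Hom_iff)
  then show ?thesis using unit_iso[OF assms] that unfolding invertible_def by auto
qed

lemma R_unit_inj:
  assumes y: "y \<in> Obj Y" and f: "f \<in> Hom X (L y) x" and g: "g \<in> Hom X (L y) x"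
    and eq: "far R f \<cdot>\<^bsub>Y\<^esub> u y = far R g \<cdot>\<^bsub>Y\<^esub> u y"
  shows "f = g"
proof -
  obtain v where v: "v \<in> Hom Y (fob R (L y)) y" "v \<cdot>\<^bsub>Y\<^esub> u y = Ide Y y" "u y \<cdot>\<^bsub>Y\<^esub> v = Ide Y (fob R (L y))"
    by (rule unit_inverse[OF y])
  have "far R f = far R f \<cdot>\<^bsub>Y\<^esub> (u y \<cdot>\<^bsub>Y\<^esub> v)" using v(3) Y.Cmp_Ide[OF R_Hom[OF f]] by simp
  also have "\<dots> = far R g \<cdot>\<^bsub>Y\<^esub> (u y \<cdot>\<^bsub>Y\<^esub> v)"
    using eq Y.Cmp_assoc[OF v(1) unit[OF y] R_Hom[OF f]] Y.Cmp_assoc[OF v(1) unit[OF y] R_Hom[OF g]] by simp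
  also have "\<dots> = far R g" using v(3) Y.Cmp_Ide[OF R_Hom[OF g]] by simp
  finally show ?thesis
    using full_faithful[OF X_Hom_Obj[OF f]] f g by (auto simp: bij_betw_def dest: inj_onD)
qed

text \<open>The equation amounts to \<open>far R f\<close> being \<open>k\<close> composed with the
  inverse of the unit, which has exactly one solution as \<open>R\<close> is fully faithful.\<close>

lemma R_unit_surj:
  assumes y: "y \<in> Obj Y" and x: "x \<in> Obj X" and k: "k \<in> Hom Y y (fob R x)"
  shows "\<exists>!f. f \<in> Hom X (L y) x \<and> far R f \<cdot>\<^bsub>Y\<^esub> u y = k"
proof -
  obtain v where v: "v \<in> Hom Y (fob R (L y)) y" "v \<cdot>\<^bsub>Y\<^esub> u y = Ide Y y" by (rule unit_inverse[OF y])
  have "k \<cdot>\<^bsub>Y\<^esub> v \<in> far R ` Hom X (L y) x"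
    using full_faithful[OF L_Obj[OF y] x] Y.Cmp_in[OF v(1) k] by (auto simp: bij_betw_def)
  then obtain f where f: "f \<in> Hom X (L y) x" "far R f = k \<cdot>\<^bsub>Y\<^esub> v" by auto
  have "far R f \<cdot>\<^bsub>Y\<^esub> u y = k"
    unfolding f(2) using Y.Cmp_assoc[OF unit[OF y] v(1) k] v(2) Y.Cmp_Ide[OF k] by simp
  then show ?thesis using f(1) R_unit_inj[OF y] by blast
qed

text \<open>The description has the same shape as \<open>Psi_mor\<close>, so that the arrow part of
  \<open>Psi\<close> is by unfolding the one of the left adjoint built here.\<close>

definition transpose where
  "transpose x y k = (THE f. f \<in> Hom X (L y) x \<and> far R f \<cdot>\<^bsub>Y\<^esub> u y = k)"

lemma transpose:
  assumes "y \<in> Obj Y" "x \<in> Obj X" "k \<in> Hom Y y (fob R x)"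
  shows "transpose x y k \<in> Hom X (L y) x" "far R (transpose x y k) \<cdot>\<^bsub>Y\<^esub> u y = k"
  using theI'[OF R_unit_surj[OF assms]] unfolding transpose_def by auto

lemma transpose_unique:
  assumes "y \<in> Obj Y" "f \<in> Hom X (L y) x" "far R f \<cdot>\<^bsub>Y\<^esub> u y = k"
  shows "f = transpose x y k"
proof (rule R_unit_inj[OF assms(1,2)])
  have k: "k \<in> Hom Y y (fob R x)" using Y.Cmp_in[OF unit[OF assms(1)] R_Hom[OF assms(2)]] assms(3) by simp
  note t = transpose[OF assms(1) X_Hom_Obj(2)[OF assms(2)] k]
  show "transpose x y k \<in> Hom X (L y) x" by (rule t)
  show "far R f \<cdot>\<^bsub>Y\<^esub> u y = far R (transpose x y k) \<cdot>\<^bsub>Y\<^esub> u y" using t assms(3) by simp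
qed

definition left where
  "left = \<lparr>fob = L, far = (\<lambda>f. transpose (L (Cod Y f)) (Dom Y f) (u (Cod Y f) \<cdot>\<^bsub>Y\<^esub> f))\<rparr>"

definition counit where
  "counit x = transpose x (fob R x) (Ide Y (fob R x))"

lemma left: assumes "f \<in> Hom Y y y'"
  shows "far left f \<in> Hom X (L y) (L y')" "far R (far left f) \<cdot>\<^bsub>Y\<^esub> u y = u y' \<cdot>\<^bsub>Y\<^esub> f"
  using transpose[OF Y_Hom_Obj(1)[OF assms] L_Obj[OF Y_Hom_Obj(2)[OF assms]] Y.Cmp_in[OF assms unit[OF Y_Hom_Obj(2)[OF assms]]]]
    assms by (auto simp: left_def Y.Hom_iff)

lemma counit: assumes "x \<in> Obj X"
  shows "counit x \<in> Hom X (L (fob R x)) x" "far R (counit x) \<cdot>\<^bsub>Y\<^esub> u (fob R x) = Ide Y (fob R x)"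
  using transpose[OF R_Obj[OF assms] assms Y.Ide_in[OF R_Obj[OF assms]]] by (auto simp: counit_def)

lemma left_functor: "is_functor Y X left"
proof (rule is_functorI)
  show "fob left y \<in> Obj X" if "y \<in> Obj Y" for y using L_Obj that by (simp add: left_def)
  show "far left f \<in> Hom X (fob left (Dom Y f)) (fob left (Cod Y f))" if "f \<in> Arr Y" for f
    using left(1)[of f "Dom Y f" "Cod Y f"] that by (simp add: Y.Hom_iff left_def)
  show "far left (Ide Y y) = Ide X (fob left y)" if y: "y \<in> Obj Y" for y
  proof (rule R_unit_inj[OF y])
    note l = left[OF Y.Ide_in[OF y]] and i = X.Ide_in[OF L_Obj[OF y]]
    show "far left (Ide Y y) \<in> Hom X (L y) (L y)" by (rule l)
    show "Ide X (fob left y) \<in> Hom X (L y) (L y)" using i by (simp add: left_def)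
    show "far R (far left (Ide Y y)) \<cdot>\<^bsub>Y\<^esub> u y = far R (Ide X (fob left y)) \<cdot>\<^bsub>Y\<^esub> u y"
      using l(2) R_Ide[OF L_Obj[OF y]] Y.Cmp_Ide[OF unit[OF y]] Y.Ide_Cmp[OF unit[OF y]] by (simp add: left_def)
  qed
  fix f g assume fg: "f \<in> Arr Y" "g \<in> Arr Y" "Dom Y g = Cod Y f"
  define x y z where "x = Dom Y f" and "y = Cod Y f" and "z = Cod Y g"
  have f: "f \<in> Hom Y x y" and g: "g \<in> Hom Y y z" using fg by (auto simp: Y.Hom_iff x_def y_def z_def)
  note gf = Y.Cmp_in[OF f g] and x = Y_Hom_Obj(1)[OF f] and y = Y_Hom_Obj(2)[OF f] and z = Y_Hom_Obj(2)[OF g]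
  show "far left (g \<cdot>\<^bsub>Y\<^esub> f) = far left g \<cdot>\<^bsub>X\<^esub> far left f"
  proof (rule R_unit_inj[OF x left(1)[OF gf] X.Cmp_in[OF left(1)[OF f] left(1)[OF g]]])
    have "far R (far left g \<cdot>\<^bsub>X\<^esub> far left f) \<cdot>\<^bsub>Y\<^esub> u x = far R (far left g) \<cdot>\<^bsub>Y\<^esub> (u y \<cdot>\<^bsub>Y\<^esub> f)"
      using R_Cmp[OF left(1)[OF f] left(1)[OF g]] left(2)[OF f]
        Y.Cmp_assoc[OF unit[OF x] R_Hom[OF left(1)[OF f]] R_Hom[OF left(1)[OF g]]] by simp
    also have "\<dots> = u z \<cdot>\<^bsub>Y\<^esub> (g \<cdot>\<^bsub>Y\<^esub> f)"
      using left(2)[OF g] Y.Cmp_assoc[OF f unit[OF y] R_Hom[OF left(1)[OF g]]] Y.Cmp_assoc[OF f g unit[OF z]] by simp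
    finally show "far R (far left (g \<cdot>\<^bsub>Y\<^esub> f)) \<cdot>\<^bsub>Y\<^esub> u x = far R (far left g \<cdot>\<^bsub>X\<^esub> far left f) \<cdot>\<^bsub>Y\<^esub> u x"
      using left(2)[OF gf] by simp
  qed
qed

lemma counit_natural:
  assumes f: "f \<in> Hom X x x'"
  shows "f \<cdot>\<^bsub>X\<^esub> counit x = counit x' \<cdot>\<^bsub>X\<^esub> far left (far R f)"
proof -
  note x = X_Hom_Obj(1)[OF f] and x' = X_Hom_Obj(2)[OF f]
  note Rf = R_Hom[OF f] and l = left[OF R_Hom[OF f]] and Rx = R_Obj[OF x] and Rx' = R_Obj[OF x']
  show ?thesis
  proof (rule R_unit_inj[OF Rx X.Cmp_in[OF counit(1)[OF x] f] X.Cmp_in[OF l(1) counit(1)[OF x']]])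
    have "far R (f \<cdot>\<^bsub>X\<^esub> counit x) \<cdot>\<^bsub>Y\<^esub> u (fob R x) = far R f"
      using R_Cmp[OF counit(1)[OF x] f] counit(2)[OF x] Y.Cmp_Ide[OF Rf]
        Y.Cmp_assoc[OF unit[OF Rx] R_Hom[OF counit(1)[OF x]] Rf] by simp
    also have "\<dots> = far R (counit x' \<cdot>\<^bsub>X\<^esub> far left (far R f)) \<cdot>\<^bsub>Y\<^esub> u (fob R x)"
      using R_Cmp[OF l(1) counit(1)[OF x']] counit(2)[OF x'] Y.Ide_Cmp[OF Rf] l(2)
        Y.Cmp_assoc[OF unit[OF Rx] R_Hom[OF l(1)] R_Hom[OF counit(1)[OF x']]]
        Y.Cmp_assoc[OF Rf unit[OF Rx'] R_Hom[OF counit(1)[OF x']]] by simp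
    finally show "far R (f \<cdot>\<^bsub>X\<^esub> counit x) \<cdot>\<^bsub>Y\<^esub> u (fob R x) = far R (counit x' \<cdot>\<^bsub>X\<^esub> far left (far R f)) \<cdot>\<^bsub>Y\<^esub> u (fob R x)" .
  qed
qed

text \<open>The inverse is the arrow that \<open>R\<close> sends to the unit at
  \<open>fob R x\<close>; it exists by fullness.\<close>

lemma counit_iso: assumes x: "x \<in> Obj X" shows "invertible X (counit x)"
proof -
  note Rx = R_Obj[OF x] and c = counit[OF x]
  have "u (fob R x) \<in> far R ` Hom X x (L (fob R x))"
    using full_faithful[OF x L_Obj[OF Rx]] unit[OF Rx] by (auto simp: bij_betw_def)
  then obtain g where g: "g \<in> Hom X x (L (fob R x))" "far R g = u (fob R x)" by auto
  have "counit x \<cdot>\<^bsub>X\<^esub> g = Ide X x"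
  proof -
    have "far R (counit x \<cdot>\<^bsub>X\<^esub> g) = far R (Ide X x)" using R_Cmp[OF g(1) c(1)] g(2) c(2) R_Ide[OF x] by simp
    then show ?thesis using full_faithful[OF x x] X.Cmp_in[OF g(1) c(1)] X.Ide_in[OF x] by (auto simp: bij_betw_def dest: inj_onD)
  qed
  moreover have "g \<cdot>\<^bsub>X\<^esub> counit x = Ide X (L (fob R x))"
  proof (rule R_unit_inj[OF Rx X.Cmp_in[OF c(1) g(1)] X.Ide_in[OF L_Obj[OF Rx]]])
    show "far R (g \<cdot>\<^bsub>X\<^esub> counit x) \<cdot>\<^bsub>Y\<^esub> u (fob R x) = far R (Ide X (L (fob R x))) \<cdot>\<^bsub>Y\<^esub> u (fob R x)"
      using R_Cmp[OF c(1) g(1)] g(2) c(2) R_Ide[OF L_Obj[OF Rx]] Y.Cmp_assoc[OF unit[OF Rx] R_Hom[OF c(1)] R_Hom[OF g(1)]]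
        Y.Cmp_Ide[OF unit[OF Rx]] Y.Ide_Cmp[OF unit[OF Rx]] by simp
  qed
  moreover have "counit x \<in> Arr X" "Dom X (counit x) = L (fob R x)" "Cod X (counit x) = x"
    using c(1) by (auto simp: X.Hom_iff)
  ultimately show ?thesis using g(1) unfolding invertible_def by auto
qed

text \<open>Formulated for any \<open>M\<close> and \<open>e\<close> that agree with the constructed
  left adjoint and counit on arrows and objects, so that it applies to \<open>Psi\<close> as it is
  defined.\<close>

lemma adjoint_equivalence:
  assumes M: "fob M = L" "\<And>f. f \<in> Arr Y \<Longrightarrow> far M f = far left f" and e: "\<And>x. x \<in> Obj X \<Longrightarrow> e x = counit x"
  shows "adjoint_equivalence X Y M R u e"
proof -
  have MF: "is_functor Y X M"
  proof (rule is_functorI)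
    note lf = left_functor[unfolded is_functor_def]
    fix f g
    show "far M f \<in> Hom X (fob M (Dom Y f)) (fob M (Cod Y f))" if "f \<in> Arr Y"
      using left(1)[of f "Dom Y f" "Cod Y f"] that M by (simp add: Y.Hom_iff)
    assume "f \<in> Arr Y" "g \<in> Arr Y" "Dom Y g = Cod Y f"
    then show "far M (g \<cdot>\<^bsub>Y\<^esub> f) = far M g \<cdot>\<^bsub>X\<^esub> far M f" using lf M(2) by simp
  next
    fix y assume y: "y \<in> Obj Y"
    show "fob M y \<in> Obj X" using L_Obj[OF y] M by simp
    show "far M (Ide Y y) = Ide X (fob M y)"
      using left_functor[unfolded is_functor_def] y M by (simp add: left_def)
  qed
  have tri: "counit (L y) \<cdot>\<^bsub>X\<^esub> far left (u y) = Ide X (L y)" if y: "y \<in> Obj Y" for y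
  proof -
    note l = left[OF unit[OF y]] and Ly = L_Obj[OF y] and c = counit[OF L_Obj[OF y]]
    show ?thesis
    proof (rule R_unit_inj[OF y X.Cmp_in[OF l(1) c(1)] X.Ide_in[OF Ly]])
      show "far R (counit (L y) \<cdot>\<^bsub>X\<^esub> far left (u y)) \<cdot>\<^bsub>Y\<^esub> u y = far R (Ide X (L y)) \<cdot>\<^bsub>Y\<^esub> u y"
        using R_Cmp[OF l(1) c(1)] l(2) c(2) Y.Cmp_assoc[OF unit[OF y] R_Hom[OF l(1)] R_Hom[OF c(1)]] R_Ide[OF Ly]
          Y.Cmp_assoc[OF unit[OF y] unit[OF R_Obj[OF Ly]] R_Hom[OF c(1)]] Y.Ide_Cmp[OF unit[OF y]] by simp
    qed
  qed
  show ?thesis unfolding adjoint_equivalence_def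
  proof (intro conjI ballI)
    show "nat_trans Y Y fid (fcomp R M) u" unfolding nat_trans_def
    proof (intro conjI ballI)
      show "u y \<in> Hom Y (fob fid y) (fob (fcomp R M) y)" if "y \<in> Obj Y" for y using unit[OF that] M by simp
      fix f assume f: "f \<in> Arr Y"
      then show "far (fcomp R M) f \<cdot>\<^bsub>Y\<^esub> u (Dom Y f) = u (Cod Y f) \<cdot>\<^bsub>Y\<^esub> far fid f"
        using left(2)[of f "Dom Y f" "Cod Y f"] M by (simp add: Y.Hom_iff)
    qed
    show "nat_trans X X (fcomp M R) fid e" unfolding nat_trans_def
    proof (intro conjI ballI)
      show "e x \<in> Hom X (fob (fcomp M R) x) (fob fid x)" if "x \<in> Obj X" for x using counit[OF that] M e that by simp
      fix f assume f: "f \<in> Arr X"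
      then have fH: "f \<in> Hom X (Dom X f) (Cod X f)" by (simp add: X.Hom_iff)
      then have "far R f \<in> Arr Y" using R_Hom by (auto simp: Y.Hom_iff)
      then show "far fid f \<cdot>\<^bsub>X\<^esub> e (Dom X f) = e (Cod X f) \<cdot>\<^bsub>X\<^esub> far (fcomp M R) f"
        using counit_natural[OF fH] f M e by simp
    qed
    fix y assume y: "y \<in> Obj Y"
    then have "u y \<in> Arr Y" using unit by (auto simp: Y.Hom_iff)
    then show "e (fob M y) \<cdot>\<^bsub>X\<^esub> far M (u y) = Ide X (fob M y)" using tri[OF y] M e L_Obj[OF y] by simp
  qed (use MF R_functor unit_iso e counit counit_iso X.category_axioms Y.category_axioms in auto)
qed

end

section \<open>The categories of cofunctors and of functors over the base\<close>

lemma is_jr_obj_D: assumes "is_jr_obj K C X"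
  shows "join_restriction_category (fst X)" "Obj (fst X) \<prec> K" "locally_small K (fst X)"
    "restriction_functor (fst X) C (snd X)" "hyperconnected (fst X) C (snd X)"
  using assms by (auto simp: is_jr_obj_def case_prod_unfold)

lemma restriction_functor_D: assumes "restriction_functor A B F"
  shows "\<And>i. i \<in> Obj A \<Longrightarrow> fob F i \<in> Obj B"
    "\<And>f. f \<in> Arr A \<Longrightarrow> far F f \<in> Arr B" "\<And>f. f \<in> Arr A \<Longrightarrow> Dom B (far F f) = fob F (Dom A f)"
    "\<And>f. f \<in> Arr A \<Longrightarrow> Cod B (far F f) = fob F (Cod A f)" "\<And>i. i \<in> Obj A \<Longrightarrow> far F (Ide A i) = Ide B (fob F i)"
    "\<And>f g. \<lbrakk>f \<in> Arr A; g \<in> Arr A; Dom A g = Cod A f\<rbrakk> \<Longrightarrow> far F (g \<cdot>\<^bsub>A\<^esub> f) = far F g \<cdot>\<^bsub>B\<^esub> far F f"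
    "\<And>f. f \<in> Arr A \<Longrightarrow> far F (Rst A f) = Rst B (far F f)"
  using assms by (auto simp: restriction_functor_def is_functor_def Hom_def)

lemma restriction_functorI:
  assumes "\<And>i. i \<in> Obj A \<Longrightarrow> fob F i \<in> Obj B"
    "\<And>f. f \<in> Arr A \<Longrightarrow> far F f \<in> Arr B" "\<And>f. f \<in> Arr A \<Longrightarrow> Dom B (far F f) = fob F (Dom A f)"
    "\<And>f. f \<in> Arr A \<Longrightarrow> Cod B (far F f) = fob F (Cod A f)" "\<And>i. i \<in> Obj A \<Longrightarrow> far F (Ide A i) = Ide B (fob F i)"
    "\<And>f g. \<lbrakk>f \<in> Arr A; g \<in> Arr A; Dom A g = Cod A f\<rbrakk> \<Longrightarrow> far F (g \<cdot>\<^bsub>A\<^esub> f) = far F g \<cdot>\<^bsub>B\<^esub> far F f"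
    "\<And>f. f \<in> Arr A \<Longrightarrow> far F (Rst A f) = Rst B (far F f)"
  shows "restriction_functor A B F"
  using assms by (auto simp: restriction_functor_def is_functor_def Hom_def)

lemma is_jr_mor_D: assumes "is_jr_mor C h"
  shows "restriction_functor (fst (JSrc h)) (fst (JTrg h)) (JF h)"
    "fob (JF h) \<in> extensional (Obj (fst (JSrc h)))" "far (JF h) \<in> extensional (Arr (fst (JSrc h)))"
    "Jnt h \<in> extensional (Obj (fst (JSrc h)))"
    "\<And>i. i \<in> Obj (fst (JSrc h)) \<Longrightarrow> total C (Jnt h i)"
    "\<And>i. i \<in> Obj (fst (JSrc h)) \<Longrightarrow> Jnt h i \<in> Arr C"
    "\<And>i. i \<in> Obj (fst (JSrc h)) \<Longrightarrow> Dom C (Jnt h i) = fob (snd (JTrg h)) (fob (JF h) i)"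
    "\<And>i. i \<in> Obj (fst (JSrc h)) \<Longrightarrow> Cod C (Jnt h i) = fob (snd (JSrc h)) i"
    "\<And>f. f \<in> Arr (fst (JSrc h)) \<Longrightarrow> far (snd (JSrc h)) f \<cdot>\<^bsub>C\<^esub> Jnt h (Dom (fst (JSrc h)) f)
       = Jnt h (Cod (fst (JSrc h)) f) \<cdot>\<^bsub>C\<^esub> far (snd (JTrg h)) (far (JF h) f)"
  using assms by (auto simp: is_jr_mor_alt nat_trans_def Hom_def)

lemma is_jr_morI:
  assumes "restriction_functor (fst (JSrc h)) (fst (JTrg h)) (JF h)"
    "fob (JF h) \<in> extensional (Obj (fst (JSrc h)))" "far (JF h) \<in> extensional (Arr (fst (JSrc h)))"
    "Jnt h \<in> extensional (Obj (fst (JSrc h)))"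
    "\<And>i. i \<in> Obj (fst (JSrc h)) \<Longrightarrow> total C (Jnt h i)"
    "\<And>i. i \<in> Obj (fst (JSrc h)) \<Longrightarrow> Dom C (Jnt h i) = fob (snd (JTrg h)) (fob (JF h) i)"
    "\<And>i. i \<in> Obj (fst (JSrc h)) \<Longrightarrow> Cod C (Jnt h i) = fob (snd (JSrc h)) i"
    "\<And>f. f \<in> Arr (fst (JSrc h)) \<Longrightarrow> far (snd (JSrc h)) f \<cdot>\<^bsub>C\<^esub> Jnt h (Dom (fst (JSrc h)) f)
       = Jnt h (Cod (fst (JSrc h)) f) \<cdot>\<^bsub>C\<^esub> far (snd (JTrg h)) (far (JF h) f)"
  shows "is_jr_mor C h"
  using assms by (auto simp: is_jr_mor_alt nat_trans_def Hom_def total_def)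

lemma jr_mor_eqI:
  assumes "is_jr_mor C h" "is_jr_mor C h'" "JSrc h = JSrc h'" "JTrg h = JTrg h'"
    "\<And>i. i \<in> Obj (fst (JSrc h')) \<Longrightarrow> fob (JF h) i = fob (JF h') i"
    "\<And>f. f \<in> Arr (fst (JSrc h')) \<Longrightarrow> far (JF h) f = far (JF h') f"
    "\<And>i. i \<in> Obj (fst (JSrc h')) \<Longrightarrow> Jnt h i = Jnt h' i"
  shows "h = h'"
proof (rule jr_mor.equality)
  note D = is_jr_mor_D[OF assms(1)] and D' = is_jr_mor_D[OF assms(2)]
  show "JF h = JF h'"
    by (rule fctr.equality) (use D(2,3) D'(2,3) assms in \<open>auto intro: extensionalityI\<close>)
  show "Jnt h = Jnt h'" by (rule extensionalityI) (use D(4) D'(4) assms in auto)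
qed (use assms in auto)

lemma jr_comp_simps [simp]:
  "JSrc (jr_comp C g f) = JSrc f" "JTrg (jr_comp C g f) = JTrg g"
  "i \<in> Obj (fst (JSrc f)) \<Longrightarrow> fob (JF (jr_comp C g f)) i = fob (JF g) (fob (JF f) i)"
  "a \<in> Arr (fst (JSrc f)) \<Longrightarrow> far (JF (jr_comp C g f)) a = far (JF g) (far (JF f) a)"
  "i \<in> Obj (fst (JSrc f)) \<Longrightarrow> Jnt (jr_comp C g f) i = Jnt f i \<cdot>\<^bsub>C\<^esub> Jnt g (fob (JF f) i)"
  "fob (JF (jr_comp C g f)) \<in> extensional (Obj (fst (JSrc f)))" "far (JF (jr_comp C g f)) \<in> extensional (Arr (fst (JSrc f)))"
  "Jnt (jr_comp C g f) \<in> extensional (Obj (fst (JSrc f)))"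
  by (auto simp: jr_comp_def Let_def)

lemma jr_id_simps [simp]:
  "JSrc (jr_id C X) = X" "JTrg (jr_id C X) = X"
  "i \<in> Obj (fst X) \<Longrightarrow> fob (JF (jr_id C X)) i = i" "a \<in> Arr (fst X) \<Longrightarrow> far (JF (jr_id C X)) a = a"
  "i \<in> Obj (fst X) \<Longrightarrow> Jnt (jr_id C X) i = Ide C (fob (snd X) i)"
  "fob (JF (jr_id C X)) \<in> extensional (Obj (fst X))" "far (JF (jr_id C X)) \<in> extensional (Arr (fst X))"
  "Jnt (jr_id C X) \<in> extensional (Obj (fst X))"
  by (auto simp: jr_id_def case_prod_unfold)

lemma jrCat_h_simps [simp]:
  "Obj (jrCat_h K C) = {X. is_jr_obj K C X}"
  "Dom (jrCat_h K C) = JSrc" "Cod (jrCat_h K C) = JTrg" "Ide (jrCat_h K C) = jr_id C" "Cmp (jrCat_h K C) = jr_comp C"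
  by (auto simp: jrCat_h_def)

lemma jrCat_h_Hom: "h \<in> Hom (jrCat_h K C) X Y \<longleftrightarrow>
    is_jr_obj K C X \<and> is_jr_obj K C Y \<and> is_jr_mor C h \<and> JSrc h = X \<and> JTrg h = Y"
  by (auto simp: jrCat_h_def Hom_def)

lemma is_jr_obj_restriction_category: "is_jr_obj K C X \<Longrightarrow> restriction_category (fst X)"
  using is_jr_obj_D(1) join_restriction_category.axioms(1) by blast

context join_restriction_category
begin

lemma is_jr_mor_id:
  assumes "category (fst X)" "restriction_category (fst X)" "restriction_functor (fst X) C (snd X)"
  shows "is_jr_mor C (jr_id C X)"
proof -
  interpret X: restriction_category "fst X" by (rule assms)
  note R = restriction_functor_D[OF assms(3)]
  show ?thesis
    by (rule is_jr_morI) (use R in \<open>auto intro!: restriction_functorI \<close>)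
qed

lemma is_jr_mor_comp:
  assumes f: "is_jr_mor C f" and g: "is_jr_mor C g" and fg: "JTrg f = JSrc g"
    and X: "restriction_category (fst (JSrc f))" "restriction_functor (fst (JSrc f)) C (snd (JSrc f))"
    and Z: "restriction_functor (fst (JTrg g)) C (snd (JTrg g))" and Y: "restriction_functor (fst (JTrg f)) C (snd (JTrg f))"
  shows "is_jr_mor C (jr_comp C g f)"
proof -
  interpret X: restriction_category "fst (JSrc f)" by (rule X(1))
  note D = is_jr_mor_D[OF f] and D' = is_jr_mor_D[OF g, folded fg]
  note F = restriction_functor_D[OF D(1)] and G = restriction_functor_D[OF D'(1)]
  note P = restriction_functor_D[OF X(2)] and R = restriction_functor_D[OF Z] and Q = restriction_functor_D[OF Y]
  show ?thesis
  proof (rule is_jr_morI)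
    show "restriction_functor (fst (JSrc (jr_comp C g f))) (fst (JTrg (jr_comp C g f))) (JF (jr_comp C g f))"
      by (rule restriction_functorI) (use F G in auto)
    show "total C (Jnt (jr_comp C g f) i)" if "i \<in> Obj (fst (JSrc (jr_comp C g f)))" for i
      using that D D' F by (auto intro!: total_Cmp)
    fix a assume "a \<in> Arr (fst (JSrc (jr_comp C g f)))"
    then have a: "a \<in> Arr (fst (JSrc f))" by simp
    note n = D(9)[OF a] and n' = D'(9)[OF F(2)[OF a]]
    have "far (snd (JSrc f)) a \<cdot> (Jnt f (Dom (fst (JSrc f)) a) \<cdot> Jnt g (fob (JF f) (Dom (fst (JSrc f)) a)))
      = Jnt f (Cod (fst (JSrc f)) a) \<cdot> (far (snd (JTrg f)) (far (JF f) a) \<cdot> Jnt g (fob (JF f) (Dom (fst (JSrc f)) a)))"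
      by (rule under2[OF n]) (use a D D' F P Q in auto)
    also have "\<dots> = Jnt f (Cod (fst (JSrc f)) a) \<cdot> (Jnt g (fob (JF f) (Cod (fst (JSrc f)) a)) \<cdot> far (snd (JTrg g)) (far (JF g) (far (JF f) a)))"
      using n' F(3,4)[OF a] by simp
    finally show "far (snd (JSrc (jr_comp C g f))) a \<cdot> Jnt (jr_comp C g f) (Dom (fst (JSrc (jr_comp C g f))) a) =
      Jnt (jr_comp C g f) (Cod (fst (JSrc (jr_comp C g f))) a) \<cdot> far (snd (JTrg (jr_comp C g f))) (far (JF (jr_comp C g f)) a)"
      using a D D' F G P Q R by simp
  qed (use D D' F fg in auto)
qed

lemma category_jrCat_h: "category (jrCat_h K C :: (('i,'a,'o,'m) jr_obj, ('i,'a,'o,'m) jr_mor) cat)"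
proof -
  let ?Y = "jrCat_h K C :: (('i,'a,'o,'m) jr_obj, ('i,'a,'o,'m) jr_mor) cat"
  have id: "jr_id C X \<in> Hom ?Y X X" if "X \<in> Obj ?Y" for X
  proof -
    note D = is_jr_obj_D[of K C X]
    have "restriction_category (fst X)" by (rule is_jr_obj_restriction_category[of K C]) (use that in simp)
    then show ?thesis using that D is_jr_mor_id[of X] by (simp add: jrCat_h_Hom restriction_category_def)
  qed
  have comp: "jr_comp C g f \<in> Hom ?Y X Z" if "f \<in> Hom ?Y X Y" "g \<in> Hom ?Y Y Z" for f g X Y Z
  proof -
    have "restriction_category (fst X)" by (rule is_jr_obj_restriction_category[of K C]) (use that in \<open>simp add: jrCat_h_Hom\<close>)
    then show ?thesis
      using that is_jr_obj_D(4)[of K C X] is_jr_obj_D(4)[of K C Y] is_jr_obj_D(4)[of K C Z] is_jr_mor_comp[of f g]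
      by (simp add: jrCat_h_Hom)
  qed
  show ?thesis
  proof
    fix f X Y assume f: "f \<in> Hom ?Y X Y"
    then have X: "X \<in> Obj ?Y" and Y: "Y \<in> Obj ?Y" and fm: "is_jr_mor C f" "JSrc f = X" "JTrg f = Y" by (auto simp: jrCat_h_Hom)
    note D = is_jr_mor_D[OF fm(1), unfolded fm(2,3)]
    note F = restriction_functor_D[OF D(1)]
    show "f \<cdot>\<^bsub>?Y\<^esub> Ide ?Y X = f"
      by (rule jr_mor_eqI[of C]) (use comp[OF id[OF X] f] fm D F in \<open>auto simp: jrCat_h_Hom\<close>)
    show "Ide ?Y Y \<cdot>\<^bsub>?Y\<^esub> f = f"
      by (rule jr_mor_eqI[of C]) (use comp[OF f id[OF Y]] fm D F in \<open>auto simp: jrCat_h_Hom\<close>)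
    fix g h Z W assume g: "g \<in> Hom ?Y Y Z" and h: "h \<in> Hom ?Y Z W"
    then have gm: "is_jr_mor C g" "JSrc g = Y" "JTrg g = Z" and hm: "is_jr_mor C h" "JSrc h = Z" "JTrg h = W" by (auto simp: jrCat_h_Hom)
    note DG = is_jr_mor_D[OF gm(1), unfolded gm(2,3)] and DH = is_jr_mor_D[OF hm(1), unfolded hm(2,3)]
    note G = restriction_functor_D[OF DG(1)]
    show "h \<cdot>\<^bsub>?Y\<^esub> (g \<cdot>\<^bsub>?Y\<^esub> f) = h \<cdot>\<^bsub>?Y\<^esub> g \<cdot>\<^bsub>?Y\<^esub> f"
      by (rule jr_mor_eqI[of C])
        (use comp[OF comp[OF f g] h] comp[OF f comp[OF g h]] fm gm hm D F DG G DH in \<open>auto simp: jrCat_h_Hom\<close>)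
  qed (use id comp in \<open>auto simp: jrCat_h_def\<close>)
qed

end

lemma peCat_c_simps [simp]:
  "Obj (peCat_c K C) = {A. source_etale C A \<and> Cpt A \<prec> K}"
  "Dom (peCat_c K C) = Src" "Cod (peCat_c K C) = Trg" "Ide (peCat_c K C) = cofunctor_id C" "Cmp (peCat_c K C) = cofunctor_comp C"
  by (auto simp: peCat_c_def Let_def)

lemma peCat_c_Hom: "F \<in> Hom (peCat_c K C) A B \<longleftrightarrow> source_etale C A \<and> Cpt A \<prec> K \<and> source_etale C B \<and> Cpt B \<prec> K \<and>
    cofunctor C F \<and> Src F = A \<and> Trg F = B"
  by (auto simp: peCat_c_def Let_def Hom_def)

lemma Phi_simps [simp]: "fob (Phi C) = Phi_obj C" "far (Phi C) = Phi_mor C"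
  by (auto simp: Phi_def)

section \<open>Identities and composites of cofunctors\<close>

context join_restriction_category
begin

lemma etale_pcatI: "source_etale C A \<Longrightarrow> etale_pcat C A"
  by (intro etale_pcat.intro join_restriction_category_axioms etale_pcat_axioms.intro)

lemma pmorI: "\<lbrakk>Src F = A; Trg F = B; source_etale C A; source_etale C B; typed_pmor C F\<rbrakk> \<Longrightarrow> pmor C A B F"
  by (intro pmor.intro pcat_pair.intro etale_pcatI pmor_axioms.intro) auto

text \<open>The cofunctor laws are reflected: the image of the identity data is the identity
  morphism over the base, and \<open>cofunctor_iff\<close> concludes.\<close>

lemma cofunctor_id:
  assumes A: "source_etale C A"
  shows "typed_pmor C (cofunctor_id C A)" and "Phi_mor C (cofunctor_id C A) = jr_id C (Phi_obj C A)"
    and "cofunctor C (cofunctor_id C A)"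
proof -
  interpret A: etale_pcat C A by (rule etale_pcatI[OF A])
  let ?I = "cofunctor_id C A"
  have pb: "has_pb C (sor A i j) (Ide C (P0 A i))" if "i \<in> Cpt A" "j \<in> Cpt A" for i j
    by (rule A.sor_pb) (use that in auto)
  show typed: "typed_pmor C ?I"
    using pb_D[OF pb] by (auto simp: typed_pmor_def pmor_extensional_def cofunctor_id_def Hom_iff)
  interpret I: pmor C A A ?I
    by (rule pmorI) (use A typed in \<open>auto simp: cofunctor_id_def\<close>)
  have sact: "sact C ?I i j s = s" if "i \<in> Cpt A" "j \<in> Cpt A" "A.sec i j s" for i j s
    using pull_section[OF pb _ that(3)] A.sec_D[OF that] that by (simp add: sact_def cofunctor_id_def)
  have rc: "is_jr_mor C (jr_id C (Phi_obj C A))"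
    using is_jr_mor_id[of "Phi_obj C A"] A.category_Phi A.restriction_category_Phi A.restriction_functor_Phi_proj by simp
  show eq: "Phi_mor C ?I = jr_id C (Phi_obj C A)"
  proof (rule jr_mor.equality)
    have c: "onC ?I i = i" "on0 ?I i = Ide C (P0 A i)" if "i \<in> Cpt A" for i using that by (simp_all add: cofunctor_id_def)
    show "JF (Phi_mor C ?I) = JF (jr_id C (Phi_obj C A))"
    proof (rule fctr.equality)
      show "fob (JF (Phi_mor C ?I)) = fob (JF (jr_id C (Phi_obj C A)))"
        by (rule extensionalityI[of _ "Cpt A"]) (use c jr_id_simps(6)[of C "Phi_obj C A"] in auto)
      show "far (JF (Phi_mor C ?I)) = far (JF (jr_id C (Phi_obj C A)))"
      proof (rule extensionalityI[of _ "Arr (Phi_cat C A)"])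
        fix f assume "f \<in> Arr (Phi_cat C A)"
        then obtain i j s where "f = (i, j, s)" "i \<in> Cpt A" "j \<in> Cpt A" "A.sec i j s" by (cases f) auto
        then show "far (JF (Phi_mor C ?I)) f = far (JF (jr_id C (Phi_obj C A))) f" by (simp add: c sact)
      qed (use Phi_mor_simps(5)[of C ?I] jr_id_simps(7)[of C "Phi_obj C A"] in auto)
    qed simp
    show "Jnt (Phi_mor C ?I) = Jnt (jr_id C (Phi_obj C A))"
      by (rule extensionalityI[of _ "Cpt A"]) (use c jr_id_simps(8)[of C "Phi_obj C A"] in auto)
  qed simp_all
  show "cofunctor C ?I" using I.cofunctor_iff eq rc by simp
qed

lemma is_jr_mor_Phi: "\<lbrakk>source_etale C (Src F); source_etale C (Trg F); cofunctor C F\<rbrakk> \<Longrightarrow> is_jr_mor C (Phi_mor C F)"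
  using pmor.cofunctor_iff[OF pmorI[OF refl refl _ _ cofunctor_typed]] by blast

text \<open>The only computation is that the composite data act on sections by the composite of the
  two actions. The image is then a composite of morphisms over the base, and
  \<open>cofunctor_iff\<close> gives the laws.\<close>

lemma cofunctor_comp:
  assumes A: "source_etale C A" and B: "source_etale C B" and D: "source_etale C D"
    and F: "cofunctor C F" "Src F = A" "Trg F = B" and G: "cofunctor C G" "Src G = B" "Trg G = D"
  shows "typed_pmor C (cofunctor_comp C G F)" and "Phi_mor C (cofunctor_comp C G F) = jr_comp C (Phi_mor C G) (Phi_mor C F)"
    and "cofunctor C (cofunctor_comp C G F)"
proof -
  interpret F: pmor C A B F by (rule pmorI[OF F(2,3) A B cofunctor_typed[OF F(1)]])
  interpret G: pmor C B D G by (rule pmorI[OF G(2,3) B D cofunctor_typed[OF G(1)]])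
  interpret F: pmor_st C A B F by (rule F.cofunctor_st[OF F(1)])
  interpret G: pmor_st C B D G by (rule G.cofunctor_st[OF G(1)])
  let ?H = "cofunctor_comp C G F"
  let ?c = "onC F" and ?d = "onC G"
  have H: "Src ?H = A" "Trg ?H = D" by (simp_all add: cofunctor_comp_def Let_def)
  have Hc: "onC ?H i = ?d (?c i)" "on0 ?H i = on0 F i \<cdot> on0 G (?c i)" if "i \<in> Cpt A" for i
    using that by (simp_all add: cofunctor_comp_def Let_def)
  have fg: "total C (on0 F i \<cdot> on0 G (?c i))" "on0 F i \<cdot> on0 G (?c i) \<in> Arr C" "Dom C (on0 F i \<cdot> on0 G (?c i)) = P0 D (?d (?c i))"
      "Cod C (on0 F i \<cdot> on0 G (?c i)) = P0 A i" if "i \<in> Cpt A" for i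
    using that by (auto intro: total_Cmp)
  have pbFG: "has_pb C (sor A i j) (on0 F i \<cdot> on0 G (?c i))" if "i \<in> Cpt A" "j \<in> Cpt A" for i j
    by (rule F.A.sor_pb) (use that fg in auto)
  have on1: "on1 ?H i j \<in> Hom C (pbo C (sor A i j) (on0 F i \<cdot> on0 G (?c i))) (P1 D (?d (?c i)) (?d (?c j)))"
    and sact: "\<And>s. F.A.sec i j s \<Longrightarrow> sact C ?H i j s = sact C G (?c i) (?c j) (sact C F i j s)" if ij: "i \<in> Cpt A" "j \<in> Cpt A" for i j
  proof -
    let ?FG = "on0 F i \<cdot> on0 G (?c i)"
    let ?p1 = "pr1 C (sor A i j) ?FG" and ?p2 = "pr2 C (sor A i j) ?FG"
    let ?x = "pairing C (sor A i j) (on0 F i) ?p1 (on0 G (?c i) \<cdot> ?p2)"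
    let ?y = "pairing C (sor B (?c i) (?c j)) (on0 G (?c i)) (on1 F i j \<cdot> ?x) ?p2"
    have o: "on1 ?H i j = on1 G (?c i) (?c j) \<cdot> ?y" using ij by (simp add: cofunctor_comp_def Let_def)
    have pb1: "has_pb C (sor A i j) (on0 F i)" and pb2: "has_pb C (sor B (?c i) (?c j)) (on0 G (?c i))" using ij by simp_all
    note B0 = pb_D[OF pbFG[OF ij]] and B1 = pb_D[OF pb1] and B2 = pb_D[OF pb2] and fgi = fg[OF ij(1)]
    have xx: "sor A i j \<cdot> ?p1 = on0 F i \<cdot> (on0 G (?c i) \<cdot> ?p2)" using B0 ij fgi by simp
    have X: "?x \<in> Arr C" "Dom C ?x = pbo C (sor A i j) ?FG" "Cod C ?x = pbo C (sor A i j) (on0 F i)"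
      "pr1 C (sor A i j) (on0 F i) \<cdot> ?x = ?p1" "pr2 C (sor A i j) (on0 F i) \<cdot> ?x = on0 G (?c i) \<cdot> ?p2"
      using pairing[OF pb1 _ _ _ _ _ xx] B0 fgi ij by simp_all
    have yy: "sor B (?c i) (?c j) \<cdot> (on1 F i j \<cdot> ?x) = on0 G (?c i) \<cdot> ?p2"
      using X ij by (simp add: under[OF F.sor_on1])
    have Y: "?y \<in> Arr C" "Dom C ?y = pbo C (sor A i j) ?FG" "Cod C ?y = pbo C (sor B (?c i) (?c j)) (on0 G (?c i))"
      "pr1 C (sor B (?c i) (?c j)) (on0 G (?c i)) \<cdot> ?y = on1 F i j \<cdot> ?x" "pr2 C (sor B (?c i) (?c j)) (on0 G (?c i)) \<cdot> ?y = ?p2"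
      using pairing[OF pb2 _ _ _ _ _ yy] B0 fgi ij X by simp_all
    show "on1 ?H i j \<in> Hom C (pbo C (sor A i j) ?FG) (P1 D (?d (?c i)) (?d (?c j)))" unfolding o using Y ij by (simp add: Hom_iff)
    fix s assume s: "F.A.sec i j s"
    note sD = F.A.sec_D[OF ij s] and S = F.sact[OF ij s] and SD = F.sact_Arr[OF ij s]
    note P = pull_section[OF pbFG[OF ij] fgi(1) s] and Q = F.pull[OF ij s] and U = G.pull[OF _ _ S(1)]
    let ?z = "pull_section C (sor A i j) ?FG s"
    \<comment> \<open>The canonical comparison of pullbacks sends the section pulled back along
      \<open>?FG\<close> to the section pulled back along \<open>on0 F i\<close>, evaluated at
      \<open>on0 G (?c i)\<close>.\<close>
    have xz: "?x \<cdot> ?z = pull_section C (sor A i j) (on0 F i) s \<cdot> on0 G (?c i)"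
    proof (rule pb_ext[OF pb1])
      show "pr1 C (sor A i j) (on0 F i) \<cdot> (?x \<cdot> ?z) = pr1 C (sor A i j) (on0 F i) \<cdot> (pull_section C (sor A i j) (on0 F i) s \<cdot> on0 G (?c i))"
        using X P Q B1 ij sD fgi by (simp add: under[OF X(4)] under[OF Q(4)])
      have "Rst C (s \<cdot> on0 F i) \<cdot> on0 G (?c i) = on0 G (?c i) \<cdot> Rst C (s \<cdot> (on0 F i \<cdot> on0 G (?c i)))"
        using Rst_slide[of "on0 G (?c i)" "s \<cdot> on0 F i"] ij sD by simp
      then show "pr2 C (sor A i j) (on0 F i) \<cdot> (?x \<cdot> ?z) = pr2 C (sor A i j) (on0 F i) \<cdot> (pull_section C (sor A i j) (on0 F i) s \<cdot> on0 G (?c i))"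
        using X P Q B1 B0 ij sD fgi by (simp add: under[OF X(5)] under[OF Q(5)])
    qed (use X P Q ij fgi in auto)
    have "?y \<cdot> ?z = pull_section C (sor B (?c i) (?c j)) (on0 G (?c i)) (sact C F i j s)"
    proof (rule pb_ext[OF pb2])
      have "on1 F i j \<cdot> (?x \<cdot> ?z) = sact C F i j s \<cdot> on0 G (?c i)"
        unfolding xz using Q ij by (simp add: sact_def)
      then show "pr1 C (sor B (?c i) (?c j)) (on0 G (?c i)) \<cdot> (?y \<cdot> ?z) =
        pr1 C (sor B (?c i) (?c j)) (on0 G (?c i)) \<cdot> pull_section C (sor B (?c i) (?c j)) (on0 G (?c i)) (sact C F i j s)"
        using Y X P B2 ij fgi U by (simp add: under[OF Y(4)])
      have "Rst C (sact C F i j s \<cdot> on0 G (?c i)) = Rst C (s \<cdot> (on0 F i \<cdot> on0 G (?c i)))"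
        using Rst_Rst_Cmp[of "on0 G (?c i)" "sact C F i j s"] SD S(2) Rst_Rst_Cmp[of "on0 G (?c i)" "s \<cdot> on0 F i"] sD ij by simp
      then show "pr2 C (sor B (?c i) (?c j)) (on0 G (?c i)) \<cdot> (?y \<cdot> ?z) =
        pr2 C (sor B (?c i) (?c j)) (on0 G (?c i)) \<cdot> pull_section C (sor B (?c i) (?c j)) (on0 G (?c i)) (sact C F i j s)"
        using Y X P B2 ij fgi U by (simp add: under[OF Y(5)])
    qed (use Y P U ij fgi in auto)
    then show "sact C ?H i j s = sact C G (?c i) (?c j) (sact C F i j s)"
      unfolding sact_def[of C ?H] sact_def[of C G] o H Hc[OF ij(1)] using Y P ij fgi by simp
  qed
  show typed: "typed_pmor C ?H"
    unfolding typed_pmor_def pmor_extensional_def H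
    using on1 Hc fg by (auto simp: Hom_iff) (auto simp: cofunctor_comp_def Let_def)
  interpret H: pmor C A D ?H by (rule pmorI[OF H A D typed])
  have mor: "is_jr_mor C (jr_comp C (Phi_mor C G) (Phi_mor C F))"
    by (rule is_jr_mor_comp)
      (use is_jr_mor_Phi[of F] is_jr_mor_Phi[of G] A B D F G F.A.restriction_category_Phi F.A.restriction_functor_Phi_proj F.B.restriction_functor_Phi_proj
        G.B.restriction_functor_Phi_proj in auto)
  show eq: "Phi_mor C ?H = jr_comp C (Phi_mor C G) (Phi_mor C F)"
  proof (rule jr_mor.equality)
    let ?J = "jr_comp C (Phi_mor C G) (Phi_mor C F)"
    show "JF (Phi_mor C ?H) = JF ?J"
    proof (rule fctr.equality)
      show "fob (JF (Phi_mor C ?H)) = fob (JF ?J)"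
        by (rule extensionalityI[of _ "Cpt A"]) (use H Hc jr_comp_simps(6)[of C "Phi_mor C G" "Phi_mor C F"] in auto)
      show "far (JF (Phi_mor C ?H)) = far (JF ?J)"
      proof (rule extensionalityI[of _ "Arr (Phi_cat C A)"])
        fix f assume "f \<in> Arr (Phi_cat C A)"
        then obtain i j s where f: "f = (i, j, s)" "i \<in> Cpt A" "j \<in> Cpt A" "F.A.sec i j s" by (cases f) auto
        then show "far (JF (Phi_mor C ?H)) f = far (JF ?J) f"
          using H Hc F.sact_sec[OF f(2-4)] sact[OF f(2,3)] by simp
      qed (use Phi_mor_simps(5)[of C ?H] H jr_comp_simps(7)[of C "Phi_mor C G" "Phi_mor C F"] in auto)
    qed simp
    show "Jnt (Phi_mor C ?H) = Jnt ?J"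
      by (rule extensionalityI[of _ "Cpt A"]) (use H Hc jr_comp_simps(8)[of C "Phi_mor C G" "Phi_mor C F"] in auto)
  qed (use H in simp_all)
  show "cofunctor C ?H" using H.cofunctor_iff eq mor by simp
qed

lemma Phi_full_faithful:
  assumes "A \<in> Obj (peCat_c K C)" "B \<in> Obj (peCat_c K C)" and ls: "locally_small K C"
  shows "bij_betw (far (Phi C)) (Hom (peCat_c K C) A B) (Hom (jrCat_h K C) (fob (Phi C) A) (fob (Phi C) B))"
proof -
  have A: "source_etale C A" "Cpt A \<prec> K" and B: "source_etale C B" "Cpt B \<prec> K" using assms by auto
  interpret pcat_pair C A B by (intro pcat_pair.intro etale_pcatI A B)
  show ?thesis unfolding bij_betw_def
  proof (intro conjI set_eqI iffI)
    show "inj_on (far (Phi C)) (Hom (peCat_c K C) A B)"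
      by (rule inj_onI) (auto simp: peCat_c_Hom intro!: Phi_mor_inj cofunctor_typed)
    show "h \<in> Hom (jrCat_h K C) (fob (Phi C) A) (fob (Phi C) B)" if "h \<in> far (Phi C) ` Hom (peCat_c K C) A B" for h
      using that A.is_jr_obj_Phi[OF ls A(2)] B.is_jr_obj_Phi[OF ls B(2)] is_jr_mor_Phi by (auto simp: peCat_c_Hom jrCat_h_Hom)
    fix h assume "h \<in> Hom (jrCat_h K C) (fob (Phi C) A) (fob (Phi C) B)"
    then have h: "is_jr_mor C h" "JSrc h = Phi_obj C A" "JTrg h = Phi_obj C B" by (auto simp: jrCat_h_Hom)
    obtain F where F: "typed_pmor C F" "Src F = A" "Trg F = B" "Phi_mor C F = h" using Phi_mor_surj[OF h] by blast
    have "cofunctor C F" using pmor.cofunctor_iff[OF pmorI[OF F(2,3) A(1) B(1) F(1)]] F h by simp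
    then have "F \<in> Hom (peCat_c K C) A B" using F A B by (simp add: peCat_c_Hom)
    then show "h \<in> far (Phi C) ` Hom (peCat_c K C) A B" using F by auto
  qed
qed

lemma category_peCat_c:
  assumes ls: "locally_small K C"
  shows "category (peCat_c K C)" "is_functor (peCat_c K C) (jrCat_h K C) (Phi C)"
proof -
  let ?X = "peCat_c K C"
  have ob: "A \<in> Obj ?X \<and> B \<in> Obj ?X" if "F \<in> Hom ?X A B" for F A B using that by (auto simp: peCat_c_Hom)
  note ff = Phi_full_faithful[OF _ _ ls]
  have mor: "far (Phi C) F \<in> Hom (jrCat_h K C) (fob (Phi C) A) (fob (Phi C) B)" if "F \<in> Hom ?X A B" for F A B
    using ob[OF that] ff[of A B] that by (auto simp: bij_betw_def)
  have inj: "inj_on (far (Phi C)) (Hom ?X A B)" if "A \<in> Obj ?X" "B \<in> Obj ?X" for A B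
    using ff[OF that] by (simp add: bij_betw_def)
  have id: "Ide ?X A \<in> Hom ?X A A" "far (Phi C) (Ide ?X A) = Ide (jrCat_h K C) (fob (Phi C) A)" if "A \<in> Obj ?X" for A
    using that cofunctor_id[of A] by (simp_all add: peCat_c_Hom cofunctor_id_def)
  have comp: "G \<cdot>\<^bsub>?X\<^esub> F \<in> Hom ?X A D" "far (Phi C) (G \<cdot>\<^bsub>?X\<^esub> F) = far (Phi C) G \<cdot>\<^bsub>jrCat_h K C\<^esub> far (Phi C) F"
    if "F \<in> Hom ?X A B" "G \<in> Hom ?X B D" for A B D F G
  proof -
    have "Src (cofunctor_comp C G F) = Src F" "Trg (cofunctor_comp C G F) = Trg G"
      by (simp_all add: cofunctor_comp_def Let_def)
    then show "G \<cdot>\<^bsub>?X\<^esub> F \<in> Hom ?X A D" "far (Phi C) (G \<cdot>\<^bsub>?X\<^esub> F) = far (Phi C) G \<cdot>\<^bsub>jrCat_h K C\<^esub> far (Phi C) F"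
      using that cofunctor_comp[of A B D F G] by (auto simp: peCat_c_Hom)
  qed
  have D: "Dom ?X F \<in> Obj ?X" "Cod ?X F \<in> Obj ?X" if "F \<in> Arr ?X" for F
    using that ob[of F "Src F" "Trg F"] by (auto simp: Hom_def)
  show "category ?X" by (rule category_of_faithful(1)[OF category_jrCat_h D id(1) comp(1) mor id(2) comp(2) inj])
  show "is_functor ?X (jrCat_h K C) (Phi C)"
    by (rule category_of_faithful(2)[OF category_jrCat_h D id(1) comp(1) mor id(2) comp(2) inj])
qed

end

section \<open>The internal category of a hyperconnected functor\<close>

context join_restriction_category
begin

lemma agree_cover:
  assumes f: "f \<in> Arr C"
  shows "cover C (Dom C f) {e \<in> RI C (Dom C f). Rst C f \<cdot> e = e \<and> f \<cdot> e = g \<cdot> e} (\<lambda>e. e) (agree C f g)"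
proof -
  have "\<exists>d. cover C (Dom C f) {e \<in> RI C (Dom C f). Rst C f \<cdot> e = e \<and> f \<cdot> e = g \<cdot> e} (\<lambda>e. e) d"
    by (rule cover_exists) (use f in auto)
  then show ?thesis unfolding agree_def by (rule someI_ex)
qed

lemma agree_sym:
  assumes "f \<in> Arr C" "g \<in> Arr C" "Dom C g = Dom C f" "Cod C g = Cod C f"
  shows "agree C f g = agree C g f"
proof -
  note a = agree[OF assms] and b = agree[OF assms(2,1) assms(3)[symmetric] assms(4)[symmetric]]
  show ?thesis
  proof (rule RI_eqI)
    show "agree C f g \<cdot> agree C g f = agree C f g" by (rule b(5)) (use a assms in auto)
    show "agree C g f \<cdot> agree C f g = agree C g f" by (rule a(5)) (use b assms in auto)
  qed (use a(1) b(1) assms in auto)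
qed

lemma agree_self: assumes "f \<in> Arr C" shows "agree C f f = Rst C f"
proof -
  note a = agree[OF assms assms refl refl]
  have "Rst C f \<cdot> agree C f f = Rst C f" by (rule a(5)) (use assms in auto)
  then show ?thesis using a(3) by simp
qed

text \<open>Where \<open>f\<close> agrees with \<open>g\<close> and \<open>g\<close> with
  \<open>h\<close>, also \<open>f\<close> agrees with \<open>h\<close>; this becomes the cocycle
  inequality of the atlas.\<close>

lemma agree_trans:
  assumes "f \<in> Arr C" "g \<in> Arr C" "h \<in> Arr C" "Dom C g = Dom C f" "Cod C g = Cod C f" "Dom C h = Dom C f" "Cod C h = Cod C f"
  shows "agree C g h \<cdot> agree C f g \<cdot> agree C f h = agree C g h \<cdot> agree C f g"
proof -
  have gh: "Dom C h = Dom C g" "Cod C h = Cod C g" using assms by simp_all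
  note a = agree[OF assms(1,2,4,5)] and b = agree[OF assms(2,3) gh] and c = agree[OF assms(1,3,6,7)]
  note aD = RI_D[OF a(1)] and bD = RI_D[OF b(1)]
  have b1: "agree C g h \<in> RI C (Dom C f)" using b(1) assms by simp
  have ba: "agree C g h \<cdot> agree C f g \<in> RI C (Dom C f)" by (rule RI_Cmp[OF b1 a(1)])
  have comm: "agree C g h \<cdot> agree C f g = agree C f g \<cdot> agree C g h" by (rule RI_comm[OF b1 a(1)])
  have "f \<cdot> (agree C f g \<cdot> agree C g h) = h \<cdot> (agree C g h \<cdot> agree C f g)"
  proof -
    have "f \<cdot> (agree C f g \<cdot> agree C g h) = g \<cdot> (agree C f g \<cdot> agree C g h)"
      by (rule under2[OF a(2)]) (use assms aD bD in auto)
    also have "\<dots> = g \<cdot> (agree C g h \<cdot> agree C f g)" unfolding comm ..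
    also have "\<dots> = h \<cdot> (agree C g h \<cdot> agree C f g)"
      by (rule under2[OF b(2)]) (use assms aD bD in auto)
    finally show ?thesis .
  qed
  moreover have "Rst C f \<cdot> (agree C f g \<cdot> agree C g h) = agree C f g \<cdot> agree C g h"
    by (rule under[OF a(3)]) (use assms aD bD in auto)
  ultimately show ?thesis using c(5)[OF ba] comm by simp
qed

text \<open>The region where a pulled-back section passes through a pulled-back chart is the inverse
  image along \<open>f\<close> of the original region \<open>q i \<cdot> t\<close>.\<close>

lemma etale_pull_at_section:
  assumes e: "etale C p I q s" and pb: "has_pb C p f" and f: "total C f" and t: "partial_section C p t" and i: "i \<in> I"
  shows "pr2 C p f \<cdot> Rst C (q i \<cdot> pr1 C p f) \<cdot> pull_section C p f t = Rst C (q i \<cdot> t \<cdot> f)"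
proof -
  note D = etale_D[OF e] and B = pb_D[OF pb] and tD = psec_D[OF t etale_D(2)[OF e]]
  note P = pull_section[OF pb f t]
  have "pr2 C p f \<cdot> Rst C (q i \<cdot> pr1 C p f) \<cdot> pull_section C p f t = pr2 C p f \<cdot> (pull_section C p f t \<cdot> Rst C (q i \<cdot> t \<cdot> f))"
    using Rst_slide[of "pull_section C p f t" "q i \<cdot> pr1 C p f"] P B D(3-8) i tD by simp
  also have "\<dots> = Rst C (t \<cdot> f) \<cdot> Rst C (q i \<cdot> (t \<cdot> f))"
    using P B D(3-8) i tD by (simp add: under[OF P(5)])
  also have "\<dots> = Rst C (q i \<cdot> t \<cdot> f)"
    using Rst_Cmp_le'[of "t \<cdot> f" "q i"] B D(3-8) i tD by simp
  finally show ?thesis .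
qed

end

locale jr_object = join_restriction_category C
  for C :: "('o,'m) rcat" (structure) +
  fixes K :: "'k set" and A :: "('i,'a) rcat" and P :: "('i,'a,'o,'m) fctr"
  assumes jr_obj: "is_jr_obj K C (A, P)" and glueings: "has_local_glueings K C"
begin

sublocale A: join_restriction_category A
  using is_jr_obj_D(1)[OF jr_obj] by simp

lemma P_functor: "restriction_functor A C P" and P_hyper: "hyperconnected A C P"
  and A_small: "Obj A \<prec> K" and A_loc: "locally_small K A"
  using is_jr_obj_D[OF jr_obj] by simp_all

lemmas P_D = restriction_functor_D[OF P_functor]

declare P_D(1-5) [simp]

lemma P_RI: "e \<in> RI A i \<Longrightarrow> far P e \<in> RI C (fob P i)"
  using P_D(7)[of e] A.RI_D[of e i] by (intro RI_I) auto

lemma P_RI_inj: "\<lbrakk>e \<in> RI A i; d \<in> RI A i; far P e = far P d\<rbrakk> \<Longrightarrow> e = d"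
  using P_hyper A.RI_D(5)[of e i] by (auto simp: hyperconnected_def bij_betw_def dest: inj_onD)

lemma P_RI_surj: assumes "i \<in> Obj A" "e \<in> RI C (fob P i)" obtains d where "d \<in> RI A i" "far P d = e"
proof -
  have "e \<in> far P ` RI A i" using P_hyper assms by (simp add: hyperconnected_def bij_betw_def)
  then show ?thesis using that by blast
qed

lemma P_RI_Cmp: "\<lbrakk>e \<in> RI A i; d \<in> RI A i\<rbrakk> \<Longrightarrow> far P (e \<cdot>\<^bsub>A\<^esub> d) = far P e \<cdot> far P d"
  using A.RI_D[of e i] A.RI_D[of d i] P_D(6) by simp

text \<open>Covers are joins in the order of restriction idempotents, and a hyperconnected functor
  is an isomorphism for that order: it is bijective on idempotents and compatible with their
  composition.\<close>

lemma P_cover_iff: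
  assumes i: "i \<in> Obj A" and c: "\<And>x. x \<in> I \<Longrightarrow> c x \<in> RI A i" and d: "d \<in> RI A i"
  shows "cover A i I c d \<longleftrightarrow> cover C (fob P i) I (\<lambda>x. far P (c x)) (far P d)"
proof
  assume cov: "cover A i I c d"
  note D = A.cover_D[OF cov]
  show "cover C (fob P i) I (\<lambda>x. far P (c x)) (far P d)"
  proof (rule coverI)
    fix k assume k: "k \<in> RI C (fob P i)" and kc: "\<And>x. x \<in> I \<Longrightarrow> far P (c x) \<cdot> k = far P (c x)"
    obtain k0 where k0: "k0 \<in> RI A i" "far P k0 = k" using P_RI_surj[OF i k] .
    have 1: "c x \<cdot>\<^bsub>A\<^esub> k0 = c x" if x: "x \<in> I" for x
      using P_RI_inj[OF A.RI_Cmp[OF c[OF x] k0(1)] c[OF x]] P_RI_Cmp[OF c[OF x] k0(1)] kc[OF x] k0 by simp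
    have "k0 \<cdot>\<^bsub>A\<^esub> d = Ide A i \<cdot>\<^bsub>A\<^esub> d"
    proof (rule A.cover_ext[OF cov])
      show "k0 \<cdot>\<^bsub>A\<^esub> c x = Ide A i \<cdot>\<^bsub>A\<^esub> c x" if x: "x \<in> I" for x
        using 1[OF x] A.RI_comm[OF k0(1) c[OF x]] A.RI_D[OF c[OF x]] by simp
    qed (use A.RI_D[OF k0(1)] i in auto)
    then have "d \<cdot>\<^bsub>A\<^esub> k0 = d" using A.RI_comm[OF k0(1) d] A.RI_D[OF d] by simp
    then show "far P d \<cdot> k = far P d" using P_RI_Cmp[OF d k0(1)] k0 by simp
  next
    show "far P (c x) \<cdot> far P d = far P (c x)" if x: "x \<in> I" for x
      using P_RI_Cmp[OF c[OF x] d] D(3)[OF x] by simp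
  qed (use d c P_RI in auto)
next
  assume cov: "cover C (fob P i) I (\<lambda>x. far P (c x)) (far P d)"
  note D = cover_D[OF cov]
  show "cover A i I c d"
  proof (rule A.coverI[OF d c])
    show "c x \<cdot>\<^bsub>A\<^esub> d = c x" if x: "x \<in> I" for x
      using P_RI_inj[OF A.RI_Cmp[OF c[OF x] d] c[OF x]] P_RI_Cmp[OF c[OF x] d] D(3)[OF x] by simp
    fix k assume k: "k \<in> RI A i" and kc: "\<And>x. x \<in> I \<Longrightarrow> c x \<cdot>\<^bsub>A\<^esub> k = c x"
    have "far P k \<cdot> far P d = Ide C (fob P i) \<cdot> far P d"
    proof (rule cover_ext[OF cov])
      show "far P k \<cdot> far P (c x) = Ide C (fob P i) \<cdot> far P (c x)" if x: "x \<in> I" for x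
        using P_RI_Cmp[OF c[OF x] k] kc[OF x] RI_comm[OF P_RI[OF k] P_RI[OF c[OF x]]] RI_D[OF P_RI[OF c[OF x]]] by simp
    qed (use RI_D[OF P_RI[OF k]] i in auto)
    then have "far P (d \<cdot>\<^bsub>A\<^esub> k) = far P d"
      using P_RI_Cmp[OF d k] RI_comm[OF P_RI[OF k] P_RI[OF d]] RI_D[OF P_RI[OF d]] by simp
    then show "d \<cdot>\<^bsub>A\<^esub> k = d" using P_RI_inj[OF A.RI_Cmp[OF d k] d] by simp
  qed
qed

text \<open>The locus is by definition the join of the images of the idempotents that cover
  \<open>agree A f g\<close>, and \<open>P\<close> preserves covers.\<close>

lemma eq_locus_agree:
  assumes f: "f \<in> Hom A i j" and g: "g \<in> Hom A i j"
  shows "eq_locus C (A, P) f g = far P (agree A f g)"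
proof -
  have fD: "f \<in> Arr A" "Dom A f = i" "Cod A f = j" and gD: "g \<in> Arr A" "Dom A g = i" "Cod A g = j"
    using f g by (auto simp: A.Hom_iff)
  then have i: "i \<in> Obj A" using A.Dom_Obj by blast
  let ?E = "{e \<in> RI A i. Rst A f \<cdot>\<^bsub>A\<^esub> e = e \<and> f \<cdot>\<^bsub>A\<^esub> e = g \<cdot>\<^bsub>A\<^esub> e}"
  \<comment> \<open>Once \<open>f\<close> and \<open>g\<close> coincide on \<open>e\<close>, lying
    below the domain of one of them implies lying below the domain of the other.\<close>
  have E: "{e \<in> RI A i. le A e (Rst A f \<cdot>\<^bsub>A\<^esub> Rst A g) \<and> f \<cdot>\<^bsub>A\<^esub> e = g \<cdot>\<^bsub>A\<^esub> e} = ?E"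
  proof (rule Collect_cong, rule conj_cong[OF refl])
    fix e assume e: "e \<in> RI A i"
    note eD = A.RI_D[OF e]
    have r: "Rst A f \<in> RI A i" "Rst A g \<in> RI A i" using fD gD by simp_all
    note rr = A.RI_Cmp[OF r]
    show "(le A e (Rst A f \<cdot>\<^bsub>A\<^esub> Rst A g) \<and> f \<cdot>\<^bsub>A\<^esub> e = g \<cdot>\<^bsub>A\<^esub> e) = (Rst A f \<cdot>\<^bsub>A\<^esub> e = e \<and> f \<cdot>\<^bsub>A\<^esub> e = g \<cdot>\<^bsub>A\<^esub> e)"
    proof (intro iffI conjI; elim conjE)
      assume "le A e (Rst A f \<cdot>\<^bsub>A\<^esub> Rst A g)"
      then have "e \<cdot>\<^bsub>A\<^esub> (Rst A f \<cdot>\<^bsub>A\<^esub> Rst A g) = e" using A.le_RI_iff[OF e rr] by simp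
      then have *: "Rst A f \<cdot>\<^bsub>A\<^esub> (Rst A g \<cdot>\<^bsub>A\<^esub> e) = e" using A.RI_comm[OF e rr] fD gD eD by simp
      have "Rst A f \<cdot>\<^bsub>A\<^esub> (Rst A f \<cdot>\<^bsub>A\<^esub> (Rst A g \<cdot>\<^bsub>A\<^esub> e)) = Rst A f \<cdot>\<^bsub>A\<^esub> (Rst A g \<cdot>\<^bsub>A\<^esub> e)"
        using fD gD eD by simp
      then show "Rst A f \<cdot>\<^bsub>A\<^esub> e = e" unfolding * .
    next
      assume 1: "Rst A f \<cdot>\<^bsub>A\<^esub> e = e" and "f \<cdot>\<^bsub>A\<^esub> e = g \<cdot>\<^bsub>A\<^esub> e"
      then have 2: "Rst A g \<cdot>\<^bsub>A\<^esub> e = e" using A.Rst_Cmp_RI[OF e, of f] A.Rst_Cmp_RI[OF e, of g] fD gD by simp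
      have "e \<cdot>\<^bsub>A\<^esub> (Rst A f \<cdot>\<^bsub>A\<^esub> Rst A g) = e" using A.RI_comm[OF e rr] 1 2 fD gD eD by simp
      then show "le A e (Rst A f \<cdot>\<^bsub>A\<^esub> Rst A g)" using A.le_RI_iff[OF e rr] by simp
    qed
  qed
  have "cover A i ?E (\<lambda>e. e) (agree A f g)" using A.agree_cover[OF fD(1), of g] fD by simp
  then have "cover C (fob P i) ?E (far P) (far P (agree A f g))"
    using P_cover_iff[OF i, of ?E "\<lambda>e. e" "agree A f g"] A.agree_RI[of f g] fD gD by simp
  then have "is_join C (fob P i) (fob P i) (far P ` ?E) (far P (agree A f g))" by (simp add: cover_def)
  then show ?thesis using E fD by (simp add: eq_locus_def join_eq)
qed

lemma local_atlas:
  assumes i: "i \<in> Obj A"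
  shows "local_atlas C (fob P i) (Hom A i j) (eq_locus C (A, P))"
  unfolding local_atlas_def
proof (intro conjI ballI)
  fix f g assume f: "f \<in> Hom A i j" and g: "g \<in> Hom A i j"
  then have fg: "f \<in> Arr A" "g \<in> Arr A" "Dom A g = Dom A f" "Cod A g = Cod A f" "Dom A f = i" by (auto simp: A.Hom_iff)
  show "eq_locus C (A, P) f g \<in> RI C (fob P i)"
    unfolding eq_locus_agree[OF f g] using P_RI[OF A.agree_RI[OF fg(1-4)]] fg by simp
  show "eq_locus C (A, P) f g = eq_locus C (A, P) g f"
    unfolding eq_locus_agree[OF f g] eq_locus_agree[OF g f] A.agree_sym[OF fg(1-4)] ..
  fix h assume h: "h \<in> Hom A i j"
  then have fh: "h \<in> Arr A" "Dom A h = Dom A f" "Cod A h = Cod A f" "Dom A h = Dom A g" "Cod A h = Cod A g" using fg f by (auto simp: A.Hom_iff)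
  have ri: "agree A f g \<in> RI A i" "agree A g h \<in> RI A i" "agree A f h \<in> RI A i"
    using A.agree_RI[OF fg(1-4)] A.agree_RI[OF fg(2) fh(1,4,5)] A.agree_RI[OF fg(1) fh(1-3)] fg by simp_all
  have "agree A g h \<cdot>\<^bsub>A\<^esub> agree A f g \<cdot>\<^bsub>A\<^esub> agree A f h = agree A g h \<cdot>\<^bsub>A\<^esub> agree A f g"
    by (rule A.agree_trans) (use fg fh in auto)
  then have "far P (agree A g h \<cdot>\<^bsub>A\<^esub> agree A f g) \<cdot> far P (agree A f h) = far P (agree A g h \<cdot>\<^bsub>A\<^esub> agree A f g)"
    using P_RI_Cmp[OF A.RI_Cmp[OF ri(2,1)] ri(3)] by simp
  then have "le C (far P (agree A g h \<cdot>\<^bsub>A\<^esub> agree A f g)) (far P (agree A f h))"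
    using le_RI_iff[OF P_RI[OF A.RI_Cmp[OF ri(2,1)]] P_RI[OF ri(3)]] by simp
  then show "le C (eq_locus C (A, P) g h \<cdot> eq_locus C (A, P) f g) (eq_locus C (A, P) f h)"
    unfolding eq_locus_agree[OF f g] eq_locus_agree[OF g h] eq_locus_agree[OF f h] P_RI_Cmp[OF ri(2,1)] .
qed

abbreviation \<sigma> where "\<sigma> \<equiv> Psi_sor C (A, P)"
abbreviation \<tau> where "\<tau> \<equiv> Psi_tgt C (A, P)"
abbreviation S where "S \<equiv> Psi_sec C (A, P)"

definition q where "q i j = fst (snd (Psi_glueing C (A, P) i j))"

lemma Hom_small: "\<lbrakk>i \<in> Obj A; j \<in> Obj A\<rbrakk> \<Longrightarrow> Hom A i j \<prec> K"
  using A_loc by (simp add: locally_small_def)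

lemma glueing:
  assumes i: "i \<in> Obj A" and j: "j \<in> Obj A"
  shows "glueing C (fob P i) (Hom A i j) (eq_locus C (A, P)) (\<sigma> i j) (q i j) S"
proof -
  obtain p' q' s' where "glueing C (fob P i) (Hom A i j) (eq_locus C (A, P)) p' q' s'"
    using glueing_exists[OF glueings _ Hom_small[OF i j] local_atlas[OF i]] i by auto
  then have "\<exists>x. case x of (p', q', s') \<Rightarrow> glueing C (fob P i) (Hom A i j) (eq_locus C (A, P)) p' q' s'" by auto
  from someI_ex[OF this]
  have "case Psi_glueing C (A, P) i j of (p', q', s') \<Rightarrow> glueing C (fob P i) (Hom A i j) (eq_locus C (A, P)) p' q' s'"
    unfolding Psi_glueing_def by simp
  then have "glueing C (fob P i) (Hom A i j) (eq_locus C (A, P)) (\<sigma> i j) (q i j) (snd (snd (Psi_glueing C (A, P) i j)))"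
    by (simp add: case_prod_unfold Psi_sor_def q_def)
  moreover have "snd (snd (Psi_glueing C (A, P) i j)) f = S f" if "f \<in> Hom A i j" for f
    using that by (simp add: Psi_sec_def A.Hom_iff)
  ultimately show ?thesis by (simp add: glueing_def)
qed

lemma \<sigma>: assumes "i \<in> Obj A" "j \<in> Obj A"
  shows "etale C (\<sigma> i j) (Hom A i j) (q i j) S" "Cod C (\<sigma> i j) = fob P i" "local_homeo C (\<sigma> i j)" "total C (\<sigma> i j)" "\<sigma> i j \<in> Arr C"
  using glueing[OF assms] etale_glueing[OF glueing[OF assms]] by (auto simp: glueing_def etale_def total_def)

lemma q_S:
  assumes f: "f \<in> Hom A i j" and g: "g \<in> Hom A i j"
  shows "q i j g \<cdot> S f = far P (agree A f g)"
proof -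
  have "i \<in> Obj A" "j \<in> Obj A" using f A.Dom_Obj[of f] A.Cod_Obj[of f] by (auto simp: A.Hom_iff simp del: A.Dom_Obj A.Cod_Obj)
  then show ?thesis using glueing[of i j] f g eq_locus_agree[OF f g] by (auto simp: glueing_def)
qed

lemma Hom_D: assumes "f \<in> Hom A i j"
  shows "f \<in> Arr A" "Dom A f = i" "Cod A f = j" "i \<in> Obj A" "j \<in> Obj A"
  using assms A.Dom_Obj[of f] A.Cod_Obj[of f] by (auto simp: A.Hom_iff simp del: A.Dom_Obj A.Cod_Obj)

lemma S: assumes f: "f \<in> Hom A i j"
  shows S_Arr: "S f \<in> Arr C" and Dom_S: "Dom C (S f) = fob P i" and Cod_S: "Cod C (S f) = Dom C (\<sigma> i j)"
    and Rst_S: "Rst C (S f) = far P (Rst A f)" and S_section: "partial_section C (\<sigma> i j) (S f)"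
proof -
  note D = Hom_D[OF f]
  note E = \<sigma>[OF D(4,5)] and ED = etale_D[OF \<sigma>(1)[OF D(4,5)]]
  show "S f \<in> Arr C" "Dom C (S f) = fob P i" "Cod C (S f) = Dom C (\<sigma> i j)" using ED(6-8)[OF f] E by simp_all
  show "Rst C (S f) = far P (Rst A f)" using ED(9)[OF f] q_S[OF f f] A.agree_self[OF D(1)] by simp
  show "partial_section C (\<sigma> i j) (S f)" by (rule etale_section[OF E(1) f])
qed

lemma S_agree: assumes f: "f \<in> Hom A i j" and g: "g \<in> Hom A i j"
  shows "S f \<cdot> far P (agree A f g) = S g \<cdot> far P (agree A f g)"
proof -
  note D = Hom_D[OF f]
  show ?thesis
    using etale_at_section(3)[OF \<sigma>(1)[OF D(4,5)] S_section[OF f] g] q_S[OF f g] by simp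
qed

text \<open>The arrows \<open>f\<close> and \<open>f \<cdot> e\<close> agree on the whole domain of
  the latter, so their sections agree over its image under \<open>P\<close>, and by
  \<open>Rst_S\<close> that image is the domain of both sides.\<close>

lemma S_RI: assumes f: "f \<in> Hom A i j" and e: "e \<in> RI A i"
  shows "S (f \<cdot>\<^bsub>A\<^esub> e) = S f \<cdot> far P e"
proof -
  note D = Hom_D[OF f] and eD = A.RI_D[OF e]
  have fe: "f \<cdot>\<^bsub>A\<^esub> e \<in> Hom A i j" using D eD by (simp add: A.Hom_iff)
  note S1 = S[OF f] and S2 = S[OF fe]
  let ?r = "Rst A (f \<cdot>\<^bsub>A\<^esub> e)"
  have r: "?r = Rst A f \<cdot>\<^bsub>A\<^esub> e" using A.Rst_Cmp_RI[OF e, of f] D by simp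
  have rR: "?r \<in> RI A i" using D eD by simp
  note a = A.agree[of f "f \<cdot>\<^bsub>A\<^esub> e"]
  have ag: "?r \<cdot>\<^bsub>A\<^esub> agree A f (f \<cdot>\<^bsub>A\<^esub> e) = ?r"
  proof (rule a(5))
    show "Rst A f \<cdot>\<^bsub>A\<^esub> ?r = ?r" unfolding r using D eD by simp
    show "f \<cdot>\<^bsub>A\<^esub> ?r = f \<cdot>\<^bsub>A\<^esub> e \<cdot>\<^bsub>A\<^esub> ?r"
      unfolding r using D eD A.RI_lcomm[OF e, of "Rst A f" e] A.RI_idem[OF e] by simp
  qed (use D eD rR in auto)
  have aR: "agree A f (f \<cdot>\<^bsub>A\<^esub> e) \<in> RI A i" using a(1) D eD by simp
  have ag': "agree A f (f \<cdot>\<^bsub>A\<^esub> e) \<cdot>\<^bsub>A\<^esub> ?r = ?r" using ag A.RI_comm[OF aR rR] by simp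
  have "S (f \<cdot>\<^bsub>A\<^esub> e) = S (f \<cdot>\<^bsub>A\<^esub> e) \<cdot> far P ?r" using S2(1) Cmp_Rst_self[OF S2(1)] S2(4) by simp
  also have "\<dots> = S (f \<cdot>\<^bsub>A\<^esub> e) \<cdot> (far P (agree A f (f \<cdot>\<^bsub>A\<^esub> e)) \<cdot> far P ?r)"
    using P_RI_Cmp[OF aR rR] ag' by simp
  also have "\<dots> = S f \<cdot> (far P (agree A f (f \<cdot>\<^bsub>A\<^esub> e)) \<cdot> far P ?r)"
    by (rule under2[OF S_agree[OF f fe, symmetric]]) (use S1 S2 RI_D[OF P_RI[OF aR]] RI_D[OF P_RI[OF rR]] in auto)
  also have "\<dots> = S f \<cdot> far P (Rst A f \<cdot>\<^bsub>A\<^esub> e)" using P_RI_Cmp[OF aR rR] ag' r by simp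
  also have "\<dots> = S f \<cdot> (Rst C (S f) \<cdot> far P e)" using P_RI_Cmp[of "Rst A f" i e] D e S1(4) by simp
  also have "\<dots> = S f \<cdot> far P e" by (rule Cmp_Rst_self_Cmp) (use S1 RI_D[OF P_RI[OF e]] in simp_all)
  finally show ?thesis .
qed

text \<open>Equal sections make the transition idempotent as large as both domains.
  Hyperconnectedness reflects this to \<open>A\<close>, where \<open>f\<close> and \<open>g\<close>
  then agree on their full domains.\<close>

lemma S_inj: assumes f: "f \<in> Hom A i j" and g: "g \<in> Hom A i j" and eq: "S f = S g"
  shows "f = g"
proof -
  note D = Hom_D[OF f] and D' = Hom_D[OF g]
  have fg: "Dom A g = Dom A f" "Cod A g = Cod A f" using D D' by simp_all
  note a = A.agree[OF D(1) D'(1) fg]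
  have R: "Rst A f \<in> RI A i" "Rst A g \<in> RI A i" "agree A f g \<in> RI A i" using D D' a(1) by simp_all
  have "far P (agree A f g) = far P (Rst A g)"
    using q_S[OF f g] q_S[OF g g] eq A.agree_self[OF D'(1)] by simp
  then have 1: "agree A f g = Rst A g" by (rule P_RI_inj[OF R(3,2)])
  have "far P (agree A f g) = far P (Rst A f)"
    using q_S[OF g f] q_S[OF f f] eq A.agree_self[OF D(1)] A.agree_sym[OF D(1) D'(1) fg] by simp
  then have 2: "agree A f g = Rst A f" by (rule P_RI_inj[OF R(3,1)])
  have "f = f \<cdot>\<^bsub>A\<^esub> agree A f g" unfolding 2 using D by simp
  also have "\<dots> = g \<cdot>\<^bsub>A\<^esub> agree A f g" by (rule a)
  also have "\<dots> = g" unfolding 1 using D' by simp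
  finally show ?thesis .
qed

lemma S_surj: assumes ij: "i \<in> Obj A" "j \<in> Obj A" and t: "partial_section C (\<sigma> i j) t"
  shows "\<exists>f \<in> Hom A i j. S f = t"
proof -
  note E = \<sigma>[OF ij] and tD = psec_D[OF t \<sigma>(5)[OF ij], unfolded \<sigma>(2)[OF ij]]
  note x = etale_at_section[OF E(1) t, unfolded E(2)]
  \<comment> \<open>The region over which \<open>t\<close> passes through the chart of
    \<open>g\<close>, lifted to an idempotent of \<open>A\<close>.\<close>
  have "\<exists>e. \<forall>g \<in> Hom A i j. e g \<in> RI A i \<and> far P (e g) = q i j g \<cdot> t"
    by (rule bchoice) (use P_RI_surj[OF ij(1) x(2)] in blast)
  then obtain e where e: "\<And>g. g \<in> Hom A i j \<Longrightarrow> e g \<in> RI A i" "\<And>g. g \<in> Hom A i j \<Longrightarrow> far P (e g) = q i j g \<cdot> t" by blast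
  have "Rst C t \<in> RI C (fob P i)" using tD by simp
  then obtain d where d: "d \<in> RI A i" "far P d = Rst C t" using P_RI_surj[OF ij(1)] by blast
  have cC: "cover C (fob P i) (Hom A i j) (\<lambda>g. far P (e g)) (far P d)"
    using etale_cover_section[OF E(1) t] e(2) d(2) E(2) by (auto elim!: cover_cong)
  then have cov: "cover A i (Hom A i j) e d" using P_cover_iff[OF ij(1), of "Hom A i j" e d] e d by simp
  have Se: "S (g \<cdot>\<^bsub>A\<^esub> e g) = t \<cdot> far P (e g)" if g: "g \<in> Hom A i j" for g
    unfolding S_RI[OF g e(1)[OF g]] e(2)[OF g] using x(3)[OF g] by simp
  note eD = A.RI_D[OF e(1)]
  \<comment> \<open>The glueing takes place in \<open>A\<close>, over the lifted cover, so its
    result is an arrow instead of a mere section.\<close>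
  have "\<exists>h \<in> Hom A i j. h \<cdot>\<^bsub>A\<^esub> d = h \<and> (\<forall>g \<in> Hom A i j. h \<cdot>\<^bsub>A\<^esub> e g = g \<cdot>\<^bsub>A\<^esub> e g)"
  proof (rule A.cover_glue[OF cov ij(2)])
    fix g assume g: "g \<in> Hom A i j"
    note D = Hom_D[OF g]
    show gH: "g \<cdot>\<^bsub>A\<^esub> e g \<in> Hom A i j" using D eD[OF g] by (simp add: A.Hom_iff)
    show "g \<cdot>\<^bsub>A\<^esub> e g \<cdot>\<^bsub>A\<^esub> e g = g \<cdot>\<^bsub>A\<^esub> e g" using D eD[OF g] A.RI_idem[OF e(1)[OF g]] by simp
    fix h assume h: "h \<in> Hom A i j"
    note D' = Hom_D[OF h]
    have hH: "h \<cdot>\<^bsub>A\<^esub> e h \<in> Hom A i j" using D' eD[OF h] by (simp add: A.Hom_iff)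
    note PR = RI_D[OF P_RI[OF e(1)[OF g]]] RI_D[OF P_RI[OF e(1)[OF h]]]
    show "g \<cdot>\<^bsub>A\<^esub> e g \<cdot>\<^bsub>A\<^esub> e h = h \<cdot>\<^bsub>A\<^esub> e h \<cdot>\<^bsub>A\<^esub> e g"
    \<comment> \<open>Agreement on overlaps is checked after applying the injective
      \<open>S\<close>, where both sides become the same restriction of \<open>t\<close>.\<close>
    proof (rule S_inj[of _ i j])
      have "S (g \<cdot>\<^bsub>A\<^esub> e g \<cdot>\<^bsub>A\<^esub> e h) = t \<cdot> (far P (e g) \<cdot> far P (e h))"
        unfolding S_RI[OF gH e(1)[OF h]] Se[OF g] using tD PR by simp
      also have "\<dots> = S (h \<cdot>\<^bsub>A\<^esub> e h \<cdot>\<^bsub>A\<^esub> e g)"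
        unfolding S_RI[OF hH e(1)[OF g]] Se[OF h] RI_comm[OF P_RI[OF e(1)[OF g]] P_RI[OF e(1)[OF h]]] using tD PR by simp
      finally show "S (g \<cdot>\<^bsub>A\<^esub> e g \<cdot>\<^bsub>A\<^esub> e h) = S (h \<cdot>\<^bsub>A\<^esub> e h \<cdot>\<^bsub>A\<^esub> e g)" .
    qed (use D D' eD[OF g] eD[OF h] in \<open>auto simp: A.Hom_iff\<close>)
  qed
  then obtain f where f: "f \<in> Hom A i j" "f \<cdot>\<^bsub>A\<^esub> d = f" "\<And>g. g \<in> Hom A i j \<Longrightarrow> f \<cdot>\<^bsub>A\<^esub> e g = g \<cdot>\<^bsub>A\<^esub> e g" by blast
  note SD = S[OF f(1)]
  have "S f \<cdot> far P d = t \<cdot> far P d"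
  proof (rule cover_ext[OF cC])
    fix g assume g: "g \<in> Hom A i j"
    show "S f \<cdot> far P (e g) = t \<cdot> far P (e g)"
      using Se[OF g] f(3)[OF g] S_RI[OF f(1) e(1)[OF g]] by simp
  qed (use SD tD in auto)
  moreover have "S f \<cdot> far P d = S f" using S_RI[OF f(1) d(1)] f(2) by simp
  moreover have "t \<cdot> far P d = t" unfolding d(2) using tD by simp
  ultimately show ?thesis using f(1) by auto
qed

text \<open>By functoriality \<open>far P f\<close> and \<open>far P g\<close> coincide on the image
  of \<open>agree A f g\<close>, which is the transition idempotent of the two charts.\<close>

lemma \<tau>:
  assumes ij: "i \<in> Obj A" "j \<in> Obj A"
  shows "\<tau> i j \<in> Arr C" "Dom C (\<tau> i j) = Dom C (\<sigma> i j)" "Cod C (\<tau> i j) = fob P j" "total C (\<tau> i j)"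
    "\<And>f. f \<in> Hom A i j \<Longrightarrow> \<tau> i j \<cdot> S f = far P f"
proof -
  note E = \<sigma>[OF ij]
  have "\<exists>t \<in> Hom C (Dom C (\<sigma> i j)) (fob P j). \<forall>f \<in> Hom A i j. t \<cdot> S f = far P f"
  proof (rule etale_glue[OF E(1)])
    show "far P f \<in> Hom C (Cod C (\<sigma> i j)) (fob P j)" if "f \<in> Hom A i j" for f using Hom_D[OF that] E(2) by (simp add: Hom_iff)
    show "far P f \<cdot> Rst C (S f) = far P f" if "f \<in> Hom A i j" for f
      using Hom_D[OF that] Rst_S[OF that] P_D(7)[of f] by simp
    fix f g assume f: "f \<in> Hom A i j" and g: "g \<in> Hom A i j"
    note D = Hom_D[OF f] and D' = Hom_D[OF g]
    have a: "agree A f g \<in> RI A i" "f \<cdot>\<^bsub>A\<^esub> agree A f g = g \<cdot>\<^bsub>A\<^esub> agree A f g" using A.agree[of f g] D D' by simp_all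
    show "far P f \<cdot> (q i j g \<cdot> S f) = far P g \<cdot> (q i j g \<cdot> S f)"
      unfolding q_S[OF f g] using arg_cong[OF a(2), of "far P"] P_D(6) D D' A.RI_D[OF a(1)] by simp
  qed (use ij in simp)
  then obtain t where t: "t \<in> Hom C (Dom C (\<sigma> i j)) (fob P j)" "\<And>f. f \<in> Hom A i j \<Longrightarrow> t \<cdot> S f = far P f" by blast
  have "\<tau> i j = t"
    unfolding Psi_tgt_def prod.case
  proof (rule the_equality)
    fix t' assume t': "t' \<in> Hom C (Dom C (\<sigma> i j)) (fob P j) \<and> (\<forall>f\<in>Hom A i j. t' \<cdot> S f = far P f)"
    show "t' = t" by (rule etale_ext[OF E(1)]) (use t t' in \<open>auto simp: Hom_iff\<close>)
  qed (use t in blast)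
  then show T: "\<tau> i j \<in> Arr C" "Dom C (\<tau> i j) = Dom C (\<sigma> i j)" "Cod C (\<tau> i j) = fob P j"
    "\<And>f. f \<in> Hom A i j \<Longrightarrow> \<tau> i j \<cdot> S f = far P f" using t by (auto simp: Hom_iff)
  show "total C (\<tau> i j)"
    by (rule etale_total[OF E(1) T(1,2)]) (use T(4) Rst_S Hom_D P_D(7) in auto)
qed

text \<open>The atlas that glues the pullback has the same index set as the presentation, namely a
  hom-set of \<open>A\<close>, and this is small.\<close>

lemma \<sigma>_pb:
  assumes ij: "i \<in> Obj A" "j \<in> Obj A" and f: "total C f" "Cod C f = fob P i"
  shows "has_pb C (\<sigma> i j) f"
proof (rule etale_has_pb[OF \<sigma>(1)[OF ij] f(1)])
  fix \<phi> assume "local_atlas C (Dom C f) (Hom A i j) \<phi>"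
  then show "\<exists>r q t. glueing C (Dom C f) (Hom A i j) \<phi> r q t"
    using glueing_exists[OF glueings _ Hom_small[OF ij]] f(1) by (auto simp: total_def)
qed (use f \<sigma>[OF ij] in auto)

abbreviation \<mu> where "\<mu> \<equiv> Psi_mul C (A, P)"

text \<open>The object of composable pairs is presented over \<open>fob P i\<close> by sections
  indexed by composable pairs of arrows, so the multiplication is glued from the sections of
  composites and its laws are tested on \<open>?W g f\<close>.\<close>

lemma \<mu>:
  assumes I: "i \<in> Obj A" "j \<in> Obj A" "k \<in> Obj A"
  shows "\<mu> i j k \<in> Arr C" "Dom C (\<mu> i j k) = pbo C (\<sigma> j k) (\<tau> i j)" "Cod C (\<mu> i j k) = Dom C (\<sigma> i k)"
    "\<And>f g. \<lbrakk>f \<in> Hom A i j; g \<in> Hom A j k\<rbrakk> \<Longrightarrow> \<mu> i j k \<cdot> (pull_section C (\<sigma> j k) (\<tau> i j) (S g) \<cdot> S f) = S (g \<cdot>\<^bsub>A\<^esub> f)"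
    "\<sigma> i k \<cdot> \<mu> i j k = \<sigma> i j \<cdot> pr2 C (\<sigma> j k) (\<tau> i j)" "\<tau> i k \<cdot> \<mu> i j k = \<tau> j k \<cdot> pr1 C (\<sigma> j k) (\<tau> i j)"
proof -
  let ?\<sigma> = "\<sigma> j k" and ?\<tau> = "\<tau> i j"
  let ?W = "\<lambda>g f. pull_section C ?\<sigma> ?\<tau> (S g) \<cdot> S f"
  note E1 = \<sigma>[OF I(1,2)] and E2 = \<sigma>[OF I(2,3)] and E3 = \<sigma>[OF I(1,3)]
  note T1 = \<tau>[OF I(1,2)] and T2 = \<tau>[OF I(2,3)] and T3 = \<tau>[OF I(1,3)]
  have pb: "has_pb C ?\<sigma> ?\<tau>" by (rule \<sigma>_pb) (use I T1 in auto)
  note B = pb_D[OF pb]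
  \<comment> \<open>The pulled-back presentation composed with that of \<open>\<sigma> i j\<close>:
    its sections are the maps \<open>?W g f\<close>.\<close>
  note ec = etale_Cmp[OF E1(1) etale_pull[OF E2(1) pb T1(4)]]
  have cd: "Cod C (pr2 C ?\<sigma> ?\<tau>) = Dom C (\<sigma> i j)" using B T1 by simp
  note ec = ec[OF cd]
  have ecD: "Dom C (\<sigma> i j \<cdot> pr2 C ?\<sigma> ?\<tau>) = pbo C ?\<sigma> ?\<tau>" "Cod C (\<sigma> i j \<cdot> pr2 C ?\<sigma> ?\<tau>) = fob P i" using E1 B cd by simp_all
  have W: "?W g f \<in> Arr C" "Dom C (?W g f) = fob P i" "Cod C (?W g f) = pbo C ?\<sigma> ?\<tau>" "Rst C (?W g f) = far P (Rst A (g \<cdot>\<^bsub>A\<^esub> f))"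
    "pr1 C ?\<sigma> ?\<tau> \<cdot> ?W g f = S g \<cdot> far P f" "pr2 C ?\<sigma> ?\<tau> \<cdot> ?W g f = S f \<cdot> far P (Rst A (g \<cdot>\<^bsub>A\<^esub> f))"
    if f: "f \<in> Hom A i j" and g: "g \<in> Hom A j k" for f g
  proof -
    note Sf = S[OF f] and Sg = S[OF g] and fD = Hom_D[OF f] and gD = Hom_D[OF g]
    note p = pull_section[OF pb T1(4) Sg(5)] and Rp = Rst_pull[OF pb E2(4) T1(4) Sg(5)]
    have c: "Cod C (S f) = Dom C ?\<tau>" using Sf T1 by simp
    note pc = pull_Cmp[OF pb T1(4) Sg(5) Sf(1) c]
    show "?W g f \<in> Arr C" "Dom C (?W g f) = fob P i" "Cod C (?W g f) = pbo C ?\<sigma> ?\<tau>" using p Sf T1 by simp_all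
    have R: "Rst C (S g \<cdot> far P f) = far P (Rst A (g \<cdot>\<^bsub>A\<^esub> f))"
    proof -
      have "Rst C (S g \<cdot> far P f) = Rst C (Rst C (S g) \<cdot> far P f)"
        by (rule Rst_Rst_Cmp[symmetric]) (use Sg fD in simp_all)
      also have "\<dots> = Rst C (far P (Rst A g \<cdot>\<^bsub>A\<^esub> f))" unfolding Sg(4) using P_D(6)[of f "Rst A g"] fD gD by simp
      also have "\<dots> = far P (Rst A (Rst A g \<cdot>\<^bsub>A\<^esub> f))" using P_D(7)[of "Rst A g \<cdot>\<^bsub>A\<^esub> f"] fD gD by simp
      finally show ?thesis using fD gD by simp
    qed
    show "Rst C (?W g f) = far P (Rst A (g \<cdot>\<^bsub>A\<^esub> f))"
    proof -
      have "Rst C (?W g f) = Rst C (Rst C (S g \<cdot> ?\<tau>) \<cdot> S f)" unfolding Rp(1)[symmetric] using p c Sf by simp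
      also have "\<dots> = Rst C (S g \<cdot> (?\<tau> \<cdot> S f))" using Sg Sf T1 c by simp
      finally show ?thesis using R T1(5)[OF f] by simp
    qed
    show "pr1 C ?\<sigma> ?\<tau> \<cdot> ?W g f = S g \<cdot> far P f" "pr2 C ?\<sigma> ?\<tau> \<cdot> ?W g f = S f \<cdot> far P (Rst A (g \<cdot>\<^bsub>A\<^esub> f))"
      using pc R T1(5)[OF f] by simp_all
  qed
  have gf: "g \<cdot>\<^bsub>A\<^esub> f \<in> Hom A i k" if "f \<in> Hom A i j" "g \<in> Hom A j k" for f g using that by (rule A.Cmp_in)
  have "\<exists>m \<in> Hom C (Dom C (\<sigma> i j \<cdot> pr2 C ?\<sigma> ?\<tau>)) (Dom C (\<sigma> i k)).
    \<forall>x \<in> Hom A i j \<times> Hom A j k. m \<cdot> (case x of (f, g) \<Rightarrow> ?W g f) = (case x of (f, g) \<Rightarrow> S (g \<cdot>\<^bsub>A\<^esub> f))"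
  proof (rule etale_glue[OF ec])
    show "Dom C (\<sigma> i k) \<in> Obj C" using E3 by simp
    show "(case x of (f, g) \<Rightarrow> S (g \<cdot>\<^bsub>A\<^esub> f)) \<in> Hom C (Cod C (\<sigma> i j \<cdot> pr2 C ?\<sigma> ?\<tau>)) (Dom C (\<sigma> i k))"
      if "x \<in> Hom A i j \<times> Hom A j k" for x
      using that S[OF gf] ecD by (auto simp: Hom_iff)
    show "(case x of (f, g) \<Rightarrow> S (g \<cdot>\<^bsub>A\<^esub> f)) \<cdot> Rst C (case x of (f, g) \<Rightarrow> ?W g f) = (case x of (f, g) \<Rightarrow> S (g \<cdot>\<^bsub>A\<^esub> f))"
      if x0: "x \<in> Hom A i j \<times> Hom A j k" for x
    proof -
      obtain f g where x: "x = (f, g)" "f \<in> Hom A i j" "g \<in> Hom A j k" using x0 by auto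
      have "S (g \<cdot>\<^bsub>A\<^esub> f) \<cdot> Rst C (S (g \<cdot>\<^bsub>A\<^esub> f)) = S (g \<cdot>\<^bsub>A\<^esub> f)"
        by (rule Cmp_Rst_self[OF S(1)[OF gf[OF x(2,3)]]])
      then show ?thesis using W(4)[OF x(2,3)] S(4)[OF gf[OF x(2,3)]] x by simp
    qed
    fix x y assume "x \<in> Hom A i j \<times> Hom A j k" "y \<in> Hom A i j \<times> Hom A j k"
    then obtain f g f' g' where x: "x = (f, g)" and f: "f \<in> Hom A i j" and g: "g \<in> Hom A j k"
      and y: "y = (f', g')" and f': "f' \<in> Hom A i j" and g': "g' \<in> Hom A j k" by auto
    note fD = Hom_D[OF f] and gD = Hom_D[OF g] and f'D = Hom_D[OF f'] and g'D = Hom_D[OF g']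
    note Sf = S[OF f] and Sg = S[OF g]
    let ?a = "agree A f f'" and ?b = "agree A g g'"
    have a: "?a \<in> RI A i" "f \<cdot>\<^bsub>A\<^esub> ?a = f' \<cdot>\<^bsub>A\<^esub> ?a" using A.agree[of f f'] fD f'D by simp_all
    have b: "?b \<in> RI A j" "g \<cdot>\<^bsub>A\<^esub> ?b = g' \<cdot>\<^bsub>A\<^esub> ?b" using A.agree[of g g'] gD g'D by simp_all
    note aD = A.RI_D[OF a(1)] and bD = A.RI_D[OF b(1)]
    let ?r = "Rst A (?b \<cdot>\<^bsub>A\<^esub> f)"
    have r: "?r \<in> RI A i" using fD bD by simp
    note rD = A.RI_D[OF r]
    have c: "?a \<cdot>\<^bsub>A\<^esub> ?r \<in> RI A i" by (rule A.RI_Cmp[OF a(1) r])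
    \<comment> \<open>The transition idempotent between the pairs \<open>(f, g)\<close> and
      \<open>(f', g')\<close> is computed as the region where \<open>f\<close> agrees with
      \<open>f'\<close> and the value of \<open>f\<close> lies where \<open>g\<close> agrees with
      \<open>g'\<close>. There the two composites coincide.\<close>
    have "q i j f' \<cdot> (pr2 C ?\<sigma> ?\<tau> \<cdot> Rst C (q j k g' \<cdot> pr1 C ?\<sigma> ?\<tau>)) \<cdot> ?W g f =
      q i j f' \<cdot> (pr2 C ?\<sigma> ?\<tau> \<cdot> Rst C (q j k g' \<cdot> pr1 C ?\<sigma> ?\<tau>) \<cdot> pull_section C ?\<sigma> ?\<tau> (S g)) \<cdot> S f"
      using etale_D(3-8)[OF E1(1)] etale_D(3-8)[OF E2(1)] f' g' B Sf Sg cd T1 pull_section[OF pb T1(4) Sg(5)] by simp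
    also have "\<dots> = q i j f' \<cdot> (Rst C (far P ?b \<cdot> ?\<tau>) \<cdot> S f)"
      unfolding etale_pull_at_section[OF E2(1) pb T1(4) Sg(5) g'] q_S[OF g g']
      using etale_D(3-8)[OF E1(1)] f' bD Sf T1 gD by simp
    also have "Rst C (far P ?b \<cdot> ?\<tau>) \<cdot> S f = S f \<cdot> far P ?r"
    proof -
      have "Rst C (far P ?b \<cdot> ?\<tau>) \<cdot> S f = S f \<cdot> Rst C (far P ?b \<cdot> (?\<tau> \<cdot> S f))"
        using Rst_slide[of "S f" "far P ?b \<cdot> ?\<tau>"] bD Sf T1 gD by simp
      also have "far P ?b \<cdot> (?\<tau> \<cdot> S f) = far P (?b \<cdot>\<^bsub>A\<^esub> f)" using T1(5)[OF f] P_D(6)[of f ?b] fD bD by simp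
      finally show ?thesis using P_D(7)[of "?b \<cdot>\<^bsub>A\<^esub> f"] fD bD by simp
    qed
    also have "q i j f' \<cdot> (S f \<cdot> far P ?r) = far P ?a \<cdot> far P ?r"
      by (rule under[OF q_S[OF f f']]) (use etale_D(3-8)[OF E1(1)] f' Sf rD in auto)
    also have "\<dots> = far P (?a \<cdot>\<^bsub>A\<^esub> ?r)" using P_RI_Cmp[OF a(1) r] by simp
    finally have Q: "q i j f' \<cdot> (pr2 C ?\<sigma> ?\<tau> \<cdot> Rst C (q j k g' \<cdot> pr1 C ?\<sigma> ?\<tau>)) \<cdot> ?W g f = far P (?a \<cdot>\<^bsub>A\<^esub> ?r)" .
    have fc: "f \<cdot>\<^bsub>A\<^esub> (?a \<cdot>\<^bsub>A\<^esub> ?r) = ?b \<cdot>\<^bsub>A\<^esub> (f \<cdot>\<^bsub>A\<^esub> ?a)"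
    proof -
      have "f \<cdot>\<^bsub>A\<^esub> (?a \<cdot>\<^bsub>A\<^esub> ?r) = f \<cdot>\<^bsub>A\<^esub> ?r \<cdot>\<^bsub>A\<^esub> ?a" using A.RI_comm[OF a(1) r] fD aD rD by simp
      also have "f \<cdot>\<^bsub>A\<^esub> ?r = ?b \<cdot>\<^bsub>A\<^esub> f" using A.RI_slide[OF b(1), of f] fD by simp
      finally show ?thesis using fD bD aD by simp
    qed
    have f'c: "f' \<cdot>\<^bsub>A\<^esub> (?a \<cdot>\<^bsub>A\<^esub> ?r) = f \<cdot>\<^bsub>A\<^esub> (?a \<cdot>\<^bsub>A\<^esub> ?r)"
      by (rule A.under2[OF a(2)[symmetric]]) (use fD f'D aD rD in auto)
    have "g \<cdot>\<^bsub>A\<^esub> (f \<cdot>\<^bsub>A\<^esub> (?a \<cdot>\<^bsub>A\<^esub> ?r)) = g' \<cdot>\<^bsub>A\<^esub> (f' \<cdot>\<^bsub>A\<^esub> (?a \<cdot>\<^bsub>A\<^esub> ?r))"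
      unfolding f'c fc by (rule A.under2[OF b(2)]) (use fD gD g'D aD bD in auto)
    then have "S (g \<cdot>\<^bsub>A\<^esub> f \<cdot>\<^bsub>A\<^esub> (?a \<cdot>\<^bsub>A\<^esub> ?r)) = S (g' \<cdot>\<^bsub>A\<^esub> f' \<cdot>\<^bsub>A\<^esub> (?a \<cdot>\<^bsub>A\<^esub> ?r))"
      using fD gD f'D g'D aD rD by simp
    then have "S (g \<cdot>\<^bsub>A\<^esub> f) \<cdot> far P (?a \<cdot>\<^bsub>A\<^esub> ?r) = S (g' \<cdot>\<^bsub>A\<^esub> f') \<cdot> far P (?a \<cdot>\<^bsub>A\<^esub> ?r)"
      unfolding S_RI[OF gf[OF f g] c] S_RI[OF gf[OF f' g'] c] .
    then show "(case x of (f, g) \<Rightarrow> S (g \<cdot>\<^bsub>A\<^esub> f)) \<cdot> ((case y of (i', j') \<Rightarrow> q i j i' \<cdot> (pr2 C ?\<sigma> ?\<tau> \<cdot> Rst C (q j k j' \<cdot> pr1 C ?\<sigma> ?\<tau>))) \<cdot> (case x of (f, g) \<Rightarrow> ?W g f)) =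
      (case y of (f, g) \<Rightarrow> S (g \<cdot>\<^bsub>A\<^esub> f)) \<cdot> ((case y of (i', j') \<Rightarrow> q i j i' \<cdot> (pr2 C ?\<sigma> ?\<tau> \<cdot> Rst C (q j k j' \<cdot> pr1 C ?\<sigma> ?\<tau>))) \<cdot> (case x of (f, g) \<Rightarrow> ?W g f))"
      unfolding x y prod.case Q .
  qed
  then obtain m where m: "m \<in> Hom C (pbo C ?\<sigma> ?\<tau>) (Dom C (\<sigma> i k))"
    "\<And>f g. \<lbrakk>f \<in> Hom A i j; g \<in> Hom A j k\<rbrakk> \<Longrightarrow> m \<cdot> ?W g f = S (g \<cdot>\<^bsub>A\<^esub> f)"
    unfolding ecD by force
  have mA: "m \<cdot> pull_section C ?\<sigma> ?\<tau> (S g) \<cdot> S f = m \<cdot> ?W g f"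
    if "m \<in> Hom C (pbo C ?\<sigma> ?\<tau>) (Dom C (\<sigma> i k))" "f \<in> Hom A i j" "g \<in> Hom A j k" for m f g
    using that pull_section[OF pb T1(4) S(5)[OF that(3)]] S[OF that(2)] T1 by (simp add: Hom_iff)
  have eqI: "h = h'" if h: "h \<in> Arr C" "h' \<in> Arr C" "Dom C h = pbo C ?\<sigma> ?\<tau>" "Dom C h' = pbo C ?\<sigma> ?\<tau>" "Cod C h = Cod C h'"
    and eq: "\<And>f g. \<lbrakk>f \<in> Hom A i j; g \<in> Hom A j k\<rbrakk> \<Longrightarrow> h \<cdot> ?W g f = h' \<cdot> ?W g f" for h h'
    by (rule etale_ext[OF ec]) (use h eq ecD in auto)
  have "\<mu> i j k = m"
    unfolding Psi_mul_def Let_def fst_conv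
  proof (rule the_equality)
    fix m' assume m': "m' \<in> Hom C (pbo C ?\<sigma> ?\<tau>) (Dom C (\<sigma> i k)) \<and>
      (\<forall>f\<in>Hom A i j. \<forall>g\<in>Hom A j k. m' \<cdot> pull_section C ?\<sigma> ?\<tau> (S g) \<cdot> S f = S (g \<cdot>\<^bsub>A\<^esub> f))"
    show "m' = m"
    proof (rule eqI)
      fix f g assume fg: "f \<in> Hom A i j" "g \<in> Hom A j k"
      have "m' \<cdot> pull_section C ?\<sigma> ?\<tau> (S g) \<cdot> S f = S (g \<cdot>\<^bsub>A\<^esub> f)" using m' fg by blast
      then show "m' \<cdot> ?W g f = m \<cdot> ?W g f" using mA[OF _ fg] m' m(2)[OF fg] by simp
    qed (use m m' in \<open>auto simp: Hom_iff\<close>)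
  next
    show "m \<in> Hom C (pbo C ?\<sigma> ?\<tau>) (Dom C (\<sigma> i k)) \<and>
      (\<forall>f\<in>Hom A i j. \<forall>g\<in>Hom A j k. m \<cdot> pull_section C ?\<sigma> ?\<tau> (S g) \<cdot> S f = S (g \<cdot>\<^bsub>A\<^esub> f))"
      using m mA[OF m(1)] by simp
  qed
  then show M: "\<mu> i j k \<in> Arr C" "Dom C (\<mu> i j k) = pbo C (\<sigma> j k) (\<tau> i j)" "Cod C (\<mu> i j k) = Dom C (\<sigma> i k)"
    "\<And>f g. \<lbrakk>f \<in> Hom A i j; g \<in> Hom A j k\<rbrakk> \<Longrightarrow> \<mu> i j k \<cdot> ?W g f = S (g \<cdot>\<^bsub>A\<^esub> f)"
    using m by (auto simp: Hom_iff)
  show "\<sigma> i k \<cdot> \<mu> i j k = \<sigma> i j \<cdot> pr2 C ?\<sigma> ?\<tau>"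
  proof (rule eqI)
    fix f g assume f: "f \<in> Hom A i j" and g: "g \<in> Hom A j k"
    note w = W[OF f g] and fD = Hom_D[OF f] and gD = Hom_D[OF g]
    have "\<sigma> i k \<cdot> \<mu> i j k \<cdot> ?W g f = far P (Rst A (g \<cdot>\<^bsub>A\<^esub> f))"
      using M(1-3) M(4)[OF f g] w E3 psec_D(4)[OF S(5)[OF gf[OF f g]] E3(5)] S(4)[OF gf[OF f g]] by simp
    moreover have "\<sigma> i j \<cdot> (S f \<cdot> far P (Rst A (g \<cdot>\<^bsub>A\<^esub> f))) = far P (Rst A f) \<cdot> far P (Rst A (g \<cdot>\<^bsub>A\<^esub> f))"
      unfolding S(4)[OF f, symmetric]
      by (rule under[OF psec_D(4)[OF S(5)[OF f] E1(5)]]) (use S[OF f] E1 fD gD in auto)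
    moreover have "far P (Rst A f) \<cdot> far P (Rst A (g \<cdot>\<^bsub>A\<^esub> f)) = far P (Rst A (g \<cdot>\<^bsub>A\<^esub> f))"
      using P_RI_Cmp[of "Rst A f" i "Rst A (g \<cdot>\<^bsub>A\<^esub> f)"] fD gD by simp
    ultimately show "\<sigma> i k \<cdot> \<mu> i j k \<cdot> ?W g f = \<sigma> i j \<cdot> pr2 C ?\<sigma> ?\<tau> \<cdot> ?W g f"
      using w E1 B cd by simp
  qed (use M E1 E3 B cd in auto)
  show "\<tau> i k \<cdot> \<mu> i j k = \<tau> j k \<cdot> pr1 C ?\<sigma> ?\<tau>"
  proof (rule eqI)
    fix f g assume f: "f \<in> Hom A i j" and g: "g \<in> Hom A j k"
    note w = W[OF f g] and fD = Hom_D[OF f] and gD = Hom_D[OF g]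
    have "\<tau> i k \<cdot> \<mu> i j k \<cdot> ?W g f = far P g \<cdot> far P f"
      using M(1-3) M(4)[OF f g] w T3 P_D(6)[of f g] fD gD gf[OF f g] by simp
    moreover have "\<tau> j k \<cdot> (S g \<cdot> far P f) = far P g \<cdot> far P f"
      by (rule under[OF T2(5)[OF g]]) (use S[OF g] T2 fD gD in auto)
    ultimately show "\<tau> i k \<cdot> \<mu> i j k \<cdot> ?W g f = \<tau> j k \<cdot> pr1 C ?\<sigma> ?\<tau> \<cdot> ?W g f"
      using w T2 B by simp
  qed (use M T2 T3 E2 B in auto)
qed

end

lemma Psi_obj_simps [simp]:
  "Cpt (Psi_obj C X) = Obj (fst X)" "P0 (Psi_obj C X) = fob (snd X)" "P1 (Psi_obj C X) i j = Dom C (Psi_sor C X i j)"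
  "sor (Psi_obj C X) = Psi_sor C X" "tgt (Psi_obj C X) = Psi_tgt C X" "unt (Psi_obj C X) i = Psi_sec C X (Ide (fst X) i)"
  "mul (Psi_obj C X) = Psi_mul C X"
  by (auto simp: Psi_obj_def)

context pcat_structure
begin

text \<open>Converse to the extraction of laws: all three internal equations are between maps out of
  domains of local homeomorphisms or their pullbacks, where sections detect equality.\<close>

lemma source_etaleI:
  assumes unit_right: "\<And>i j t. \<lbrakk>i \<in> Cpt A; j \<in> Cpt A; sec i j t\<rbrakk> \<Longrightarrow> scomp C A i i j t (unt A i) = t"
    and unit_left: "\<And>i j s. \<lbrakk>i \<in> Cpt A; j \<in> Cpt A; sec i j s\<rbrakk> \<Longrightarrow> scomp C A i j j (unt A j) s = s"
    and assoc: "\<And>i j k l s t u. \<lbrakk>i \<in> Cpt A; j \<in> Cpt A; k \<in> Cpt A; l \<in> Cpt A; sec i j s; sec j k t; sec k l u\<rbrakk> \<Longrightarrow>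
      scomp C A i k l u (scomp C A i j k t s) = scomp C A i j l (scomp C A j k l u t) s"
  shows "source_etale C A"
proof -
  have right: "mul A i i j \<cdot> pairing C (sor A i j) (tgt A i i) (Ide C (P1 A i j)) (unt A i \<cdot> sor A i j) = Ide C (P1 A i j)"
    if ij: "i \<in> Cpt A" "j \<in> Cpt A" for i j
  proof (rule local_homeo_ext[OF sor(5)[OF ij]])
    note R = unit_right_at_section[OF ij]
    fix t assume t: "sec i j t"
    note tD = sec_D[OF ij t]
    show "mul A i i j \<cdot> pairing C (sor A i j) (tgt A i i) (Ide C (P1 A i j)) (unt A i \<cdot> sor A i j) \<cdot> t = Ide C (P1 A i j) \<cdot> t"
      using R(1-3) R(4)[OF t, of "Ide C (P0 A i)"] unit_right[OF ij t] tD ij by simp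
  qed (use unit_right_at_section(1-3)[OF ij] ij in auto)
  have left: "mul A i j j \<cdot> pairing C (sor A j j) (tgt A i j) (unt A j \<cdot> tgt A i j) (Ide C (P1 A i j)) = Ide C (P1 A i j)"
    if ij: "i \<in> Cpt A" "j \<in> Cpt A" for i j
  proof (rule local_homeo_ext[OF sor(5)[OF ij]])
    note R = unit_left_at_section[OF ij]
    fix s assume s: "sec i j s"
    note sD = sec_D[OF ij s]
    have "Rst C (tgt A i j \<cdot> s) = Rst C s" using Rst_total_Cmp sD ij by simp
    then show "mul A i j j \<cdot> pairing C (sor A j j) (tgt A i j) (unt A j \<cdot> tgt A i j) (Ide C (P1 A i j)) \<cdot> s = Ide C (P1 A i j) \<cdot> s"
      using R(1-3) R(4)[OF s, of "Ide C (P0 A j)"] unit_left[OF ij s] sD ij by simp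
  qed (use unit_left_at_section(1-3)[OF ij] ij in auto)
  have ass: "mul A i k l \<cdot> pairing C (sor A k l) (tgt A i k)
       (pr1 C (sor A k l) (tgt A j k \<cdot> pr1 C (sor A j k) (tgt A i j)))
       (mul A i j k \<cdot> pr2 C (sor A k l) (tgt A j k \<cdot> pr1 C (sor A j k) (tgt A i j))) =
     mul A i j l \<cdot> pairing C (sor A j l) (tgt A i j)
       (mul A j k l \<cdot> pairing C (sor A k l) (tgt A j k)
         (pr1 C (sor A k l) (tgt A j k \<cdot> pr1 C (sor A j k) (tgt A i j)))
         (pr1 C (sor A j k) (tgt A i j) \<cdot> pr2 C (sor A k l) (tgt A j k \<cdot> pr1 C (sor A j k) (tgt A i j))))
       (pr2 C (sor A j k) (tgt A i j) \<cdot> pr2 C (sor A k l) (tgt A j k \<cdot> pr1 C (sor A j k) (tgt A i j)))"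
    (is "_ \<cdot> ?om = _ \<cdot> ?mo")
    if I: "i \<in> Cpt A" "j \<in> Cpt A" "k \<in> Cpt A" "l \<in> Cpt A" for i j k l
  proof -
    note L = assoc_at_sections[OF I]
    note L1 = L(1,2)[unfolded Hom_iff]
    let ?f = "tgt A j k \<cdot> pr1 C (sor A j k) (tgt A i j)"
    have pb: "has_pb C (sor A j k) (tgt A i j)" using I by simp
    show ?thesis
    \<comment> \<open>Three nested tests, on \<open>u\<close>, \<open>t\<close> and
      \<open>s\<close>, follow the bracketing of the triple pullback.\<close>
    proof (rule pull_ext[OF sor(5)[OF I(3,4)] L(4,3)])
      fix u assume u: "sec k l u"
      let ?u = "pull_section C (sor A k l) ?f u"
      note U = pull_section[OF L(4,3) u, unfolded L(5)]
      show "mul A i k l \<cdot> ?om \<cdot> ?u = mul A i j l \<cdot> ?mo \<cdot> ?u"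
      proof (rule pull_ext[OF sor(5)[OF I(2,3)] pb tgt(4)[OF I(1,2)]])
        fix t assume t: "sec j k t"
        let ?t = "pull_section C (sor A j k) (tgt A i j) t"
        note T = pull_section[OF pb tgt(4)[OF I(1,2)] t]
        show "mul A i k l \<cdot> ?om \<cdot> ?u \<cdot> ?t = mul A i j l \<cdot> ?mo \<cdot> ?u \<cdot> ?t"
        proof (rule local_homeo_ext[OF sor(5)[OF I(1,2)]])
          fix s assume s: "sec i j s"
          have "mul A i k l \<cdot> (?om \<cdot> (?u \<cdot> (?t \<cdot> s))) = mul A i j l \<cdot> (?mo \<cdot> (?u \<cdot> (?t \<cdot> s)))"
            using L(7,8)[OF s t u] assoc[OF I s t u] by simp
          then show "mul A i k l \<cdot> ?om \<cdot> ?u \<cdot> ?t \<cdot> s = mul A i j l \<cdot> ?mo \<cdot> ?u \<cdot> ?t \<cdot> s"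
            using L1 U(1-3) T(1-3) sec_D[OF I(1,2) s] I by simp
        qed (use L1 U(1-3) T(1-3) I in auto)
      qed (use L1 U(1-3) I in auto)
    qed (use L1 I in auto)
  qed
  show ?thesis
    unfolding source_etale_def pcategory_def Let_def
  proof (intro conjI ballI allI impI)
    fix i j f assume ij: "i \<in> Cpt A" "j \<in> Cpt A" and "total C f \<and> Cod C f = P0 A i"
    then have "is_pullback C (sor A i j) f (pr1 C (sor A i j) f) (pr2 C (sor A i j) f)"
      using sor_pb[OF ij, of f] by (simp add: has_pb_def)
    then show "\<exists>p q. is_pullback C (sor A i j) f p q" by blast
  qed (use right left ass mul_sor_tgt in \<open>auto simp: Hom_iff\<close>)
qed

end

context jr_object
begin

lemma Ide_Hom: "i \<in> Obj A \<Longrightarrow> Ide A i \<in> Hom A i i"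
  by (rule A.Ide_in)

lemma pcat_structure_Psi: "pcat_structure C (Psi_obj C (A, P))"
proof (intro pcat_structure.intro join_restriction_category_axioms pcat_structure_axioms.intro)
  show "is_pcat_structure C (Psi_obj C (A, P))"
    unfolding is_pcat_structure_def Psi_obj_simps fst_conv snd_conv
  proof (intro conjI ballI allI impI)
    fix i assume i: "i \<in> Obj A"
    note Si = S[OF Ide_Hom[OF i]]
    show "fob P i \<in> Obj C" using i by simp
    show "S (Ide A i) \<in> Hom C (fob P i) (Dom C (\<sigma> i i))" using Si by (simp add: Hom_iff)
    show "\<sigma> i i \<cdot> S (Ide A i) = Ide C (fob P i)"
      using psec_D(4)[OF Si(5) \<sigma>(5)[OF i i]] Si(4) i by simp
    show "\<tau> i i \<cdot> S (Ide A i) = Ide C (fob P i)" using \<tau>(5)[OF i i Ide_Hom[OF i]] i by simp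
    fix j assume j: "j \<in> Obj A"
    note E = \<sigma>[OF i j] and T = \<tau>[OF i j]
    show "Dom C (\<sigma> i j) \<in> Obj C" "\<sigma> i j \<in> Hom C (Dom C (\<sigma> i j)) (fob P i)" "total C (\<sigma> i j)" "local_homeo C (\<sigma> i j)"
      "\<tau> i j \<in> Hom C (Dom C (\<sigma> i j)) (fob P j)" "total C (\<tau> i j)"
      using E T by (auto simp: Hom_iff)
    show "has_pb C (\<sigma> i j) f" if "total C f \<and> Cod C f = fob P i" for f using \<sigma>_pb[OF i j] that by simp
    fix k assume k: "k \<in> Obj A"
    note M = \<mu>[OF i j k]
    show "\<mu> i j k \<in> Hom C (pbo C (\<sigma> j k) (\<tau> i j)) (Dom C (\<sigma> i k))" using M by (simp add: Hom_iff)
    show "\<sigma> i k \<cdot> \<mu> i j k = \<sigma> i j \<cdot> pr2 C (\<sigma> j k) (\<tau> i j)" by (rule M)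
    show "\<tau> i k \<cdot> \<mu> i j k = \<tau> j k \<cdot> pr1 C (\<sigma> j k) (\<tau> i j)" by (rule M)
  qed
qed

lemma scomp_S:
  assumes f: "f \<in> Hom A i j" and g: "g \<in> Hom A j k"
  shows "scomp C (Psi_obj C (A, P)) i j k (S g) (S f) = S (g \<cdot>\<^bsub>A\<^esub> f)"
proof -
  interpret pcat_structure C "Psi_obj C (A, P)" by (rule pcat_structure_Psi)
  note D = Hom_D[OF f] and D' = Hom_D[OF g]
  show ?thesis using scomp_eq[of i j k "S f" "S g"] S(5)[OF f] S(5)[OF g] \<mu>(4)[OF _ _ _ f g] D D' by simp
qed

text \<open>By \<open>S_surj\<close> every partial section has the form \<open>S f\<close>, and
  \<open>scomp_S\<close> turns the laws on sections into the category laws of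
  \<open>A\<close>.\<close>

lemma source_etale_Psi: "source_etale C (Psi_obj C (A, P))"
proof -
  interpret B: pcat_structure C "Psi_obj C (A, P)" by (rule pcat_structure_Psi)
  have sec: "\<exists>f \<in> Hom A i j. S f = t" if "i \<in> Obj A" "j \<in> Obj A" "partial_section C (\<sigma> i j) t" for i j t
    using S_surj that by simp
  show ?thesis
  proof (rule B.source_etaleI; unfold Psi_obj_simps fst_conv)
    fix i j t assume ij: "i \<in> Obj A" "j \<in> Obj A" and "partial_section C (\<sigma> i j) t"
    then obtain f where f: "f \<in> Hom A i j" "t = S f" using sec by blast
    note fD = Hom_D[OF f(1)]
    show "scomp C (Psi_obj C (A, P)) i i j t (S (Ide A i)) = t" 
      unfolding f(2) scomp_S[OF Ide_Hom[OF ij(1)] f(1)] using fD by simp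
    show "scomp C (Psi_obj C (A, P)) i j j (S (Ide A j)) t = t"
      unfolding f(2) scomp_S[OF f(1) Ide_Hom[OF ij(2)]] using fD by simp
    fix k l u v assume kl: "k \<in> Obj A" "l \<in> Obj A" and "partial_section C (\<sigma> j k) u" "partial_section C (\<sigma> k l) v"
    then obtain g h where g: "g \<in> Hom A j k" "u = S g" and h: "h \<in> Hom A k l" "v = S h" using sec ij by metis
    note gD = Hom_D[OF g(1)] and hD = Hom_D[OF h(1)]
    show "scomp C (Psi_obj C (A, P)) i k l v (scomp C (Psi_obj C (A, P)) i j k u t) =
      scomp C (Psi_obj C (A, P)) i j l (scomp C (Psi_obj C (A, P)) j k l v u) t"
      unfolding f(2) g(2) h(2) scomp_S[OF f(1) g(1)] scomp_S[OF g(1) h(1)]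
        scomp_S[OF A.Cmp_in[OF f(1) g(1)] h(1)] scomp_S[OF f(1) A.Cmp_in[OF g(1) h(1)]]
      using fD gD hD by simp
  qed
qed

end

text \<open>The type of \<^const>\<open>Psi_unit\<close> fixes the type of the arrows.\<close>

locale jr_object_triples = jr_object C K A P
  for C :: "('o,'m) rcat" (structure) and K :: "'k set" and A :: "('i, 'i \<times> 'i \<times> 'm) rcat" and P
begin

lemma Psi_unit_simps:
  "JSrc (Psi_unit C (A, P)) = (A, P)" "JTrg (Psi_unit C (A, P)) = Phi_obj C (Psi_obj C (A, P))"
  "i \<in> Obj A \<Longrightarrow> fob (JF (Psi_unit C (A, P))) i = i"
  "f \<in> Arr A \<Longrightarrow> far (JF (Psi_unit C (A, P))) f = (Dom A f, Cod A f, S f)"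
  "i \<in> Obj A \<Longrightarrow> Jnt (Psi_unit C (A, P)) i = Ide C (fob P i)"
  "fob (JF (Psi_unit C (A, P))) \<in> extensional (Obj A)" "far (JF (Psi_unit C (A, P))) \<in> extensional (Arr A)"
  "Jnt (Psi_unit C (A, P)) \<in> extensional (Obj A)"
  by (auto simp: Psi_unit_def Let_def)

lemma is_jr_mor_unit: "is_jr_mor C (Psi_unit C (A, P))"
proof -
  interpret B: etale_pcat C "Psi_obj C (A, P)" by (rule etale_pcatI[OF source_etale_Psi])
  note U = Psi_unit_simps
  have H: "f \<in> Hom A (Dom A f) (Cod A f)" if "f \<in> Arr A" for f using that by (simp add: A.Hom_iff)
  show ?thesis
  proof (rule is_jr_morI; unfold U(1,2) Phi_obj_simps fst_conv snd_conv)
    show "restriction_functor A (Phi_cat C (Psi_obj C (A, P))) (JF (Psi_unit C (A, P)))"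
    proof (rule restriction_functorI)
      fix f assume f: "f \<in> Arr A"
      note SD = S[OF H[OF f]]
      show "far (JF (Psi_unit C (A, P))) f \<in> Arr (Phi_cat C (Psi_obj C (A, P)))" using U(4)[OF f] SD f by simp
      show "Dom (Phi_cat C (Psi_obj C (A, P))) (far (JF (Psi_unit C (A, P))) f) = fob (JF (Psi_unit C (A, P))) (Dom A f)"
        "Cod (Phi_cat C (Psi_obj C (A, P))) (far (JF (Psi_unit C (A, P))) f) = fob (JF (Psi_unit C (A, P))) (Cod A f)"
        using U(3,4) f by simp_all
      have "S (Rst A f) = S (Ide A (Dom A f)) \<cdot> far P (Rst A f)"
        using S_RI[OF Ide_Hom[of "Dom A f"], of "Rst A f"] f by simp
      then show "far (JF (Psi_unit C (A, P))) (Rst A f) = Rst (Phi_cat C (Psi_obj C (A, P))) (far (JF (Psi_unit C (A, P))) f)"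
        using U(4)[of f] U(4)[of "Rst A f"] f SD(4) by simp
      fix g assume g: "g \<in> Arr A" "Dom A g = Cod A f"
      have "g \<in> Hom A (Cod A f) (Cod A g)" using g by (simp add: A.Hom_iff)
      then show "far (JF (Psi_unit C (A, P))) (g \<cdot>\<^bsub>A\<^esub> f) =
        far (JF (Psi_unit C (A, P))) g \<cdot>\<^bsub>Phi_cat C (Psi_obj C (A, P))\<^esub> far (JF (Psi_unit C (A, P))) f"
        using U(4)[of f] U(4)[of g] U(4)[of "g \<cdot>\<^bsub>A\<^esub> f"] f g scomp_S[OF H[OF f]] by simp
    qed (use U(3,4) in auto)
    show "far P f \<cdot> Jnt (Psi_unit C (A, P)) (Dom A f) =
        Jnt (Psi_unit C (A, P)) (Cod A f) \<cdot> far (Phi_proj C (Psi_obj C (A, P))) (far (JF (Psi_unit C (A, P))) f)" if f: "f \<in> Arr A" for f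
      using U(4,5) f \<tau>(5)[OF _ _ H[OF f]] by simp
  qed (use U in auto)
qed

lemma Psi_unit_bij: "bij_betw (far (JF (Psi_unit C (A, P)))) (Arr A) (Arr (Phi_cat C (Psi_obj C (A, P))))"
  unfolding bij_betw_def
proof (intro conjI)
  note U = Psi_unit_simps
  show "inj_on (far (JF (Psi_unit C (A, P)))) (Arr A)"
  proof (rule inj_onI)
    fix f g assume fg: "f \<in> Arr A" "g \<in> Arr A" and "far (JF (Psi_unit C (A, P))) f = far (JF (Psi_unit C (A, P))) g"
    then have "Dom A f = Dom A g" "Cod A f = Cod A g" "S f = S g" using U(4) by auto
    then show "f = g" using fg S_inj[of f "Dom A g" "Cod A g" g] by (simp add: A.Hom_iff)
  qed
  show "far (JF (Psi_unit C (A, P))) ` Arr A = Arr (Phi_cat C (Psi_obj C (A, P)))"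
  proof (intro set_eqI iffI)
    fix x assume "x \<in> far (JF (Psi_unit C (A, P))) ` Arr A"
    then obtain f where f: "f \<in> Arr A" "x = (Dom A f, Cod A f, S f)" using U(4) by auto
    then show "x \<in> Arr (Phi_cat C (Psi_obj C (A, P)))" using S(5)[of f "Dom A f" "Cod A f"] by (simp add: A.Hom_iff)
  next
    fix x assume "x \<in> Arr (Phi_cat C (Psi_obj C (A, P)))"
    then obtain i j t where x: "x = (i, j, t)" "i \<in> Obj A" "j \<in> Obj A" "partial_section C (\<sigma> i j) t" by (cases x) auto
    then obtain f where f: "f \<in> Hom A i j" "S f = t" using S_surj by blast
    then show "x \<in> far (JF (Psi_unit C (A, P))) ` Arr A" using x U(4)[of f] by (intro image_eqI[of _ _ f]) (auto simp: A.Hom_iff)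
  qed
qed

end

section \<open>Invertibility of the unit\<close>

context join_restriction_category
begin

text \<open>The pointwise inverse on arrows is again a functor over the base, because injectivity of
  \<open>far (JF h)\<close> reflects the equations to be shown.\<close>

lemma jr_iso:
  assumes h: "h \<in> Hom (jrCat_h K C) X Y" and ob: "Obj (fst Y) = Obj (fst X)"
    and F: "\<And>i. i \<in> Obj (fst X) \<Longrightarrow> fob (JF h) i = i" and J: "\<And>i. i \<in> Obj (fst X) \<Longrightarrow> Jnt h i = Ide C (fob (snd X) i)"
    and bij: "bij_betw (far (JF h)) (Arr (fst X)) (Arr (fst Y))"
  shows "\<exists>k \<in> Hom (jrCat_h K C) Y X. jr_comp C k h = jr_id C X \<and> jr_comp C h k = jr_id C Y"
proof -
  have X: "is_jr_obj K C X" and Y: "is_jr_obj K C Y" and hm: "is_jr_mor C h" "JSrc h = X" "JTrg h = Y" using h by (auto simp: jrCat_h_Hom)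
  interpret A: join_restriction_category "fst X" by (rule is_jr_obj_D(1)[OF X])
  interpret B: join_restriction_category "fst Y" by (rule is_jr_obj_D(1)[OF Y])
  note PD = restriction_functor_D[OF is_jr_obj_D(4)[OF X]] and QD = restriction_functor_D[OF is_jr_obj_D(4)[OF Y]]
  note D = is_jr_mor_D[OF hm(1), unfolded hm(2,3)]
  note FD = restriction_functor_D[OF D(1)]
  let ?F = "far (JF h)"
  define G where "G = inv_into (Arr (fst X)) ?F"
  have GF: "G (?F f) = f" if "f \<in> Arr (fst X)" for f using bij that by (simp add: G_def bij_betw_inv_into_left)
  have FG: "?F (G g) = g" and GA: "G g \<in> Arr (fst X)" if "g \<in> Arr (fst Y)" for g
    using bij that by (auto simp: G_def bij_betw_inv_into_right) (metis bij_betw_def inv_into_into)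
  have inj: "f = f'" if "f \<in> Arr (fst X)" "f' \<in> Arr (fst X)" "?F f = ?F f'" for f f' using GF that by metis
  have GD: "Dom (fst X) (G g) = Dom (fst Y) g" "Cod (fst X) (G g) = Cod (fst Y) g" if g: "g \<in> Arr (fst Y)" for g
    using FD(3,4)[OF GA[OF g]] FG[OF g] F GA[OF g] by simp_all
  have Pob: "fob (snd Y) i = fob (snd X) i" if i: "i \<in> Obj (fst X)" for i using D(7)[OF i] J[OF i] F[OF i] PD(1)[OF i] by simp
  have Pnat: "far (snd Y) (?F f) = far (snd X) f" if f: "f \<in> Arr (fst X)" for f
    using D(9)[OF f] J F PD QD FD f Pob by simp
  define k where "k = \<lparr>JSrc = Y, JTrg = X, JF = \<lparr>fob = (\<lambda>i \<in> Obj (fst Y). i), far = (\<lambda>g \<in> Arr (fst Y). G g)\<rparr>,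
    Jnt = (\<lambda>i \<in> Obj (fst Y). Ide C (fob (snd Y) i))\<rparr>"
  have k: "JSrc k = Y" "JTrg k = X" "\<And>i. i \<in> Obj (fst X) \<Longrightarrow> fob (JF k) i = i" "\<And>g. g \<in> Arr (fst Y) \<Longrightarrow> far (JF k) g = G g"
    "\<And>i. i \<in> Obj (fst X) \<Longrightarrow> Jnt k i = Ide C (fob (snd X) i)"
    "fob (JF k) \<in> extensional (Obj (fst Y))" "far (JF k) \<in> extensional (Arr (fst Y))" "Jnt k \<in> extensional (Obj (fst Y))"
    using ob Pob by (auto simp: k_def)
  have km: "is_jr_mor C k"
  proof (rule is_jr_morI; unfold k(1,2))
    have obY: "Dom (fst Y) g \<in> Obj (fst X)" "Cod (fst Y) g \<in> Obj (fst X)" if "g \<in> Arr (fst Y)" for g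
      using that B.Dom_Obj B.Cod_Obj ob by auto
    show "restriction_functor (fst Y) (fst X) (JF k)"
    proof (rule restriction_functorI)
      fix g assume g: "g \<in> Arr (fst Y)"
      show "far (JF k) g \<in> Arr (fst X)" "Dom (fst X) (far (JF k) g) = fob (JF k) (Dom (fst Y) g)"
        "Cod (fst X) (far (JF k) g) = fob (JF k) (Cod (fst Y) g)"
        using k g GA GD obY by simp_all
      show "far (JF k) (Rst (fst Y) g) = Rst (fst X) (far (JF k) g)"
        using k g by simp (rule inj, use GA g FG FD(7) in auto)
      fix g' assume g': "g' \<in> Arr (fst Y)" "Dom (fst Y) g' = Cod (fst Y) g"
      show "far (JF k) (g' \<cdot>\<^bsub>fst Y\<^esub> g) = far (JF k) g' \<cdot>\<^bsub>fst X\<^esub> far (JF k) g"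
        using k g g' by simp (rule inj, use GA GD g g' FG FD(6) in auto)
    next
      fix i assume "i \<in> Obj (fst Y)"
      then have i: "i \<in> Obj (fst X)" "i \<in> Obj (fst Y)" using ob by auto
      show "fob (JF k) i \<in> Obj (fst X)" using k i by simp
      show "far (JF k) (Ide (fst Y) i) = Ide (fst X) (fob (JF k) i)"
        using k i GF[of "Ide (fst X) i"] FD(5)[OF i(1)] F[OF i(1)] by simp
    qed
    fix g assume g: "g \<in> Arr (fst Y)"
    show "far (snd Y) g \<cdot> Jnt k (Dom (fst Y) g) = Jnt k (Cod (fst Y) g) \<cdot> far (snd X) (far (JF k) g)"
      using k g obY[OF g] Pnat[OF GA[OF g]] FG[OF g] GA[OF g] GD[OF g] QD PD Pob by simp
  qed (use k ob Pob PD in auto)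
  have kH: "k \<in> Hom (jrCat_h K C) Y X" using X Y km k by (simp add: jrCat_h_Hom)
  note cat = category.Cmp_in[OF category_jrCat_h] category.Ide_in[OF category_jrCat_h]
  have m: "is_jr_mor C (jr_comp C k h)" "is_jr_mor C (jr_comp C h k)" "is_jr_mor C (jr_id C X)" "is_jr_mor C (jr_id C Y)"
    using cat(1)[OF h kH] cat(1)[OF kH h] cat(2)[of X K] cat(2)[of Y K] X Y by (auto simp: jrCat_h_Hom)
  have "jr_comp C k h = jr_id C X"
    by (rule jr_mor_eqI[OF m(1,3)]) (use k hm F J FD GF PD in auto)
  moreover have "jr_comp C h k = jr_id C Y"
    by (rule jr_mor_eqI[OF m(2,4)]) (use k hm F J FD FG PD ob Pob in auto)
  ultimately show ?thesis using kH by blast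
qed

lemma Psi_unit_iso:
  assumes X: "is_jr_obj K C X" and gl: "has_local_glueings K C" and ls: "locally_small K C"
  shows "Psi_obj C X \<in> Obj (peCat_c K C)" and "Psi_unit C X \<in> Hom (jrCat_h K C) X (Phi_obj C (Psi_obj C X))"
    and "\<exists>k \<in> Hom (jrCat_h K C) (Phi_obj C (Psi_obj C X)) X.
      jr_comp C k (Psi_unit C X) = jr_id C X \<and> jr_comp C (Psi_unit C X) k = jr_id C (Phi_obj C (Psi_obj C X))"
proof -
  obtain A P where AP: "X = (A, P)" by (cases X)
  interpret jr_object_triples C K A P
    by (intro jr_object_triples.intro jr_object.intro join_restriction_category_axioms jr_object_axioms.intro) (use X gl AP in auto)
  interpret B: etale_pcat C "Psi_obj C (A, P)" by (rule etale_pcatI[OF source_etale_Psi])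
  have small: "Cpt (Psi_obj C (A, P)) \<prec> K" using A_small by simp
  show "Psi_obj C X \<in> Obj (peCat_c K C)" using small source_etale_Psi AP by simp
  show u: "Psi_unit C X \<in> Hom (jrCat_h K C) X (Phi_obj C (Psi_obj C X))"
    using X is_jr_mor_unit B.is_jr_obj_Phi[OF ls small] Psi_unit_simps(1,2) by (simp add: jrCat_h_Hom AP)
  show "\<exists>k \<in> Hom (jrCat_h K C) (Phi_obj C (Psi_obj C X)) X.
      jr_comp C k (Psi_unit C X) = jr_id C X \<and> jr_comp C (Psi_unit C X) k = jr_id C (Phi_obj C (Psi_obj C X))"
    by (rule jr_iso[OF u]) (use Psi_unit_simps Psi_unit_bij in \<open>auto simp: AP\<close>)
qed

lemma ff_with_units_Phi:
  assumes gl: "has_local_glueings K C" and ls: "locally_small K C"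
  shows "ff_with_units (peCat_c K C :: (('i,'o,'m) pcat, ('i,'o,'m) pmor) cat) (jrCat_h K C) (Phi C) (Psi_obj C) (Psi_unit C)"
proof (intro ff_with_units.intro ff_with_units_axioms.intro category_peCat_c[OF ls] category_jrCat_h)
  fix X :: "('i, 'i \<times> 'i \<times> 'm, 'o, 'm) jr_obj"
  assume "X \<in> Obj (jrCat_h K C)"
  then have X: "is_jr_obj K C X" by simp
  note u = Psi_unit_iso[OF X gl ls]
  show "Psi_obj C X \<in> Obj (peCat_c K C)" "Psi_unit C X \<in> Hom (jrCat_h K C) X (fob (Phi C) (Psi_obj C X))"
    using u by simp_all
  show "invertible (jrCat_h K C) (Psi_unit C X)"
    using u(2,3) unfolding invertible_def by (auto simp: Hom_def)
qed (rule Phi_full_faithful[OF _ _ ls])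

end

section \<open>Localic morphisms\<close>

context restriction_category
begin

lemma functor_le:
  assumes "restriction_functor C B F" "le C f g" "f \<in> Arr C" "g \<in> Arr C" "Dom C f = Dom C g"
  shows "le B (far F f) (far F g)"
proof -
  note FD = restriction_functor_D[OF assms(1)]
  have "far F (g \<cdot> Rst C f) = far F f" using le_D[OF assms(2)] by simp
  then show ?thesis unfolding le_def[of B] using FD(6)[of "Rst C f" g] FD(7)[of f] assms(3-5) by simp
qed

end

lemma localic_D: assumes "localic A B F"
  shows "restriction_functor A B F" "join_restriction_functor A B F" "bij_betw (fob F) (Obj A) (Obj B)"
    "\<And>i j f g. \<lbrakk>i \<in> Obj A; j \<in> Obj A; f \<in> Hom A i j; g \<in> Hom A i j\<rbrakk> \<Longrightarrow> meet B (far F f) (far F g) = far F (meet A f g)"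
    "\<And>i j g. \<lbrakk>i \<in> Obj A; j \<in> Obj A; g \<in> Hom B (fob F i) (fob F j)\<rbrakk> \<Longrightarrow>
       is_join B (fob F i) (fob F j) ((\<lambda>f. meet B g (far F f)) ` Hom A i j) g"
  using assms unfolding localic_def join_restriction_functor_def by blast+

context join_restriction_category
begin

lemma meet_D:
  assumes f: "f \<in> Hom C A B" and g: "g \<in> Hom C A B"
  shows "meet C f g \<in> Hom C A B" "le C (meet C f g) f" "le C (meet C f g) g"
    "\<And>k. \<lbrakk>k \<in> Hom C A B; le C k f; le C k g\<rbrakk> \<Longrightarrow> le C k (meet C f g)"
  using meet_is_meet[OF f g] f by (auto simp: is_meet_def Hom_iff)

text \<open>By \<open>is_join_coverI\<close> only domains matter. Read through the two
  hyperconnected functors, the action on idempotents is inverse image along \<open>Jnt h i\<close>,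
  and inverse images preserve covers.\<close>

lemma is_jr_mor_join:
  assumes X: "is_jr_obj K C (JSrc h)" and Y: "is_jr_obj K C (JTrg h)" and gl: "has_local_glueings K C" and h: "is_jr_mor C h"
  shows "join_restriction_functor (fst (JSrc h)) (fst (JTrg h)) (JF h)"
proof -
  obtain A P where X': "JSrc h = (A, P)" by (cases "JSrc h")
  obtain B Q where Y': "JTrg h = (B, Q)" by (cases "JTrg h")
  interpret X: jr_object C K A P
    by (intro jr_object.intro join_restriction_category_axioms jr_object_axioms.intro) (use X gl X' in auto)
  interpret Y: jr_object C K B Q
    by (intro jr_object.intro join_restriction_category_axioms jr_object_axioms.intro) (use Y gl Y' in auto)
  note D = is_jr_mor_D[OF h, unfolded X' Y' fst_conv snd_conv]
  note F = restriction_functor_D[OF D(1)]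
  let ?F = "far (JF h)"
  have "is_join B (fob (JF h) i) (fob (JF h) j) (?F ` S) (?F k)" if i: "i \<in> Obj A" and j: "j \<in> Obj A" and J: "is_join A i j S k" for i j S k
  proof (rule Y.A.is_join_coverI)
    note kD = X.A.is_join_Hom[OF J]
    have S: "f \<in> Arr A" "Dom A f = i" "Cod A f = j" if "f \<in> S" for f using kD(1) that by (auto simp: X.A.Hom_iff)
    show "?F f \<in> Hom B (fob (JF h) i) (fob (JF h) j)" if "f \<in> S" for f using S[OF that] F by (simp add: Y.A.Hom_iff)
    show "?F k \<in> Hom B (fob (JF h) i) (fob (JF h) j)" using kD F by (simp add: Y.A.Hom_iff)
    show "le B (?F f) (?F k)" if "f \<in> S" for f
      by (rule X.A.functor_le[OF D(1) X.A.is_join_upper[OF J that]]) (use S[OF that] kD in auto)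
    have RI: "Rst A f \<in> RI A i" if "f \<in> S" for f using S[OF that] by simp
    have RIk: "Rst A k \<in> RI A i" using kD by simp
    have FRI: "?F e \<in> RI B (fob (JF h) i)" if e: "e \<in> RI A i" for e
      using X.A.RI_D[OF e] F(2-4) F(7)[of e] by (intro Y.A.RI_I) auto
    \<comment> \<open>Naturality at \<open>e\<close>, after taking restrictions; the total map
      \<open>Jnt h i\<close> on the left leaves the domain unchanged.\<close>
    have nat: "Rst C (far P e \<cdot> Jnt h i) = far Q (?F e)" if e: "e \<in> RI A i" for e
    proof -
      note eD = X.A.RI_D[OF e] and Fe = Y.P_RI[OF FRI[OF e]]
      have "far P e \<cdot> Jnt h i = Jnt h i \<cdot> far Q (?F e)" using D(9)[of e] eD by simp
      then have "Rst C (far P e \<cdot> Jnt h i) = Rst C (far Q (?F e))"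
        using Rst_total_Cmp[OF D(5)[OF i], of "far Q (?F e)"] D(6,7)[OF i] RI_D[OF Fe] by simp
      then show ?thesis using RI_D[OF Fe] by simp
    qed
    have "cover A i S (\<lambda>f. Rst A f) (Rst A k)" using X.A.is_join_cover[of i j "\<lambda>f. f" S k] J by simp
    then have "cover C (fob P i) S (\<lambda>f. far P (Rst A f)) (far P (Rst A k))" using X.P_cover_iff[OF i, of S "\<lambda>f. Rst A f" "Rst A k"] RI RIk by simp
    then have "cover C (Dom C (Jnt h i)) S (\<lambda>f. Rst C (far P (Rst A f) \<cdot> Jnt h i)) (Rst C (far P (Rst A k) \<cdot> Jnt h i))"
      by (rule cover_precomp) (use D i in auto)
    then have "cover C (fob Q (fob (JF h) i)) S (\<lambda>f. far Q (?F (Rst A f))) (far Q (?F (Rst A k)))"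
      using nat RI RIk D(7)[OF i] by (auto elim!: cover_cong)
    then have "cover B (fob (JF h) i) S (\<lambda>f. ?F (Rst A f)) (?F (Rst A k))"
      using Y.P_cover_iff[OF F(1)[OF i], of S "\<lambda>f. ?F (Rst A f)" "?F (Rst A k)"] FRI RI RIk by simp
    then show "cover B (fob (JF h) i) S (\<lambda>f. Rst B (?F f)) (Rst B (?F k))"
      by (rule Y.A.cover_cong) (use F(7) S kD in auto)
  qed
  then show ?thesis using D(1) X' Y' by (simp add: join_restriction_functor_def)
qed

text \<open>Both directions of an isomorphism are monotone, so meets are preserved, and every arrow
  of the codomain is itself an image.\<close>

lemma localic_iso:
  assumes h: "h \<in> Hom (jrCat_h K C) X Y" and k: "k \<in> Hom (jrCat_h K C) Y X"
    and kh: "jr_comp C k h = jr_id C X" and hk: "jr_comp C h k = jr_id C Y" and gl: "has_local_glueings K C"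
  shows "localic (fst X) (fst Y) (JF h)"
proof -
  have X: "is_jr_obj K C X" and Y: "is_jr_obj K C Y" and hm: "is_jr_mor C h" "JSrc h = X" "JTrg h = Y"
    and km: "is_jr_mor C k" "JSrc k = Y" "JTrg k = X" using h k by (auto simp: jrCat_h_Hom)
  interpret A: join_restriction_category "fst X" by (rule is_jr_obj_D(1)[OF X])
  interpret B: join_restriction_category "fst Y" by (rule is_jr_obj_D(1)[OF Y])
  note D = is_jr_mor_D[OF hm(1), unfolded hm(2,3)] and E = is_jr_mor_D[OF km(1), unfolded km(2,3)]
  note F = restriction_functor_D[OF D(1)] and G = restriction_functor_D[OF E(1)]
  have GFo: "fob (JF k) (fob (JF h) i) = i" if "i \<in> Obj (fst X)" for i
    using arg_cong[OF kh, of "\<lambda>z. fob (JF z) i"] that hm by simp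
  have FGo: "fob (JF h) (fob (JF k) i) = i" if "i \<in> Obj (fst Y)" for i
    using arg_cong[OF hk, of "\<lambda>z. fob (JF z) i"] that km by simp
  have GF: "far (JF k) (far (JF h) f) = f" if "f \<in> Arr (fst X)" for f
    using arg_cong[OF kh, of "\<lambda>z. far (JF z) f"] that hm by simp
  have FG: "far (JF h) (far (JF k) f) = f" if "f \<in> Arr (fst Y)" for f
    using arg_cong[OF hk, of "\<lambda>z. far (JF z) f"] that km by simp
  have FH: "far (JF h) f \<in> Hom (fst Y) (fob (JF h) i) (fob (JF h) j)" if "f \<in> Hom (fst X) i j" for f i j
    using F that by (auto simp: A.Hom_iff B.Hom_iff)
  have GH: "far (JF k) g \<in> Hom (fst X) i j" if ij: "i \<in> Obj (fst X)" "j \<in> Obj (fst X)" and g: "g \<in> Hom (fst Y) (fob (JF h) i) (fob (JF h) j)" for g i j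
    using G g GFo ij by (auto simp: A.Hom_iff B.Hom_iff)
  show ?thesis unfolding localic_def
  proof (intro conjI ballI)
    show "join_restriction_functor (fst X) (fst Y) (JF h)" using is_jr_mor_join[of K h] X Y gl hm by simp
    show "bij_betw (fob (JF h)) (Obj (fst X)) (Obj (fst Y))"
      by (rule bij_betw_byWitness[of _ "fob (JF k)"]) (use GFo FGo F G in auto)
    fix i j assume ij: "i \<in> Obj (fst X)" "j \<in> Obj (fst X)"
    { fix f g assume f: "f \<in> Hom (fst X) i j" and g: "g \<in> Hom (fst X) i j"
      note M = A.meet_D[OF f g] and fD = f[unfolded A.Hom_iff] and gD = g[unfolded A.Hom_iff] and mD = A.meet_D(1)[OF f g, unfolded A.Hom_iff]
      show "meet (fst Y) (far (JF h) f) (far (JF h) g) = far (JF h) (meet (fst X) f g)"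
      proof (rule B.meet_eqI, unfold is_meet_def, intro conjI ballI impI)
        show "far (JF h) (meet (fst X) f g) \<in> Hom (fst Y) (Dom (fst Y) (far (JF h) f)) (Cod (fst Y) (far (JF h) f))"
          using FH[OF M(1)] FH[OF f] by (simp add: B.Hom_iff)
        show "le (fst Y) (far (JF h) (meet (fst X) f g)) (far (JF h) f)" "le (fst Y) (far (JF h) (meet (fst X) f g)) (far (JF h) g)"
          by (rule A.functor_le[OF D(1)]; use M(2,3) mD fD gD in simp)+
        fix u assume "u \<in> Hom (fst Y) (Dom (fst Y) (far (JF h) f)) (Cod (fst Y) (far (JF h) f))"
          and u2: "le (fst Y) u (far (JF h) f) \<and> le (fst Y) u (far (JF h) g)"
        then have u: "u \<in> Hom (fst Y) (fob (JF h) i) (fob (JF h) j)" using FH[OF f] by (simp add: B.Hom_iff)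
        note uD = u[unfolded B.Hom_iff]
        have "le (fst X) (far (JF k) u) (far (JF k) (far (JF h) f))" "le (fst X) (far (JF k) u) (far (JF k) (far (JF h) g))"
          by (rule B.functor_le[OF E(1)]; use u2 uD FH[OF f] FH[OF g] in \<open>simp add: B.Hom_iff\<close>)+
        then have "le (fst X) (far (JF k) u) (meet (fst X) f g)" using M(4)[OF GH[OF ij u]] GF fD gD by simp
        then have "le (fst Y) (far (JF h) (far (JF k) u)) (far (JF h) (meet (fst X) f g))"
          by (rule A.functor_le[OF D(1)]) (use GH[OF ij u] mD in \<open>auto simp: A.Hom_iff\<close>)
        then show "le (fst Y) u (far (JF h) (meet (fst X) f g))" using FG uD by simp
      qed }
    fix g assume g: "g \<in> Hom (fst Y) (fob (JF h) i) (fob (JF h) j)"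
    note gD = g[unfolded B.Hom_iff]
    show "is_join (fst Y) (fob (JF h) i) (fob (JF h) j) ((\<lambda>f. meet (fst Y) g (far (JF h) f)) ` Hom (fst X) i j) g"
      unfolding is_join_def
    proof (intro conjI ballI impI)
      show "(\<lambda>f. meet (fst Y) g (far (JF h) f)) ` Hom (fst X) i j \<subseteq> Hom (fst Y) (fob (JF h) i) (fob (JF h) j)"
        using B.meet_D(1)[OF g FH] by auto
      show "le (fst Y) m g" if "m \<in> (\<lambda>f. meet (fst Y) g (far (JF h) f)) ` Hom (fst X) i j" for m
        using that B.meet_D(2)[OF g FH] by auto
      fix u assume u: "\<forall>f\<in>(\<lambda>f. meet (fst Y) g (far (JF h) f)) ` Hom (fst X) i j. le (fst Y) f u"
      \<comment> \<open>The family to be joined already contains \<open>g\<close>, as the meet of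
        \<open>g\<close> with the image of its preimage under \<open>k\<close>.\<close>
      have "meet (fst Y) g g = g"
        by (rule B.meet_eqI) (use gD in \<open>auto simp: is_meet_def B.Hom_iff intro: B.le_refl\<close>)
      moreover have "le (fst Y) (meet (fst Y) g (far (JF h) (far (JF k) g))) u" using u GH[OF ij g] by blast
      ultimately show "le (fst Y) g u" using FG gD by simp
    qed (rule g)
  qed
qed

text \<open>For the join condition, an arrow of the last category is decomposed along images of
  arrows \<open>b\<close> of the middle one, and each \<open>b\<close> along images of arrows
  \<open>a\<close> of the first.\<close>

lemma localic_comp:
  assumes f: "f \<in> Hom (jrCat_h K C) X Y" and g: "g \<in> Hom (jrCat_h K C) Y Z" and gl: "has_local_glueings K C"
    and lf: "localic (fst X) (fst Y) (JF f)" and lg: "localic (fst Y) (fst Z) (JF g)"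
  shows "localic (fst X) (fst Z) (JF (jr_comp C g f))"
proof -
  have gf: "jr_comp C g f \<in> Hom (jrCat_h K C) X Z" using category.Cmp_in[OF category_jrCat_h f g] by simp
  have X: "is_jr_obj K C X" and Y: "is_jr_obj K C Y" and Z: "is_jr_obj K C Z"
    and fm: "is_jr_mor C f" "JSrc f = X" "JTrg f = Y" and gm: "is_jr_mor C g" "JSrc g = Y" "JTrg g = Z"
    and hm: "is_jr_mor C (jr_comp C g f)"
    using f g gf by (auto simp: jrCat_h_Hom)
  interpret A: join_restriction_category "fst X" by (rule is_jr_obj_D(1)[OF X])
  interpret B: join_restriction_category "fst Y" by (rule is_jr_obj_D(1)[OF Y])
  interpret D: join_restriction_category "fst Z" by (rule is_jr_obj_D(1)[OF Z])
  note LF = localic_D[OF lf] and LG = localic_D[OF lg]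
  note F = restriction_functor_D[OF LF(1)] and G = restriction_functor_D[OF LG(1)]
  let ?H = "JF (jr_comp C g f)"
  have Ho: "fob ?H i = fob (JF g) (fob (JF f) i)" if "i \<in> Obj (fst X)" for i using that fm by simp
  have Ha: "far ?H a = far (JF g) (far (JF f) a)" if "a \<in> Hom (fst X) i j" for a i j using that fm by (simp add: A.Hom_iff)
  have FH: "far (JF f) a \<in> Hom (fst Y) (fob (JF f) i) (fob (JF f) j)" if "a \<in> Hom (fst X) i j" for a i j
    using F that by (auto simp: A.Hom_iff B.Hom_iff)
  have GH: "far (JF g) a \<in> Hom (fst Z) (fob (JF g) i) (fob (JF g) j)" if "a \<in> Hom (fst Y) i j" for a i j
    using G that by (auto simp: D.Hom_iff B.Hom_iff)
  show ?thesis unfolding localic_def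
  proof (intro conjI ballI)
    show "join_restriction_functor (fst X) (fst Z) ?H" using is_jr_mor_join[of K "jr_comp C g f"] X Z gl hm fm gm by simp
    have "bij_betw (fob (JF g) \<circ> fob (JF f)) (Obj (fst X)) (Obj (fst Z))" by (rule bij_betw_trans[OF LF(3) LG(3)])
    then show "bij_betw (fob ?H) (Obj (fst X)) (Obj (fst Z))" using Ho by (simp cong: bij_betw_cong)
    fix i j assume ij: "i \<in> Obj (fst X)" "j \<in> Obj (fst X)"
    note Fij = F(1)[OF ij(1)] F(1)[OF ij(2)]
    { fix a b assume a: "a \<in> Hom (fst X) i j" and b: "b \<in> Hom (fst X) i j"
      show "meet (fst Z) (far ?H a) (far ?H b) = far ?H (meet (fst X) a b)"
        using LG(4)[OF Fij FH[OF a] FH[OF b]] LF(4)[OF ij a b] Ha[OF a] Ha[OF b] Ha[OF A.meet_D(1)[OF a b]] by simp }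
    fix c assume "c \<in> Hom (fst Z) (fob ?H i) (fob ?H j)"
    then have c: "c \<in> Hom (fst Z) (fob (JF g) (fob (JF f) i)) (fob (JF g) (fob (JF f) j))" using Ho ij by simp
    have HH: "far ?H a \<in> Hom (fst Z) (fob (JF g) (fob (JF f) i)) (fob (JF g) (fob (JF f) j))" if "a \<in> Hom (fst X) i j" for a
      unfolding Ha[OF that] by (rule GH[OF FH[OF that]])
    note M = D.meet_D[OF c HH]
    have "is_join (fst Z) (fob (JF g) (fob (JF f) i)) (fob (JF g) (fob (JF f) j)) ((\<lambda>a. meet (fst Z) c (far ?H a)) ` Hom (fst X) i j) c"
      unfolding is_join_def
    proof (intro conjI ballI impI)
      fix u assume u: "u \<in> Hom (fst Z) (fob (JF g) (fob (JF f) i)) (fob (JF g) (fob (JF f) j))"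
        and up: "\<forall>m\<in>(\<lambda>a. meet (fst Z) c (far ?H a)) ` Hom (fst X) i j. le (fst Z) m u"
      show "le (fst Z) c u"
      proof (rule D.is_join_least[OF LG(5)[OF Fij c] u])
        fix m assume "m \<in> (\<lambda>b. meet (fst Z) c (far (JF g) b)) ` Hom (fst Y) (fob (JF f) i) (fob (JF f) j)"
        then obtain b where b: "b \<in> Hom (fst Y) (fob (JF f) i) (fob (JF f) j)" and m: "m = meet (fst Z) c (far (JF g) b)" by blast
        note Mb = D.meet_D[OF c GH[OF b], folded m]
        note mD = Mb(1)[unfolded D.Hom_iff] and cD = c[unfolded D.Hom_iff] and gb = GH[OF b, unfolded D.Hom_iff]
        \<comment> \<open>Join preservation carries the decomposition of \<open>b\<close> into the
          last category; precomposition with the domain of \<open>m\<close> then decomposes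
          \<open>m\<close>.\<close>
        have J: "is_join (fst Z) (fob (JF g) (fob (JF f) i)) (fob (JF g) (fob (JF f) j))
          (far (JF g) ` (\<lambda>a. meet (fst Y) b (far (JF f) a)) ` Hom (fst X) i j) (far (JF g) b)"
          using LG(2) LF(5)[OF ij b] Fij unfolding join_restriction_functor_def by blast
        have "is_join (fst Z) (fob (JF g) (fob (JF f) i)) (fob (JF g) (fob (JF f) j))
          ((\<lambda>x. x \<cdot>\<^bsub>fst Z\<^esub> Rst (fst Z) m) ` far (JF g) ` (\<lambda>a. meet (fst Y) b (far (JF f) a)) ` Hom (fst X) i j) (far (JF g) b \<cdot>\<^bsub>fst Z\<^esub> Rst (fst Z) m)"
          by (rule D.join_precomp[OF J]) (use mD in \<open>simp add: D.Hom_iff\<close>)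
        then have J': "is_join (fst Z) (fob (JF g) (fob (JF f) i)) (fob (JF g) (fob (JF f) j))
          ((\<lambda>x. x \<cdot>\<^bsub>fst Z\<^esub> Rst (fst Z) m) ` far (JF g) ` (\<lambda>a. meet (fst Y) b (far (JF f) a)) ` Hom (fst X) i j) m"
          unfolding D.le_D[OF Mb(3)] .
        show "le (fst Z) m u"
        proof (rule D.is_join_least[OF J' u])
          fix v assume "v \<in> (\<lambda>x. x \<cdot>\<^bsub>fst Z\<^esub> Rst (fst Z) m) ` far (JF g) ` (\<lambda>a. meet (fst Y) b (far (JF f) a)) ` Hom (fst X) i j"
          then obtain a where a: "a \<in> Hom (fst X) i j"
            and v: "v = far (JF g) (meet (fst Y) b (far (JF f) a)) \<cdot>\<^bsub>fst Z\<^esub> Rst (fst Z) m" by blast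
          note Ma = B.meet_D[OF b FH[OF a]]
          note w = GH[OF Ma(1), unfolded D.Hom_iff] and bD = b[unfolded B.Hom_iff] and maD = Ma(1)[unfolded B.Hom_iff] and faD = FH[OF a, unfolded B.Hom_iff]
          have vD: "v \<in> Arr (fst Z)" "Dom (fst Z) v = fob (JF g) (fob (JF f) i)" "Cod (fst Z) v = fob (JF g) (fob (JF f) j)"
            unfolding v using w mD by simp_all
          have "le (fst Z) v (far (JF g) b \<cdot>\<^bsub>fst Z\<^esub> Rst (fst Z) m)"
            unfolding v by (rule D.le_precomp[OF B.functor_le[OF LG(1) Ma(2)]]) (use w mD gb bD maD in auto)
          then have vm: "le (fst Z) v m" unfolding D.le_D[OF Mb(3)] .
          have vc: "le (fst Z) v c" by (rule D.le_trans[OF vm Mb(2)]) (use vD mD cD in auto)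
          have "le (fst Z) v (far (JF g) (meet (fst Y) b (far (JF f) a)))"
            unfolding v by (rule D.le_RI[of _ "fob (JF g) (fob (JF f) i)"]) (use w mD in auto)
          moreover have "le (fst Z) (far (JF g) (meet (fst Y) b (far (JF f) a))) (far ?H a)"
            unfolding Ha[OF a] by (rule B.functor_le[OF LG(1) Ma(3)]) (use maD faD in auto)
          ultimately have va: "le (fst Z) v (far ?H a)"
            by (rule D.le_trans) (use vD w HH[OF a] in \<open>auto simp: D.Hom_iff\<close>)
          have "le (fst Z) v (meet (fst Z) c (far ?H a))" by (rule M(4)[OF a _ vc va]) (use vD in \<open>simp add: D.Hom_iff\<close>)
          moreover have "le (fst Z) (meet (fst Z) c (far ?H a)) u" using up a by blast
          ultimately show "le (fst Z) v u"
            by (rule D.le_trans) (use vD M(1)[OF a] u in \<open>auto simp: D.Hom_iff\<close>)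
        qed
      qed
    qed (use M c in auto)
    then show "is_join (fst Z) (fob ?H i) (fob ?H j) ((\<lambda>a. meet (fst Z) c (far ?H a)) ` Hom (fst X) i j) c" using Ho ij by simp
  qed
qed

lemma jrCat_hl_Hom: "h \<in> Hom (jrCat_hl K C) X Y \<longleftrightarrow> h \<in> Hom (jrCat_h K C) X Y \<and> localic (fst X) (fst Y) (JF h)"
  by (auto simp: jrCat_hl_def Hom_def)

lemma jrCat_hl_simps [simp]:
  "Obj (jrCat_hl K C) = Obj (jrCat_h K C)" "Dom (jrCat_hl K C) = JSrc" "Cod (jrCat_hl K C) = JTrg"
  "Ide (jrCat_hl K C) = jr_id C" "Cmp (jrCat_hl K C) = jr_comp C"
  by (auto simp: jrCat_hl_def)

lemma category_jrCat_hl: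
  assumes gl: "has_local_glueings K C"
  shows "category (jrCat_hl K C :: (('i,'a,'o,'m) jr_obj, ('i,'a,'o,'m) jr_mor) cat)"
    and "is_functor (jrCat_hl K C :: (('i,'a,'o,'m) jr_obj, ('i,'a,'o,'m) jr_mor) cat) (jrCat_h K C) fid"
proof -
  let ?Y' = "jrCat_hl K C :: (('i,'a,'o,'m) jr_obj, ('i,'a,'o,'m) jr_mor) cat"
  let ?Y = "jrCat_h K C :: (('i,'a,'o,'m) jr_obj, ('i,'a,'o,'m) jr_mor) cat"
  interpret Y: category ?Y by (rule category_jrCat_h)
  have id: "Ide ?Y' X \<in> Hom ?Y' X X" "far fid (Ide ?Y' X) = Ide ?Y (fob fid X)" if X: "X \<in> Obj ?Y'" for X
  proof -
    have i: "jr_id C X \<in> Hom ?Y X X" using Y.Ide_in[of X] X by simp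
    have "jr_comp C (jr_id C X) (jr_id C X) = jr_id C X" using Y.Cmp_Ide[OF i] by simp
    then show "Ide ?Y' X \<in> Hom ?Y' X X" using i localic_iso[OF i i _ _ gl] by (simp add: jrCat_hl_Hom)
  qed simp
  have comp: "g \<cdot>\<^bsub>?Y'\<^esub> f \<in> Hom ?Y' X Z" "far fid (g \<cdot>\<^bsub>?Y'\<^esub> f) = far fid g \<cdot>\<^bsub>?Y\<^esub> far fid f"
    if "f \<in> Hom ?Y' X Y" "g \<in> Hom ?Y' Y Z" for f g X Y Z
    using that Y.Cmp_in[of f X Y g Z] localic_comp[of f K X Y g Z] gl by (simp_all add: jrCat_hl_Hom)
  have D: "Dom ?Y' f \<in> Obj ?Y'" "Cod ?Y' f \<in> Obj ?Y'" if "f \<in> Arr ?Y'" for f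
    using that by (auto simp: jrCat_hl_def jrCat_h_def)
  have mor: "far fid f \<in> Hom ?Y (fob fid X) (fob fid Y)" if "f \<in> Hom ?Y' X Y" for f X Y using that by (simp add: jrCat_hl_Hom)
  have inj: "inj_on (far fid) (Hom ?Y' X Y)" for X Y by (rule inj_onI) simp
  show "category ?Y'" by (rule category_of_faithful(1)[OF category_jrCat_h D id(1) comp(1) mor id(2) comp(2) inj])
  show "is_functor ?Y' ?Y fid" by (rule category_of_faithful(2)[OF category_jrCat_h D id(1) comp(1) mor id(2) comp(2) inj])
qed

end

section \<open>Covering functors\<close>

context restriction_category
begin

lemma pullback_iso:
  assumes 1: "is_pullback C f g p q" and k: "k \<in> Arr C" "Cod C k = Dom C p" and k': "k' \<in> Hom C (Dom C p) (Dom C k)"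
    and kk: "k \<cdot> k' = Ide C (Dom C p)" "k' \<cdot> k = Ide C (Dom C k)"
  shows "is_pullback C f g (p \<cdot> k) (q \<cdot> k)"
proof -
  note D = pullback_D[OF 1] and k'D = k'[unfolded Hom_iff]
  show ?thesis unfolding is_pullback_def
  proof (intro conjI ballI impI)
    fix U u v assume "U \<in> Obj C" "u \<in> Hom C U (Dom C f)" "v \<in> Hom C U (Dom C g)" and uv: "f \<cdot> u = g \<cdot> v"
    then have u: "u \<in> Arr C" "Dom C u = U" "Cod C u = Dom C f" and v: "v \<in> Arr C" "Dom C v = U" "Cod C v = Dom C g"
      by (auto simp: Hom_iff)
    have "\<exists>h. h \<in> Hom C (Dom C u) (Dom C p) \<and> p \<cdot> h = u \<and> q \<cdot> h = v"
      by (rule pullback_ex[OF 1]) (use u v uv D in auto)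
    then obtain h where h: "h \<in> Arr C" "Dom C h = U" "Cod C h = Dom C p" "p \<cdot> h = u" "q \<cdot> h = v" using u unfolding Hom_iff by blast
    have kh: "k \<cdot> (k' \<cdot> h) = h" using k k'D h by (simp add: under[OF kk(1)])
    show "\<exists>!h. h \<in> Hom C U (Dom C (p \<cdot> k)) \<and> p \<cdot> k \<cdot> h = u \<and> q \<cdot> k \<cdot> h = v"
    proof (rule ex1I[of _ "k' \<cdot> h"])
      show "k' \<cdot> h \<in> Hom C U (Dom C (p \<cdot> k)) \<and> p \<cdot> k \<cdot> (k' \<cdot> h) = u \<and> q \<cdot> k \<cdot> (k' \<cdot> h) = v"
        using h k k'D D kh by (simp add: Hom_iff)
      fix l assume l0: "l \<in> Hom C U (Dom C (p \<cdot> k)) \<and> p \<cdot> k \<cdot> l = u \<and> q \<cdot> k \<cdot> l = v"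
      have "Dom C (p \<cdot> k) = Dom C k" by (rule Dom_Cmp) (use D k in auto)
      then have l1: "l \<in> Arr C" "Dom C l = U" "Cod C l = Dom C k" using l0[THEN conjunct1] by (simp_all only: Hom_iff)
      have "p \<cdot> k \<cdot> l = p \<cdot> (k \<cdot> l)" "q \<cdot> k \<cdot> l = q \<cdot> (k \<cdot> l)" using l1 D k by (simp_all add: assoc)
      then have l: "l \<in> Arr C" "Dom C l = U" "Cod C l = Dom C k" "p \<cdot> (k \<cdot> l) = u" "q \<cdot> (k \<cdot> l) = v"
        using l0[THEN conjunct2] l1 by auto
      have "k \<cdot> l = h" by (rule pullback_ext[OF 1]) (use l h k in simp_all)
      then have "k' \<cdot> (k \<cdot> l) = k' \<cdot> h" by simp
      then show "l = k' \<cdot> h" using l k k'D by (simp add: under[OF kk(2)])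
    qed
  qed (use D k in \<open>simp_all add: Hom_iff under2[OF D(9)]\<close>)
qed

end

context join_restriction_category
begin

text \<open>An isomorphism is a local homeomorphism with one global chart, whose section is the
  inverse.\<close>

lemma etale_iso:
  assumes h: "h \<in> Arr C" and h': "h' \<in> Hom C (Cod C h) (Dom C h)" and hh: "h' \<cdot> h = Ide C (Dom C h)" "h \<cdot> h' = Ide C (Cod C h)"
  shows "etale C h' {()} (\<lambda>_. h') (\<lambda>_. h)"
proof -
  note D = h'[unfolded Hom_iff]
  have t: "Rst C g = Ide C (Dom C g)" if "g \<in> Arr C" "k \<in> Arr C" "Dom C k = Cod C g" "k \<cdot> g = Ide C (Dom C g)" for g k
    using Rst_Cmp_le[of g k] that by simp
  have 1: "Rst C h = Ide C (Dom C h)" "Rst C h' = Ide C (Cod C h)" using t[of h h'] t[of h' h] h D hh by simp_all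
  have "cover C (Cod C h) {()} (\<lambda>_. Ide C (Cod C h)) (Ide C (Cod C h))"
    by (rule coverI) (use h in \<open>auto simp: RI_D\<close>)
  then show ?thesis unfolding etale_def using h D hh 1 by (simp add: Hom_iff total_def)
qed

end

text \<open>Separates typing and source-target compatibility from the unit and multiplication laws,
  which for a functor obtained from a cofunctor are established by evaluation on sections.\<close>

definition is_pfunctor_st :: "('o,'m) rcat \<Rightarrow> ('i,'o,'m) pmor \<Rightarrow> bool" where
  "is_pfunctor_st C G \<longleftrightarrow> (let B = Src G; A = Trg G; c = onC G in
     (\<forall>i \<in> Cpt B. c i \<in> Cpt A) \<and>
     (\<forall>i \<in> Cpt B. on0 G i \<in> Hom C (P0 B i) (P0 A (c i)) \<and> total C (on0 G i)) \<and>
     (\<forall>i \<in> Cpt B. \<forall>j \<in> Cpt B.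
        on1 G i j \<in> Hom C (P1 B i j) (P1 A (c i) (c j)) \<and>
        on0 G i \<cdot>\<^bsub>C\<^esub> sor B i j = sor A (c i) (c j) \<cdot>\<^bsub>C\<^esub> on1 G i j \<and>
        on0 G j \<cdot>\<^bsub>C\<^esub> tgt B i j = tgt A (c i) (c j) \<cdot>\<^bsub>C\<^esub> on1 G i j))"

locale pfunctor_st = pcat_pair +
  fixes G
  assumes st: "is_pfunctor_st C G" and Src_G [simp]: "Src G = B" and Trg_G [simp]: "Trg G = A"
begin

lemma G_C [simp]: "i \<in> Cpt B \<Longrightarrow> onC G i \<in> Cpt A"
  using st by (simp add: is_pfunctor_st_def Let_def)

lemma G0 [simp]: assumes "i \<in> Cpt B"
  shows "on0 G i \<in> Arr C" "Dom C (on0 G i) = P0 B i" "Cod C (on0 G i) = P0 A (onC G i)" "total C (on0 G i)"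
  using st assms by (auto simp: is_pfunctor_st_def Let_def A.Hom_iff)

lemma G1 [simp]: assumes "i \<in> Cpt B" "j \<in> Cpt B"
  shows "on1 G i j \<in> Arr C" "Dom C (on1 G i j) = P1 B i j" "Cod C (on1 G i j) = P1 A (onC G i) (onC G j)"
  using st assms by (auto simp: is_pfunctor_st_def Let_def A.Hom_iff)

lemma G_sor: "\<lbrakk>i \<in> Cpt B; j \<in> Cpt B\<rbrakk> \<Longrightarrow> on0 G i \<cdot> sor B i j = sor A (onC G i) (onC G j) \<cdot> on1 G i j"
  and G_tgt: "\<lbrakk>i \<in> Cpt B; j \<in> Cpt B\<rbrakk> \<Longrightarrow> on0 G j \<cdot> tgt B i j = tgt A (onC G i) (onC G j) \<cdot> on1 G i j"
  using st by (auto simp: is_pfunctor_st_def Let_def)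

lemma G1_total: assumes ij: "i \<in> Cpt B" "j \<in> Cpt B" shows "total C (on1 G i j)"
proof -
  have "total C (sor A (onC G i) (onC G j) \<cdot> on1 G i j)" unfolding G_sor[OF ij, symmetric]
    by (rule A.total_Cmp) (use ij in auto)
  moreover have "Rst C (sor A (onC G i) (onC G j) \<cdot> on1 G i j) = Rst C (on1 G i j)"
    by (rule A.Rst_total_Cmp) (use ij in auto)
  ultimately show ?thesis using ij by (simp add: total_def)
qed

text \<open>The map induced by \<open>G\<close> on objects of composable pairs.\<close>

definition square where
  "square i j k = pairing C (sor A (onC G j) (onC G k)) (tgt A (onC G i) (onC G j))
     (on1 G j k \<cdot> pr1 C (sor B j k) (tgt B i j)) (on1 G i j \<cdot> pr2 C (sor B j k) (tgt B i j))"

lemma square: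
  assumes I: "i \<in> Cpt B" "j \<in> Cpt B" "k \<in> Cpt B"
  shows "square i j k \<in> Arr C" "Dom C (square i j k) = pbo C (sor B j k) (tgt B i j)"
    "Cod C (square i j k) = pbo C (sor A (onC G j) (onC G k)) (tgt A (onC G i) (onC G j))"
    "pr1 C (sor A (onC G j) (onC G k)) (tgt A (onC G i) (onC G j)) \<cdot> square i j k = on1 G j k \<cdot> pr1 C (sor B j k) (tgt B i j)"
    "pr2 C (sor A (onC G j) (onC G k)) (tgt A (onC G i) (onC G j)) \<cdot> square i j k = on1 G i j \<cdot> pr2 C (sor B j k) (tgt B i j)"
proof -
  have pA: "has_pb C (sor A (onC G j) (onC G k)) (tgt A (onC G i) (onC G j))" and pB: "has_pb C (sor B j k) (tgt B i j)"
    using I by simp_all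
  note D = A.pb_D[OF pB]
  have "sor A (onC G j) (onC G k) \<cdot> (on1 G j k \<cdot> pr1 C (sor B j k) (tgt B i j)) = on0 G j \<cdot> (sor B j k \<cdot> pr1 C (sor B j k) (tgt B i j))"
    by (rule A.under2[OF G_sor[OF I(2,3), symmetric]]) (use I D in auto)
  also have "\<dots> = on0 G j \<cdot> (tgt B i j \<cdot> pr2 C (sor B j k) (tgt B i j))" using D by simp
  also have "\<dots> = tgt A (onC G i) (onC G j) \<cdot> (on1 G i j \<cdot> pr2 C (sor B j k) (tgt B i j))"
    by (rule A.under2[OF G_tgt[OF I(1,2)]]) (use I D in auto)
  finally have e: "sor A (onC G j) (onC G k) \<cdot> (on1 G j k \<cdot> pr1 C (sor B j k) (tgt B i j)) =
     tgt A (onC G i) (onC G j) \<cdot> (on1 G i j \<cdot> pr2 C (sor B j k) (tgt B i j))" .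
  show "square i j k \<in> Arr C" "Dom C (square i j k) = pbo C (sor B j k) (tgt B i j)"
    "Cod C (square i j k) = pbo C (sor A (onC G j) (onC G k)) (tgt A (onC G i) (onC G j))"
    "pr1 C (sor A (onC G j) (onC G k)) (tgt A (onC G i) (onC G j)) \<cdot> square i j k = on1 G j k \<cdot> pr1 C (sor B j k) (tgt B i j)"
    "pr2 C (sor A (onC G j) (onC G k)) (tgt A (onC G i) (onC G j)) \<cdot> square i j k = on1 G i j \<cdot> pr2 C (sor B j k) (tgt B i j)"
    unfolding square_def using A.pairing[OF pA _ _ _ _ _ e] I D by simp_all
qed

text \<open>Here \<open>s'\<close> and \<open>t'\<close> are lifts of \<open>s\<close> and
  \<open>t\<close> along \<open>G\<close>. The evaluation does not presuppose the multiplication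
  law, so it also serves to prove it.\<close>

lemma square_at_sections:
  assumes I: "i \<in> Cpt B" "j \<in> Cpt B" "k \<in> Cpt B" and s': "B.sec i j s'" and t': "B.sec j k t'"
    and s: "A.sec (onC G i) (onC G j) s" and t: "A.sec (onC G j) (onC G k) t"
    and Gs: "on1 G i j \<cdot> s' = s \<cdot> on0 G i" and Gt: "on1 G j k \<cdot> t' = t \<cdot> on0 G j"
  shows "mul A (onC G i) (onC G j) (onC G k) \<cdot> (square i j k \<cdot> (pull_section C (sor B j k) (tgt B i j) t' \<cdot> s')) =
    scomp C A (onC G i) (onC G j) (onC G k) t s \<cdot> on0 G i"
    and "Rst C (t' \<cdot> (tgt B i j \<cdot> s')) = Rst C (t \<cdot> (tgt A (onC G i) (onC G j) \<cdot> (s \<cdot> on0 G i)))"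
proof -
  let ?i = "onC G i" and ?j = "onC G j" and ?k = "onC G k"
  let ?W = "pull_section C (sor B j k) (tgt B i j) t' \<cdot> s'"
  have J: "?i \<in> Cpt A" "?j \<in> Cpt A" "?k \<in> Cpt A" using I by simp_all
  note sD = A.sec_D[OF J(1,2) s] and tD = A.sec_D[OF J(2,3) t] and s'D = B.sec_D[OF I(1,2) s'] and t'D = B.sec_D[OF I(2,3) t']
  note Q = square[OF I]
  have pA: "has_pb C (sor A ?j ?k) (tgt A ?i ?j)" and pB: "has_pb C (sor B j k) (tgt B i j)" using I by simp_all
  note BA = A.pb_D[OF pA] and BB = A.pb_D[OF pB]
  note P = A.pull_section[OF pB B.tgt(4)[OF I(1,2)] t']
  have c: "Cod C s' = Dom C (tgt B i j)" using s'D I by simp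
  note PC = A.pull_Cmp[OF pB B.tgt(4)[OF I(1,2)] t' s'D(1) c]
  have W: "?W \<in> Arr C" "Cod C ?W = pbo C (sor B j k) (tgt B i j)" using P s'D I by simp_all
  have ts: "on0 G j \<cdot> (tgt B i j \<cdot> s') = tgt A ?i ?j \<cdot> (s \<cdot> on0 G i)"
    using I s'D Gs by (simp add: A.under2[OF G_tgt])
  have Gt': "on1 G j k \<cdot> (t' \<cdot> (tgt B i j \<cdot> s')) = t \<cdot> (tgt A ?i ?j \<cdot> (s \<cdot> on0 G i))"
    using I s'D t'D ts tD by (simp add: A.under2[OF Gt])
  have "Rst C (on1 G j k \<cdot> (t' \<cdot> (tgt B i j \<cdot> s'))) = Rst C (t' \<cdot> (tgt B i j \<cdot> s'))"
    by (rule A.Rst_total_Cmp[OF G1_total]) (use I s'D t'D in auto)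
  then show R: "Rst C (t' \<cdot> (tgt B i j \<cdot> s')) = Rst C (t \<cdot> (tgt A ?i ?j \<cdot> (s \<cdot> on0 G i)))" using Gt' by simp
  have "mul A ?i ?j ?k \<cdot> (square i j k \<cdot> ?W) = scomp C A ?i ?j ?k t (s \<cdot> on0 G i)"
  proof (rule A.mul_eq_scomp[OF J t])
    have "pr1 C (sor A ?j ?k) (tgt A ?i ?j) \<cdot> (square i j k \<cdot> ?W) = on1 G j k \<cdot> (pr1 C (sor B j k) (tgt B i j) \<cdot> ?W)"
      by (rule A.under2[OF Q(4)]) (use Q BA BB W I in auto)
    then show "pr1 C (sor A ?j ?k) (tgt A ?i ?j) \<cdot> (square i j k \<cdot> ?W) = t \<cdot> (tgt A ?i ?j \<cdot> (s \<cdot> on0 G i))" using PC Gt' by simp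
    have "pr2 C (sor A ?j ?k) (tgt A ?i ?j) \<cdot> (square i j k \<cdot> ?W) = on1 G i j \<cdot> (pr2 C (sor B j k) (tgt B i j) \<cdot> ?W)"
      by (rule A.under2[OF Q(5)]) (use Q BA BB W I in auto)
    also have "\<dots> = s \<cdot> (on0 G i \<cdot> Rst C (t \<cdot> (tgt A ?i ?j \<cdot> (s \<cdot> on0 G i))))"
      unfolding PC R using I s'D sD tD J by (simp add: A.under2[OF Gs])
    finally show "pr2 C (sor A ?j ?k) (tgt A ?i ?j) \<cdot> (square i j k \<cdot> ?W) = s \<cdot> on0 G i \<cdot> Rst C (t \<cdot> (tgt A ?i ?j \<cdot> (s \<cdot> on0 G i)))"
      using I sD tD J by simp
  qed (use sD Q W I in auto)
  also have "\<dots> = scomp C A ?i ?j ?k t s \<cdot> on0 G i"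
    using A.pull_section[OF pA A.tgt(4)[OF J(1,2)] t] sD I J by (simp add: scomp_def)
  finally show "mul A ?i ?j ?k \<cdot> (square i j k \<cdot> ?W) = scomp C A ?i ?j ?k t s \<cdot> on0 G i" .
qed

end

lemma pfunctor_st: "pfunctor C G \<Longrightarrow> is_pfunctor_st C G"
  by (simp add: pfunctor_def is_pfunctor_st_def Let_def)

definition covering_cofunctor :: "('o,'m) rcat \<Rightarrow> ('i,'o,'m) pmor \<Rightarrow> bool" where
  "covering_cofunctor C F \<longleftrightarrow> cofunctor C F \<and> bij_betw (onC F) (Cpt (Src F)) (Cpt (Trg F)) \<and>
     (\<forall>k \<in> Cpt (Src F). \<forall>l \<in> Cpt (Src F). invertible C (on1 F k l))"

locale covering_functor = pfunctor_st +
  assumes covering: "covering C G"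
begin

lemma G_bij: "bij_betw (onC G) (Cpt B) (Cpt A)"
  using covering by (simp add: covering_def)

lemma G_pullback: "\<lbrakk>i \<in> Cpt B; j \<in> Cpt B\<rbrakk> \<Longrightarrow> is_pullback C (sor A (onC G i) (onC G j)) (on0 G i) (on1 G i j) (sor B i j)"
  using covering by (simp add: covering_def)

lemma G_unt: "i \<in> Cpt B \<Longrightarrow> on1 G i i \<cdot> unt B i = unt A (onC G i) \<cdot> on0 G i"
  using covering by (simp add: covering_def pfunctor_def Let_def)

lemma G_mul: "\<lbrakk>i \<in> Cpt B; j \<in> Cpt B; k \<in> Cpt B\<rbrakk> \<Longrightarrow>
    on1 G i k \<cdot> mul B i j k = mul A (onC G i) (onC G j) (onC G k) \<cdot> square i j k"
  using covering by (simp add: covering_def pfunctor_def Let_def square_def)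

lemma G_scomp:
  assumes I: "i \<in> Cpt B" "j \<in> Cpt B" "k \<in> Cpt B" and s': "B.sec i j s'" and t': "B.sec j k t'"
    and s: "A.sec (onC G i) (onC G j) s" and t: "A.sec (onC G j) (onC G k) t"
    and Gs: "on1 G i j \<cdot> s' = s \<cdot> on0 G i" and Gt: "on1 G j k \<cdot> t' = t \<cdot> on0 G j"
  shows "on1 G i k \<cdot> scomp C B i j k t' s' = scomp C A (onC G i) (onC G j) (onC G k) t s \<cdot> on0 G i"
proof -
  have pB: "has_pb C (sor B j k) (tgt B i j)" using I by simp
  note P = A.pull_section[OF pB B.tgt(4)[OF I(1,2)] t'] and s'D = B.sec_D[OF I(1,2) s']
  have "on1 G i k \<cdot> scomp C B i j k t' s' = mul A (onC G i) (onC G j) (onC G k) \<cdot> (square i j k \<cdot> (pull_section C (sor B j k) (tgt B i j) t' \<cdot> s'))"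
    unfolding B.scomp_eq[OF I s' t']
    by (rule A.under2[OF G_mul[OF I]]) (use I P s'D square[OF I] in auto)
  then show ?thesis using square_at_sections(1)[OF assms] by simp
qed

abbreviation F where "F \<equiv> cofunctor_of_covering C G"
abbreviation c where "c \<equiv> inv_into (Cpt B) (onC G)"

lemma c [simp]: assumes "k \<in> Cpt A" shows "c k \<in> Cpt B" "onC G (c k) = k"
  using G_bij assms by (auto simp: bij_betw_def intro: inv_into_into f_inv_into_f)

lemma c_G [simp]: "i \<in> Cpt B \<Longrightarrow> c (onC G i) = i"
  using G_bij by (simp add: bij_betw_inv_into_left)

lemma F_simps [simp]: "Src F = A" "Trg F = B" "k \<in> Cpt A \<Longrightarrow> onC F k = c k" "k \<in> Cpt A \<Longrightarrow> on0 F k = on0 G (c k)"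
  by (auto simp: cofunctor_of_covering_def Let_def)

lemma c_pullback: "\<lbrakk>k \<in> Cpt A; l \<in> Cpt A\<rbrakk> \<Longrightarrow> is_pullback C (sor A k l) (on0 G (c k)) (on1 G (c k) (c l)) (sor B (c k) (c l))"
  using G_pullback[of "c k" "c l"] by simp

lemma F1:
  assumes kl: "k \<in> Cpt A" "l \<in> Cpt A"
  shows "on1 F k l \<in> Hom C (pbo C (sor A k l) (on0 G (c k))) (P1 B (c k) (c l))"
    "on1 G (c k) (c l) \<cdot> on1 F k l = pr1 C (sor A k l) (on0 G (c k))"
    "sor B (c k) (c l) \<cdot> on1 F k l = pr2 C (sor A k l) (on0 G (c k))"
proof -
  have pb: "has_pb C (sor A k l) (on0 G (c k))" using has_pbI[OF c_pullback[OF kl]] .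
  note D = A.pb_D[OF pb]
  have "\<exists>!h. h \<in> Hom C (pbo C (sor A k l) (on0 G (c k))) (Dom C (on1 G (c k) (c l))) \<and>
      on1 G (c k) (c l) \<cdot> h = pr1 C (sor A k l) (on0 G (c k)) \<and> sor B (c k) (c l) \<cdot> h = pr2 C (sor A k l) (on0 G (c k))"
    using c_pullback[OF kl] D kl A.Dom_Obj[OF D(3)] unfolding is_pullback_def by (auto simp: A.Hom_iff)
  then have ex: "\<exists>!h. h \<in> Hom C (pbo C (sor A k l) (on0 G (c k))) (P1 B (c k) (c l)) \<and>
      on1 G (c k) (c l) \<cdot> h = pr1 C (sor A k l) (on0 G (c k)) \<and> sor B (c k) (c l) \<cdot> h = pr2 C (sor A k l) (on0 G (c k))"
    using kl by simp
  have "on1 F k l = (THE h. h \<in> Hom C (pbo C (sor A k l) (on0 G (c k))) (P1 B (c k) (c l)) \<and>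
      on1 G (c k) (c l) \<cdot> h = pr1 C (sor A k l) (on0 G (c k)) \<and> sor B (c k) (c l) \<cdot> h = pr2 C (sor A k l) (on0 G (c k)))"
    using kl by (simp add: cofunctor_of_covering_def Let_def)
  then show "on1 F k l \<in> Hom C (pbo C (sor A k l) (on0 G (c k))) (P1 B (c k) (c l))"
    "on1 G (c k) (c l) \<cdot> on1 F k l = pr1 C (sor A k l) (on0 G (c k))"
    "sor B (c k) (c l) \<cdot> on1 F k l = pr2 C (sor A k l) (on0 G (c k))"
    using theI'[OF ex] by simp_all
qed

lemma F_pmor: "pmor C A B F"
proof -
  have "typed_pmor C F"
    unfolding typed_pmor_def pmor_extensional_def F_simps
    using F1 by (auto simp: A.Hom_iff) (auto simp: cofunctor_of_covering_def Let_def)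
  then show ?thesis by (intro pmor.intro pcat_pair_axioms pmor_axioms.intro) simp_all
qed

sublocale F: pmor C A B F by (rule F_pmor)

sublocale F: pmor_st C A B F
proof (intro pmor_st.intro F_pmor pmor_st_axioms.intro)
  fix k l assume kl: "k \<in> Cpt A" "l \<in> Cpt A"
  show "sor B (onC F k) (onC F l) \<cdot> on1 F k l = pr2 C (sor A k l) (on0 F k)" using F1(3)[OF kl] kl by simp
  have "on0 G (c l) \<cdot> (tgt B (c k) (c l) \<cdot> on1 F k l) = tgt A k l \<cdot> (on1 G (c k) (c l) \<cdot> on1 F k l)"
    using A.under2[OF G_tgt[of "c k" "c l"], of "on1 F k l"] F1(1)[OF kl] kl by (simp add: A.Hom_iff)
  then show "on0 F l \<cdot> (tgt B (onC F k) (onC F l) \<cdot> on1 F k l) = tgt A k l \<cdot> pr1 C (sor A k l) (on0 F k)"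
    using F1(2)[OF kl] kl by simp
qed

lemma G_sact:
  assumes kl: "k \<in> Cpt A" "l \<in> Cpt A" and s: "A.sec k l s"
  shows "on1 G (c k) (c l) \<cdot> sact C F k l s = s \<cdot> on0 G (c k)"
proof -
  note P = F.pull[OF kl s]
  have "on1 G (c k) (c l) \<cdot> sact C F k l s = pr1 C (sor A k l) (on0 G (c k)) \<cdot> pull_section C (sor A k l) (on0 F k) s"
    unfolding sact_def F_simps by (rule A.under[OF F1(2)[OF kl]]) (use P kl F1(1)[OF kl] in \<open>auto simp: A.Hom_iff\<close>)
  then show ?thesis using P kl by simp
qed

text \<open>By the pullback property a section over \<open>B\<close> is determined by its image
  under \<open>on1 G\<close> and by its source, which is its domain; since \<open>on1 G\<close> is
  total the image already determines the domain. Functoriality of \<open>F\<close> is thus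
  uniqueness of lifts.\<close>

lemma sact_unique:
  assumes kl: "k \<in> Cpt A" "l \<in> Cpt A" and s: "A.sec k l s" and x: "B.sec (c k) (c l) x"
    and eq: "on1 G (c k) (c l) \<cdot> x = s \<cdot> on0 G (c k)"
  shows "sact C F k l s = x"
proof -
  note xD = B.sec_D[OF _ _ x] and S = F.sact[OF kl s] F.sact_Arr[OF kl s] and sD = A.sec_D[OF kl s]
  have "Rst C (on1 G (c k) (c l) \<cdot> x) = Rst C x" by (rule A.Rst_total_Cmp[OF G1_total]) (use xD kl in auto)
  then have R: "Rst C x = Rst C (s \<cdot> on0 G (c k))" using eq by simp
  show ?thesis
  proof (rule A.pullback_ext[OF c_pullback[OF kl]])
    show "on1 G (c k) (c l) \<cdot> sact C F k l s = on1 G (c k) (c l) \<cdot> x" using G_sact[OF kl s] eq by simp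
    show "sor B (c k) (c l) \<cdot> sact C F k l s = sor B (c k) (c l) \<cdot> x"
      using B.sec_D(4)[OF _ _ S(1)] S(2) xD(4) R kl by simp
  qed (use S xD kl in auto)
qed

lemma F_section_functor: "section_functor C F"
  unfolding section_functor_def Let_def F_simps
proof (intro conjI ballI allI impI)
  fix k assume k: "k \<in> Cpt A"
  show "sact C F k k (unt A k) = unt B (onC F k)"
  proof (rule sact_unique[OF k k A.sec_unt'[OF k]])
    show "B.sec (c k) (c k) (unt B (onC F k))" using B.sec_unt' k by simp
    show "on1 G (c k) (c k) \<cdot> unt B (onC F k) = unt A k \<cdot> on0 G (c k)" using G_unt[of "c k"] k by simp
  qed
  fix l assume l: "l \<in> Cpt A"
  fix s
  { assume s: "A.sec k l s"
    show "B.sec (onC F k) (onC F l) (sact C F k l s)" "Rst C (sact C F k l s) = Rst C (s \<cdot> on0 F k)"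
      "on0 F l \<cdot> (tgt B (onC F k) (onC F l) \<cdot> sact C F k l s) = tgt A k l \<cdot> (s \<cdot> on0 F k)"
      using F.sact[OF k l s] by simp_all }
  fix m t assume m: "m \<in> Cpt A" and s: "A.sec k l s" and t: "A.sec l m t"
  note S = F.sact_sec[OF k l s] and T = F.sact_sec[OF l m t]
  show "sact C F k m (scomp C A k l m t s) = scomp C B (onC F k) (onC F l) (onC F m) (sact C F l m t) (sact C F k l s)"
  proof (rule sact_unique[OF k m A.scomp_sec[OF k l m s t]])
    show "B.sec (c k) (c m) (scomp C B (onC F k) (onC F l) (onC F m) (sact C F l m t) (sact C F k l s))"
      using B.scomp_sec[OF _ _ _ S T] k l m by simp
    show "on1 G (c k) (c m) \<cdot> scomp C B (onC F k) (onC F l) (onC F m) (sact C F l m t) (sact C F k l s) = scomp C A k l m t s \<cdot> on0 G (c k)"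
      using G_scomp[of "c k" "c l" "c m" "sact C F k l s" "sact C F l m t" s t] G_sact[OF k l s] G_sact[OF l m t] S T s t k l m by simp
  qed
qed

lemma F_inverse:
  assumes kl: "k \<in> Cpt A" "l \<in> Cpt A"
  shows "\<exists>g \<in> Hom C (P1 B (c k) (c l)) (pbo C (sor A k l) (on0 G (c k))).
    on1 F k l \<cdot> g = Ide C (P1 B (c k) (c l)) \<and> g \<cdot> on1 F k l = Ide C (pbo C (sor A k l) (on0 G (c k)))"
proof -
  let ?g = "pairing C (sor A k l) (on0 G (c k)) (on1 G (c k) (c l)) (sor B (c k) (c l))"
  have pb: "has_pb C (sor A k l) (on0 G (c k))" using has_pbI[OF c_pullback[OF kl]] .
  note D = A.pb_D[OF pb] and H = F1[OF kl] and HD = F1(1)[OF kl, unfolded A.Hom_iff]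
  have sq: "sor A k l \<cdot> on1 G (c k) (c l) = on0 G (c k) \<cdot> sor B (c k) (c l)" using G_sor[of "c k" "c l"] kl by simp
  have g: "?g \<in> Arr C" "Dom C ?g = P1 B (c k) (c l)" "Cod C ?g = pbo C (sor A k l) (on0 G (c k))"
    "pr1 C (sor A k l) (on0 G (c k)) \<cdot> ?g = on1 G (c k) (c l)" "pr2 C (sor A k l) (on0 G (c k)) \<cdot> ?g = sor B (c k) (c l)"
    using A.pairing[OF pb _ _ _ _ _ sq] kl by simp_all
  have "on1 F k l \<cdot> ?g = Ide C (P1 B (c k) (c l))"
  proof (rule A.pullback_ext[OF c_pullback[OF kl]])
    show "on1 G (c k) (c l) \<cdot> (on1 F k l \<cdot> ?g) = on1 G (c k) (c l) \<cdot> Ide C (P1 B (c k) (c l))"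
      using HD g kl by (simp add: A.under[OF H(2)])
    show "sor B (c k) (c l) \<cdot> (on1 F k l \<cdot> ?g) = sor B (c k) (c l) \<cdot> Ide C (P1 B (c k) (c l))"
      using HD g kl by (simp add: A.under[OF H(3)])
  qed (use HD g kl in auto)
  moreover have "?g \<cdot> on1 F k l = Ide C (pbo C (sor A k l) (on0 G (c k)))"
  proof (rule A.pb_ext[OF pb])
    show "pr1 C (sor A k l) (on0 G (c k)) \<cdot> (?g \<cdot> on1 F k l) = pr1 C (sor A k l) (on0 G (c k)) \<cdot> Ide C (pbo C (sor A k l) (on0 G (c k)))"
      using HD g D H by (simp add: A.under[OF g(4)])
    show "pr2 C (sor A k l) (on0 G (c k)) \<cdot> (?g \<cdot> on1 F k l) = pr2 C (sor A k l) (on0 G (c k)) \<cdot> Ide C (pbo C (sor A k l) (on0 G (c k)))"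
      using HD g D H by (simp add: A.under[OF g(5)])
  qed (use HD g D A.Dom_Obj[OF D(3)] in auto)
  ultimately show ?thesis using g by (auto simp: A.Hom_iff)
qed

lemma F_covering_cofunctor: "covering_cofunctor C F"
  unfolding covering_cofunctor_def F_simps
proof (intro conjI ballI)
  show "cofunctor C F" by (rule F.section_functor_cofunctor[OF F_section_functor])
  have "bij_betw c (Cpt A) (Cpt B)" by (rule bij_betw_inv_into[OF G_bij])
  then show "bij_betw (onC F) (Cpt A) (Cpt B)" by (simp cong: bij_betw_cong)
  fix k l assume kl: "k \<in> Cpt A" "l \<in> Cpt A"
  then show "invertible C (on1 F k l)"
    using F_inverse[OF kl] F1(1)[OF kl] unfolding invertible_def by (auto simp: A.Hom_iff)
qed

end

section \<open>From cofunctors with invertible components to covering functors\<close>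

context pmor_st
begin

text \<open>Transporting the pulled-back presentation along the isomorphism \<open>on1 F i j\<close>
  presents the source map of \<open>B\<close> by images of sections. The \<open>unit\<close> factor
  of the index stems from the one-chart presentation of the inverse.\<close>

lemma etale_sact:
  assumes ij: "i \<in> Cpt A" "j \<in> Cpt A" and inv: "invertible C (on1 F i j)"
  shows "\<exists>M q s. etale C (sor B (onC F i) (onC F j)) (M :: ('b \<times> unit) set) q (\<lambda>m. sact C F i j (s m)) \<and>
    (\<forall>m \<in> M. A.sec i j (s m))"
proof -
  obtain g where g: "g \<in> Arr C" "Dom C g = P1 B (onC F i) (onC F j)" "Cod C g = pbo C (sor A i j) (on0 F i)"
    "on1 F i j \<cdot> g = Ide C (P1 B (onC F i) (onC F j))" "g \<cdot> on1 F i j = Ide C (pbo C (sor A i j) (on0 F i))"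
    using inv ij by (auto simp: invertible_def A.Hom_iff)
  obtain M :: "'b set" and s where e0: "etale C (sor A i j) M (\<lambda>q. q) s" using A.local_homeo_etale[of "sor A i j"] ij by auto
  have pb: "has_pb C (sor A i j) (on0 F i)" using ij by simp
  note e1 = A.etale_pull[OF e0 pb on0(4)[OF ij(1)]]
  have ei: "etale C g {()} (\<lambda>_. g) (\<lambda>_. on1 F i j)"
    by (rule A.etale_iso) (use g ij in \<open>auto simp: A.Hom_iff\<close>)
  have "sor B (onC F i) (onC F j) \<cdot> (on1 F i j \<cdot> g) = pr2 C (sor A i j) (on0 F i) \<cdot> g"
    by (rule A.under[OF sor_on1]) (use g ij in auto)
  then have sg: "pr2 C (sor A i j) (on0 F i) \<cdot> g = sor B (onC F i) (onC F j)" using g(4) ij by simp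
  have "etale C (pr2 C (sor A i j) (on0 F i) \<cdot> g) (M \<times> {()})
    (\<lambda>(m, u). pr2 C (sor A i j) (on0 F i) \<cdot> Rst C (m \<cdot> pr1 C (sor A i j) (on0 F i)) \<cdot> g)
    (\<lambda>(m, u). on1 F i j \<cdot> pull_section C (sor A i j) (on0 F i) (s m))"
    by (rule A.etale_Cmp[OF e1 ei]) (use g A.pb_D[OF pb] in simp)
  then have e: "etale C (sor B (onC F i) (onC F j)) (M \<times> {()})
    (\<lambda>(m, u). pr2 C (sor A i j) (on0 F i) \<cdot> Rst C (m \<cdot> pr1 C (sor A i j) (on0 F i)) \<cdot> g)
    (\<lambda>x. sact C F i j (s (fst x)))"
    unfolding sg by (simp add: sact_def case_prod_unfold)
  have "\<forall>x \<in> M \<times> {()}. A.sec i j (s (fst x))" using A.etale_section[OF e0] by auto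
  with e show ?thesis by (intro exI[where x = "M \<times> {()}"] exI exI[where x = "\<lambda>x. s (fst x)"] conjI)
qed

end

context pmor
begin

text \<open>Under an invertible component the arrow object of \<open>B\<close> is the pullback
  itself, so both the pullback squares and the identification with \<open>F\<close> come from the
  chosen pullback; the multiplication law needs a test on sections.\<close>

lemma covering_of_cofunctor:
  assumes cf: "covering_cofunctor C F"
  shows "\<exists>G. covering C G \<and> Src G = B \<and> Trg G = A \<and> cofunctor_of_covering C G = F"
proof -
  interpret pmor_st C A B F by (rule cofunctor_st) (use cf in \<open>simp add: covering_cofunctor_def\<close>)
  have sf: "section_functor C F" by (rule cofunctor_section_functor) (use cf in \<open>simp add: covering_cofunctor_def\<close>)
  note SF = section_functor_D[OF sf]
  have bij: "bij_betw (onC F) (Cpt A) (Cpt B)" using cf by (simp add: covering_cofunctor_def)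
  define d where "d = inv_into (Cpt A) (onC F)"
  have d [simp]: "d i \<in> Cpt A" "onC F (d i) = i" if "i \<in> Cpt B" for i
    using bij that by (auto simp: d_def bij_betw_def intro: inv_into_into f_inv_into_f)
  have dF [simp]: "d (onC F k) = k" if "k \<in> Cpt A" for k using bij that by (simp add: d_def bij_betw_inv_into_left)
  have "\<exists>g. g \<in> Hom C (P1 B (onC F k) (onC F l)) (pbo C (sor A k l) (on0 F k)) \<and>
    on1 F k l \<cdot> g = Ide C (P1 B (onC F k) (onC F l)) \<and> g \<cdot> on1 F k l = Ide C (pbo C (sor A k l) (on0 F k))"
    if kl: "k \<in> Cpt A" "l \<in> Cpt A" for k l
    using cf kl by (auto simp: covering_cofunctor_def invertible_def)
  then obtain g where g0: "\<And>k l. \<lbrakk>k \<in> Cpt A; l \<in> Cpt A\<rbrakk> \<Longrightarrow> g k l \<in> Hom C (P1 B (onC F k) (onC F l)) (pbo C (sor A k l) (on0 F k)) \<and>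
    on1 F k l \<cdot> g k l = Ide C (P1 B (onC F k) (onC F l)) \<and> g k l \<cdot> on1 F k l = Ide C (pbo C (sor A k l) (on0 F k))" by metis
  have g: "g k l \<in> Arr C" "Dom C (g k l) = P1 B (onC F k) (onC F l)" "Cod C (g k l) = pbo C (sor A k l) (on0 F k)"
    "on1 F k l \<cdot> g k l = Ide C (P1 B (onC F k) (onC F l))" "g k l \<cdot> on1 F k l = Ide C (pbo C (sor A k l) (on0 F k))"
    if "k \<in> Cpt A" "l \<in> Cpt A" for k l using g0[OF that] by (auto simp: A.Hom_iff)
  \<comment> \<open>On arrows, the first projection read through the inverse of
    \<open>on1 F\<close>.\<close>
  define G where "G = \<lparr>Src = B, Trg = A, onC = (\<lambda>i \<in> Cpt B. d i), on0 = (\<lambda>i \<in> Cpt B. on0 F (d i)),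
    on1 = (\<lambda>i j. if i \<in> Cpt B \<and> j \<in> Cpt B then pr1 C (sor A (d i) (d j)) (on0 F (d i)) \<cdot> g (d i) (d j) else undefined)\<rparr>"
  have G: "Src G = B" "Trg G = A" "\<And>i. i \<in> Cpt B \<Longrightarrow> onC G i = d i" "\<And>i. i \<in> Cpt B \<Longrightarrow> on0 G i = on0 F (d i)"
    "\<And>i j. \<lbrakk>i \<in> Cpt B; j \<in> Cpt B\<rbrakk> \<Longrightarrow> on1 G i j = pr1 C (sor A (d i) (d j)) (on0 F (d i)) \<cdot> g (d i) (d j)"
    by (simp_all add: G_def)
  note Bd = A.pb_D[OF on0_pb]
  have sg: "sor B i j = pr2 C (sor A (d i) (d j)) (on0 F (d i)) \<cdot> g (d i) (d j)" if ij: "i \<in> Cpt B" "j \<in> Cpt B" for i j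
  proof -
    let ?g = "g (d i) (d j)"
    have "sor B (onC F (d i)) (onC F (d j)) \<cdot> (on1 F (d i) (d j) \<cdot> ?g) = pr2 C (sor A (d i) (d j)) (on0 F (d i)) \<cdot> ?g"
      by (rule A.under[OF sor_on1]) (use g[of "d i" "d j"] ij in auto)
    moreover have "on1 F (d i) (d j) \<cdot> ?g = Ide C (P1 B i j)" using g(4)[of "d i" "d j"] ij by simp
    ultimately show ?thesis using ij B.sor[OF ij] by simp
  qed
  have st: "is_pfunctor_st C G"
    unfolding is_pfunctor_st_def Let_def G(1,2)
  proof (intro conjI ballI)
    fix i assume i: "i \<in> Cpt B"
    show "onC G i \<in> Cpt A" "on0 G i \<in> Hom C (P0 B i) (P0 A (onC G i))" "total C (on0 G i)" using G i by (simp_all add: A.Hom_iff)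
    fix j assume j: "j \<in> Cpt B"
    note gij = g[OF d(1)[OF i] d(1)[OF j]] and D = Bd[OF d(1)[OF i] d(1)[OF j]]
    show "on1 G i j \<in> Hom C (P1 B i j) (P1 A (onC G i) (onC G j))" using G gij D i j by (simp add: A.Hom_iff)
    show "on0 G i \<cdot> sor B i j = sor A (onC G i) (onC G j) \<cdot> on1 G i j"
      unfolding sg[OF i j] using G gij D i j by (simp add: A.pb_square[OF on0_pb])
    have "on0 F (d j) \<cdot> (tgt B i j \<cdot> on1 F (d i) (d j)) \<cdot> g (d i) (d j) = tgt A (d i) (d j) \<cdot> pr1 C (sor A (d i) (d j)) (on0 F (d i)) \<cdot> g (d i) (d j)"
      using tgt_on1[OF d(1)[OF i] d(1)[OF j]] i j by simp
    then show "on0 G j \<cdot> tgt B i j = tgt A (onC G i) (onC G j) \<cdot> on1 G i j"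
      using G gij D i j by simp
  qed
  interpret G: pfunctor_st C A B G
    by (intro pfunctor_st.intro pcat_pair_axioms pfunctor_st_axioms.intro st G)
  have Gsact: "on1 G (onC F k) (onC F l) \<cdot> sact C F k l s = s \<cdot> on0 F k" if kl: "k \<in> Cpt A" "l \<in> Cpt A" and s: "A.sec k l s" for k l s
  proof -
    note P = pull[OF kl s] and gkl = g[OF kl] and D = Bd[OF kl]
    show ?thesis using G(5)[of "onC F k" "onC F l"] kl P gkl D
      by (simp add: sact_def A.under[OF gkl(5)])
  qed
  have pbk: "is_pullback C (sor A (onC G i) (onC G j)) (on0 G i) (on1 G i j) (sor B i j)" if ij: "i \<in> Cpt B" "j \<in> Cpt B" for i j
  proof -
    note gij = g[OF d(1)[OF ij(1)] d(1)[OF ij(2)]]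
    have "is_pullback C (sor A (d i) (d j)) (on0 F (d i))
      (pr1 C (sor A (d i) (d j)) (on0 F (d i)) \<cdot> g (d i) (d j)) (pr2 C (sor A (d i) (d j)) (on0 F (d i)) \<cdot> g (d i) (d j))"
      by (rule A.pullback_iso[where k' = "on1 F (d i) (d j)"]) (use on0_pb[of "d i" "d j"] gij ij in \<open>auto simp: has_pb_def A.Hom_iff\<close>)
    then show ?thesis using G ij sg[OF ij] by simp
  qed
  have unit: "on1 G i i \<cdot> unt B i = unt A (onC G i) \<cdot> on0 G i" if i: "i \<in> Cpt B" for i
    using Gsact[OF d(1)[OF i] d(1)[OF i] A.sec_unt'[OF d(1)[OF i]]] SF(4)[of "d i"] G i by simp
  have mult: "on1 G i k \<cdot> mul B i j k = mul A (onC G i) (onC G j) (onC G k) \<cdot> G.square i j k"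
    if I: "i \<in> Cpt B" "j \<in> Cpt B" "k \<in> Cpt B" for i j k
  proof -
    obtain M q s where e2: "etale C (sor B j k) (M :: ('b \<times> unit) set) q (\<lambda>m. sact C F (d j) (d k) (s m))"
      and sM: "\<And>m. m \<in> M \<Longrightarrow> A.sec (d j) (d k) (s m)"
      using etale_sact[of "d j" "d k"] I cf by (auto simp: covering_cofunctor_def)
    have pbB: "has_pb C (sor B j k) (tgt B i j)" using I by simp
    note e3 = A.etale_pull[OF e2 pbB B.tgt(4)[OF I(1,2)]]
    note DB = A.pb_D[OF pbB] and Sq = G.square[OF I]
    show ?thesis
    proof (rule A.etale_ext[OF e3])
      fix m assume m: "m \<in> M"
      note t = sM[OF m]
      let ?t = "sact C F (d j) (d k) (s m)"
      have t': "B.sec j k ?t" using SF(1)[OF _ _ t] I by simp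
      let ?P = "pull_section C (sor B j k) (tgt B i j) ?t"
      note P = A.pull_section[OF pbB B.tgt(4)[OF I(1,2)] t']
      \<comment> \<open>Precomposing with the invertible \<open>on1 F (d i) (d j)\<close> moves the
        test to a pullback over \<open>A\<close>, where pulled-back sections suffice; the
        isomorphism is cancelled afterwards.\<close>
      have "on1 G i k \<cdot> mul B i j k \<cdot> ?P \<cdot> on1 F (d i) (d j) = mul A (onC G i) (onC G j) (onC G k) \<cdot> G.square i j k \<cdot> ?P \<cdot> on1 F (d i) (d j)"
      proof (rule on1_ext[of "d i" "d j"])
        fix r assume r: "A.sec (d i) (d j) r"
        let ?r = "sact C F (d i) (d j) r" and ?Q = "pull_section C (sor A (d i) (d j)) (on0 F (d i)) r"
        have r': "B.sec i j ?r" using SF(1)[OF _ _ r] I by simp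
        note Q = pull[OF d(1)[OF I(1)] d(1)[OF I(2)] r]
        note S = G.square_at_sections(1)[OF I r' t', of r "s m"]
        have "on1 G i k \<cdot> (mul B i j k \<cdot> (?P \<cdot> ?r)) = on1 G i k \<cdot> sact C F (d i) (d k) (scomp C A (d i) (d j) (d k) (s m) r)"
          using SF(5)[OF _ _ _ r t] B.scomp_eq[OF I r' t'] I by simp
        also have "\<dots> = scomp C A (d i) (d j) (d k) (s m) r \<cdot> on0 F (d i)"
          using Gsact[of "d i" "d k" "scomp C A (d i) (d j) (d k) (s m) r"] A.scomp_sec[OF _ _ _ r t] I by simp
        also have "\<dots> = mul A (onC G i) (onC G j) (onC G k) \<cdot> (G.square i j k \<cdot> (?P \<cdot> ?r))"
          using S G I r t Gsact[OF _ _ r] Gsact[OF _ _ t] by simp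
        finally show "on1 G i k \<cdot> mul B i j k \<cdot> ?P \<cdot> on1 F (d i) (d j) \<cdot> ?Q =
          mul A (onC G i) (onC G j) (onC G k) \<cdot> G.square i j k \<cdot> ?P \<cdot> on1 F (d i) (d j) \<cdot> ?Q"
          using P Q Sq I by (simp add: sact_def)
      qed (use P Sq I in auto)
      then have "on1 G i k \<cdot> mul B i j k \<cdot> ?P \<cdot> on1 F (d i) (d j) \<cdot> g (d i) (d j) =
        mul A (onC G i) (onC G j) (onC G k) \<cdot> G.square i j k \<cdot> ?P \<cdot> on1 F (d i) (d j) \<cdot> g (d i) (d j)" by simp
      then have "on1 G i k \<cdot> mul B i j k \<cdot> ?P = mul A (onC G i) (onC G j) (onC G k) \<cdot> G.square i j k \<cdot> ?P"
        using P Sq I g[of "d i" "d j"] by simp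
      then show "on1 G i k \<cdot> mul B i j k \<cdot> ?P = mul A (onC G i) (onC G j) (onC G k) \<cdot> G.square i j k \<cdot> ?P" .
    qed (use DB Sq I in auto)
  qed
  have ext: "pmor_extensional G" by (auto simp: pmor_extensional_def G_def)
  have cov: "covering C G"
    unfolding covering_def pfunctor_def Let_def G(1,2)
  proof (intro conjI ballI)
    have "bij_betw d (Cpt B) (Cpt A)" unfolding d_def by (rule bij_betw_inv_into[OF bij])
    then show "bij_betw (onC G) (Cpt B) (Cpt A)" using G by (simp cong: bij_betw_cong)
    fix i j k assume I: "i \<in> Cpt B" "j \<in> Cpt B" "k \<in> Cpt B"
    show "on1 G i k \<cdot> mul B i j k = mul A (onC G i) (onC G j) (onC G k) \<cdot>
          pairing C (sor A (onC G j) (onC G k)) (tgt A (onC G i) (onC G j))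
            (on1 G j k \<cdot> pr1 C (sor B j k) (tgt B i j)) (on1 G i j \<cdot> pr2 C (sor B j k) (tgt B i j))"
      using mult[OF I] by (simp add: G.square_def)
  qed (use ext unit pbk G.G1_total G.G_sor G.G_tgt in \<open>auto simp: A.Hom_iff\<close>)
  interpret G: covering_functor C A B G
    by (intro covering_functor.intro G.pfunctor_st_axioms covering_functor_axioms.intro cov)
  have cG: "inv_into (Cpt B) (onC G) k = onC F k" if k: "k \<in> Cpt A" for k
    using G.c_G[of "onC F k"] G k by simp
  have "cofunctor_of_covering C G = F"
  proof (rule pmor_eqI[OF G.F.typed_pmor typed_pmor])
    fix k l assume "k \<in> Cpt (Src F)" "l \<in> Cpt (Src F)"
    then have kl: "k \<in> Cpt A" "l \<in> Cpt A" by simp_all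
    note H = G.F1[OF kl, unfolded cG[OF kl(1)] cG[OF kl(2)]] and D = Bd[OF kl]
    have pbkl: "is_pullback C (sor A k l) (on0 F k) (on1 G (onC F k) (onC F l)) (sor B (onC F k) (onC F l))"
      using pbk[of "onC F k" "onC F l"] G kl by simp
    show "on1 (cofunctor_of_covering C G) k l = on1 F k l"
    proof (rule A.pullback_ext[OF pbkl])
      show "on1 G (onC F k) (onC F l) \<cdot> on1 (cofunctor_of_covering C G) k l = on1 G (onC F k) (onC F l) \<cdot> on1 F k l"
        using H(2) G kl g[OF kl] D by simp
      show "sor B (onC F k) (onC F l) \<cdot> on1 (cofunctor_of_covering C G) k l = sor B (onC F k) (onC F l) \<cdot> on1 F k l"
        using H(3) G kl sor_on1[OF kl] by simp
    qed (use H(1) kl G(3-5) g[OF kl] D in \<open>auto simp: A.Hom_iff\<close>)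
  qed (use cG G in auto)
  then show ?thesis using cov G by blast
qed

end

section \<open>Localic functors between categories of partial sections\<close>

context join_restriction_category
begin

text \<open>Agreement loci of sections of a local homeomorphism are stable under pullback. Where the
  common value lies in the chart \<open>i\<close>, both sections equal \<open>r i\<close>, so the
  region on which both pass through that chart is contained in the locus, and \<open>f\<close>
  restricted to the corresponding part of \<open>e\<close> lands in this region.\<close>

lemma pull_agree:
  assumes p: "etale C p I q r" and s: "partial_section C p s" and t: "partial_section C p t"
    and f: "f \<in> Arr C" "Cod C f = Cod C p" and e: "e \<in> RI C (Dom C f)"
    and eq: "s \<cdot> (f \<cdot> e) = t \<cdot> (f \<cdot> e)" and le: "Rst C (s \<cdot> f) \<cdot> e = e"
  shows "Rst C (agree C s t \<cdot> f) \<cdot> e = e"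
proof -
  note D = etale_D[OF p] and sD = psec_D[OF s etale_D(2)[OF p]] and tD = psec_D[OF t etale_D(2)[OF p]] and eD = RI_D[OF e]
  have st: "Dom C t = Dom C s" "Cod C t = Cod C s" using sD tD by simp_all
  note a = agree[OF sD(1) tD(1) st] and aD = RI_D[OF agree_RI[OF sD(1) tD(1) st]]
  have R: "Rst C (s \<cdot> (f \<cdot> e)) = e" using Rst_Cmp_RI[OF e, of "s \<cdot> f"] le sD f eD by simp
  have "cover C (Dom C (s \<cdot> (f \<cdot> e))) I (\<lambda>i. Rst C (Rst C (q i) \<cdot> (s \<cdot> (f \<cdot> e)))) (Rst C (Ide C (Dom C p) \<cdot> (s \<cdot> (f \<cdot> e))))"
    by (rule cover_precomp[OF D(12)]) (use sD f eD in auto)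
  then have c: "cover C (Dom C f) I (\<lambda>i. Rst C (q i \<cdot> (s \<cdot> (f \<cdot> e)))) e"
    using R sD f eD D by (auto elim!: cover_cong)
  have "Rst C (agree C s t \<cdot> f) \<cdot> e = e \<cdot> e"
  proof (rule cover_ext[OF c])
    fix i assume i: "i \<in> I"
    \<comment> \<open>The part of \<open>f \<cdot> e\<close> whose common value lies in the chart
      \<open>i\<close>; it lands both in \<open>q i \<cdot> s\<close> and in
      \<open>q i \<cdot> t\<close>.\<close>
    define x where "x = q i \<cdot> (s \<cdot> (f \<cdot> e))"
    note qs = etale_at_section[OF p s i] and qt = etale_at_section[OF p t i]
    note qsD = RI_D[OF qs(2)] and qtD = RI_D[OF qt(2)]
    let ?d = "q i \<cdot> s" and ?d' = "q i \<cdot> t"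
    have x: "x \<in> Arr C" "Dom C x = Dom C f" "Cod C x = Cod C p" unfolding x_def using i D sD f eD by simp_all
    have xd: "x = ?d \<cdot> (f \<cdot> e)" unfolding x_def using i D sD f eD by simp
    have xd': "x = ?d' \<cdot> (f \<cdot> e)" unfolding x_def eq using i D tD f eD by simp
    have dx: "?d \<cdot> x = x" unfolding xd by (rule RI_idem_Cmp[OF qs(2)]) (use f eD in auto)
    have d'x: "?d' \<cdot> x = x" unfolding xd' by (rule RI_idem_Cmp[OF qt(2)]) (use f eD in auto)
    have dd: "?d \<cdot> ?d' \<in> RI C (Dom C s)" using RI_Cmp[OF qs(2) qt(2)] sD by simp
    \<comment> \<open>Where both sections pass through the chart \<open>i\<close> they coincide with
      \<open>r i\<close>, hence with each other.\<close>
    have "s \<cdot> (?d \<cdot> ?d') = r i \<cdot> (?d \<cdot> ?d')" using under2[OF qs(3)[symmetric], of ?d'] qsD qtD sD D i by simp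
    also have "\<dots> = r i \<cdot> (?d' \<cdot> ?d)" unfolding RI_comm[OF qs(2) qt(2)] ..
    also have "\<dots> = t \<cdot> (?d' \<cdot> ?d)" using under2[OF qt(3), of ?d] qsD qtD tD D i by simp
    also have "\<dots> = t \<cdot> (?d \<cdot> ?d')" unfolding RI_comm[OF qs(2) qt(2)] ..
    finally have sd: "s \<cdot> (?d \<cdot> ?d') = t \<cdot> (?d \<cdot> ?d')" .
    have "Rst C s \<cdot> (?d \<cdot> ?d') = ?d \<cdot> ?d'" by (rule under[OF qs(4)]) (use qsD qtD sD in auto)
    from agree_greatest[OF sD(1) tD(1) st dd this sd]
    have ddx: "?d \<cdot> ?d' \<cdot> agree C s t = ?d \<cdot> ?d'" .
    have "agree C s t \<cdot> x = agree C s t \<cdot> (?d \<cdot> ?d' \<cdot> x)" using dx d'x x qsD qtD by simp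
    also have "\<dots> = ?d \<cdot> ?d' \<cdot> (agree C s t \<cdot> x)"
      by (rule under2[OF RI_comm[OF agree_RI[OF sD(1) tD(1) st] dd]]) (use x aD RI_D[OF dd] sD in auto)
    also have "\<dots> = ?d \<cdot> ?d' \<cdot> agree C s t \<cdot> x"
      by (rule assoc[symmetric]) (use x aD RI_D[OF dd] sD in auto)
    also have "\<dots> = x" unfolding ddx using dx d'x x qsD qtD by simp
    finally have ax: "agree C s t \<cdot> x = x" .
    have ex: "f \<cdot> (e \<cdot> Rst C x) = x"
    proof -
      have "x = f \<cdot> e \<cdot> Rst C (?d \<cdot> (f \<cdot> e))" unfolding xd
        by (rule RI_slide[OF qs(2)]) (use f eD in auto)
      then have "x = f \<cdot> e \<cdot> Rst C x" unfolding xd[symmetric] .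
      also have "f \<cdot> e \<cdot> Rst C x = f \<cdot> (e \<cdot> Rst C x)" by (rule assoc) (use f eD x in auto)
      finally show ?thesis by (rule sym)
    qed
    have "Rst C (agree C s t \<cdot> f) \<cdot> (e \<cdot> Rst C x) = Rst C (agree C s t \<cdot> f \<cdot> (e \<cdot> Rst C x))"
      using Rst_Cmp_RI[of "e \<cdot> Rst C x" "Dom C f" "agree C s t \<cdot> f"] RI_Cmp[OF e RI_Rst[OF x(1,2)]] aD f sD by simp
    also have "agree C s t \<cdot> f \<cdot> (e \<cdot> Rst C x) = agree C s t \<cdot> (f \<cdot> (e \<cdot> Rst C x))"
      by (rule assoc) (use aD f sD eD x in auto)
    also have "\<dots> = x" unfolding ex ax ..
    finally have 1: "Rst C (agree C s t \<cdot> f) \<cdot> (e \<cdot> Rst C x) = Rst C x" .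
    have 2: "e \<cdot> Rst C x = Rst C x" using cover_D(4)[OF c i] unfolding x_def .
    show "Rst C (agree C s t \<cdot> f) \<cdot> Rst C (q i \<cdot> (s \<cdot> (f \<cdot> e))) = e \<cdot> Rst C (q i \<cdot> (s \<cdot> (f \<cdot> e)))"
      unfolding x_def[symmetric] using 1 2 by simp
  qed (use aD f sD eD in auto)
  then show ?thesis using RI_idem[OF e] aD f sD eD by simp
qed

end

context etale_pcat
begin

lemma meet_Phi:
  assumes ij: "i \<in> Cpt A" "j \<in> Cpt A" and s: "sec i j s" and t: "sec i j t"
  shows "meet (Phi_cat C A) (i, j, s) (i, j, t) = (i, j, s \<cdot> agree C s t)"
proof -
  interpret Phi: join_restriction_category "Phi_cat C A" by (rule join_restriction_category_Phi)
  note sD = sec_D[OF ij s] and tD = sec_D[OF ij t]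
  have st: "s \<in> Hom C (P0 A i) (P1 A i j)" "t \<in> Hom C (P0 A i) (P1 A i j)" using sD tD by (auto simp: Hom_iff)
  have m: "sec i j (s \<cdot> agree C s t)" using sec_RI[OF ij s] agree_RI[of s t] sD tD by simp
  note M = is_meet_agree[OF st, unfolded is_meet_def]
  show ?thesis
  proof (rule Phi.meet_eqI)
    show "is_meet (Phi_cat C A) (i, j, s) (i, j, t) (i, j, s \<cdot> agree C s t)"
      unfolding is_meet_def
    proof (intro conjI ballI impI)
      show "(i, j, s \<cdot> agree C s t) \<in> Hom (Phi_cat C A) (Dom (Phi_cat C A) (i, j, s)) (Cod (Phi_cat C A) (i, j, s))"
        using ij m by (simp add: Phi_Hom)
      show "le (Phi_cat C A) (i, j, s \<cdot> agree C s t) (i, j, s)" "le (Phi_cat C A) (i, j, s \<cdot> agree C s t) (i, j, t)"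
        using M ij s t m by (simp_all add: le_Phi)
      fix k assume "k \<in> Hom (Phi_cat C A) (Dom (Phi_cat C A) (i, j, s)) (Cod (Phi_cat C A) (i, j, s))"
      then obtain u where u: "k = (i, j, u)" "sec i j u" by (auto simp: Phi_Hom)
      assume "le (Phi_cat C A) k (i, j, s) \<and> le (Phi_cat C A) k (i, j, t)"
      then have "le C u s" "le C u t" using u ij s t by (simp_all add: le_Phi)
      then have "le C u (s \<cdot> agree C s t)" using M sec_D[OF ij u(2)] sD by (simp add: Hom_iff)
      then show "le (Phi_cat C A) k (i, j, s \<cdot> agree C s t)" using u ij m by (simp add: le_Phi)
    qed
  qed
qed

end

text \<open>Preservation of meets in terms of domains: the agreement locus of the images is the
  inverse image of the agreement locus.\<close>

definition meet_law :: "('o,'m) rcat \<Rightarrow> ('i,'o,'m) pmor \<Rightarrow> 'i \<Rightarrow> 'i \<Rightarrow> bool" where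
  "meet_law C F i j \<longleftrightarrow> (\<forall>s t. partial_section C (sor (Src F) i j) s \<and> partial_section C (sor (Src F) i j) t \<longrightarrow>
     agree C (sact C F i j s) (sact C F i j t) = Rst C (agree C s t \<cdot>\<^bsub>C\<^esub> on0 F i))"

text \<open>The join condition in terms of domains: every section over the codomain agrees locally
  with images of sections.\<close>

definition join_law :: "('o,'m) rcat \<Rightarrow> ('i,'o,'m) pmor \<Rightarrow> 'i \<Rightarrow> 'i \<Rightarrow> bool" where
  "join_law C F i j \<longleftrightarrow> (\<forall>g. partial_section C (sor (Trg F) (onC F i) (onC F j)) g \<longrightarrow>
     cover C (P0 (Trg F) (onC F i)) {s. partial_section C (sor (Src F) i j) s} (\<lambda>s. agree C g (sact C F i j s)) (Rst C g))"

section \<open>Meet and join laws versus invertibility of the components\<close>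

context pmor_st
begin

text \<open>Both sides of the meet equation are restrictions of \<open>sact C F i j s\<close>, so
  the equation is one between their domains.\<close>

lemma meet_law_alt:
  assumes ij: "i \<in> Cpt A" "j \<in> Cpt A" and s: "A.sec i j s" and t: "A.sec i j t"
  shows "meet (Phi_cat C B) (far (JF (Phi_mor C F)) (i, j, s)) (far (JF (Phi_mor C F)) (i, j, t)) =
      far (JF (Phi_mor C F)) (meet (Phi_cat C A) (i, j, s) (i, j, t)) \<longleftrightarrow>
    agree C (sact C F i j s) (sact C F i j t) = Rst C (agree C s t \<cdot> on0 F i)"
proof -
  note sD = A.sec_D[OF ij s] and tD = A.sec_D[OF ij t] and S = sact[OF ij s] sact_Arr[OF ij s] and T = sact[OF ij t] sact_Arr[OF ij t]
  have st: "Dom C t = Dom C s" "Cod C t = Cod C s" using sD tD by simp_all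
  have ST: "Dom C (sact C F i j t) = Dom C (sact C F i j s)" "Cod C (sact C F i j t) = Cod C (sact C F i j s)" using S T by simp_all
  note a = A.agree[OF sD(1) tD(1) st] and aD = A.RI_D[OF A.agree_RI[OF sD(1) tD(1) st]]
  note b = A.agree[OF S(4) T(4) ST] and bD = A.RI_D[OF A.agree_RI[OF S(4) T(4) ST]]
  let ?a = "agree C s t" and ?b = "agree C (sact C F i j s) (sact C F i j t)"
  have aR: "?a \<in> RI C (P0 A i)" using a(1) sD by simp
  have m: "A.sec i j (s \<cdot> ?a)" by (rule A.sec_RI[OF ij s aR])
  have Rs: "Rst C (s \<cdot> ?a) = ?a" using A.Rst_Cmp_RI[OF a(1) sD(1) refl] a(3) by simp
  have Rb: "Rst C (sact C F i j s \<cdot> ?b) = ?b" using A.Rst_Cmp_RI[OF b(1) S(4) refl] b(3) by simp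
  have Ra: "Rst C (sact C F i j (s \<cdot> ?a)) = Rst C (?a \<cdot> on0 F i)"
    unfolding sact(2)[OF ij m] using A.Rst_Rst_Cmp[of "on0 F i" "s \<cdot> ?a"] Rs ij sD aD by simp
  have "meet (Phi_cat C B) (far (JF (Phi_mor C F)) (i, j, s)) (far (JF (Phi_mor C F)) (i, j, t)) =
      far (JF (Phi_mor C F)) (meet (Phi_cat C A) (i, j, s) (i, j, t)) \<longleftrightarrow>
    sact C F i j s \<cdot> ?b = sact C F i j (s \<cdot> ?a)"
    using ij s t m S T by (simp add: A.meet_Phi B.meet_Phi)
  also have "\<dots> \<longleftrightarrow> ?b = Rst C (?a \<cdot> on0 F i)"
    using Rb Ra sact_RI[OF ij s aR] by metis
  finally show ?thesis .
qed

lemma join_law_alt: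
  assumes ij: "i \<in> Cpt A" "j \<in> Cpt A" and g: "B.sec (onC F i) (onC F j) g"
  shows "is_join (Phi_cat C B) (onC F i) (onC F j)
      ((\<lambda>f. meet (Phi_cat C B) (onC F i, onC F j, g) (far (JF (Phi_mor C F)) f)) ` Hom (Phi_cat C A) i j) (onC F i, onC F j, g) \<longleftrightarrow>
    cover C (P0 B (onC F i)) {s. A.sec i j s} (\<lambda>s. agree C g (sact C F i j s)) (Rst C g)"
proof -
  let ?g = "\<lambda>s. g \<cdot> agree C g (sact C F i j s)" and ?i = "onC F i" and ?j = "onC F j"
  have IJ: "?i \<in> Cpt B" "?j \<in> Cpt B" using ij by simp_all
  note gD = B.sec_D[OF IJ g]
  have a: "agree C g (sact C F i j s) \<in> RI C (P0 B ?i)" "B.sec ?i ?j (?g s)" "Rst C (?g s) = agree C g (sact C F i j s)" "le C (?g s) g"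
    if s: "A.sec i j s" for s
  proof -
    note S = sact_Arr[OF ij s]
    have ST: "Dom C (sact C F i j s) = Dom C g" "Cod C (sact C F i j s) = Cod C g" using S gD by simp_all
    note b = A.agree[OF gD(1) S(1) ST]
    show "agree C g (sact C F i j s) \<in> RI C (P0 B ?i)" using b(1) gD by simp
    then show "B.sec ?i ?j (?g s)" "le C (?g s) g" using B.sec_RI[OF IJ g] A.le_RI[of _ "P0 B ?i" g] gD by simp_all
    show "Rst C (?g s) = agree C g (sact C F i j s)" using A.Rst_Cmp_RI[OF b(1) gD(1) refl] b(3) by simp
  qed
  have H: "Hom (Phi_cat C A) i j = (\<lambda>s. (i, j, s)) ` {s. A.sec i j s}" using ij by (auto simp: Phi_Hom)
  have "(\<lambda>f. meet (Phi_cat C B) (?i, ?j, g) (far (JF (Phi_mor C F)) f)) ` Hom (Phi_cat C A) i j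
     = (\<lambda>s. (?i, ?j, s)) ` ?g ` {s. A.sec i j s}"
    unfolding H image_image by (rule image_cong[OF refl]) (use ij IJ g sact_sec[OF ij] in \<open>simp add: B.meet_Phi\<close>)
  then have "is_join (Phi_cat C B) ?i ?j ((\<lambda>f. meet (Phi_cat C B) (?i, ?j, g) (far (JF (Phi_mor C F)) f)) ` Hom (Phi_cat C A) i j) (?i, ?j, g)
    \<longleftrightarrow> is_join C (P0 B ?i) (P1 B ?i ?j) (?g ` {s. A.sec i j s}) g"
    using B.is_join_Phi[OF IJ, of "?g ` {s. A.sec i j s}" g] a(2) g by auto
  also have "\<dots> \<longleftrightarrow> cover C (P0 B ?i) {s. A.sec i j s} (\<lambda>s. agree C g (sact C F i j s)) (Rst C g)"
  proof
    assume "is_join C (P0 B ?i) (P1 B ?i ?j) (?g ` {s. A.sec i j s}) g"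
    from A.is_join_cover[OF this] show "cover C (P0 B ?i) {s. A.sec i j s} (\<lambda>s. agree C g (sact C F i j s)) (Rst C g)"
      using a(3) by (auto elim!: A.cover_cong)
  next
    assume "cover C (P0 B ?i) {s. A.sec i j s} (\<lambda>s. agree C g (sact C F i j s)) (Rst C g)"
    then have c: "cover C (P0 B ?i) {s. A.sec i j s} (\<lambda>s. Rst C (?g s)) (Rst C g)"
      by (rule A.cover_cong) (use a(3) in auto)
    show "is_join C (P0 B ?i) (P1 B ?i ?j) (?g ` {s. A.sec i j s}) g"
      by (rule A.is_join_coverI[OF _ _ _ c]) (use a gD B.sec_D[OF IJ a(2)] in \<open>auto simp: A.Hom_iff\<close>)
  qed
  finally show ?thesis .
qed

lemma localic_alt:
  assumes jr: "join_restriction_functor (Phi_cat C A) (Phi_cat C B) (JF (Phi_mor C F))"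
  shows "localic (Phi_cat C A) (Phi_cat C B) (JF (Phi_mor C F)) \<longleftrightarrow>
    bij_betw (onC F) (Cpt A) (Cpt B) \<and> (\<forall>i \<in> Cpt A. \<forall>j \<in> Cpt A. meet_law C F i j \<and> join_law C F i j)"
proof -
  let ?h = "JF (Phi_mor C F)"
  have b: "bij_betw (fob ?h) (Cpt A) (Cpt B) \<longleftrightarrow> bij_betw (onC F) (Cpt A) (Cpt B)" by (simp cong: bij_betw_cong)
  have m: "(\<forall>f \<in> Hom (Phi_cat C A) i j. \<forall>g \<in> Hom (Phi_cat C A) i j.
        meet (Phi_cat C B) (far ?h f) (far ?h g) = far ?h (meet (Phi_cat C A) f g)) \<longleftrightarrow> meet_law C F i j"
    if ij: "i \<in> Cpt A" "j \<in> Cpt A" for i j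
    unfolding meet_law_def using meet_law_alt[OF ij] ij by (fastforce simp: Phi_Hom simp del: Phi_mor_simps)
  have j: "(\<forall>g \<in> Hom (Phi_cat C B) (fob ?h i) (fob ?h j).
        is_join (Phi_cat C B) (fob ?h i) (fob ?h j) ((\<lambda>f. meet (Phi_cat C B) g (far ?h f)) ` Hom (Phi_cat C A) i j) g) \<longleftrightarrow> join_law C F i j"
    if ij: "i \<in> Cpt A" "j \<in> Cpt A" for i j
  proof -
    have f: "fob ?h i = onC F i" "fob ?h j = onC F j" using ij by simp_all
    have "(\<forall>g \<in> Hom (Phi_cat C B) (onC F i) (onC F j). P g) \<longleftrightarrow> (\<forall>g. B.sec (onC F i) (onC F j) g \<longrightarrow> P (onC F i, onC F j, g))" for P
      using ij by (auto simp: Phi_Hom)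
    then show ?thesis unfolding f join_law_def using join_law_alt[OF ij] by simp
  qed
  show ?thesis unfolding localic_def using jr b m j by (simp add: ball_conj_distrib)
qed

text \<open>An inverse cancels the component, so where the images of two sections agree their
  pullbacks agree, and \<open>pull_agree\<close> converts this into the agreement locus of the
  sections themselves. For joins, \<open>etale_sact\<close> presents the source map of
  \<open>B\<close> by images of sections.\<close>

lemma laws_of_invertible:
  assumes ij: "i \<in> Cpt A" "j \<in> Cpt A" and inv: "invertible C (on1 F i j)"
  shows "meet_law C F i j" and "join_law C F i j"
proof -
  let ?i = "onC F i" and ?j = "onC F j"
  have IJ: "?i \<in> Cpt B" "?j \<in> Cpt B" using ij by simp_all
  obtain k where k: "k \<in> Arr C" "Dom C k = P1 B ?i ?j" "Cod C k = pbo C (sor A i j) (on0 F i)"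
    "k \<cdot> on1 F i j = Ide C (pbo C (sor A i j) (on0 F i))"
    using inv ij by (auto simp: invertible_def A.Hom_iff)
  obtain I r where p: "etale C (sor A i j) I (\<lambda>q. q) r" using A.local_homeo_etale[of "sor A i j"] ij by auto
  have ks: "k \<cdot> (sact C F i j s \<cdot> x) = pull_section C (sor A i j) (on0 F i) s \<cdot> x"
    if "A.sec i j s" "x \<in> Arr C" "Cod C x = P0 B ?i" for s x
  proof -
    note P = pull[OF ij that(1)]
    have "k \<cdot> (on1 F i j \<cdot> (pull_section C (sor A i j) (on0 F i) s \<cdot> x)) = Ide C (pbo C (sor A i j) (on0 F i)) \<cdot> (pull_section C (sor A i j) (on0 F i) s \<cdot> x)"
      by (rule A.under[OF k(4)]) (use k P that ij in auto)
    then show ?thesis using P that ij by (simp add: sact_def)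
  qed
  show "meet_law C F i j" unfolding meet_law_def
  proof (intro allI impI)
    fix s t assume "partial_section C (sor (Src F) i j) s \<and> partial_section C (sor (Src F) i j) t"
    then have s: "A.sec i j s" and t: "A.sec i j t" by simp_all
    note sD = A.sec_D[OF ij s] and tD = A.sec_D[OF ij t] and S = sact[OF ij s] sact_Arr[OF ij s] and T = sact[OF ij t] sact_Arr[OF ij t]
    have st: "Dom C t = Dom C s" "Cod C t = Cod C s" using sD tD by simp_all
    have ST: "Dom C (sact C F i j t) = Dom C (sact C F i j s)" "Cod C (sact C F i j t) = Cod C (sact C F i j s)" using S T by simp_all
    note a = A.agree[OF sD(1) tD(1) st] and aD = A.RI_D[OF A.agree_RI[OF sD(1) tD(1) st]]
    note b = A.agree[OF S(4) T(4) ST] and bD = A.RI_D[OF A.agree_RI[OF S(4) T(4) ST]]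
    let ?a = "agree C s t" and ?b = "agree C (sact C F i j s) (sact C F i j t)"
    let ?e = "Rst C (?a \<cdot> on0 F i)"
    note P = pull[OF ij s] and Q = pull[OF ij t]
    have aR: "?a \<in> RI C (P0 A i)" using a(1) sD by simp
    have eR: "?e \<in> RI C (P0 B ?i)" using ij aD sD by simp
    have bR: "?b \<in> RI C (P0 B ?i)" using b(1) S by simp
    have "k \<cdot> (sact C F i j s \<cdot> ?b) = k \<cdot> (sact C F i j t \<cdot> ?b)" unfolding b(2) ..
    then have "pull_section C (sor A i j) (on0 F i) s \<cdot> ?b = pull_section C (sor A i j) (on0 F i) t \<cdot> ?b"
      using ks[OF s] ks[OF t] A.RI_D[OF bR] by simp
    then have "pr1 C (sor A i j) (on0 F i) \<cdot> (pull_section C (sor A i j) (on0 F i) s \<cdot> ?b) = pr1 C (sor A i j) (on0 F i) \<cdot> (pull_section C (sor A i j) (on0 F i) t \<cdot> ?b)"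
      by simp
    then have eq: "s \<cdot> (on0 F i \<cdot> ?b) = t \<cdot> (on0 F i \<cdot> ?b)"
      using A.under2[OF P(4), of ?b] A.under2[OF Q(4), of ?b] P Q A.RI_D[OF bR] A.pb_D[OF on0_pb[OF ij]] sD tD ij by simp
    have 1: "?e \<cdot> ?b = ?b"
      by (rule A.pull_agree[OF p s t _ _ _ eq]) (use ij bR b(3) S in auto)
    have "?e \<cdot> ?b = ?e"
    proof (rule A.agree_greatest[OF S(4) T(4) ST])
      show "?e \<in> RI C (Dom C (sact C F i j s))" using eR S by simp
      have "sact C F i j (s \<cdot> ?a) = sact C F i j (t \<cdot> ?a)" unfolding a(2) ..
      then show "sact C F i j s \<cdot> ?e = sact C F i j t \<cdot> ?e" using sact_RI[OF ij s aR] sact_RI[OF ij t aR] by simp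
      have "Rst C s \<cdot> ?a \<cdot> on0 F i = ?a \<cdot> on0 F i" unfolding a(3) ..
      then have "?e = Rst C (Rst C s \<cdot> (?a \<cdot> on0 F i))" using aD sD ij by simp
      also have "Rst C s \<cdot> (?a \<cdot> on0 F i) = Rst C s \<cdot> (on0 F i \<cdot> ?e)" using A.RI_slide[OF aR, of "on0 F i"] ij by simp
      also have "Rst C (Rst C s \<cdot> (on0 F i \<cdot> ?e)) = Rst C (s \<cdot> on0 F i) \<cdot> ?e"
        using A.Rst_Cmp_RI[OF eR, of "Rst C s \<cdot> on0 F i"] A.RI_D[OF eR] sD ij by simp
      finally show "Rst C (sact C F i j s) \<cdot> ?e = ?e" using S(2) by simp
    qed
    then show "?b = ?e" using 1 by simp
  qed
  obtain M q s where e: "etale C (sor B ?i ?j) (M :: ('b \<times> unit) set) q (\<lambda>m. sact C F i j (s m))"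
    and sM: "\<And>m. m \<in> M \<Longrightarrow> A.sec i j (s m)"
    using etale_sact[OF ij inv] by auto
  show "join_law C F i j" unfolding join_law_def
  proof (intro allI impI)
    fix g assume "partial_section C (sor (Trg F) (onC F i) (onC F j)) g"
    then have g: "B.sec ?i ?j g" by simp
    note gD = B.sec_D[OF IJ g]
    have a: "agree C g (sact C F i j s) \<in> RI C (P0 B ?i)" "agree C g (sact C F i j s) \<cdot> Rst C g = agree C g (sact C F i j s)"
      "\<And>e. \<lbrakk>e \<in> RI C (P0 B ?i); Rst C g \<cdot> e = e; g \<cdot> e = sact C F i j s \<cdot> e\<rbrakk> \<Longrightarrow> e \<cdot> agree C g (sact C F i j s) = e"
      if s: "A.sec i j s" for s
    proof -
      note S = sact_Arr[OF ij s]
      have ST: "Dom C (sact C F i j s) = Dom C g" "Cod C (sact C F i j s) = Cod C g" using S gD by simp_all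
      note b = A.agree[OF gD(1) S(1) ST]
      show 1: "agree C g (sact C F i j s) \<in> RI C (P0 B ?i)" using b(1) gD by simp
      show "agree C g (sact C F i j s) \<cdot> Rst C g = agree C g (sact C F i j s)"
        using A.RI_comm[OF 1, of "Rst C g"] b(3) gD by simp
      fix e assume "e \<in> RI C (P0 B ?i)" "Rst C g \<cdot> e = e" "g \<cdot> e = sact C F i j s \<cdot> e"
      then show "e \<cdot> agree C g (sact C F i j s) = e" using b(5)[of e] gD by simp
    qed
    have c: "cover C (P0 B ?i) M (\<lambda>m. q m \<cdot> g) (Rst C g)" using A.etale_cover_section[OF e g] IJ by simp
    show "cover C (P0 (Trg F) (onC F i)) {s. partial_section C (sor (Src F) i j) s} (\<lambda>s. agree C g (sact C F i j s)) (Rst C g)"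
      unfolding Src Trg
    proof (rule A.coverI)
      fix k assume k: "k \<in> RI C (P0 B ?i)" and le: "\<And>s. s \<in> {s. A.sec i j s} \<Longrightarrow> agree C g (sact C F i j s) \<cdot> k = agree C g (sact C F i j s)"
      have "k \<cdot> Rst C g = Ide C (P0 B ?i) \<cdot> Rst C g"
      proof (rule A.cover_ext[OF c])
        fix m assume m: "m \<in> M"
        note G = A.etale_at_section[OF e g m] and sm = sM[OF m]
        have qR: "q m \<cdot> g \<in> RI C (P0 B ?i)" using G(2) IJ by simp
        note qD = A.RI_D[OF qR] and kD = A.RI_D[OF k] and aD = A.RI_D[OF a(1)[OF sm]]
        have ag: "q m \<cdot> g \<cdot> agree C g (sact C F i j (s m)) = q m \<cdot> g"
          by (rule a(3)[OF sm qR G(4) G(3)[symmetric]])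
        have "k \<cdot> (q m \<cdot> g) = q m \<cdot> g \<cdot> k" by (rule A.RI_comm[OF k qR])
        also have "\<dots> = q m \<cdot> g \<cdot> agree C g (sact C F i j (s m)) \<cdot> k" unfolding ag ..
        also have "\<dots> = q m \<cdot> g \<cdot> (agree C g (sact C F i j (s m)) \<cdot> k)" by (rule A.assoc) (use qD kD aD in auto)
        also have "\<dots> = q m \<cdot> g" using le[of "s m"] sm ag by simp
        finally show "k \<cdot> (q m \<cdot> g) = Ide C (P0 B ?i) \<cdot> (q m \<cdot> g)" using qD by simp
      qed (use A.RI_D[OF k] in auto)
      then show "Rst C g \<cdot> k = Rst C g" using A.RI_comm[OF k, of "Rst C g"] gD IJ by simp
    qed (use a gD in auto)
  qed
qed

text \<open>By the meet law \<open>e\<close> lies in the inverse image of the agreement locus of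
  \<open>s\<close> and \<open>t\<close>, and there both pulled-back sections come from the common
  restriction.\<close>

lemma pull_eq_RI:
  assumes ij: "i \<in> Cpt A" "j \<in> Cpt A" and law: "meet_law C F i j" and s: "A.sec i j s" and t: "A.sec i j t"
    and e: "e \<in> RI C (P0 B (onC F i))" and eq: "sact C F i j s \<cdot> e = sact C F i j t \<cdot> e" and le: "Rst C (sact C F i j s) \<cdot> e = e"
  shows "pull_section C (sor A i j) (on0 F i) s \<cdot> e = pull_section C (sor A i j) (on0 F i) t \<cdot> e"
proof -
  note sD = A.sec_D[OF ij s] and tD = A.sec_D[OF ij t] and S = sact_Arr[OF ij s] and T = sact_Arr[OF ij t]
  have st: "Dom C t = Dom C s" "Cod C t = Cod C s" using sD tD by simp_all
  have ST: "Dom C (sact C F i j t) = Dom C (sact C F i j s)" "Cod C (sact C F i j t) = Cod C (sact C F i j s)" using S T by simp_all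
  note a = A.agree[OF sD(1) tD(1) st]
  let ?a = "agree C s t"
  let ?d = "Rst C (?a \<cdot> on0 F i)"
  have aR: "?a \<in> RI C (P0 A i)" using a(1) sD by simp
  have dR: "?d \<in> RI C (P0 B (onC F i))" using A.RI_D[OF aR] ij by simp
  have "agree C (sact C F i j s) (sact C F i j t) = ?d" using law s t by (simp add: meet_law_def)
  then have "e \<cdot> ?d = e" using A.agree_greatest[OF S(1) T(1) ST _ le eq] e S by simp
  then have de: "?d \<cdot> e = e" using A.RI_comm[OF dR e] by simp
  have p: "pull_section C (sor A i j) (on0 F i) x \<cdot> e = pull_section C (sor A i j) (on0 F i) (x \<cdot> ?a) \<cdot> e" if x: "A.sec i j x" for x
  proof -
    note P = pull[OF ij x]
    have "pull_section C (sor A i j) (on0 F i) (x \<cdot> ?a) = pull_section C (sor A i j) (on0 F i) x \<cdot> ?d"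
      by (rule A.pull_RI) (use ij x aR in auto)
    then show ?thesis using de P A.RI_D[OF dR] A.RI_D[OF e] by simp
  qed
  show ?thesis unfolding p[OF s] p[OF t] a(2) ..
qed

text \<open>The same statement over a piece \<open>e\<close> of the arrow object that lies in the
  images of both sections. It is reduced to \<open>pull_eq_RI\<close> by passing to the
  base.\<close>

lemma pull_eq:
  assumes ij: "i \<in> Cpt A" "j \<in> Cpt A" and law: "meet_law C F i j" and s: "A.sec i j s" and t: "A.sec i j t"
    and e: "e \<in> RI C (P1 B (onC F i) (onC F j))"
    and eq: "sact C F i j s \<cdot> (sor B (onC F i) (onC F j) \<cdot> e) = e" "sact C F i j t \<cdot> (sor B (onC F i) (onC F j) \<cdot> e) = e"
  shows "pull_section C (sor A i j) (on0 F i) s \<cdot> (sor B (onC F i) (onC F j) \<cdot> e) =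
    pull_section C (sor A i j) (on0 F i) t \<cdot> (sor B (onC F i) (onC F j) \<cdot> e)"
proof -
  let ?i = "onC F i" and ?j = "onC F j"
  let ?S = "sact C F i j s" and ?T = "sact C F i j t" and ?w = "sor B (onC F i) (onC F j) \<cdot> e"
  have IJ: "?i \<in> Cpt B" "?j \<in> Cpt B" using ij by simp_all
  note eD = A.RI_D[OF e] and S = sact_Arr[OF ij s] and T = sact_Arr[OF ij t] and SD = B.sec_D[OF IJ sact_sec[OF ij s]]
  note P = pull[OF ij s] and Q = pull[OF ij t]
  have w: "?w \<in> Arr C" "Dom C ?w = P1 B ?i ?j" "Cod C ?w = P0 B ?i" using eD IJ by simp_all
  have we: "?w \<cdot> e = ?w" using A.RI_idem[OF e] eD IJ by simp
  \<comment> \<open>The region of the base over which \<open>?S\<close> takes values in the piece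
    \<open>e\<close>.\<close>
  let ?d = "?w \<cdot> ?S"
  have "?d = sor B ?i ?j \<cdot> (e \<cdot> ?S)" by (rule A.assoc) (use eD S IJ in auto)
  also have "e \<cdot> ?S = ?S \<cdot> Rst C (e \<cdot> ?S)" by (rule A.RI_slide[OF e]) (use S in auto)
  also have "sor B ?i ?j \<cdot> (?S \<cdot> Rst C (e \<cdot> ?S)) = Rst C ?S \<cdot> Rst C (e \<cdot> ?S)"
    by (rule A.under[OF SD(4)]) (use eD S IJ in auto)
  finally have d: "?d = Rst C ?S \<cdot> Rst C (e \<cdot> ?S)" .
  have dR: "?d \<in> RI C (P0 B ?i)" unfolding d by (rule A.RI_Cmp) (use eD S in auto)
  have Sd: "?S \<cdot> ?d = e \<cdot> ?S" by (rule A.under[OF eq(1)]) (use w S in auto)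
  have Td: "?T \<cdot> ?d = e \<cdot> ?S" by (rule A.under[OF eq(2)]) (use w S T in auto)
  have "Rst C ?S \<cdot> ?d = ?d" unfolding d by (rule A.Rst_idem_Cmp) (use eD S in auto)
  then have pd: "pull_section C (sor A i j) (on0 F i) s \<cdot> ?d = pull_section C (sor A i j) (on0 F i) t \<cdot> ?d"
    using Sd Td by (intro pull_eq_RI[OF ij law s t dR]) simp_all
  have "?d \<cdot> ?w = ?w \<cdot> (?S \<cdot> ?w)" by (rule A.assoc) (use w S in auto)
  also have "\<dots> = ?w" unfolding eq(1) by (rule we)
  finally have dw: "?d \<cdot> ?w = ?w" .
  have "pull_section C (sor A i j) (on0 F i) s \<cdot> ?w = pull_section C (sor A i j) (on0 F i) s \<cdot> (?d \<cdot> ?w)" unfolding dw ..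
  also have "\<dots> = pull_section C (sor A i j) (on0 F i) t \<cdot> ?d \<cdot> ?w"
    by (rule A.under[OF pd]) (use w A.RI_D[OF dR] P in auto)
  also have "\<dots> = pull_section C (sor A i j) (on0 F i) t \<cdot> (?d \<cdot> ?w)"
    by (rule A.assoc) (use w A.RI_D[OF dR] Q in auto)
  also have "\<dots> = pull_section C (sor A i j) (on0 F i) t \<cdot> ?w" unfolding dw ..
  finally show ?thesis .
qed

text \<open>The pieces over which the inverse is glued are indexed by pairs of a chart
  \<open>m\<close> of the source map of \<open>B\<close> and a section \<open>s\<close> of that of
  \<open>A\<close>. The join law makes them cover, and the meet law supplies agreement on
  overlaps.\<close>

lemma invertible_of_laws:
  assumes ij: "i \<in> Cpt A" "j \<in> Cpt A" and law: "meet_law C F i j" "join_law C F i j"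
  shows "invertible C (on1 F i j)"
proof -
  let ?i = "onC F i" and ?j = "onC F j"
  let ?\<sigma> = "sor B (onC F i) (onC F j)" and ?pull = "pull_section C (sor A i j) (on0 F i)" and ?S = "sact C F i j"
  let ?P = "pbo C (sor A i j) (on0 F i)"
  have IJ: "?i \<in> Cpt B" "?j \<in> Cpt B" using ij by simp_all
  obtain M t where e: "etale C ?\<sigma> M (\<lambda>q. q) t" using A.local_homeo_etale[of ?\<sigma>] IJ by auto
  note D = A.etale_D[OF e]
  have tS: "B.sec ?i ?j (t m)" if "m \<in> M" for m by (rule A.etale_section[OF e that])
  note tD = B.sec_D[OF IJ tS]
  have mD: "m \<in> Arr C" "Dom C m = P1 B ?i ?j" "Cod C m = P0 B ?i" if "m \<in> M" for m using D(3-5)[OF that] IJ by simp_all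
  \<comment> \<open>The region where the chart section \<open>t m\<close> agrees with the image of
    \<open>s\<close>.\<close>
  define a where "a m s = agree C (t m) (?S s)" for m s
  have a: "a m s \<in> RI C (P0 B ?i)" "t m \<cdot> a m s = ?S s \<cdot> a m s" "Rst C (?S s) \<cdot> a m s = a m s" if "m \<in> M" "A.sec i j s" for m s
    unfolding a_def using A.agree(1,2,4)[OF tD(1)[OF that(1)] sact_Arr(1)[OF ij that(2)]] tD[OF that(1)] sact_Arr[OF ij that(2)] by simp_all
  note aD = A.RI_D[OF a(1)]
  define I where "I = M \<times> {s. A.sec i j s}"
  \<comment> \<open>The part of the domain of the chart \<open>m\<close> that lies over
    \<open>a m s\<close>; by \<open>piece\<close> it consists of values of the image of
    \<open>s\<close>.\<close>
  define c where "c = (\<lambda>(m, s). Rst C (a m s \<cdot> m))"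
  \<comment> \<open>On this piece the inverse is forced: it takes values along the pulled-back
    section of \<open>s\<close>.\<close>
  define z where "z = (\<lambda>(m, s). ?pull s \<cdot> (a m s \<cdot> m))"
  have cov: "cover C (P1 B ?i ?j) I c (Ide C (P1 B ?i ?j))"
    unfolding I_def c_def
  proof (rule A.cover_Sigma)
    show "cover C (P1 B ?i ?j) M (\<lambda>m. Rst C m) (Ide C (P1 B ?i ?j))" using D(12) IJ by simp
    fix m assume m: "m \<in> M"
    have "cover C (P0 B ?i) {s. A.sec i j s} (\<lambda>s. a m s) (Rst C (t m))"
      using law(2) tS[OF m] by (simp add: join_law_def a_def)
    then have "cover C (Dom C m) {s. A.sec i j s} (\<lambda>s. Rst C (a m s \<cdot> m)) (Rst C (Rst C (t m) \<cdot> m))"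
      by (rule A.cover_precomp) (use mD[OF m] in auto)
    moreover have "Rst C (Rst C (t m) \<cdot> m) = Rst C m"
      using A.Rst_Rst_Cmp[of m "t m"] D(10)[OF m] mD[OF m] tD[OF m] by simp
    ultimately show "cover C (P1 B ?i ?j) {s. A.sec i j s} (\<lambda>s. Rst C (a m s \<cdot> m)) (Rst C m)" using mD[OF m] by simp
  qed
  note cD = A.cover_D[OF cov] and cRD = A.RI_D[OF A.cover_D(1)[OF cov]]
  have piece: "a m s \<cdot> m = ?\<sigma> \<cdot> c (m, s)" "?S s \<cdot> (?\<sigma> \<cdot> c (m, s)) = c (m, s)" if m: "m \<in> M" and s: "A.sec i j s" for m s
  proof -
    note S = sact_Arr[OF ij s] and mm = mD[OF m] and am = aD[OF m s] and tm = tD[OF m]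
    have "?\<sigma> \<cdot> Rst C m = m" by (rule D(11)[OF m])
    have "a m s \<cdot> m = m \<cdot> Rst C (a m s \<cdot> m)" by (rule A.RI_slide[OF a(1)[OF m s]]) (use mm in auto)
    also have "\<dots> = ?\<sigma> \<cdot> Rst C m \<cdot> Rst C (a m s \<cdot> m)" unfolding D(11)[OF m] ..
    also have "\<dots> = ?\<sigma> \<cdot> (Rst C m \<cdot> Rst C (a m s \<cdot> m))" by (rule A.assoc) (use mm am IJ in auto)
    also have "\<dots> = ?\<sigma> \<cdot> c (m, s)" using mm am by (simp add: c_def)
    finally show 1: "a m s \<cdot> m = ?\<sigma> \<cdot> c (m, s)" .
    have "?S s \<cdot> (a m s \<cdot> m) = t m \<cdot> (a m s \<cdot> m)"
      by (rule A.under2[OF a(2)[OF m s, symmetric]]) (use mm am tm S in auto)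
    also have "\<dots> = t m \<cdot> (m \<cdot> Rst C (a m s \<cdot> m))"
      unfolding A.RI_slide[OF a(1)[OF m s] mm(1,3), symmetric] ..
    also have "\<dots> = Rst C m \<cdot> Rst C (a m s \<cdot> m)" by (rule A.under[OF D(10)[OF m]]) (use mm am tm in auto)
    also have "\<dots> = c (m, s)" using mm am by (simp add: c_def)
    finally show "?S s \<cdot> (?\<sigma> \<cdot> c (m, s)) = c (m, s)" unfolding 1 .
  qed
  have z: "z (m, s) = ?pull s \<cdot> (?\<sigma> \<cdot> c (m, s))" if "m \<in> M" "A.sec i j s" for m s
    unfolding z_def using piece(1)[OF that] by simp
  have zD: "z x \<in> Arr C" "Dom C (z x) = P1 B ?i ?j" "Cod C (z x) = ?P" if xI: "x \<in> I" for x
  proof -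
    obtain m s where x: "x = (m, s)" "m \<in> M" "A.sec i j s" using xI by (auto simp: I_def)
    show "z x \<in> Arr C" "Dom C (z x) = P1 B ?i ?j" "Cod C (z x) = ?P"
      unfolding x(1) z[OF x(2,3)] using pull[OF ij x(3)] cRD[OF xI] IJ x(1) by simp_all
  qed
  have "\<exists>k \<in> Hom C (P1 B ?i ?j) ?P. k \<cdot> Ide C (P1 B ?i ?j) = k \<and> (\<forall>x \<in> I. k \<cdot> c x = z x)"
  proof (rule A.cover_glue[OF cov])
    show "?P \<in> Obj C" unfolding pbo_def by (rule A.Dom_Obj[OF A.pb_D(3)[OF on0_pb[OF ij]]])
    fix x assume xI: "x \<in> I"
    then obtain m s where x: "x = (m, s)" "m \<in> M" "A.sec i j s" by (auto simp: I_def)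
    note cx = cD(1)[OF xI] and cxD = cRD[OF xI] and P = pull[OF ij x(3)]
    show "z x \<in> Hom C (P1 B ?i ?j) ?P" using zD[OF xI] by (simp add: A.Hom_iff)
    show "z x \<cdot> c x = z x"
      unfolding x(1) z[OF x(2,3)] using A.RI_idem[OF cx] cxD P IJ unfolding x(1) by simp
    fix y assume yI: "y \<in> I"
    then obtain n u where y: "y = (n, u)" "n \<in> M" "A.sec i j u" by (auto simp: I_def)
    note cy = cD(1)[OF yI] and cyD = cRD[OF yI] and Q = pull[OF ij y(3)]
    let ?e = "c x \<cdot> c y"
    have eR: "?e \<in> RI C (P1 B ?i ?j)" by (rule A.RI_Cmp[OF cx cy])
    have yx: "c y \<cdot> c x = ?e" by (rule A.RI_comm[OF cy cx])
    note S = sact_Arr[OF ij x(3)] and U = sact_Arr[OF ij y(3)]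
    have "?S s \<cdot> (?\<sigma> \<cdot> c x) \<cdot> c y = c x \<cdot> c y" unfolding x(1) piece(2)[OF x(2,3)] ..
    then have 1: "?S s \<cdot> (?\<sigma> \<cdot> ?e) = ?e" using S cxD cyD IJ by simp
    have "?S u \<cdot> (?\<sigma> \<cdot> c y) \<cdot> c x = c y \<cdot> c x" unfolding y(1) piece(2)[OF y(2,3)] ..
    then have 2: "?S u \<cdot> (?\<sigma> \<cdot> ?e) = ?e" using U cxD cyD IJ yx by simp
    have "z x \<cdot> c y = ?pull s \<cdot> (?\<sigma> \<cdot> ?e)" unfolding x(1) z[OF x(2,3)] using P cxD cyD IJ unfolding x(1) by simp
    also have "\<dots> = ?pull u \<cdot> (?\<sigma> \<cdot> ?e)" by (rule pull_eq[OF ij law(1) x(3) y(3) eR 1 2])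
    also have "\<dots> = z y \<cdot> c x" unfolding y(1) z[OF y(2,3)] using Q cxD cyD IJ yx unfolding y(1) by simp
    finally show "z x \<cdot> c y = z y \<cdot> c x" .
  qed
  then obtain k where k: "k \<in> Arr C" "Dom C k = P1 B ?i ?j" "Cod C k = ?P" "\<And>x. x \<in> I \<Longrightarrow> k \<cdot> c x = z x"
    by (auto simp: A.Hom_iff)
  have oz: "on1 F i j \<cdot> z x = c x" if xI: "x \<in> I" for x
  proof -
    obtain m s where x: "x = (m, s)" "m \<in> M" "A.sec i j s" using xI by (auto simp: I_def)
    have "on1 F i j \<cdot> z x = ?S s \<cdot> (?\<sigma> \<cdot> c x)"
      unfolding x(1) z[OF x(2,3)] sact_def using pull[OF ij x(3)] cRD[OF xI] ij IJ unfolding x(1) by simp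
    also have "\<dots> = c x" unfolding x(1) by (rule piece(2)[OF x(2,3)])
    finally show ?thesis .
  qed
  have "on1 F i j \<cdot> k \<cdot> Ide C (P1 B ?i ?j) = Ide C (P1 B ?i ?j) \<cdot> Ide C (P1 B ?i ?j)"
  proof (rule A.cover_ext[OF cov])
    fix x assume x: "x \<in> I"
    have "on1 F i j \<cdot> k \<cdot> c x = on1 F i j \<cdot> (k \<cdot> c x)" by (rule A.assoc) (use k(1-3) cRD[OF x] ij in auto)
    then show "on1 F i j \<cdot> k \<cdot> c x = Ide C (P1 B ?i ?j) \<cdot> c x" using k(4)[OF x] oz[OF x] cRD[OF x] by simp
  qed (use k(1-3) ij IJ in auto)
  then have ok: "on1 F i j \<cdot> k = Ide C (P1 B ?i ?j)" using k(1-3) ij IJ by simp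
  \<comment> \<open>The image of \<open>s\<close> is followed through the pieces. Inside a piece
    indexed by \<open>u\<close> it coincides with the image of \<open>u\<close>, and
    \<open>pull_eq_RI\<close> exchanges the pulled-back section of \<open>u\<close>, supplied by
    \<open>k\<close>, for that of \<open>s\<close>.\<close>
  have ko: "k \<cdot> on1 F i j = Ide C ?P"
  proof (rule on1_ext[OF ij])
    fix s assume s: "A.sec i j s"
    note S = sact_Arr[OF ij s] and P = pull[OF ij s] and R = Rst_sact[OF ij s]
    have cs: "cover C (P0 B ?i) I (\<lambda>x. Rst C (c x \<cdot> ?S s)) (Rst C (?S s))"
      using A.cover_precomp[OF cov S(1)] S by simp
    have "k \<cdot> ?S s \<cdot> Rst C (?S s) = ?pull s \<cdot> Rst C (?S s)"
    proof (rule A.cover_ext[OF cs])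
      fix x assume xI: "x \<in> I"
      then obtain m u where x: "x = (m, u)" "m \<in> M" "A.sec i j u" by (auto simp: I_def)
      note cxD = cRD[OF xI] and U = sact_Arr[OF ij x(3)] and Q = pull[OF ij x(3)] and mm = mD[OF x(2)] and am = aD[OF x(2,3)]
      note ms = A.etale_at_section[OF e sact_sec[OF ij s] x(2)]
      have msR: "m \<cdot> ?S s \<in> RI C (P0 B ?i)" using ms(2) IJ by simp
      \<comment> \<open>The region of the base over which \<open>?S s\<close> takes values in the
        piece \<open>x\<close>, as confirmed by the equation \<open>w\<close>.\<close>
      let ?w = "a m u \<cdot> (m \<cdot> ?S s)"
      have wR: "?w \<in> RI C (P0 B ?i)" by (rule A.RI_Cmp[OF a(1)[OF x(2,3)] msR])
      note wD = A.RI_D[OF wR]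
      have zs: "z x \<cdot> ?S s = ?pull u \<cdot> ?w" unfolding x(1) z_def using Q am mm S by simp
      have "?S u \<cdot> ?w = on1 F i j \<cdot> ?pull u \<cdot> ?w" by (simp only: sact_def Src)
      also have "\<dots> = on1 F i j \<cdot> (?pull u \<cdot> ?w)" by (rule A.assoc) (use Q wD ij in auto)
      also have "\<dots> = on1 F i j \<cdot> (z x \<cdot> ?S s)" by (simp only: zs)
      also have "\<dots> = c x \<cdot> ?S s" by (rule A.under[OF oz[OF xI]]) (use zD[OF xI] S ij in auto)
      finally have Uw: "?S u \<cdot> ?w = c x \<cdot> ?S s" .
      have Uw': "Rst C (?S u) \<cdot> ?w = ?w"
        by (rule A.under[OF a(3)[OF x(2,3)]]) (use am U A.RI_D[OF msR] in auto)
      have w: "Rst C (c x \<cdot> ?S s) = ?w"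
        unfolding Uw[symmetric] using A.Rst_Cmp_RI[OF wR U(1,2)] Uw' by simp
      have Sw: "?S u \<cdot> ?w = ?S s \<cdot> ?w"
        unfolding Uw using A.RI_slide[OF cD(1)[OF xI] S(1,3)] w by simp
      have "k \<cdot> (?S s \<cdot> ?w) = k \<cdot> (c x \<cdot> ?S s)" unfolding Sw[symmetric] Uw ..
      also have "\<dots> = z x \<cdot> ?S s" by (rule A.under[OF k(4)[OF xI]]) (use cxD S k in auto)
      also have "\<dots> = ?pull u \<cdot> ?w" by (rule zs)
      also have "\<dots> = ?pull s \<cdot> ?w" by (rule pull_eq_RI[OF ij law(1) x(3) s wR Sw Uw'])
      finally have "k \<cdot> (?S s \<cdot> ?w) = ?pull s \<cdot> ?w" .
      then show "k \<cdot> ?S s \<cdot> Rst C (c x \<cdot> ?S s) = ?pull s \<cdot> Rst C (c x \<cdot> ?S s)"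
        unfolding w using A.assoc[of ?w "?S s" k] wD S k(1-3) by simp
    qed (use k(1-3) S P in auto)
    moreover have "?pull s \<cdot> Rst C (?S s) = ?pull s" using P A.Cmp_Rst_self[OF P(1)] R by simp
    moreover have "k \<cdot> on1 F i j \<cdot> ?pull s = k \<cdot> ?S s" unfolding sact_def Src by (rule A.assoc) (use k(1-3) P ij in auto)
    ultimately show "k \<cdot> on1 F i j \<cdot> ?pull s = Ide C ?P \<cdot> ?pull s" using k(1-3) S P by simp
  qed (use k(1-3) ij IJ A.pb_D[OF on0_pb[OF ij]] A.Dom_Obj[OF A.pb_D(3)[OF on0_pb[OF ij]]] in auto)
  show ?thesis unfolding invertible_def using ok ko k(1-3) ij by (auto simp: A.Hom_iff)
qed

end

context join_restriction_category
begin

lemma localic_Phi_iff: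
  assumes A: "A \<in> Obj (peCat_c K C)" and B: "B \<in> Obj (peCat_c K C)" and F: "F \<in> Hom (peCat_c K C) A B"
    and gl: "has_local_glueings K C" and ls: "locally_small K C"
  shows "localic (Phi_cat C A) (Phi_cat C B) (JF (Phi_mor C F)) \<longleftrightarrow> covering_cofunctor C F"
proof -
  have A': "source_etale C A" "Cpt A \<prec> K" and B': "source_etale C B" "Cpt B \<prec> K"
    and F': "cofunctor C F" "Src F = A" "Trg F = B" using A B F by (auto simp: peCat_c_Hom)
  interpret pmor C A B F by (rule pmorI[OF F'(2,3) A'(1) B'(1) cofunctor_typed[OF F'(1)]])
  interpret pmor_st C A B F by (rule cofunctor_st[OF F'(1)])
  have "join_restriction_functor (fst (JSrc (Phi_mor C F))) (fst (JTrg (Phi_mor C F))) (JF (Phi_mor C F))"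
    by (rule is_jr_mor_join[OF _ _ gl is_jr_mor_Phi])
      (simp_all only: F' A'(1) B'(1) Phi_mor_simps(1,2) A.is_jr_obj_Phi[OF ls A'(2)] B.is_jr_obj_Phi[OF ls B'(2)])
  then have jr: "join_restriction_functor (Phi_cat C A) (Phi_cat C B) (JF (Phi_mor C F))" by simp
  have inv: "meet_law C F i j \<and> join_law C F i j \<longleftrightarrow> invertible C (on1 F i j)" if "i \<in> Cpt A" "j \<in> Cpt A" for i j
    using laws_of_invertible[OF that] invertible_of_laws[OF that] by blast
  show ?thesis unfolding localic_alt[OF jr] covering_cofunctor_def F'(2,3) using F'(1) inv by blast
qed

end

section \<open>The equivalence for covering functors\<close>

context covering_functor
begin

text \<open>Identifies explicitly given data \<open>H\<close> with a covering functor obtained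
  abstractly: arrows are tested on the lifts \<open>sact C F k l s\<close>, which suffices because
  the component of \<open>F\<close> has a right inverse.\<close>

lemma eq_at_sections:
  assumes H: "pmor_extensional H" "Src H = B" "Trg H = A"
    and H_C: "\<And>i. i \<in> Cpt B \<Longrightarrow> onC H i = onC G i" and H_0: "\<And>i. i \<in> Cpt B \<Longrightarrow> on0 H i = on0 G i"
    and H_1: "\<And>i j. \<lbrakk>i \<in> Cpt B; j \<in> Cpt B\<rbrakk> \<Longrightarrow> on1 H i j \<in> Hom C (P1 B i j) (P1 A (onC G i) (onC G j))"
    and H_sact: "\<And>k l s. \<lbrakk>k \<in> Cpt A; l \<in> Cpt A; A.sec k l s\<rbrakk> \<Longrightarrow> on1 H (c k) (c l) \<cdot> sact C F k l s = s \<cdot> on0 G (c k)"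
  shows "H = G"
proof (rule pmor.equality)
  have G: "pmor_extensional G" using covering by (simp add: covering_def pfunctor_def)
  show "onC H = onC G" "on0 H = on0 G"
    using H G H_C H_0 by (auto simp: pmor_extensional_def intro!: extensionalityI[of _ "Cpt B"])
  have eq: "on1 H i j = on1 G i j" if ij: "i \<in> Cpt B" "j \<in> Cpt B" for i j
  proof -
    let ?k = "onC G i" and ?l = "onC G j"
    have kl: "?k \<in> Cpt A" "?l \<in> Cpt A" using ij by simp_all
    have h: "on1 H i j \<in> Arr C" "Dom C (on1 H i j) = P1 B i j" "Cod C (on1 H i j) = P1 A ?k ?l"
      using H_1[OF ij] by (auto simp: A.Hom_iff)
    obtain g where g: "g \<in> Arr C" "Dom C g = P1 B i j" "Cod C g = pbo C (sor A ?k ?l) (on0 G i)" "on1 F ?k ?l \<cdot> g = Ide C (P1 B i j)"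
      using F_inverse[OF kl] ij by (auto simp: A.Hom_iff)
    have f: "on1 F ?k ?l \<in> Arr C" "Dom C (on1 F ?k ?l) = pbo C (sor A ?k ?l) (on0 G i)" "Cod C (on1 F ?k ?l) = P1 B i j"
      using F1(1)[OF kl] ij by (auto simp: A.Hom_iff)
    have "on1 H i j \<cdot> on1 F ?k ?l = on1 G i j \<cdot> on1 F ?k ?l"
    proof (rule F.on1_ext[OF kl])
      fix s assume s: "A.sec ?k ?l s"
      note P = F.pull[OF kl s]
      have "on1 X i j \<cdot> on1 F ?k ?l \<cdot> pull_section C (sor A ?k ?l) (on0 F ?k) s = on1 X i j \<cdot> sact C F ?k ?l s"
        if "on1 X i j \<in> Arr C" "Dom C (on1 X i j) = P1 B i j" for X :: "('c, 'a, 'b) pmor"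
        unfolding sact_def F.Src by (rule A.assoc) (use that f P ij in auto)
      then show "on1 H i j \<cdot> on1 F ?k ?l \<cdot> pull_section C (sor A ?k ?l) (on0 F ?k) s =
        on1 G i j \<cdot> on1 F ?k ?l \<cdot> pull_section C (sor A ?k ?l) (on0 F ?k) s"
        using H_sact[OF kl s] G_sact[OF kl s] ij h by simp
    qed (use h f ij in auto)
    then have "on1 H i j \<cdot> on1 F ?k ?l \<cdot> g = on1 G i j \<cdot> on1 F ?k ?l \<cdot> g" by simp
    then show ?thesis using A.assoc[of g "on1 F ?k ?l"] h f g ij by simp
  qed
  show "on1 H = on1 G"
  proof (intro ext)
    fix i j show "on1 H i j = on1 G i j"
      using eq[of i j] H G by (cases "i \<in> Cpt B \<and> j \<in> Cpt B") (auto simp: pmor_extensional_def)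
  qed
qed (use H in simp_all)

end

lemma peCat_cov_simps [simp]:
  "Obj (opposite (peCat_cov K C)) = {A. source_etale C A \<and> Cpt A \<prec> K}" "Dom (opposite (peCat_cov K C)) = Trg"
  "Cod (opposite (peCat_cov K C)) = Src" "Ide (opposite (peCat_cov K C)) = pfunctor_id C"
  "Cmp (opposite (peCat_cov K C)) g f = pfunctor_comp C f g"
  by (auto simp: opposite_def peCat_cov_def Let_def)

lemma peCat_cov_Hom: "G \<in> Hom (opposite (peCat_cov K C)) A B \<longleftrightarrow> source_etale C A \<and> Cpt A \<prec> K \<and> source_etale C B \<and> Cpt B \<prec> K \<and>
    covering C G \<and> Trg G = A \<and> Src G = B"
  by (auto simp: opposite_def peCat_cov_def Let_def Hom_def)

lemma cov_inclusion_simps [simp]: "fob (cov_inclusion C) A = A" "far (cov_inclusion C) = cofunctor_of_covering C"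
  by (auto simp: cov_inclusion_def)

context join_restriction_category
begin

lemma covering_functorI:
  assumes "source_etale C A" "source_etale C B" "covering C G" "Src G = B" "Trg G = A"
  shows "covering_functor C A B G"
  by (intro covering_functor.intro pfunctor_st.intro pcat_pair.intro etale_pcatI pfunctor_st_axioms.intro covering_functor_axioms.intro)
    (use assms pfunctor_st[of C G] in \<open>auto simp: covering_def\<close>)

lemma cofunctor_of_covering_inj:
  assumes A: "source_etale C A" and B: "source_etale C B"
    and G: "covering C G" "Src G = B" "Trg G = A" and H: "covering C H" "Src H = B" "Trg H = A"
    and eq: "cofunctor_of_covering C H = cofunctor_of_covering C G"
  shows "H = G"
proof -
  interpret G: covering_functor C A B G by (rule covering_functorI[OF A B G])
  interpret H: covering_functor C A B H by (rule covering_functorI[OF A B H])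
  have c: "H.c k = G.c k" if "k \<in> Cpt A" for k using G.F_simps(3)[OF that] H.F_simps(3)[OF that] eq by simp
  have HC: "onC H i = onC G i" if i: "i \<in> Cpt B" for i
    using c[of "onC G i"] H.c(2)[of "onC G i"] i by simp
  show ?thesis
  proof (rule G.eq_at_sections)
    fix i assume i: "i \<in> Cpt B"
    show "on0 H i = on0 G i" using G.F_simps(4)[of "onC G i"] H.F_simps(4)[of "onC G i"] c[of "onC G i"] i eq by simp
  next
    fix k l s assume kl: "k \<in> Cpt A" "l \<in> Cpt A" and s: "G.A.sec k l s"
    show "on1 H (G.c k) (G.c l) \<cdot> sact C G.F k l s = s \<cdot> on0 G (G.c k)"
      using H.G_sact[OF kl s] c kl eq G.F_simps(4)[OF kl(1)] H.F_simps(4)[OF kl(1)] by simp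
  qed (use H HC H.G1 in \<open>auto simp: covering_def pfunctor_def Hom_iff\<close>)
qed

lemma covering_Hom:
  assumes G: "G \<in> Hom (opposite (peCat_cov K C)) A B" and gl: "has_local_glueings K C" and ls: "locally_small K C"
  shows "cofunctor_of_covering C G \<in> Hom (peCat_c K C) A B"
    and "Phi_mor C (cofunctor_of_covering C G) \<in> Hom (jrCat_hl K C) (Phi_obj C A) (Phi_obj C B)"
proof -
  have G': "source_etale C A" "Cpt A \<prec> K" "source_etale C B" "Cpt B \<prec> K" "covering C G" "Src G = B" "Trg G = A"
    using G by (auto simp: peCat_cov_Hom)
  interpret covering_functor C A B G by (rule covering_functorI[OF G'(1,3,5-7)])
  show F: "cofunctor_of_covering C G \<in> Hom (peCat_c K C) A B"
    using F_covering_cofunctor G' by (simp add: peCat_c_Hom covering_cofunctor_def)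
  have "localic (Phi_cat C A) (Phi_cat C B) (JF (Phi_mor C F))"
    using localic_Phi_iff[OF _ _ F gl ls] F_covering_cofunctor G' by simp
  moreover have "Phi_mor C F \<in> Hom (jrCat_h K C) (Phi_obj C A) (Phi_obj C B)"
    using Phi_full_faithful[of A K B] ls F G' by (auto simp: bij_betw_def)
  ultimately show "Phi_mor C (cofunctor_of_covering C G) \<in> Hom (jrCat_hl K C) (Phi_obj C A) (Phi_obj C B)"
    by (simp add: jrCat_hl_Hom)
qed

lemma covering_of_localic:
  assumes F: "F \<in> Hom (peCat_c K C) A B" and loc: "Phi_mor C F \<in> Hom (jrCat_hl K C) (Phi_obj C A) (Phi_obj C B)"
    and gl: "has_local_glueings K C" and ls: "locally_small K C"
  obtains G where "G \<in> Hom (opposite (peCat_cov K C)) A B" "cofunctor_of_covering C G = F"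
proof -
  have F': "source_etale C A" "Cpt A \<prec> K" "source_etale C B" "Cpt B \<prec> K" "cofunctor C F" "Src F = A" "Trg F = B"
    using F by (auto simp: peCat_c_Hom)
  interpret pmor C A B F by (rule pmorI[OF F'(6,7,1,3) cofunctor_typed[OF F'(5)]])
  have "covering_cofunctor C F" using localic_Phi_iff[OF _ _ F gl ls] loc F' by (simp add: jrCat_hl_Hom)
  then obtain G where "covering C G" "Src G = B" "Trg G = A" "cofunctor_of_covering C G = F"
    using covering_of_cofunctor by blast
  then show ?thesis using F' that[of G] by (simp add: peCat_cov_Hom)
qed

lemma sact_of_Phi_mor:
  assumes "Phi_mor C F = h" "far (JF h) (k, l, s) = (k', l', s')" "k \<in> Cpt (Src F)" "l \<in> Cpt (Src F)" "partial_section C (sor (Src F) k l) s"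
  shows "onC F k = k'" "sact C F k l s = s'"
  using assms by auto

text \<open>The identity cofunctor is localic on sections, so it comes from some covering functor,
  and \<open>eq_at_sections\<close> identifies that functor with the identity data.\<close>

lemma pfunctor_id_covering:
  fixes A :: "('i,'o,'m) pcat"
  assumes A: "source_etale C A" "Cpt A \<prec> K" and gl: "has_local_glueings K C" and ls: "locally_small K C"
  shows "pfunctor_id C A \<in> Hom (opposite (peCat_cov K C)) A A" and "cofunctor_of_covering C (pfunctor_id C A) = cofunctor_id C A"
proof -
  let ?I = "cofunctor_id C A"
  interpret X: category "peCat_c K C" by (rule category_peCat_c(1)[OF ls])
  interpret A: etale_pcat C A by (rule etale_pcatI[OF A(1)])
  note id = cofunctor_id[OF A(1)]
  have Y: "category (jrCat_hl K C :: (('i, 'i \<times> 'i \<times> 'm, 'o, 'm) jr_obj, ('i, 'i \<times> 'i \<times> 'm, 'o, 'm) jr_mor) cat)"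
    by (rule category_jrCat_hl(1)[OF gl])
  have I: "?I \<in> Hom (peCat_c K C) A A" using X.Ide_in[of A] A by simp
  have loc: "Phi_mor C ?I \<in> Hom (jrCat_hl K C) (Phi_obj C A) (Phi_obj C A)"
    using category.Ide_in[OF Y, of "Phi_obj C A"] A.is_jr_obj_Phi[OF ls A(2)] id(2) by simp
  obtain G where G: "G \<in> Hom (opposite (peCat_cov K C)) A A" "cofunctor_of_covering C G = ?I"
    by (rule covering_of_localic[OF I loc gl ls])
  interpret G: covering_functor C A A G by (rule covering_functorI) (use G in \<open>auto simp: peCat_cov_Hom\<close>)
  have IA: "onC ?I k = k" "on0 ?I k = Ide C (P0 A k)" "Src ?I = A" if "k \<in> Cpt A" for k
    using that by (simp_all add: cofunctor_id_def)
  have c: "G.c k = k" "on0 G k = Ide C (P0 A k)" if "k \<in> Cpt A" for k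
    using G.F_simps(3,4)[OF that] IA[OF that] that unfolding G(2) by simp_all
  have GC: "onC G k = k" if "k \<in> Cpt A" for k using G.c(2)[OF that] c that by simp
  have "pfunctor_id C A = G"
  proof (rule G.eq_at_sections)
    fix k l s assume kl: "k \<in> Cpt A" "l \<in> Cpt A" and s: "A.sec k l s"
    have "sact C ?I k l s = s"
      by (rule sact_of_Phi_mor(2)[OF id(2), of k l s k l]) (use kl s IA in auto)
    then show "on1 (pfunctor_id C A) (G.c k) (G.c l) \<cdot> sact C G.F k l s = s \<cdot> on0 G (G.c k)"
      unfolding G(2) using c kl A.sec_D[OF kl s] by (simp add: pfunctor_id_def)
  qed (use c GC in \<open>auto simp: pfunctor_id_def pmor_extensional_def Hom_iff\<close>)
  then show "pfunctor_id C A \<in> Hom (opposite (peCat_cov K C)) A A" "cofunctor_of_covering C (pfunctor_id C A) = ?I"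
    using G by simp_all
qed

text \<open>As for identities: the composite of the two cofunctors is localic on sections and hence
  comes from a covering functor, which is then recognised as the composite data.\<close>

lemma pfunctor_comp_covering:
  fixes A B D :: "('i,'o,'m) pcat"
  assumes H: "H \<in> Hom (opposite (peCat_cov K C)) D A" and G: "G \<in> Hom (opposite (peCat_cov K C)) A B"
    and gl: "has_local_glueings K C" and ls: "locally_small K C"
  shows "pfunctor_comp C H G \<in> Hom (opposite (peCat_cov K C)) D B"
    and "cofunctor_of_covering C (pfunctor_comp C H G) = cofunctor_comp C (cofunctor_of_covering C G) (cofunctor_of_covering C H)"
proof -
  note G' = G[unfolded peCat_cov_Hom] and H' = H[unfolded peCat_cov_Hom]
  interpret G: covering_functor C A B G by (rule covering_functorI) (use G' in auto)
  interpret H: covering_functor C D A H by (rule covering_functorI) (use H' in auto)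
  interpret X: category "peCat_c K C" by (rule category_peCat_c(1)[OF ls])
  have Y: "category (jrCat_hl K C :: (('i, 'i \<times> 'i \<times> 'm, 'o, 'm) jr_obj, ('i, 'i \<times> 'i \<times> 'm, 'o, 'm) jr_mor) cat)"
    by (rule category_jrCat_hl(1)[OF gl])
  let ?E = "cofunctor_comp C G.F H.F"
  note JG = covering_Hom[OF G gl ls] and JH = covering_Hom[OF H gl ls]
  have E: "?E \<in> Hom (peCat_c K C) D B" using X.Cmp_in[OF JH(1) JG(1)] by simp
  have PE: "Phi_mor C ?E = jr_comp C (Phi_mor C G.F) (Phi_mor C H.F)"
    by (rule cofunctor_comp(2)[of D A B]) (use JG(1) JH(1) in \<open>auto simp: peCat_c_Hom\<close>)
  have loc: "Phi_mor C ?E \<in> Hom (jrCat_hl K C) (Phi_obj C D) (Phi_obj C B)"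
    using category.Cmp_in[OF Y JH(2) JG(2)] PE by simp
  obtain L where L: "L \<in> Hom (opposite (peCat_cov K C)) D B" "cofunctor_of_covering C L = ?E"
    by (rule covering_of_localic[OF E loc gl ls])
  interpret L: covering_functor C D B L by (rule covering_functorI) (use L in \<open>auto simp: peCat_cov_Hom\<close>)
  have EC: "onC ?E k = G.c (H.c k)" "on0 ?E k = on0 H (H.c k) \<cdot> on0 G (G.c (H.c k))" "Src ?E = D" if "k \<in> Cpt D" for k
    using that by (simp_all add: cofunctor_comp_def Let_def)
  have c: "L.c k = G.c (H.c k)" "on0 L (G.c (H.c k)) = on0 H (H.c k) \<cdot> on0 G (G.c (H.c k))" if k: "k \<in> Cpt D" for k
    using L.F_simps(3,4)[OF k] EC[OF k] unfolding L(2) by simp_all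
  have LC: "onC L i = onC H (onC G i)" if i: "i \<in> Cpt B" for i
    using c(1)[of "onC H (onC G i)"] L.c(2)[of "onC H (onC G i)"] i by simp
  have L0: "on0 L i = on0 H (onC G i) \<cdot> on0 G i" if i: "i \<in> Cpt B" for i
    using c(2)[of "onC H (onC G i)"] i by simp
  have P: "Src (pfunctor_comp C H G) = B" "Trg (pfunctor_comp C H G) = D" using G' H' by (simp_all add: pfunctor_comp_def Let_def)
  have PC: "onC (pfunctor_comp C H G) i = onC H (onC G i)" "on0 (pfunctor_comp C H G) i = on0 H (onC G i) \<cdot> on0 G i"
    if "i \<in> Cpt B" for i using that G' by (simp_all add: pfunctor_comp_def Let_def)
  have P1: "on1 (pfunctor_comp C H G) i j = on1 H (onC G i) (onC G j) \<cdot> on1 G i j" if "i \<in> Cpt B" "j \<in> Cpt B" for i j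
    using that G' by (simp add: pfunctor_comp_def Let_def)
  have "pfunctor_comp C H G = L"
  proof (rule L.eq_at_sections[OF _ P])
    show "pmor_extensional (pfunctor_comp C H G)"
      using G' by (auto simp: pmor_extensional_def pfunctor_comp_def Let_def)
    fix k l s assume kl: "k \<in> Cpt D" "l \<in> Cpt D" and s: "H.A.sec k l s"
    let ?s = "sact C H.F k l s" and ?c = "H.c k" and ?d = "H.c l"
    have cd: "?c \<in> Cpt A" "?d \<in> Cpt A" using kl by simp_all
    have s': "G.A.sec ?c ?d ?s" using H.F.sact_sec[OF kl s] kl by simp
    note sD = H.A.sec_D[OF kl s]
    note S = G.F.sact_Arr[OF cd s'] and S' = G.A.sec_D[OF cd s']
    have "sact C ?E k l s = sact C G.F ?c ?d ?s"
      by (rule sact_of_Phi_mor(2)[OF PE, of k l s "G.c ?c" "G.c ?d"]) (use kl s s' cd EC in auto)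
    moreover have "on1 H ?c ?d \<cdot> on1 G (G.c ?c) (G.c ?d) \<cdot> sact C G.F ?c ?d ?s = on1 H ?c ?d \<cdot> (on1 G (G.c ?c) (G.c ?d) \<cdot> sact C G.F ?c ?d ?s)"
      by (rule assoc) (use S cd in auto)
    moreover have "on1 H ?c ?d \<cdot> (on1 G (G.c ?c) (G.c ?d) \<cdot> sact C G.F ?c ?d ?s) = on1 H ?c ?d \<cdot> (?s \<cdot> on0 G (G.c ?c))"
      unfolding G.G_sact[OF cd s'] ..
    moreover have "on1 H ?c ?d \<cdot> (?s \<cdot> on0 G (G.c ?c)) = s \<cdot> (on0 H ?c \<cdot> on0 G (G.c ?c))"
      by (rule under2[OF H.G_sact[OF kl s]]) (use S' sD cd kl in auto)
    ultimately show "on1 (pfunctor_comp C H G) (L.c k) (L.c l) \<cdot> sact C L.F k l s = s \<cdot> on0 L (L.c k)"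
      unfolding L(2) using c kl cd P1 by simp
  qed (use LC L0 PC P1 in \<open>auto simp: Hom_iff\<close>)
  then show "pfunctor_comp C H G \<in> Hom (opposite (peCat_cov K C)) D B" "cofunctor_of_covering C (pfunctor_comp C H G) = ?E"
    using L by simp_all
qed

lemma category_peCat_cov:
  assumes gl: "has_local_glueings K C" and ls: "locally_small K C"
  shows "category (opposite (peCat_cov K C) :: (('i,'o,'m) pcat, ('i,'o,'m) pmor) cat)"
    and "is_functor (opposite (peCat_cov K C) :: (('i,'o,'m) pcat, ('i,'o,'m) pmor) cat) (peCat_c K C) (cov_inclusion C)"
    and "embedding (opposite (peCat_cov K C) :: (('i,'o,'m) pcat, ('i,'o,'m) pmor) cat) (peCat_c K C) (cov_inclusion C)"
proof -
  let ?X = "opposite (peCat_cov K C) :: (('i,'o,'m) pcat, ('i,'o,'m) pmor) cat"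
  have D: "Dom ?X G \<in> Obj ?X" "Cod ?X G \<in> Obj ?X" if "G \<in> Arr ?X" for G
    using that peCat_cov_Hom[of G K C "Trg G" "Src G"] by (auto simp: Hom_def)
  have id: "Ide ?X A \<in> Hom ?X A A" "far (cov_inclusion C) (Ide ?X A) = Ide (peCat_c K C) (fob (cov_inclusion C) A)" if "A \<in> Obj ?X" for A
    using pfunctor_id_covering[of A K, OF _ _ gl ls] that by simp_all
  have comp: "G \<cdot>\<^bsub>?X\<^esub> H \<in> Hom ?X D B" "far (cov_inclusion C) (G \<cdot>\<^bsub>?X\<^esub> H) = far (cov_inclusion C) G \<cdot>\<^bsub>peCat_c K C\<^esub> far (cov_inclusion C) H"
    if "H \<in> Hom ?X D A" "G \<in> Hom ?X A B" for A B D G H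
    using pfunctor_comp_covering[OF that gl ls] by simp_all
  have mor: "far (cov_inclusion C) G \<in> Hom (peCat_c K C) (fob (cov_inclusion C) A) (fob (cov_inclusion C) B)" if "G \<in> Hom ?X A B" for A B G
    using covering_Hom(1)[OF that gl ls] by simp
  have inj: "inj_on (far (cov_inclusion C)) (Hom ?X A B)" for A B
    by (rule inj_onI) (auto simp: peCat_cov_Hom intro: cofunctor_of_covering_inj)
  show "category ?X" by (rule category_of_faithful(1)[OF category_peCat_c(1)[OF ls] D id(1) comp(1) mor id(2) comp(2) inj])
  show f: "is_functor ?X (peCat_c K C) (cov_inclusion C)"
    by (rule category_of_faithful(2)[OF category_peCat_c(1)[OF ls] D id(1) comp(1) mor id(2) comp(2) inj])
  have "inj_on (far (cov_inclusion C)) (Arr ?X)"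
  proof (rule inj_onI)
    fix G H assume GH: "G \<in> Arr ?X" "H \<in> Arr ?X" "far (cov_inclusion C) G = far (cov_inclusion C) H"
    have "Src (cofunctor_of_covering C G) = Trg G" "Trg (cofunctor_of_covering C G) = Src G" for G :: "('i,'o,'m) pmor"
      by (simp_all add: cofunctor_of_covering_def Let_def)
    then have "Trg G = Trg H" "Src G = Src H" using GH(3) by (metis cov_inclusion_simps(2))+
    then have "G \<in> Hom ?X (Trg G) (Src G)" "H \<in> Hom ?X (Trg G) (Src G)" using GH by (simp_all add: Hom_def)
    then show "G = H" using inj_onD[OF inj GH(3)] by blast
  qed
  then show "embedding ?X (peCat_c K C) (cov_inclusion C)" using f by (simp add: embedding_def inj_on_def)
qed

text \<open>Fullness onto localic morphisms is the correspondence of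
  \<open>covering_of_localic\<close>. The units of the larger equivalence can be kept because they
  and their inverses are localic.\<close>

lemma ff_with_units_localic:
  assumes gl: "has_local_glueings K C" and ls: "locally_small K C"
  shows "ff_with_units (opposite (peCat_cov K C) :: (('i,'o,'m) pcat, ('i,'o,'m) pmor) cat) (jrCat_hl K C)
    (fcomp (Phi C) (cov_inclusion C)) (Psi_obj C) (Psi_unit C)"
proof -
  let ?X' = "opposite (peCat_cov K C) :: (('i,'o,'m) pcat, ('i,'o,'m) pmor) cat"
  let ?Y = "jrCat_h K C :: (('i, 'i \<times> 'i \<times> 'm, 'o, 'm) jr_obj, ('i, 'i \<times> 'i \<times> 'm, 'o, 'm) jr_mor) cat"
  let ?Y' = "jrCat_hl K C :: (('i, 'i \<times> 'i \<times> 'm, 'o, 'm) jr_obj, ('i, 'i \<times> 'i \<times> 'm, 'o, 'm) jr_mor) cat"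
  let ?R = "fcomp (Phi C) (cov_inclusion C) :: (('i,'o,'m) pcat, ('i,'o,'m) pmor, ('i, 'i \<times> 'i \<times> 'm, 'o, 'm) jr_obj, ('i, 'i \<times> 'i \<times> 'm, 'o, 'm) jr_mor) fctr"
  interpret X': category ?X' by (rule category_peCat_cov(1)[OF gl ls])
  have mor: "far ?R G \<in> Hom ?Y' (fob ?R A) (fob ?R B)" if "G \<in> Hom ?X' A B" for A B G
    using covering_Hom(2)[OF that gl ls] by simp
  have J: "is_functor ?X' (peCat_c K C) (cov_inclusion C)" and P: "is_functor (peCat_c K C) ?Y (Phi C)"
    by (rule category_peCat_cov(2)[OF gl ls], rule category_peCat_c(2)[OF ls])
  have R: "is_functor ?X' ?Y' ?R"
  proof (rule is_functorI)
    show "fob ?R A \<in> Obj ?Y'" if "A \<in> Obj ?X'" for A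
      using P that by (simp add: is_functor_def)
    show "far ?R G \<in> Hom ?Y' (fob ?R (Dom ?X' G)) (fob ?R (Cod ?X' G))" if "G \<in> Arr ?X'" for G
      using mor[of G "Dom ?X' G" "Cod ?X' G"] that by (simp add: Hom_def)
    show "far ?R (Ide ?X' A) = Ide ?Y' (fob ?R A)" if A: "A \<in> Obj ?X'" for A
      using cofunctor_id(2)[of A] pfunctor_id_covering(2)[of A K, OF _ _ gl ls] A by simp
    show "far ?R (H \<cdot>\<^bsub>?X'\<^esub> G) = far ?R H \<cdot>\<^bsub>?Y'\<^esub> far ?R G" if GH: "G \<in> Arr ?X'" "H \<in> Arr ?X'" "Dom ?X' H = Cod ?X' G" for G H
    proof -
      have g: "G \<in> Hom ?X' (Trg G) (Src G)" and h: "H \<in> Hom ?X' (Src G) (Src H)" using GH by (simp_all add: Hom_def)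
      have "Phi_mor C (cofunctor_comp C (cofunctor_of_covering C H) (cofunctor_of_covering C G)) =
          jr_comp C (Phi_mor C (cofunctor_of_covering C H)) (Phi_mor C (cofunctor_of_covering C G))"
        by (rule cofunctor_comp(2)[of "Trg G" "Src G" "Src H"])
          (use covering_Hom(1)[OF g gl ls] covering_Hom(1)[OF h gl ls] in \<open>auto simp: peCat_c_Hom\<close>)
      then show ?thesis using pfunctor_comp_covering(2)[OF g h gl ls] by simp
    qed
  qed
  show ?thesis
  proof (intro ff_with_units.intro ff_with_units_axioms.intro X'.category_axioms category_jrCat_hl(1)[OF gl] R)
    fix A B assume AB: "A \<in> Obj ?X'" "B \<in> Obj ?X'"
    note ff = Phi_full_faithful[of A K B, OF _ _ ls]
    show "bij_betw (far ?R) (Hom ?X' A B) (Hom ?Y' (fob ?R A) (fob ?R B))"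
      unfolding bij_betw_def
    proof (intro conjI set_eqI iffI)
      show "inj_on (far ?R) (Hom ?X' A B)"
      proof (rule inj_onI)
        fix G H assume GH: "G \<in> Hom ?X' A B" "H \<in> Hom ?X' A B" "far ?R G = far ?R H"
        have "cofunctor_of_covering C G = cofunctor_of_covering C H"
          using ff AB covering_Hom(1)[OF GH(1) gl ls] covering_Hom(1)[OF GH(2) gl ls] GH(3) by (auto simp: bij_betw_def dest: inj_onD)
        then show "G = H" using cofunctor_of_covering_inj[of A B H G] GH by (auto simp: peCat_cov_Hom)
      qed
      show "h \<in> Hom ?Y' (fob ?R A) (fob ?R B)" if "h \<in> far ?R ` Hom ?X' A B" for h
        using that mor by blast
      fix h assume h: "h \<in> Hom ?Y' (fob ?R A) (fob ?R B)"
      then have "h \<in> Hom ?Y (fob (Phi C) A) (fob (Phi C) B)" by (simp add: jrCat_hl_Hom)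
      then have "h \<in> far (Phi C) ` Hom (peCat_c K C) A B" using ff AB by (simp add: bij_betw_def)
      then obtain F where F: "F \<in> Hom (peCat_c K C) A B" "h = Phi_mor C F" by auto
      obtain G where "G \<in> Hom ?X' A B" "cofunctor_of_covering C G = F"
        by (rule covering_of_localic[OF F(1) _ gl ls]) (use h F in auto)
      then show "h \<in> far ?R ` Hom ?X' A B" using F by (auto intro!: image_eqI[of _ _ G])
    qed
  next
    fix X :: "('i, 'i \<times> 'i \<times> 'm, 'o, 'm) jr_obj"
    assume "X \<in> Obj ?Y'"
    then have X: "is_jr_obj K C X" by simp
    note u = Psi_unit_iso[OF X gl ls]
    obtain k where k: "k \<in> Hom ?Y (Phi_obj C (Psi_obj C X)) X"
      "jr_comp C k (Psi_unit C X) = jr_id C X" "jr_comp C (Psi_unit C X) k = jr_id C (Phi_obj C (Psi_obj C X))"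
      using u(3) by blast
    show "Psi_obj C X \<in> Obj ?X'" using u(1) by simp
    \<comment> \<open>Isomorphisms over the base are localic, so the unit stays invertible in the
      smaller category.\<close>
    have uY: "Psi_unit C X \<in> Hom ?Y' X (Phi_obj C (Psi_obj C X))"
      using localic_iso[OF u(2) k gl] u(2) by (simp add: jrCat_hl_Hom)
    then show "Psi_unit C X \<in> Hom ?Y' X (fob ?R (Psi_obj C X))" by simp
    have "k \<in> Hom ?Y' (Phi_obj C (Psi_obj C X)) X"
      using localic_iso[OF k(1) u(2) k(3,2) gl] k(1) by (simp add: jrCat_hl_Hom)
    then show "invertible ?Y' (Psi_unit C X)"
      using k(2,3) uY unfolding invertible_def by (auto simp: Hom_def)
  qed
qed

end

theorem theorem7p7:
  fixes C :: "('o,'m) rcat" and K :: "'k set"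
  assumes "join_restriction_category C"
    and "locally_small K C"
    and "has_local_glueings K C"
  shows "\<exists>\<epsilon>.
    adjoint_equivalence
      (peCat_c K C :: (('i,'o,'m) pcat, ('i,'o,'m) pmor) cat) (jrCat_h K C)
      (Psi K C) (Phi C) (Psi_unit C) \<epsilon> \<and>
    restricts_to_equivalence
      (peCat_c K C) (jrCat_h K C)
      (Psi K C) (Phi C) (Psi_unit C) \<epsilon>
      (opposite (peCat_cov K C)) (cov_inclusion C) (jrCat_hl K C)"
proof -
  interpret join_restriction_category C by (rule assms(1))
  note ls = assms(2) and gl = assms(3)
  let ?X = "peCat_c K C :: (('i,'o,'m) pcat, ('i,'o,'m) pmor) cat"
  let ?X' = "opposite (peCat_cov K C) :: (('i,'o,'m) pcat, ('i,'o,'m) pmor) cat"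
  let ?Y = "jrCat_h K C :: (('i, 'i \<times> 'i \<times> 'm, 'o, 'm) jr_obj, ('i, 'i \<times> 'i \<times> 'm, 'o, 'm) jr_mor) cat"
  let ?Y' = "jrCat_hl K C :: (('i, 'i \<times> 'i \<times> 'm, 'o, 'm) jr_obj, ('i, 'i \<times> 'i \<times> 'm, 'o, 'm) jr_mor) cat"
  let ?J = "cov_inclusion C :: (('i,'o,'m) pcat, ('i,'o,'m) pmor, ('i,'o,'m) pcat, ('i,'o,'m) pmor) fctr"
  interpret E: ff_with_units ?X ?Y "Phi C" "Psi_obj C" "Psi_unit C" by (rule ff_with_units_Phi[OF gl ls])
  interpret E': ff_with_units ?X' ?Y' "fcomp (Phi C) ?J" "Psi_obj C" "Psi_unit C" by (rule ff_with_units_localic[OF gl ls])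
  \<comment> \<open>Both sides unfold to the same definite description, so no property of
    \<open>Psi_mor\<close> has to be proved separately.\<close>
  have Psi: "far (Psi K C) h = far E.left h" for h :: "('i, 'i \<times> 'i \<times> 'm, 'o, 'm) jr_mor"
    by (simp add: Psi_def Psi_mor_def E.left_def E.transpose_def)
  have adj: "adjoint_equivalence ?X ?Y (Psi K C) (Phi C) (Psi_unit C) E.counit"
    by (rule E.adjoint_equivalence[OF _ Psi]) (auto simp: Psi_def)
  have adj': "adjoint_equivalence ?X' ?Y' E'.left (fcomp (Phi C) ?J) (Psi_unit C) E'.counit"
    by (rule E'.adjoint_equivalence) (auto simp: E'.left_def)
  have emb: "embedding ?Y' ?Y fid"
    using category_jrCat_hl(2)[OF gl] by (simp add: embedding_def inj_on_def)
  have left: "far ?J (far E'.left h) = far (Psi K C) h" if h: "h \<in> Arr ?Y'" for h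
  proof -
    have hH: "h \<in> Hom ?Y' (JSrc h) (JTrg h)" using h by (simp add: Hom_def)
    note l = E'.left[OF hH]
    have y: "JSrc h \<in> Obj ?Y" using E'.Y_Hom_Obj(1)[OF hH] by simp
    have "far ?J (far E'.left h) = E.transpose (Psi_obj C (JTrg h)) (JSrc h) (jr_comp C (Psi_unit C (JTrg h)) h)"
      by (rule E.transpose_unique[OF y]) (use covering_Hom(1)[OF l(1) gl ls] l(2) in auto)
    then show ?thesis unfolding Psi by (simp add: E.left_def)
  qed
  have counit: "far ?J (E'.counit A) = E.counit (fob ?J A)" if A: "A \<in> Obj ?X'" for A
  proof -
    note c = E'.counit[OF A]
    have y: "Phi_obj C A \<in> Obj ?Y" using E'.R_Obj[OF A] by simp
    have "far ?J (E'.counit A) = E.transpose A (Phi_obj C A) (jr_id C (Phi_obj C A))"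
      by (rule E.transpose_unique[OF y]) (use covering_Hom(1)[OF c(1) gl ls] c(2) in auto)
    then show ?thesis by (simp add: E.counit_def)
  qed
  have "restricts_to_equivalence ?X ?Y (Psi K C) (Phi C) (Psi_unit C) E.counit ?X' ?J ?Y'"
    unfolding restricts_to_equivalence_def
    using category_peCat_cov(3)[OF gl ls] emb adj' left counit
    by (intro conjI exI[of _ E'.left] exI[of _ E'.counit]) (auto simp: E'.left_def Psi_def)
  then show ?thesis using adj by blast
qed

end
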